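(* Let $\mathscr{G}$ be a smooth étale groupoid with associated simplicial smooth manifold $\mathscr{G}_\bullet$, let $\Lambda$ be a subgroup of $\mathbb{C}$, and let $\mathcal{F}=\{F^r\Omega^*_{dR}(\mathscr{G}_\bullet)\}$ be a filtration (by subcomplexes) of the de Rham complex of compatible forms $\Omega^*_{dR}(\mathscr{G}_\bullet)$. Then for all integers $r,n$ there exists a surjective map (homomorphism of abelian groups) $$\Xi:\hat{H}^{2r-n-1}_r(\mathscr{G}_\bullet;\mathbb{C}/\Lambda;\mathcal{F})\longrightarrow MH^{2r}_n(\mathscr{G}_\bullet;\Lambda;\mathcal{F})$$ whose kernel is the group of forms in $F^r\Omega^{2r-n-1}_{dR}(\mathscr{G}_\bullet)$ modulo those forms (in $F^r\Omega^{2r-n-1}_{dR}(\mathscr{G}_\bullet)$) that are closed and whose complex cohomology class is the image of a class in $H^{*}(\mathscr{G}_\bullet;\Lambda)$.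
   Context: A smooth étale groupoid $\mathscr{G}=[\mathscr{G}_1\rightrightarrows\mathscr{G}_0]$ is a groupoid with $\mathscr{G}_0,\mathscr{G}_1$ smooth manifolds and all structure maps (source $s$, target $t$, composition, inverse, identity) local diffeomorphisms. Its associated simplicial smooth manifold is $\mathscr{G}_\bullet=\{\mathscr{G}_n\}_{n\ge 0}$, where $\mathscr{G}_n=\mathscr{G}_1\times_{t,\mathscr{G}_0,s}\cdots\times_{t,\mathscr{G}_0,s}\mathscr{G}_1$ ($n$ factors) is the manifold of composable $n$-tuples, with the usual face maps $\varepsilon_i:\mathscr{G}_n\to\mathscr{G}_{n-1}$ and degeneracies. Let $\varepsilon^i:\Delta^{n-1}\to\Delta^n$ be the coface maps of the standard simplices. Compatible forms: $\Omega^k_{dR}(\mathscr{G}_\bullet)$ is the set of sequences $\omega=\{\omega^{(n)}\}_{n\ge0}$ of smooth complex $k$-forms $\omega^{(n)}\in\Omega^k_{dR}(\Delta^n\times\mathscr{G}_n)$ with $(\varepsilon^i\times \mathrm{id})^*\omega^{(n)}=(\mathrm{id}\times\varepsilon_i)^*\omega^{(n-1)}$ in $\Omega^k_{dR}(\Delta^{n-1}\times\mathscr{G}_n)$ for all $0\le i\le n$, $n\ge1$; the differential $\mathrm{d}$ is the exterior differential. Compatible cochains: for an abelian group $R$, $C^k(\mathscr{G}_\bullet;R)$ is the set of sequences $c=\{c^{(n)}\}$ of singular cochains $c^{(n)}\in S^k(\Delta^n\times\mathscr{G}_n;R)$ with $(\varepsilon^i\times \mathrm{id})^*c^{(n)}=(\mathrm{id}\times\varepsilon_i)^*c^{(n-1)}$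 for all $0\le i\le n$, $n\geq 1$, with the singular coboundary. (Singular simplices are taken smooth, so that forms can be integrated over them.) Integration gives a cochain map $\mathcal{I}':\Omega^*_{dR}(\mathscr{G}_\bullet)\to C^*(\mathscr{G}_\bullet;\mathbb{C})$. Write $H^*(\mathscr{G}_\bullet;R)$ for the cohomology of $C^*(\mathscr{G}_\bullet;R)$; the inclusion $\Lambda\subset\mathbb{C}$ induces $H^*(\mathscr{G}_\bullet;\Lambda)\to H^*(\mathscr{G}_\bullet;\mathbb{C})$, and the complex cohomology class of a closed form is the class of its image under $\mathcal{I}'$. For a cochain map $f:A^*\to B^*$, $\mathrm{cone}(f)$ is graded so that its degree $k$ part is $A^k\oplus B^{k-1}$. For a complex $C^*$, $\sigma_{\ge k}C^*$ is the subcomplex equal to $C^j$ for $j\ge k$ and $0$ for $j<k$. Definitions: $$\hat{H}^{k-1}_r(\mathscr{G}_\bullet;\mathbb{C}/\Lambda;\mathcal{F})=H^k\big(\mathrm{cone}(\sigma_{\ge k}F^r\Omega^*_{dR}(\mathscr{G}_\bullet)\to C^*(\mathscr{G}_\bullet;\mathbb{C}/\Lambda))\big),$$ where the map is integration followed by reduction mod $\Lambda$, and $$MH^{2r}_n(\mathscr{G}_\bullet;\Lambda;\mathcal{F})=H^{2r-n}\big(\mathrm{cone}(C^*(\mathscr{G}_\bullet;\Lambda)\oplus F^r\Omega^*_{dR}(\mathscr{G}_\bullet)\to C^*(\mathscr{G}_\bullet;\mathbb{C}))\big),$$ where the map is the difference $(c,\omega)\mapsto c-\mathcal{I}'(\omega)$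 of the natural maps. *)

theory Defs
  imports
    "HOL-Analysis.Analysis"
    "HOL-Homology.Homology"
    "HOL-Algebra.Product_Groups"
    "HOL-Library.Function_Algebras"
begin

section \<open>Smooth functions on subsets of Euclidean space\<close>

text \<open>As in \<^const>\<open>Euclidean_space\<close> and \<^const>\<open>standard_simplex\<close>, the space
  $\mathbb{R}^N$ is the set of all \<open>x :: nat \<Rightarrow> real\<close> with \<open>x i = 0\<close> for \<open>i \<ge> N\<close>; this
  allows the dimension to vary (and to be zero).\<close>

abbreviation RN :: "nat \<Rightarrow> (nat \<Rightarrow> real) set" where
  "RN N \<equiv> topspace (Euclidean_space N)"

definition partial :: "nat \<Rightarrow> ((nat \<Rightarrow> real) \<Rightarrow> 'b::real_normed_vector) \<Rightarrow> (nat \<Rightarrow> real) \<Rightarrow> 'b" where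
  "partial i f x = vector_derivative (\<lambda>h. f (x(i := h))) (at (x i))"

text \<open>\<open>Ck N k U f\<close>: on the open set \<open>U\<close> of $\mathbb{R}^N$ all partial derivatives of \<open>f\<close> of
  order at most \<open>k\<close> exist and are continuous.\<close>

primrec Ck :: "nat \<Rightarrow> nat \<Rightarrow> (nat \<Rightarrow> real) set \<Rightarrow> ((nat \<Rightarrow> real) \<Rightarrow> 'b::real_normed_vector) \<Rightarrow> bool" where
  "Ck N 0 U f \<longleftrightarrow> continuous_on U f"
| "Ck N (Suc k) U f \<longleftrightarrow> continuous_on U f \<and>
     (\<forall>i<N. (\<forall>x\<in>U. (\<lambda>h. f (x(i := h))) differentiable (at (x i))) \<and> Ck N k U (partial i f))"

definition smooth_open :: "nat \<Rightarrow> (nat \<Rightarrow> real) set \<Rightarrow> ((nat \<Rightarrow> real) \<Rightarrow> 'b::real_normed_vector) \<Rightarrow> bool" where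
  "smooth_open N U f \<longleftrightarrow> openin (Euclidean_space N) U \<and> (\<forall>k. Ck N k U f)"

text \<open>On an arbitrary subset \<open>A\<close> of $\mathbb{R}^N$, smooth means locally extendable to a smooth
  function on an open subset of $\mathbb{R}^N$.\<close>

definition smooth_on_set :: "nat \<Rightarrow> (nat \<Rightarrow> real) set \<Rightarrow> ((nat \<Rightarrow> real) \<Rightarrow> 'b::real_normed_vector) \<Rightarrow> bool" where
  "smooth_on_set N A f \<longleftrightarrow>
     (\<forall>x\<in>A. \<exists>U g. smooth_open N U g \<and> x \<in> U \<and> (\<forall>y\<in>A \<inter> U. g y = f y))"

text \<open>The derivative at \<open>x \<in> A\<close> in the direction \<open>v\<close> of a function smooth on \<open>A\<close>, computed with
  any local extension. It does not depend on the extension for the sets and directions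
  used below: relatively open subsets of $\mathbb{R}^m$ or of $\Delta^n\times\mathbb{R}^m$ and
  vectors tangent to these.\<close>

definition deriv_on :: "nat \<Rightarrow> (nat \<Rightarrow> real) set \<Rightarrow> ((nat \<Rightarrow> real) \<Rightarrow> 'b::real_normed_vector)
    \<Rightarrow> (nat \<Rightarrow> real) \<Rightarrow> (nat \<Rightarrow> real) \<Rightarrow> 'b" where
  "deriv_on N A f x v = (THE d. \<exists>U g. smooth_open N U g \<and> x \<in> U \<and> (\<forall>y\<in>A \<inter> U. g y = f y) \<and>
     d = vector_derivative (\<lambda>h. g (\<lambda>i. x i + h * v i)) (at 0))"

definition tangent_map :: "nat \<Rightarrow> (nat \<Rightarrow> real) set \<Rightarrow> ((nat \<Rightarrow> real) \<Rightarrow> (nat \<Rightarrow> real))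
    \<Rightarrow> (nat \<Rightarrow> real) \<Rightarrow> (nat \<Rightarrow> real) \<Rightarrow> (nat \<Rightarrow> real)" where
  "tangent_map N A F x v = (\<lambda>j. deriv_on N A (\<lambda>y. F y j) x v)"

section \<open>Manifolds and their products with simplices\<close>

type_synonym 'a chart = "'a set \<times> ('a \<Rightarrow> nat \<Rightarrow> real)"

text \<open>A space with an atlas. To cover $\Delta^n\times M$ as well as a manifold \<open>M\<close>, the images of
  the charts are subsets of $\mathbb{R}^N$, \<open>N = ambient_dim\<close>, all of whose tangent spaces are
  the same linear subspace \<open>tangents\<close> of $\mathbb{R}^N$. The atlas need not be maximal.\<close>

record 'a charted =
  space_top :: "'a topology"
  ambient_dim :: nat
  tangents :: "(nat \<Rightarrow> real) set"
  atlas :: "'a chart set"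

definition smooth_map :: "'a charted \<Rightarrow> 'b charted \<Rightarrow> ('a \<Rightarrow> 'b) \<Rightarrow> bool" where
  "smooth_map X Y f \<longleftrightarrow> continuous_map (space_top X) (space_top Y) f \<and>
     (\<forall>(U, \<phi>)\<in>atlas X. \<forall>(V, \<psi>)\<in>atlas Y. \<forall>j<ambient_dim Y.
        smooth_on_set (ambient_dim X) (\<phi> ` {p\<in>U. f p \<in> V}) (\<lambda>x. \<psi> (f (inv_into U \<phi> x)) j))"

definition smooth_manifold :: "'a charted \<Rightarrow> bool" where
  "smooth_manifold M \<longleftrightarrow>
     Hausdorff_space (space_top M) \<and> second_countable (space_top M) \<and>
     tangents M = RN (ambient_dim M) \<and>
     (\<Union>(U, \<phi>)\<in>atlas M. U) = topspace (space_top M) \<and>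
     (\<forall>(U, \<phi>)\<in>atlas M. openin (space_top M) U \<and>
        openin (Euclidean_space (ambient_dim M)) (\<phi> ` U) \<and>
        homeomorphic_map (subtopology (space_top M) U)
          (subtopology (Euclidean_space (ambient_dim M)) (\<phi> ` U)) \<phi>) \<and>
     (\<forall>(U, \<phi>)\<in>atlas M. \<forall>(V, \<psi>)\<in>atlas M. \<forall>j<ambient_dim M.
        smooth_on_set (ambient_dim M) (\<phi> ` (U \<inter> V)) (\<lambda>x. \<psi> (inv_into U \<phi> x) j))"

definition open_sub :: "'a charted \<Rightarrow> 'a set \<Rightarrow> 'a charted" where
  "open_sub X W = X\<lparr>space_top := subtopology (space_top X) W,
                    atlas := (\<lambda>(U, \<phi>). (U \<inter> W, \<phi>)) ` atlas X\<rparr>"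

definition diffeomorphism :: "'a charted \<Rightarrow> 'b charted \<Rightarrow> ('a \<Rightarrow> 'b) \<Rightarrow> bool" where
  "diffeomorphism X Y f \<longleftrightarrow> smooth_map X Y f \<and>
     (\<exists>g. smooth_map Y X g \<and> (\<forall>p\<in>topspace (space_top X). g (f p) = p) \<and>
          (\<forall>q\<in>topspace (space_top Y). f (g q) = q))"

definition local_diffeo :: "'a charted \<Rightarrow> 'b charted \<Rightarrow> ('a \<Rightarrow> 'b) \<Rightarrow> bool" where
  "local_diffeo X Y f \<longleftrightarrow> (\<forall>p\<in>topspace (space_top X). \<exists>U. openin (space_top X) U \<and> p \<in> U \<and>
     openin (space_top Y) (f ` U) \<and> diffeomorphism (open_sub X U) (open_sub Y (f ` U)) f)"

definition std_simplex :: "nat \<Rightarrow> (nat \<Rightarrow> real) charted" where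
  "std_simplex n = \<lparr>space_top = subtopology (powertop_real UNIV) (standard_simplex n),
     ambient_dim = Suc n,
     tangents = {v \<in> RN (Suc n). (\<Sum>i\<le>n. v i) = 0},
     atlas = {(standard_simplex n, \<lambda>x. x)}\<rparr>"

text \<open>$\Delta^n\times M$; the coordinates of \<open>M\<close> are placed after the \<open>n + 1\<close> barycentric ones.\<close>

definition simplex_times :: "nat \<Rightarrow> 'a charted \<Rightarrow> ((nat \<Rightarrow> real) \<times> 'a) charted" where
  "simplex_times n M = \<lparr>space_top = prod_topology (space_top (std_simplex n)) (space_top M),
     ambient_dim = Suc n + ambient_dim M,
     tangents = {v \<in> RN (Suc n + ambient_dim M).
                   (\<Sum>i\<le>n. v i) = 0 \<and> (\<lambda>i. v (Suc n + i)) \<in> tangents M},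
     atlas = (\<lambda>(U, \<phi>). (standard_simplex n \<times> U,
                        \<lambda>(t, p) i. if i \<le> n then t i else \<phi> p (i - Suc n))) ` atlas M\<rparr>"

section \<open>Differential forms\<close>

text \<open>A complex \<open>k\<close>-form assigns to each chart a smooth function from the image of the chart to the
  alternating \<open>k\<close>-linear functions of tangent vectors (here lists of length \<open>k\<close>), compatibly
  with the coordinate changes. Outside of this domain it is set to zero, so that equality of
  forms is equality of functions. In particular the only form of negative degree is zero.\<close>

type_synonym 'a form = "'a chart \<Rightarrow> (nat \<Rightarrow> real) \<Rightarrow> (nat \<Rightarrow> real) list \<Rightarrow> complex"

definition form_arg :: "'a charted \<Rightarrow> 'a chart \<Rightarrow> (nat \<Rightarrow> real) \<Rightarrow> (nat \<Rightarrow> real) list \<Rightarrow> bool" where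
  "form_arg X c x vs \<longleftrightarrow> c \<in> atlas X \<and> x \<in> snd c ` fst c \<and> set vs \<subseteq> tangents X"

definition alternating_multilinear ::
    "(nat \<Rightarrow> real) set \<Rightarrow> ((nat \<Rightarrow> real) list \<Rightarrow> complex) \<Rightarrow> bool" where
  "alternating_multilinear T \<alpha> \<longleftrightarrow>
     (\<forall>vs i u w a b. set vs \<subseteq> T \<longrightarrow> i < length vs \<longrightarrow> u \<in> T \<longrightarrow> w \<in> T \<longrightarrow>
        \<alpha> (vs[i := (\<lambda>l. a * u l + b * w l)]) =
          complex_of_real a * \<alpha> (vs[i := u]) + complex_of_real b * \<alpha> (vs[i := w])) \<and>
     (\<forall>vs i j. set vs \<subseteq> T \<longrightarrow> i < j \<longrightarrow> j < length vs \<longrightarrow> vs ! i = vs ! j \<longrightarrow> \<alpha> vs = 0)"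

definition forms :: "'a charted \<Rightarrow> int \<Rightarrow> 'a form set" where
  "forms X k = {\<omega>.
     (\<forall>c x vs. \<not> (form_arg X c x vs \<and> int (length vs) = k) \<longrightarrow> \<omega> c x vs = 0) \<and>
     (\<forall>(U, \<phi>)\<in>atlas X.
        (\<forall>x\<in>\<phi> ` U. alternating_multilinear (tangents X) (\<omega> (U, \<phi>) x)) \<and>
        (\<forall>vs. set vs \<subseteq> tangents X \<longrightarrow>
           smooth_on_set (ambient_dim X) (\<phi> ` U) (\<lambda>x. \<omega> (U, \<phi>) x vs))) \<and>
     (\<forall>(U, \<phi>)\<in>atlas X. \<forall>(V, \<psi>)\<in>atlas X. \<forall>p\<in>U \<inter> V. \<forall>vs. set vs \<subseteq> tangents X \<longrightarrow>
        \<omega> (U, \<phi>) (\<phi> p) vs =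
        \<omega> (V, \<psi>) (\<psi> p)
          (map (tangent_map (ambient_dim X) (\<phi> ` (U \<inter> V)) (\<lambda>x. \<psi> (inv_into U \<phi> x)) (\<phi> p)) vs))}"

definition ext_deriv :: "'a charted \<Rightarrow> 'a form \<Rightarrow> 'a form" where
  "ext_deriv X \<omega> = (\<lambda>c x vs. if form_arg X c x vs then
     (\<Sum>i<length vs. (- 1) ^ i *
        deriv_on (ambient_dim X) (snd c ` fst c)
          (\<lambda>y. \<omega> c y (take i vs @ drop (Suc i) vs)) x (vs ! i))
     else 0)"

definition pullback :: "'a charted \<Rightarrow> 'b charted \<Rightarrow> ('a \<Rightarrow> 'b) \<Rightarrow> 'b form \<Rightarrow> 'a form" where
  "pullback X Y f \<omega> = (\<lambda>c x vs. if form_arg X c x vs then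
     (let (U, \<phi>) = c;
          p = inv_into U \<phi> x;
          (V, \<psi>) = (SOME c'. c' \<in> atlas Y \<and> f p \<in> fst c')
      in \<omega> (V, \<psi>) (\<psi> (f p))
           (map (tangent_map (ambient_dim X) (\<phi> ` {q\<in>U. f q \<in> V})
                   (\<lambda>y. \<psi> (f (inv_into U \<phi> y))) x) vs))
     else 0)"

text \<open>The standard simplex of dimension \<open>k\<close> is parametrised by $x_1,\dots,x_k$ (with
  $x_0 = 1 - x_1 - \dots - x_k$) and oriented by $dx_1\wedge\dots\wedge dx_k$; the corresponding
  coordinate vector fields are $e_i - e_0$.\<close>

definition bary :: "nat \<Rightarrow> (nat \<Rightarrow> real) \<Rightarrow> nat \<Rightarrow> real" where
  "bary k x = (\<lambda>i. if i = 0 then 1 - (\<Sum>j=1..k. x j) else if i \<le> k then x i else 0)"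

definition edge_vector :: "nat \<Rightarrow> nat \<Rightarrow> real" where
  "edge_vector i = (\<lambda>j. if j = i then 1 else if j = 0 then - 1 else 0)"

definition integrate_form :: "'a charted \<Rightarrow> nat \<Rightarrow> ((nat \<Rightarrow> real) \<Rightarrow> 'a) \<Rightarrow> 'a form \<Rightarrow> complex" where
  "integrate_form X k \<sigma> \<omega> =
     (LINT x : {x. bary k x \<in> standard_simplex k} | PiM {1..k} (\<lambda>_. lborel).
        pullback (std_simplex k) X \<sigma> \<omega> (standard_simplex k, \<lambda>x. x) (bary k x)
          (map edge_vector [1..<Suc k]))"

section \<open>Smooth singular cochains\<close>

definition smooth_simplices :: "'a charted \<Rightarrow> int \<Rightarrow> ((nat \<Rightarrow> real) \<Rightarrow> 'a) set" where
  "smooth_simplices X k = {\<sigma>. 0 \<le> k \<and> singular_simplex (nat k) (space_top X) \<sigma> \<and>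
                              smooth_map (std_simplex (nat k)) X \<sigma>}"

definition cochains :: "'a charted \<Rightarrow> 'r monoid \<Rightarrow> int \<Rightarrow> (((nat \<Rightarrow> real) \<Rightarrow> 'a) \<Rightarrow> 'r) monoid" where
  "cochains X R k = product_group (smooth_simplices X k) (\<lambda>_. R)"

definition coboundary :: "'a charted \<Rightarrow> 'r monoid \<Rightarrow> int
    \<Rightarrow> (((nat \<Rightarrow> real) \<Rightarrow> 'a) \<Rightarrow> 'r) \<Rightarrow> (((nat \<Rightarrow> real) \<Rightarrow> 'a) \<Rightarrow> 'r)" where
  "coboundary X R k c = (\<lambda>\<sigma>\<in>smooth_simplices X (k + 1).
     if k < 0 then \<one>\<^bsub>R\<^esub>
     else finprod R (\<lambda>i. c (singular_face (nat (k + 1)) i \<sigma>) [^]\<^bsub>R\<^esub> ((- 1) ^ i :: int)) {..nat (k + 1)})"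

definition cochain_pullback :: "'a charted \<Rightarrow> int \<Rightarrow> ('a \<Rightarrow> 'b)
    \<Rightarrow> (((nat \<Rightarrow> real) \<Rightarrow> 'b) \<Rightarrow> 'r) \<Rightarrow> (((nat \<Rightarrow> real) \<Rightarrow> 'a) \<Rightarrow> 'r)" where
  "cochain_pullback X k f c = (\<lambda>\<sigma>\<in>smooth_simplices X k. c (simplex_map (nat k) f \<sigma>))"

section \<open>Smooth etale groupoids and their nerves\<close>

text \<open>\<open>arr_comp G g h\<close> is the composite of \<open>g\<close> followed by \<open>h\<close>, defined when \<open>tgt G g = src G h\<close>.\<close>

record ('a, 'b) groupoid =
  Obj :: "'a charted"
  Arr :: "'b charted"
  src :: "'b \<Rightarrow> 'a"
  tgt :: "'b \<Rightarrow> 'a"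
  arr_comp :: "'b \<Rightarrow> 'b \<Rightarrow> 'b"
  inverse_arr :: "'b \<Rightarrow> 'b"
  ident :: "'a \<Rightarrow> 'b"

text \<open>A point of $\mathscr{G}_n$ is a composable tuple \<open>(g 0, \<dots>, g (n - 1))\<close> together with its starting
  object, which is redundant for \<open>n > 0\<close> and is the whole datum for \<open>n = 0\<close>.\<close>

definition nerve_set :: "('a, 'b) groupoid \<Rightarrow> nat \<Rightarrow> ('a \<times> (nat \<Rightarrow> 'b)) set" where
  "nerve_set G n = {(x, g).
     x \<in> topspace (space_top (Obj G)) \<and> g \<in> (\<Pi>\<^sub>E i\<in>{..<n}. topspace (space_top (Arr G))) \<and>
     (0 < n \<longrightarrow> src G (g 0) = x) \<and> (\<forall>i. Suc i < n \<longrightarrow> tgt G (g i) = src G (g (Suc i)))}"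

definition nerve_top :: "('a, 'b) groupoid \<Rightarrow> nat \<Rightarrow> ('a \<times> (nat \<Rightarrow> 'b)) topology" where
  "nerve_top G n = subtopology
     (prod_topology (space_top (Obj G)) (product_topology (\<lambda>_. space_top (Arr G)) {..<n}))
     (nerve_set G n)"

text \<open>For an etale groupoid all projections from the fibre product $\mathscr{G}_n$ to
  $\mathscr{G}_1$ and $\mathscr{G}_0$ are local diffeomorphisms. Hence its manifold structure is
  given by the charts that are composed of the starting-object projection, restricted to
  open sets on which it is injective, and charts of $\mathscr{G}_0$.\<close>

definition nerve :: "('a, 'b) groupoid \<Rightarrow> nat \<Rightarrow> ('a \<times> (nat \<Rightarrow> 'b)) charted" where
  "nerve G n = \<lparr>space_top = nerve_top G n,
     ambient_dim = ambient_dim (Obj G),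
     tangents = tangents (Obj G),
     atlas = {(U, \<phi> \<circ> fst) | U V \<phi>. (V, \<phi>) \<in> atlas (Obj G) \<and> openin (nerve_top G n) U \<and>
                inj_on fst U \<and> fst ` U \<subseteq> V \<and> openin (space_top (Obj G)) (fst ` U)}\<rparr>"

locale smooth_etale_groupoid =
  fixes G :: "('a, 'b) groupoid"
  assumes manifold_Obj: "smooth_manifold (Obj G)"
    and manifold_Arr: "smooth_manifold (Arr G)"
    and etale_src: "local_diffeo (Arr G) (Obj G) (src G)"
    and etale_tgt: "local_diffeo (Arr G) (Obj G) (tgt G)"
    and etale_comp: "local_diffeo (nerve G 2) (Arr G) (\<lambda>(x, g). arr_comp G (g 0) (g 1))"
    and etale_inverse: "local_diffeo (Arr G) (Arr G) (inverse_arr G)"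
    and etale_ident: "local_diffeo (Obj G) (Arr G) (ident G)"
    and src_comp: "\<lbrakk>g \<in> topspace (space_top (Arr G)); h \<in> topspace (space_top (Arr G)); tgt G g = src G h\<rbrakk>
        \<Longrightarrow> src G (arr_comp G g h) = src G g"
    and tgt_comp: "\<lbrakk>g \<in> topspace (space_top (Arr G)); h \<in> topspace (space_top (Arr G)); tgt G g = src G h\<rbrakk>
        \<Longrightarrow> tgt G (arr_comp G g h) = tgt G h"
    and comp_assoc: "\<lbrakk>g \<in> topspace (space_top (Arr G)); h \<in> topspace (space_top (Arr G));
          k \<in> topspace (space_top (Arr G)); tgt G g = src G h; tgt G h = src G k\<rbrakk>
        \<Longrightarrow> arr_comp G (arr_comp G g h) k = arr_comp G g (arr_comp G h k)"
    and src_ident: "x \<in> topspace (space_top (Obj G)) \<Longrightarrow> src G (ident G x) = x"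
    and tgt_ident: "x \<in> topspace (space_top (Obj G)) \<Longrightarrow> tgt G (ident G x) = x"
    and ident_comp: "g \<in> topspace (space_top (Arr G)) \<Longrightarrow> arr_comp G (ident G (src G g)) g = g"
    and comp_ident: "g \<in> topspace (space_top (Arr G)) \<Longrightarrow> arr_comp G g (ident G (tgt G g)) = g"
    and src_inverse: "g \<in> topspace (space_top (Arr G)) \<Longrightarrow> src G (inverse_arr G g) = tgt G g"
    and tgt_inverse: "g \<in> topspace (space_top (Arr G)) \<Longrightarrow> tgt G (inverse_arr G g) = src G g"
    and comp_inverse: "g \<in> topspace (space_top (Arr G)) \<Longrightarrow> arr_comp G g (inverse_arr G g) = ident G (src G g)"
    and inverse_comp: "g \<in> topspace (space_top (Arr G)) \<Longrightarrow> arr_comp G (inverse_arr G g) g = ident G (tgt G g)"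

text \<open>The face maps $\mathscr{G}_n\to\mathscr{G}_{n-1}$, used for \<open>i \<le> n\<close> and \<open>n \<ge> 1\<close>.\<close>

definition nerve_face :: "('a, 'b) groupoid \<Rightarrow> nat \<Rightarrow> nat \<Rightarrow> 'a \<times> (nat \<Rightarrow> 'b) \<Rightarrow> 'a \<times> (nat \<Rightarrow> 'b)" where
  "nerve_face G n i = (\<lambda>(x, g).
     if i = 0 then (tgt G (g 0), \<lambda>j\<in>{..<n - 1}. g (Suc j))
     else if i = n then (x, \<lambda>j\<in>{..<n - 1}. g j)
     else (x, \<lambda>j\<in>{..<n - 1}. if j < i - 1 then g j
                             else if j = i - 1 then arr_comp G (g (i - 1)) (g i)
                             else g (Suc j)))"

abbreviation simplicial_piece :: "('a, 'b) groupoid \<Rightarrow> nat \<Rightarrow> ((nat \<Rightarrow> real) \<times> ('a \<times> (nat \<Rightarrow> 'b))) charted" where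
  "simplicial_piece G n \<equiv> simplex_times n (nerve G n)"

abbreviation mixed_piece :: "('a, 'b) groupoid \<Rightarrow> nat \<Rightarrow> ((nat \<Rightarrow> real) \<times> ('a \<times> (nat \<Rightarrow> 'b))) charted" where
  "mixed_piece G n \<equiv> simplex_times (n - 1) (nerve G n)"

section \<open>Cochain complexes of abelian groups\<close>

record 'x cochain_complex =
  grp :: "int \<Rightarrow> 'x monoid"
  diff :: "int \<Rightarrow> 'x \<Rightarrow> 'x"

definition cocycles :: "'x cochain_complex \<Rightarrow> int \<Rightarrow> 'x monoid" where
  "cocycles C k = (grp C k)\<lparr>carrier := kernel (grp C k) (grp C (k + 1)) (diff C k)\<rparr>"

definition coboundaries :: "'x cochain_complex \<Rightarrow> int \<Rightarrow> 'x set" where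
  "coboundaries C k = diff C (k - 1) ` carrier (grp C (k - 1))"

definition cohomology :: "'x cochain_complex \<Rightarrow> int \<Rightarrow> 'x set monoid" where
  "cohomology C k = cocycles C k Mod coboundaries C k"

definition cohomology_class :: "'x cochain_complex \<Rightarrow> int \<Rightarrow> 'x \<Rightarrow> 'x set" where
  "cohomology_class C k z = coboundaries C k #>\<^bsub>cocycles C k\<^esub> z"

definition cohomology_map :: "'y cochain_complex \<Rightarrow> int \<Rightarrow> (int \<Rightarrow> 'x \<Rightarrow> 'y) \<Rightarrow> 'x set \<Rightarrow> 'y set" where
  "cohomology_map D k f X = cohomology_class D k (f k (SOME z. z \<in> X))"

definition direct_sum :: "'x cochain_complex \<Rightarrow> 'y cochain_complex \<Rightarrow> ('x \<times> 'y) cochain_complex" where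
  "direct_sum A B = \<lparr>grp = (\<lambda>k. grp A k \<times>\<times> grp B k),
                     diff = (\<lambda>k (a, b). (diff A k a, diff B k b))\<rparr>"

text \<open>The cone has differential $(a, b) \mapsto (da, f(a) - db)$.\<close>

definition mapping_cone :: "'x cochain_complex \<Rightarrow> 'y cochain_complex \<Rightarrow> (int \<Rightarrow> 'x \<Rightarrow> 'y)
    \<Rightarrow> ('x \<times> 'y) cochain_complex" where
  "mapping_cone A B f = \<lparr>grp = (\<lambda>k. grp A k \<times>\<times> grp B (k - 1)),
     diff = (\<lambda>k (a, b). (diff A k a,
               f k a \<otimes>\<^bsub>grp B k\<^esub> inv\<^bsub>grp B k\<^esub> (diff B (k - 1) b)))\<rparr>"

definition truncation :: "int \<Rightarrow> 'x cochain_complex \<Rightarrow> 'x cochain_complex" where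
  "truncation k C = C\<lparr>grp := (\<lambda>j. if k \<le> j then grp C j else (grp C j)\<lparr>carrier := {\<one>\<^bsub>grp C j\<^esub>}\<rparr>)\<rparr>"

definition subcomplex_on :: "'x cochain_complex \<Rightarrow> (int \<Rightarrow> 'x set) \<Rightarrow> 'x cochain_complex" where
  "subcomplex_on C S = C\<lparr>grp := (\<lambda>k. (grp C k)\<lparr>carrier := S k\<rparr>)\<rparr>"

definition is_subcomplex :: "'x cochain_complex \<Rightarrow> (int \<Rightarrow> 'x set) \<Rightarrow> bool" where
  "is_subcomplex C S \<longleftrightarrow>
     (\<forall>k. subgroup (S k) (grp C k)) \<and> (\<forall>k. \<forall>x\<in>S k. diff C k x \<in> S (k + 1))"

text \<open>Subcomplexes are only required to be stable under the group operations and the differential.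
  Filtrations are decreasing and indexed by all integers.\<close>

definition is_filtration :: "'x cochain_complex \<Rightarrow> (int \<Rightarrow> int \<Rightarrow> 'x set) \<Rightarrow> bool" where
  "is_filtration C F \<longleftrightarrow> (\<forall>r. is_subcomplex C (F r)) \<and> (\<forall>r k. F (r + 1) k \<subseteq> F r k)"

section \<open>Compatible forms and cochains\<close>

type_synonym ('a, 'b) sform = "nat \<Rightarrow> ((nat \<Rightarrow> real) \<times> ('a \<times> (nat \<Rightarrow> 'b))) form"
type_synonym ('a, 'b, 'r) scochain =
  "nat \<Rightarrow> ((nat \<Rightarrow> real) \<Rightarrow> (nat \<Rightarrow> real) \<times> ('a \<times> (nat \<Rightarrow> 'b))) \<Rightarrow> 'r"

definition compatible_forms :: "('a, 'b) groupoid \<Rightarrow> int \<Rightarrow> ('a, 'b) sform set" where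
  "compatible_forms G k = {\<omega>. (\<forall>n. \<omega> n \<in> forms (simplicial_piece G n) k) \<and>
     (\<forall>n\<ge>1. \<forall>i\<le>n.
        pullback (mixed_piece G n) (simplicial_piece G n) (map_prod (simplical_face i) id) (\<omega> n) =
        pullback (mixed_piece G n) (simplicial_piece G (n - 1)) (map_prod id (nerve_face G n i)) (\<omega> (n - 1)))}"

definition de_rham :: "('a, 'b) groupoid \<Rightarrow> ('a, 'b) sform cochain_complex" where
  "de_rham G = \<lparr>grp = (\<lambda>k. \<lparr>carrier = compatible_forms G k, monoid.mult = (+), one = 0\<rparr>),
                diff = (\<lambda>k \<omega> n. ext_deriv (simplicial_piece G n) (\<omega> n))\<rparr>"

definition compatible_cochains :: "('a, 'b) groupoid \<Rightarrow> 'r monoid \<Rightarrow> int \<Rightarrow> ('a, 'b, 'r) scochain set" where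
  "compatible_cochains G R k = {c. (\<forall>n. c n \<in> carrier (cochains (simplicial_piece G n) R k)) \<and>
     (\<forall>n\<ge>1. \<forall>i\<le>n.
        cochain_pullback (mixed_piece G n) k (map_prod (simplical_face i) id) (c n) =
        cochain_pullback (mixed_piece G n) k (map_prod id (nerve_face G n i)) (c (n - 1)))}"

definition singular_complex :: "('a, 'b) groupoid \<Rightarrow> 'r monoid \<Rightarrow> ('a, 'b, 'r) scochain cochain_complex" where
  "singular_complex G R =
     \<lparr>grp = (\<lambda>k. (product_group UNIV (\<lambda>n. cochains (simplicial_piece G n) R k))
                    \<lparr>carrier := compatible_cochains G R k\<rparr>),
      diff = (\<lambda>k c n. coboundary (simplicial_piece G n) R k (c n))\<rparr>"

definition integration :: "('a, 'b) groupoid \<Rightarrow> int \<Rightarrow> ('a, 'b) sform \<Rightarrow> ('a, 'b, complex) scochain" where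
  "integration G k \<omega> = (\<lambda>n. \<lambda>\<sigma>\<in>smooth_simplices (simplicial_piece G n) k.
     integrate_form (simplicial_piece G n) (nat k) \<sigma> (\<omega> n))"

section \<open>Differential characters and multiplicative cohomology\<close>

definition complex_group :: "complex monoid" where
  "complex_group = \<lparr>carrier = UNIV, monoid.mult = (+), one = 0\<rparr>"

abbreviation coeff_subgroup :: "complex set \<Rightarrow> complex monoid" where
  "coeff_subgroup \<Lambda> \<equiv> complex_group\<lparr>carrier := \<Lambda>\<rparr>"

definition reduction :: "('a, 'b) groupoid \<Rightarrow> complex set \<Rightarrow> int
    \<Rightarrow> ('a, 'b, complex) scochain \<Rightarrow> ('a, 'b, complex set) scochain" where
  "reduction G \<Lambda> k c = (\<lambda>n. \<lambda>\<sigma>\<in>smooth_simplices (simplicial_piece G n) k. \<Lambda> #>\<^bsub>complex_group\<^esub> c n \<sigma>)"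

definition differential_characters ::
    "('a, 'b) groupoid \<Rightarrow> complex set \<Rightarrow> (int \<Rightarrow> int \<Rightarrow> ('a, 'b) sform set) \<Rightarrow> int \<Rightarrow> int
      \<Rightarrow> (('a, 'b) sform \<times> ('a, 'b, complex set) scochain) set monoid" where
  "differential_characters G \<Lambda> F r j = cohomology
     (mapping_cone (truncation (j + 1) (subcomplex_on (de_rham G) (F r)))
           (singular_complex G (complex_group Mod \<Lambda>))
           (\<lambda>k \<omega>. reduction G \<Lambda> k (integration G k \<omega>))) (j + 1)"

definition multiplicative_cohomology ::
    "('a, 'b) groupoid \<Rightarrow> complex set \<Rightarrow> (int \<Rightarrow> int \<Rightarrow> ('a, 'b) sform set) \<Rightarrow> int \<Rightarrow> int
      \<Rightarrow> ((('a, 'b, complex) scochain \<times> ('a, 'b) sform) \<times> ('a, 'b, complex) scochain) set monoid" where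
  "multiplicative_cohomology G \<Lambda> F r n = cohomology
     (mapping_cone (direct_sum (singular_complex G (coeff_subgroup \<Lambda>)) (subcomplex_on (de_rham G) (F r)))
           (singular_complex G complex_group)
           (\<lambda>k (c, \<omega>). c \<otimes>\<^bsub>grp (singular_complex G complex_group) k\<^esub>
              inv\<^bsub>grp (singular_complex G complex_group) k\<^esub> (integration G k \<omega>))) (2 * r - n)"

text \<open>The closed forms in \<open>S\<close> of degree \<open>j\<close> whose complex class comes from a class with
  coefficients in \<open>\<Lambda>\<close>; on cochains the inclusion of \<open>\<Lambda>\<close> into the complex numbers is the identity.\<close>

definition integral_forms ::
    "('a, 'b) groupoid \<Rightarrow> complex set \<Rightarrow> ('a, 'b) sform set \<Rightarrow> int \<Rightarrow> ('a, 'b) sform set" where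
  "integral_forms G \<Lambda> S j = {\<omega> \<in> S.
     diff (de_rham G) j \<omega> = \<one>\<^bsub>grp (de_rham G) (j + 1)\<^esub> \<and>
     cohomology_class (singular_complex G complex_group) j (integration G j \<omega>) \<in>
       cohomology_map (singular_complex G complex_group) j (\<lambda>_ c. c) `
         carrier (cohomology (singular_complex G (coeff_subgroup \<Lambda>)) j)}"

end

theory Submission
  imports Defs
begin

text \<open>A cocycle of the cone defining \<open>MH\<close> is a triple of a \<open>\<Lambda>\<close>-valued cochain \<open>a\<close>, a form \<open>w\<close> and a complex
  cochain \<open>h\<close> with \<open>a - I w = dh\<close>. It is determined by \<open>(w, h)\<close>, and such an \<open>a\<close> exists if and only if
  \<open>(w, - h mod \<Lambda>)\<close> is a cocycle of the cone defining differential characters; as cochains lift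
  along \<open>\<complex> \<rightarrow> \<complex>/\<Lambda>\<close>, all of these arise. So both groups are quotients of the same cocycles, and \<open>\<Xi>\<close> divides
  out the additional coboundaries \<open>(dw, I w mod \<Lambda>)\<close>, with \<open>w\<close> of the degree that the truncation
  removes. This needs only that integration is a map of cochain complexes, which is Stokes' theorem. On the
  simplex, Stokes' theorem is the fundamental theorem of calculus along the edges at vertex \<open>0\<close>; all
  calculus takes place in charts with values in products of simplices and Euclidean spaces.\<close>

section \<open>Calculus on open subsets of Euclidean space\<close>

text \<open>Two points shape the development. Forms are given in charts only, and both
  \<open>deriv_on\<close> (a definite description over local extensions) and \<open>pullback\<close>
  (a selected chart of the target) involve choices. Independence of the first rests on the model
  \<Delta>^n \<times> \<real>^m: even at its corners enough half-lines point inwards to fix every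
  tangential derivative. Independence of the second is the chain rule together with the transition
  law of forms. As the dimension varies and points are sequences with finitely many free
  coordinates, derivatives are handled through partial derivatives and boxes in the first
  \<open>N\<close> coordinates. The shape of the kernel comes from the truncation: in the cone of
  differential characters no form of degree k - 1 is left, so the pair (dw, I w mod \<Lambda>) of
  such a form is a coboundary exactly if dw = 0 and I w mod \<Lambda> = db. A lift c of b then makes
  I w - dc a \<Lambda>-valued cocycle in the class of I w, which is the condition in
  \<open>integral_forms\<close>.\<close>

lemma mem_RN: "x \<in> RN N \<longleftrightarrow> (\<forall>i\<ge>N. x i = 0)"
  by (simp add: topspace_Euclidean_space)

lemma openin_RN: "openin (Euclidean_space N) U \<longleftrightarrow> (\<exists>T. open T \<and> U = T \<inter> RN N)"
  by (simp add: Euclidean_space_def openin_subtopology euclidean_product_topology)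

lemma openin_RN_subset: "openin (Euclidean_space N) U \<Longrightarrow> U \<subseteq> RN N"
  by (simp add: openin_subset)

section \<open>Neighbourhoods as boxes in the first \<open>N\<close> coordinates\<close>

lemma uniform_radius:
  fixes P :: "nat \<Rightarrow> real \<Rightarrow> bool"
  assumes "\<And>i. i < N \<Longrightarrow> \<exists>d>0. P i d" and "\<And>i d d'. P i d \<Longrightarrow> 0 < d' \<Longrightarrow> d' \<le> d \<Longrightarrow> P i d'"
  shows "\<exists>d>0. \<forall>i<N. P i d"
  using assms(1)
proof (induction N)
  case 0
  then show ?case by (auto intro: exI[of _ 1])
next
  case (Suc N)
  then obtain d where d: "d > 0" "\<forall>i<N. P i d" by auto
  obtain d' where d': "d' > 0" "P N d'" using Suc.prems by blast
  have "\<forall>i<Suc N. P i (min d d')"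
  proof (intro allI impI)
    fix i assume "i < Suc N"
    then consider "i < N" | "i = N" by linarith
    then show "P i (min d d')"
      by cases (use d d' assms(2) in \<open>auto intro: assms(2)\<close>)
  qed
  then show ?case using d(1) d'(1) by (intro exI[of _ "min d d'"]) auto
qed

text \<open>An open set of the product topology contains a product of open sets around
  \<open>x\<close>. Only the first \<open>N\<close> factors constrain a point of
  \<open>RN N\<close>, since all later coordinates vanish there as they do for \<open>x\<close>, and
  finitely many radii have a positive minimum.\<close>

lemma open_contains_box:
  assumes "open T" "x \<in> T" "x \<in> RN N"
  shows "\<exists>d>0. \<forall>y\<in>RN N. (\<forall>i<N. \<bar>y i - x i\<bar> < d) \<longrightarrow> y \<in> T"
proof -
  have "openin (product_topology (\<lambda>i. euclidean) UNIV) T"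
    using assms(1) by (simp add: euclidean_product_topology)
  then obtain X where X: "x \<in> (\<Pi>\<^sub>E i\<in>UNIV. X i)" "\<And>i. openin euclidean (X i)" "(\<Pi>\<^sub>E i\<in>UNIV. X i) \<subseteq> T"
    using product_topology_open_contains_basis[OF _ assms(2)] by (metis (no_types, lifting))
  have "\<exists>d>0. \<forall>i<N. \<forall>t. \<bar>t - x i\<bar> < d \<longrightarrow> t \<in> X i"
  proof (rule uniform_radius)
    fix i
    have "open (X i)" "x i \<in> X i" using X(1,2) by (auto simp: PiE_def Pi_def)
    then show "\<exists>d>0. \<forall>t. \<bar>t - x i\<bar> < d \<longrightarrow> t \<in> X i"
      by (metis open_dist dist_real_def)
  qed (use order_less_le_trans in blast)
  then obtain d where d: "d > 0" "\<And>i t. i < N \<Longrightarrow> \<bar>t - x i\<bar> < d \<Longrightarrow> t \<in> X i" by blast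
  have "y \<in> T" if "y \<in> RN N" "\<forall>i<N. \<bar>y i - x i\<bar> < d" for y
  proof -
    have "y i \<in> X i" for i
    proof (cases "i < N")
      case True then show ?thesis using d(2) that(2) by blast
    next
      case False
      then have "y i = x i" using that(1) assms(3) by (auto simp: mem_RN)
      then show ?thesis using X(1) by (auto simp: PiE_def Pi_def)
    qed
    then show "y \<in> T" using X(3) by (auto simp: PiE_def Pi_def)
  qed
  then show ?thesis using d(1) by blast
qed

lemma continuous_on_box:
  assumes "openin (Euclidean_space N) U" "continuous_on U f" "x \<in> U" "e > 0"
  shows "\<exists>d>0. \<forall>y\<in>RN N. (\<forall>i<N. \<bar>y i - x i\<bar> < d) \<longrightarrow> y \<in> U \<and> dist (f y) (f x) < e"
proof -
  obtain T where T: "open T" "U = T \<inter> RN N" using assms(1) by (auto simp: openin_RN)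
  have "openin (top_of_set U) (U \<inter> f -` ball (f x) e)"
    using assms(2) by (simp add: continuous_on_open_gen[where T=UNIV] continuous_openin_preimage_gen)
  then obtain W where W: "open W" "U \<inter> f -` ball (f x) e = U \<inter> W" by (auto simp: openin_open)
  have "x \<in> W" using W(2) assms(3,4) by auto
  then obtain d where "d > 0" "\<forall>y\<in>RN N. (\<forall>i<N. \<bar>y i - x i\<bar> < d) \<longrightarrow> y \<in> T \<inter> W"
    using open_contains_box[of "T \<inter> W" x N] T W(1) assms(3) by auto
  then have "\<forall>y\<in>RN N. (\<forall>i<N. \<bar>y i - x i\<bar> < d) \<longrightarrow> y \<in> U \<and> dist (f y) (f x) < e"
  proof (intro ballI impI)
    fix y assume "y \<in> RN N" "\<forall>i<N. \<bar>y i - x i\<bar> < d"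
    then have "y \<in> U \<inter> W" using \<open>\<forall>y\<in>RN N. _\<close> T(2) by auto
    then show "y \<in> U \<and> dist (f y) (f x) < e" unfolding W(2)[symmetric] by (auto simp: dist_commute)
  qed
  then show ?thesis using \<open>d > 0\<close> by blast
qed

text \<open>This is what makes \<open>partial i\<close> local: for \<open>i < N\<close> a small
  change of one coordinate does not leave \<open>U\<close>, so only values on \<open>U\<close>
  enter.\<close>

lemma eventually_fun_upd_in:
  assumes "openin (Euclidean_space N) U" "x \<in> U" "i < N"
  shows "\<forall>\<^sub>F h in nhds (x i). x(i := h) \<in> U"
proof -
  obtain T where T: "open T" "U = T \<inter> RN N" using assms(1) by (auto simp: openin_RN)
  have "continuous_on UNIV (\<lambda>h. x(i := h))"
  proof (rule continuous_on_coordinatewise_then_product)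
    show "continuous_on UNIV (\<lambda>h. (x(i := h)) j)" for j by (cases "j = i") auto
  qed
  then have "open ((\<lambda>h. x(i := h)) -` T)" using T(1) by (simp add: open_vimage)
  then have "\<forall>\<^sub>F h in nhds (x i). h \<in> (\<lambda>h. x(i := h)) -` T"
    using assms(2) T(2) by (intro eventually_nhds_in_open) auto
  then show ?thesis
    by eventually_elim (use T(2) assms(2,3) in \<open>auto simp: mem_RN\<close>)
qed

section \<open>Closure properties of functions of class C^k\<close>

lemma has_vector_derivative_partial:
  assumes "Ck N (Suc k) U f" "x \<in> U" "i < N"
  shows "((\<lambda>h. f (x(i := h))) has_vector_derivative partial i f x) (at (x i))"
  using assms by (auto simp: partial_def vector_derivative_works)

lemma Ck_imp_continuous_on: "Ck N k U f \<Longrightarrow> continuous_on U f"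
  by (cases k) auto

lemma Ck_partial: "Ck N (Suc k) U f \<Longrightarrow> i < N \<Longrightarrow> Ck N k U (partial i f)"
  by simp

lemma Ck_Suc_imp_Ck: "Ck N (Suc k) U f \<Longrightarrow> Ck N k U f"
  by (induction k arbitrary: f) auto

lemma Ck_mono: "Ck N k U f \<Longrightarrow> l \<le> k \<Longrightarrow> Ck N l U f"
  by (induction k) (use Ck_Suc_imp_Ck le_Suc_eq in blast)+

lemma Ck_subset: "Ck N k U f \<Longrightarrow> V \<subseteq> U \<Longrightarrow> Ck N k V f"
  by (induction k arbitrary: f) (auto intro: continuous_on_subset)

text \<open>By induction on the order: on an open set equal functions have equal partial
  derivatives, because a partial derivative at a point of \<open>U\<close> is a limit over points of
  \<open>U\<close>.\<close>

lemma Ck_cong: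
  assumes "openin (Euclidean_space N) U" "\<And>x. x \<in> U \<Longrightarrow> f x = g x" "Ck N k U f"
  shows "Ck N k U g"
  using assms(2,3)
proof (induction k arbitrary: f g)
  case 0
  then show ?case by (simp cong: continuous_on_cong)
next
  case (Suc k)
  have d: "((\<lambda>h. g (x(i := h))) has_vector_derivative partial i f x) (at (x i))"
    if xi: "x \<in> U" "i < N" for x i
  proof -
    obtain T where T: "open T" "x i \<in> T" "\<And>h. h \<in> T \<Longrightarrow> x(i := h) \<in> U"
      using eventually_fun_upd_in[OF assms(1) xi] by (auto simp: eventually_nhds)
    show ?thesis
      by (rule has_vector_derivative_transform_within_open[OF has_vector_derivative_partial[OF Suc.prems(2) xi] T(1,2)])
        (use T(3) Suc.prems(1) in \<open>simp del: fun_upd_apply\<close>)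
  qed
  then have "partial i g x = partial i f x" if "x \<in> U" "i < N" for x i
    using that by (auto simp: partial_def[of i g] intro: vector_derivative_at)
  moreover have "continuous_on U g"
    using Suc.prems by (simp cong: continuous_on_cong)
  ultimately show ?case
    using Suc.prems(2) by (auto intro!: Suc.IH[of "partial i f" "partial i g" for i] differentiableI_vector[OF d])
qed

text \<open>Spares the computation of \<open>partial\<close>: the derivatives \<open>D i\<close> may
  be guessed by a formula, and class C^k is then checked for the formula instead of for
  \<open>partial i f\<close>.\<close>

lemma Ck_SucI:
  assumes "openin (Euclidean_space N) U" "continuous_on U f"
    and d: "\<And>x i. x \<in> U \<Longrightarrow> i < N \<Longrightarrow> ((\<lambda>h. f (x(i := h))) has_vector_derivative D i x) (at (x i))"
    and "\<And>i. i < N \<Longrightarrow> Ck N k U (D i)"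
  shows "Ck N (Suc k) U f"
proof -
  have "partial i f x = D i x" if "x \<in> U" "i < N" for x i
    using d that by (auto simp: partial_def intro: vector_derivative_at)
  then have "Ck N k U (partial i f)" if "i < N" for i
    using that assms(4) by (intro Ck_cong[OF assms(1), of "D i" "partial i f"]) auto
  then show ?thesis using assms(2) d by (auto intro: differentiableI_vector)
qed

lemma Ck_const: "openin (Euclidean_space N) U \<Longrightarrow> Ck N k U (\<lambda>x. c)"
proof (induction k arbitrary: c)
  case (Suc k)
  then show ?case by (intro Ck_SucI[where D = "\<lambda>i x. 0"]) auto
qed auto

lemma Ck_coord: "openin (Euclidean_space N) U \<Longrightarrow> Ck N k U (\<lambda>x. x j)"
proof (cases k)
  case 0
  then show ?thesis by (auto intro: continuous_on_subset[OF continuous_on_product_coordinates])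
next
  case (Suc l)
  assume "openin (Euclidean_space N) U"
  then show ?thesis unfolding Suc
    by (intro Ck_SucI[where D = "\<lambda>i x. if i = j then 1 else 0"] continuous_on_subset[OF continuous_on_product_coordinates])
      (auto intro: Ck_const)
qed

lemma Ck_add:
  assumes "openin (Euclidean_space N) U"
  shows "Ck N k U f \<Longrightarrow> Ck N k U g \<Longrightarrow> Ck N k U (\<lambda>x. f x + g x)"
proof (induction k arbitrary: f g)
  case 0
  then show ?case by (simp add: continuous_on_add continuous_on_scaleR)
next
  case (Suc k)
  show ?case
  proof (rule Ck_SucI[OF assms])
    show "((\<lambda>h. f (x(i := h)) + g (x(i := h))) has_vector_derivative partial i f x + partial i g x) (at (x i))"
      if "x \<in> U" "i < N" for x i
      using Suc.prems that by (intro has_vector_derivative_add has_vector_derivative_partial)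
    show "Ck N k U (\<lambda>x. partial i f x + partial i g x)" if "i < N" for i
      using that Suc.prems by (intro Suc.IH) auto
  qed (use Suc.prems in \<open>simp_all add: continuous_on_add continuous_on_scaleR\<close>)
qed

lemma Ck_scaleR:
  fixes f :: "(nat \<Rightarrow> real) \<Rightarrow> real"
  assumes "openin (Euclidean_space N) U"
  shows "Ck N k U f \<Longrightarrow> Ck N k U g \<Longrightarrow> Ck N k U (\<lambda>x. f x *\<^sub>R g x)"
proof (induction k arbitrary: f g)
  case 0
  then show ?case by (simp add: continuous_on_add continuous_on_scaleR)
next
  case (Suc k)
  show ?case
  proof (rule Ck_SucI[OF assms])
    show "((\<lambda>h. f (x(i := h)) *\<^sub>R g (x(i := h))) has_vector_derivative
        f x *\<^sub>R partial i g x + partial i f x *\<^sub>R g x) (at (x i))"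
      if "x \<in> U" "i < N" for x i
      using has_vector_derivative_scaleR[of "\<lambda>h. f (x(i := h))" "partial i f x" "x i" UNIV "\<lambda>h. g (x(i := h))" "partial i g x"]
        has_vector_derivative_partial[OF Suc.prems(1) that] has_vector_derivative_partial[OF Suc.prems(2) that]
      by (simp add: has_real_derivative_iff_has_vector_derivative)
    \<comment> \<open>Each summand of the product rule keeps one factor undifferentiated; that
      factor is lowered from order \<open>Suc k\<close> to \<open>k\<close> before the induction
      hypothesis applies.\<close>
    show "Ck N k U (\<lambda>x. f x *\<^sub>R partial i g x + partial i f x *\<^sub>R g x)" if "i < N" for i
      using that Suc.prems Suc.prems[THEN Ck_Suc_imp_Ck] by (intro Ck_add[OF assms] Suc.IH) auto
  qed (use Suc.prems in \<open>simp_all add: continuous_on_add continuous_on_scaleR\<close>)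
qed

lemma Ck_sum:
  assumes "openin (Euclidean_space N) U" "\<And>j. j \<in> J \<Longrightarrow> Ck N k U (f j)"
  shows "Ck N k U (\<lambda>x. \<Sum>j\<in>J. f j x)"
  using assms(2)
  by (induction J rule: infinite_finite_induct) (auto intro!: Ck_const Ck_add assms(1))

text \<open>Telescoping over the coordinates and the mean value inequality in each of them.\<close>

lemma Ck1_frechet:
  assumes U: "openin (Euclidean_space N) U" and g: "Ck N (Suc 0) U g" and x: "x \<in> U" and "e > 0"
  shows "\<exists>d>0. \<forall>y\<in>RN N. (\<forall>i<N. \<bar>y i - x i\<bar> < d) \<longrightarrow>
    norm (g y - g x - (\<Sum>i<N. (y i - x i) *\<^sub>R partial i g x)) \<le> e * (\<Sum>i<N. \<bar>y i - x i\<bar>)"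
proof -
  have xR: "x \<in> RN N" using U x openin_RN_subset by blast
  have "\<exists>d>0. \<forall>i<N. \<forall>y\<in>RN N. (\<forall>j<N. \<bar>y j - x j\<bar> < d) \<longrightarrow> y \<in> U \<and> dist (partial i g y) (partial i g x) < e"
  proof (rule uniform_radius)
    fix i assume "i < N"
    then have "continuous_on U (partial i g)" using g by simp
    from continuous_on_box[OF U this x \<open>e > 0\<close>]
    show "\<exists>d>0. \<forall>y\<in>RN N. (\<forall>j<N. \<bar>y j - x j\<bar> < d) \<longrightarrow> y \<in> U \<and> dist (partial i g y) (partial i g x) < e" .
  qed (use order_less_le_trans in blast)
  then obtain d where d: "d > 0"
    "\<And>i y. i < N \<Longrightarrow> y \<in> RN N \<Longrightarrow> (\<forall>j<N. \<bar>y j - x j\<bar> < d) \<Longrightarrow> y \<in> U \<and> dist (partial i g y) (partial i g x) < e"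
    by blast
  show ?thesis
  proof (intro exI[of _ d] conjI ballI impI)
    fix y assume y: "y \<in> RN N" "\<forall>i<N. \<bar>y i - x i\<bar> < d"
    \<comment> \<open>\<open>p i\<close> takes its first \<open>i\<close> coordinates from
      \<open>y\<close> and the others from \<open>x\<close>, so \<open>p 0, ..., p N\<close> is a
      path from \<open>x\<close> to \<open>y\<close> that changes one coordinate at a time.\<close>
    define p where "p i j = (if j < i then y j else x j)" for i j :: nat
    have pN: "p N = y" "p 0 = x" using y(1) xR by (auto simp: p_def mem_RN fun_eq_iff)
    have step: "norm (g (p (Suc i)) - g (p i) - (y i - x i) *\<^sub>R partial i g x) \<le> e * \<bar>y i - x i\<bar>" if i: "i < N" for i
    proof -
      define S where "S = closed_segment (x i) (y i)"
      \<comment> \<open>Subtracting the linear function with slope \<open>partial i g x\<close>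
        leaves a function whose derivative on the segment has norm below \<open>e\<close>.\<close>
      let ?\<psi> = "\<lambda>h. g ((p i)(i := h)) - h *\<^sub>R partial i g x"
      have q: "(p i)(i := h) \<in> U" "dist (partial i g ((p i)(i := h))) (partial i g x) < e" if h: "h \<in> S" for h
      proof -
        have "\<bar>h - x i\<bar> \<le> \<bar>y i - x i\<bar>" using h by (auto simp: S_def closed_segment_eq_real_ivl split: if_splits)
        then have "\<forall>j<N. \<bar>((p i)(i := h)) j - x j\<bar> < d" using y(2) d(1) i by (auto simp: p_def)
        moreover have "(p i)(i := h) \<in> RN N" using y(1) xR i by (auto simp: p_def mem_RN)
        ultimately show "(p i)(i := h) \<in> U" "dist (partial i g ((p i)(i := h))) (partial i g x) < e"
          using d(2)[OF i] by blast+
      qed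
      have der: "(?\<psi> has_vector_derivative partial i g ((p i)(i := h)) - partial i g x) (at h within S)" if "h \<in> S" for h
      proof (rule has_vector_derivative_diff)
        show "((\<lambda>h. g ((p i)(i := h))) has_vector_derivative partial i g ((p i)(i := h))) (at h within S)"
          using has_vector_derivative_partial[OF g q(1)[OF that] i] by (auto intro: has_vector_derivative_at_within)
        show "((\<lambda>h. h *\<^sub>R partial i g x) has_vector_derivative partial i g x) (at h within S)"
          unfolding has_vector_derivative_def
          by (rule bounded_linear_imp_has_derivative[OF bounded_linear_scaleR_left])
      qed
      have "norm (?\<psi> (y i) - ?\<psi> (x i)) \<le> e * norm (y i - x i)"
      proof (rule differentiable_bound[of S ?\<psi> "\<lambda>h t. t *\<^sub>R (partial i g ((p i)(i := h)) - partial i g x)"])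
        show "convex S" by (simp add: S_def)
        show "(?\<psi> has_derivative (\<lambda>t. t *\<^sub>R (partial i g ((p i)(i := h)) - partial i g x))) (at h within S)"
          if "h \<in> S" for h
          using der[OF that] by (simp add: has_vector_derivative_def)
        show "onorm (\<lambda>t. t *\<^sub>R (partial i g ((p i)(i := h)) - partial i g x)) \<le> e" if "h \<in> S" for h
          using q(2)[OF that] by (intro onorm_le) (auto simp: dist_norm mult.commute[of e] intro!: mult_left_mono)
      qed (auto simp: S_def)
      moreover have "(p i)(i := y i) = p (Suc i)" "(p i)(i := x i) = p i"
        by (auto simp: p_def fun_eq_iff)
      ultimately show ?thesis by (simp add: algebra_simps)
    qed
    have "g y - g x = (\<Sum>i<N. g (p (Suc i)) - g (p i))"
      using sum_lessThan_telescope[of "\<lambda>i. g (p i)" N] pN by simp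
    then have "norm (g y - g x - (\<Sum>i<N. (y i - x i) *\<^sub>R partial i g x))
        = norm (\<Sum>i<N. g (p (Suc i)) - g (p i) - (y i - x i) *\<^sub>R partial i g x)"
      by (simp add: sum_subtractf)
    also have "\<dots> \<le> (\<Sum>i<N. e * \<bar>y i - x i\<bar>)" by (intro sum_norm_le) (use step in auto)
    finally show "norm (g y - g x - (\<Sum>i<N. (y i - x i) *\<^sub>R partial i g x)) \<le> e * (\<Sum>i<N. \<bar>y i - x i\<bar>)"
      by (simp add: sum_distrib_left)
  qed (rule d(1))
qed

text \<open>The increment of \<open>c\<close> is inserted into \<open>Ck1_frechet\<close>. The set
  \<open>S\<close> of parameters is arbitrary so that one-sided derivatives are covered as well;
  later curves start on the boundary of a simplex.\<close>

lemma Ck1_curve: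
  assumes U: "openin (Euclidean_space N) U" and g: "Ck N (Suc 0) U g" and x: "c t \<in> U"
    and cR: "\<And>s. s \<in> S \<Longrightarrow> c s \<in> RN N"
    and c': "\<And>i. i < N \<Longrightarrow> ((\<lambda>s. c s i) has_vector_derivative c' i) (at t within S)"
  shows "((\<lambda>s. g (c s)) has_vector_derivative (\<Sum>i<N. c' i *\<^sub>R partial i g (c t))) (at t within S)"
  unfolding has_vector_derivative_def has_derivative_within_alt2
proof (intro conjI allI impI)
  show "bounded_linear (\<lambda>x. x *\<^sub>R (\<Sum>i<N. c' i *\<^sub>R partial i g (c t)))" by (rule bounded_linear_scaleR_left)
  fix e :: real assume "e > 0"
  define M where "M = (\<Sum>i<N. \<bar>c' i\<bar> + 1)"
  define B where "B = (\<Sum>i<N. norm (partial i g (c t)))"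
  have MB: "0 \<le> M" "0 \<le> B" by (auto simp: M_def B_def intro!: sum_nonneg)
  \<comment> \<open>The error splits into the remainder of \<open>g\<close>, controlled by
    \<open>e2 * M\<close>, and the remainders of the coordinates of \<open>c\<close>, controlled by
    \<open>e1 * B\<close>; each takes half of \<open>e\<close>. The bound \<open>e1 \<le> 1\<close>
    makes \<open>\<bar>c' i\<bar> + 1\<close> a Lipschitz constant of the i-th coordinate near
    \<open>t\<close>, and the summands 1 in the denominators keep these positive.\<close>
  define e1 where "e1 = min 1 (e / (2 * (B + 1)))"
  define e2 where "e2 = e / (2 * (M + 1))"
  have e12: "e1 > 0" "e1 \<le> 1" "e2 > 0" "e1 * B \<le> e / 2" "e2 * M \<le> e / 2"
  proof -
    show "e1 > 0" "e1 \<le> 1" "e2 > 0" using MB \<open>e > 0\<close> by (auto simp: e1_def e2_def)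
    have "e1 * B \<le> e / (2 * (B + 1)) * (B + 1)" using MB \<open>e > 0\<close> by (intro mult_mono) (auto simp: e1_def)
    also have "\<dots> = e / 2" using MB by (simp add: field_simps)
    finally show "e1 * B \<le> e / 2" .
    have "e2 * M \<le> e / (2 * (M + 1)) * (M + 1)" using MB \<open>e > 0\<close> by (intro mult_mono) (auto simp: e2_def)
    also have "\<dots> = e / 2" using MB by (simp add: field_simps)
    finally show "e2 * M \<le> e / 2" .
  qed
  obtain d where d: "d > 0" "\<And>y. y \<in> RN N \<Longrightarrow> (\<forall>i<N. \<bar>y i - c t i\<bar> < d) \<Longrightarrow>
     norm (g y - g (c t) - (\<Sum>i<N. (y i - c t i) *\<^sub>R partial i g (c t))) \<le> e2 * (\<Sum>i<N. \<bar>y i - c t i\<bar>)"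
    using Ck1_frechet[OF U g x e12(3)] by blast
  have "\<forall>\<^sub>F s in at t within S. \<forall>i\<in>{..<N}. \<bar>c s i - c t i\<bar> < d"
  proof (rule eventually_ball_finite, simp, rule ballI)
    fix i assume "i \<in> {..<N}"
    then have "((\<lambda>s. c s i) \<longlongrightarrow> c t i) (at t within S)"
      using has_vector_derivative_continuous[OF c'] by (simp add: continuous_within)
    from tendstoD[OF this d(1)] show "\<forall>\<^sub>F s in at t within S. \<bar>c s i - c t i\<bar> < d" by (simp add: dist_real_def)
  qed
  moreover have "\<forall>\<^sub>F s in at t within S. \<forall>i\<in>{..<N}. \<bar>c s i - c t i - (s - t) * c' i\<bar> \<le> e1 * \<bar>s - t\<bar>"
  proof (rule eventually_ball_finite, simp, rule ballI)
    fix i assume "i \<in> {..<N}"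
    then show "\<forall>\<^sub>F s in at t within S. \<bar>c s i - c t i - (s - t) * c' i\<bar> \<le> e1 * \<bar>s - t\<bar>"
      using c'[of i] e12(1) unfolding has_vector_derivative_def has_derivative_within_alt2 by auto
  qed
  moreover have "\<forall>\<^sub>F s in at t within S. s \<in> S" by (simp add: eventually_at_filter)
  ultimately show "\<forall>\<^sub>F s in at t within S. norm (g (c s) - g (c t) - (s - t) *\<^sub>R (\<Sum>i<N. c' i *\<^sub>R partial i g (c t)))
      \<le> e * norm (s - t)"
  proof eventually_elim
    case (elim s)
    let ?R = "g (c s) - g (c t) - (\<Sum>i<N. (c s i - c t i) *\<^sub>R partial i g (c t))"
    have "(\<Sum>i<N. \<bar>c s i - c t i\<bar>) \<le> (\<Sum>i<N. (\<bar>c' i\<bar> + 1) * \<bar>s - t\<bar>)"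
    proof (rule sum_mono)
      fix i assume "i \<in> {..<N}"
      then have "\<bar>c s i - c t i - (s - t) * c' i\<bar> \<le> e1 * \<bar>s - t\<bar>" using elim by blast
      also have "\<dots> \<le> 1 * \<bar>s - t\<bar>" using e12 by (intro mult_right_mono) auto
      finally have "\<bar>c s i - c t i\<bar> \<le> \<bar>(s - t) * c' i\<bar> + \<bar>s - t\<bar>"
        using abs_triangle_ineq[of "c s i - c t i - (s - t) * c' i" "(s - t) * c' i"] by simp
      then show "\<bar>c s i - c t i\<bar> \<le> (\<bar>c' i\<bar> + 1) * \<bar>s - t\<bar>" unfolding abs_mult by (simp add: distrib_right mult.commute[of "\<bar>s - t\<bar>"])
    qed
    also have "\<dots> = M * \<bar>s - t\<bar>" by (simp add: M_def sum_distrib_right)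
    finally have "e2 * (\<Sum>i<N. \<bar>c s i - c t i\<bar>) \<le> e2 * (M * \<bar>s - t\<bar>)"
      using e12(3) by (intro mult_left_mono) auto
    then have 1: "norm ?R \<le> (e / 2) * \<bar>s - t\<bar>"
      using d(2)[OF cR] elim e12(5) mult_right_mono[of "e2 * M" "e / 2" "\<bar>s - t\<bar>"] by (fastforce simp: mult.assoc)
    have "norm (\<Sum>i<N. (c s i - c t i - (s - t) * c' i) *\<^sub>R partial i g (c t))
        \<le> (\<Sum>i<N. (e1 * \<bar>s - t\<bar>) * norm (partial i g (c t)))"
      by (rule sum_norm_le) (use elim in \<open>auto intro!: mult_right_mono\<close>)
    also have "\<dots> = (e1 * B) * \<bar>s - t\<bar>" by (simp add: B_def sum_distrib_left sum_distrib_right mult_ac)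
    also have "\<dots> \<le> (e / 2) * \<bar>s - t\<bar>" using e12(4) by (intro mult_right_mono) auto
    finally have 2: "norm (\<Sum>i<N. (c s i - c t i - (s - t) * c' i) *\<^sub>R partial i g (c t)) \<le> (e / 2) * \<bar>s - t\<bar>" .
    have eq: "g (c s) - g (c t) - (s - t) *\<^sub>R (\<Sum>i<N. c' i *\<^sub>R partial i g (c t)) =
        ?R + (\<Sum>i<N. (c s i - c t i - (s - t) * c' i) *\<^sub>R partial i g (c t))"
      by (simp add: scaleR_diff_left sum_subtractf scaleR_sum_right)
    show ?case unfolding eq using norm_triangle_mono[OF 1 2] by simp
  qed
qed

text \<open>Induction on the order: the partial derivatives of the composite are sums of products of
  partial derivatives of \<open>F\<close> with \<open>partial j g\<close> after \<open>F\<close>,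
  and the induction hypothesis applies to the latter.\<close>

lemma Ck_compose:
  assumes U: "openin (Euclidean_space N) U" and V: "openin (Euclidean_space M) V"
    and F: "\<And>x. x \<in> U \<Longrightarrow> F x \<in> V"
  shows "Ck M k V g \<Longrightarrow> (\<And>j. j < M \<Longrightarrow> Ck N k U (\<lambda>x. F x j)) \<Longrightarrow> Ck N k U (\<lambda>x. g (F x))"
proof (induction k arbitrary: g)
  case 0
  \<comment> \<open>Coordinates \<open>j \<ge> M\<close> are not covered by the hypothesis on
    \<open>F\<close>, but they vanish because \<open>F\<close> maps into \<open>V\<close>.\<close>
  have "continuous_on U (\<lambda>x. F x j)" for j
  proof (cases "j < M")
    case True then show ?thesis using 0(2) by simp
  next
    case False
    then have "F x j = 0" if "x \<in> U" for x using F[OF that] openin_RN_subset[OF V] by (auto simp: mem_RN)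
    then show ?thesis by (simp cong: continuous_on_cong)
  qed
  then have "continuous_on U F" by (rule continuous_on_coordinatewise_then_product)
  then show ?case unfolding Ck.simps using 0(1) F by (intro continuous_on_compose2[of V g U F]) auto
next
  case (Suc k)
  have "continuous_on U (\<lambda>x. F x j)" for j
  proof (cases "j < M")
    case True then show ?thesis using Suc.prems(2) by simp
  next
    case False
    then have "F x j = 0" if "x \<in> U" for x using F[OF that] openin_RN_subset[OF V] by (auto simp: mem_RN)
    then show ?thesis by (simp cong: continuous_on_cong)
  qed
  then have cF: "continuous_on U F" by (rule continuous_on_coordinatewise_then_product)
  show ?case
  proof (rule Ck_SucI[OF U, where D = "\<lambda>i x. \<Sum>j<M. partial i (\<lambda>x. F x j) x *\<^sub>R partial j g (F x)"])
    show "continuous_on U (\<lambda>x. g (F x))"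
      using cF Ck_imp_continuous_on[OF Suc.prems(1)] F by (intro continuous_on_compose2[of V g U F]) auto
    fix i assume i: "i < N"
    show "Ck N k U (\<lambda>x. \<Sum>j<M. partial i (\<lambda>x. F x j) x *\<^sub>R partial j g (F x))"
      using i Suc.prems Suc.prems(2)[THEN Ck_Suc_imp_Ck]
      by (intro Ck_sum[OF U] Ck_scaleR[OF U] Suc.IH) auto
    fix x assume x: "x \<in> U"
    obtain T where T: "open T" "x i \<in> T" "\<And>h. h \<in> T \<Longrightarrow> x(i := h) \<in> U"
      using eventually_fun_upd_in[OF U x i] by (auto simp: eventually_nhds)
    have "((\<lambda>h. g (F (x(i := h)))) has_vector_derivative
        (\<Sum>j<M. partial i (\<lambda>x. F x j) x *\<^sub>R partial j g (F (x(i := x i))))) (at (x i) within T)"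
    proof (rule Ck1_curve[OF V])
      show "Ck M (Suc 0) V g" by (rule Ck_mono[OF Suc.prems(1)]) simp
      show "F (x(i := x i)) \<in> V" using F x by simp
      show "F (x(i := h)) \<in> RN M" if "h \<in> T" for h using T(3)[OF that] F openin_RN_subset[OF V] by blast
      show "((\<lambda>h. F (x(i := h)) j) has_vector_derivative partial i (\<lambda>x. F x j) x) (at (x i) within T)"
        if "j < M" for j
        by (rule has_vector_derivative_at_within[OF has_vector_derivative_partial[OF Suc.prems(2)[OF that] x i]])
    qed
    then show "((\<lambda>h. g (F (x(i := h)))) has_vector_derivative
        (\<Sum>j<M. partial i (\<lambda>x. F x j) x *\<^sub>R partial j g (F x))) (at (x i))"
      by (simp add: at_within_open[OF T(2,1)])
  qed
qed

text \<open>Two applications of the mean value theorem: first in direction \<open>i\<close> to the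
  difference of \<open>g\<close> along direction \<open>j\<close>, then in direction
  \<open>j\<close> to \<open>partial i g\<close>. Their order decides which mixed derivative
  appears.\<close>

lemma Ck2_second_difference:
  fixes g :: "(nat \<Rightarrow> real) \<Rightarrow> real"
  assumes U: "openin (Euclidean_space N) U" and g: "Ck N (Suc (Suc 0)) U g" and x: "x \<in> RN N"
    and ij: "i < N" "j < N" "i \<noteq> j" and d: "\<And>y. y \<in> RN N \<Longrightarrow> (\<forall>l<N. \<bar>y l - x l\<bar> < d) \<Longrightarrow> y \<in> U"
    and h: "0 < h" "h < d"
  shows "\<exists>y\<in>RN N. (\<forall>l<N. \<bar>y l - x l\<bar> \<le> h) \<and>
    g (x(i := x i + h, j := x j + h)) - g (x(i := x i + h)) - g (x(j := x j + h)) + g x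
      = h * h * partial j (partial i g) y"
proof -
  define q where "q s t = x(i := x i + s, j := x j + t)" for s t
  have qU: "q s t \<in> U" "q s t \<in> RN N" if "0 \<le> s" "s \<le> h" "0 \<le> t" "t \<le> h" for s t
    using x ij h that by (auto intro!: d simp: q_def mem_RN)
  have gi: "((\<lambda>s. g (q s t)) has_real_derivative partial i g (q s t)) (at s)" if "0 \<le> s" "s \<le> h" "0 \<le> t" "t \<le> h" for s t
  proof -
    have "((\<lambda>r. g ((q s t)(i := r))) has_vector_derivative partial i g (q s t)) (at (q s t i))"
      by (rule has_vector_derivative_partial[OF g qU(1)[OF that] ij(1)])
    then have "((\<lambda>r. g ((q s t)(i := r))) has_real_derivative partial i g (q s t)) (at (s + x i))"
      using ij by (simp add: q_def has_real_derivative_iff_has_vector_derivative add.commute)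
    then have "((\<lambda>s'. g ((q s t)(i := s' + x i))) has_real_derivative partial i g (q s t)) (at s)"
      by (subst (asm) DERIV_shift)
    moreover have "(q s t)(i := s' + x i) = q s' t" for s' using ij by (auto simp: q_def)
    ultimately show ?thesis by simp
  qed
  have gj: "((\<lambda>t. partial i g (q s t)) has_real_derivative partial j (partial i g) (q s t)) (at t)"
    if "0 \<le> s" "s \<le> h" "0 \<le> t" "t \<le> h" for s t
  proof -
    have "((\<lambda>r. partial i g ((q s t)(j := r))) has_vector_derivative partial j (partial i g) (q s t)) (at (q s t j))"
      by (rule has_vector_derivative_partial[OF Ck_partial[OF g ij(1)] qU(1)[OF that] ij(2)])
    then have "((\<lambda>r. partial i g ((q s t)(j := r))) has_real_derivative partial j (partial i g) (q s t)) (at (t + x j))"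
      using ij by (simp add: q_def has_real_derivative_iff_has_vector_derivative add.commute)
    then have "((\<lambda>t'. partial i g ((q s t)(j := t' + x j))) has_real_derivative partial j (partial i g) (q s t)) (at t)"
      by (subst (asm) DERIV_shift)
    moreover have "(q s t)(j := t' + x j) = q s t'" for t' using ij by (auto simp: q_def)
    ultimately show ?thesis by simp
  qed
  have "\<exists>z. 0 < z \<and> z < h \<and> (g (q h h) - g (q h 0)) - (g (q 0 h) - g (q 0 0))
      = (h - 0) * (partial i g (q z h) - partial i g (q z 0))"
    using h by (intro MVT2[of 0 h "\<lambda>s. g (q s h) - g (q s 0)"]) (auto intro!: derivative_intros gi)
  then obtain z where z: "0 < z" "z < h" "(g (q h h) - g (q h 0)) - (g (q 0 h) - g (q 0 0))
      = h * (partial i g (q z h) - partial i g (q z 0))" by auto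
  have "\<exists>w. 0 < w \<and> w < h \<and> partial i g (q z h) - partial i g (q z 0) = (h - 0) * partial j (partial i g) (q z w)"
    using h z by (intro MVT2) (auto intro!: gj)
  then obtain w where w: "0 < w" "w < h"
    "partial i g (q z h) - partial i g (q z 0) = h * partial j (partial i g) (q z w)" by auto
  have "q z w \<in> RN N" using qU z w by auto
  moreover have "\<forall>l<N. \<bar>q z w l - x l\<bar> \<le> h" using z w h by (auto simp: q_def)
  moreover have "q h 0 = x(i := x i + h)" "q 0 h = x(j := x j + h)" "q 0 0 = x"
    using ij by (auto simp: q_def)
  ultimately show ?thesis using z(3) w(3) by (intro bexI[of _ "q z w"]) (auto simp: q_def[of h h])
qed

text \<open>The second difference does not change when \<open>i\<close> and \<open>j\<close> are
  exchanged, so the two mixed derivatives coincide at two points whose coordinates differ from those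
  of \<open>x\<close> by at most \<open>h\<close>; continuity at \<open>x\<close> removes the
  dependence on these points.\<close>

lemma Ck2_symmetric_real:
  fixes g :: "(nat \<Rightarrow> real) \<Rightarrow> real"
  assumes U: "openin (Euclidean_space N) U" and g: "Ck N (Suc (Suc 0)) U g" and x: "x \<in> U" and "i < N" "j < N"
  shows "partial j (partial i g) x = partial i (partial j g) x"
proof (cases "i = j")
  case ij: False
  have xR: "x \<in> RN N" using U x openin_RN_subset by blast
  have c: "continuous_on U (partial j (partial i g))" "continuous_on U (partial i (partial j g))"
    using g assms(4,5) by auto
  have "\<bar>partial j (partial i g) x - partial i (partial j g) x\<bar> < e" if "e > 0" for e
  proof -
    have "e / 2 > 0" using that by simp
    obtain d1 where d1: "d1 > 0" "\<And>y. y \<in> RN N \<Longrightarrow> (\<forall>l<N. \<bar>y l - x l\<bar> < d1) \<Longrightarrow>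
        y \<in> U \<and> dist (partial j (partial i g) y) (partial j (partial i g) x) < e / 2"
      using continuous_on_box[OF U c(1) x \<open>e / 2 > 0\<close>] by blast
    obtain d2 where d2: "d2 > 0" "\<And>y. y \<in> RN N \<Longrightarrow> (\<forall>l<N. \<bar>y l - x l\<bar> < d2) \<Longrightarrow>
        y \<in> U \<and> dist (partial i (partial j g) y) (partial i (partial j g) x) < e / 2"
      using continuous_on_box[OF U c(2) x \<open>e / 2 > 0\<close>] by blast
    define h where "h = min d1 d2 / 2"
    have h: "0 < h" "h < d1" "h < d2" using d1 d2 by (auto simp: h_def)
    obtain y1 where y1: "y1 \<in> RN N" "\<forall>l<N. \<bar>y1 l - x l\<bar> \<le> h"
      "g (x(i := x i + h, j := x j + h)) - g (x(i := x i + h)) - g (x(j := x j + h)) + g x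
        = h * h * partial j (partial i g) y1"
      using Ck2_second_difference[OF U g xR assms(4,5) ij, of d1 h] d1(2) h(1,2) by metis
    obtain y2 where y2: "y2 \<in> RN N" "\<forall>l<N. \<bar>y2 l - x l\<bar> \<le> h"
      "g (x(j := x j + h, i := x i + h)) - g (x(j := x j + h)) - g (x(i := x i + h)) + g x
        = h * h * partial i (partial j g) y2"
      using Ck2_second_difference[OF U g xR assms(5,4) ij[symmetric], of d2 h] d2(2) h(1,3) by metis
    have "h * h * partial j (partial i g) y1 = h * h * partial i (partial j g) y2"
      using y1(3) y2(3) unfolding fun_upd_twist[OF ij, of x "x i + h" "x j + h"] by linarith
    then have "partial j (partial i g) y1 = partial i (partial j g) y2" using h by simp
    moreover have "dist (partial j (partial i g) y1) (partial j (partial i g) x) < e / 2"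
      using d1(2)[OF y1(1)] y1(2) h(2) by (meson le_less_trans)
    moreover have "dist (partial i (partial j g) y2) (partial i (partial j g) x) < e / 2"
      using d2(2)[OF y2(1)] y2(2) h(3) by (meson le_less_trans)
    ultimately show ?thesis unfolding dist_real_def by linarith
  qed
  then have "partial j (partial i g) x - partial i (partial j g) x = 0"
    by (intro dense_eq0_I) (simp add: less_imp_le)
  then show ?thesis by simp
qed simp

lemma partial_cong:
  assumes "openin (Euclidean_space N) U" "x \<in> U" "i < N" "\<And>y. y \<in> U \<Longrightarrow> f y = g y"
    and "((\<lambda>h. f (x(i := h))) has_vector_derivative D) (at (x i))"
  shows "partial i g x = D"
proof -
  obtain T where T: "open T" "x i \<in> T" "\<And>h. h \<in> T \<Longrightarrow> x(i := h) \<in> U"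
    using eventually_fun_upd_in[OF assms(1-3)] by (auto simp: eventually_nhds)
  have "((\<lambda>h. g (x(i := h))) has_vector_derivative D) (at (x i))"
    by (rule has_vector_derivative_transform_within_open[OF assms(5) T(1,2)])
      (use T(3) assms(4) in \<open>simp del: fun_upd_apply\<close>)
  then show ?thesis by (simp add: partial_def vector_derivative_at)
qed

lemma has_vector_derivative_inner_partial:
  fixes f :: "(nat \<Rightarrow> real) \<Rightarrow> 'a::real_inner"
  assumes "Ck N (Suc k) U f" "x \<in> U" "i < N"
  shows "((\<lambda>h. inner u (f (x(i := h)))) has_vector_derivative inner u (partial i f x)) (at (x i))"
  by (rule bounded_linear.has_vector_derivative[OF bounded_linear_inner_right has_vector_derivative_partial[OF assms]])

lemma Ck_inner:
  fixes f :: "(nat \<Rightarrow> real) \<Rightarrow> 'a::real_inner"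
  assumes "openin (Euclidean_space N) U"
  shows "Ck N k U f \<Longrightarrow> Ck N k U (\<lambda>x. inner u (f x))"
proof (induction k arbitrary: f)
  case 0
  then show ?case by (simp add: continuous_on_inner)
next
  case (Suc k)
  show ?case
    by (rule Ck_SucI[OF assms _ has_vector_derivative_inner_partial[OF Suc.prems] Suc.IH[OF Ck_partial[OF Suc.prems]]])
      (use Suc.prems in \<open>simp_all add: continuous_on_inner\<close>)
qed

text \<open>The mean value theorem is confined to real values. The complex coefficients of forms are
  reached by testing with all functionals \<open>inner u\<close>, which commute with
  \<open>partial\<close>.\<close>

lemma Ck2_symmetric:
  fixes g :: "(nat \<Rightarrow> real) \<Rightarrow> 'a::real_inner"
  assumes U: "openin (Euclidean_space N) U" and g: "Ck N (Suc (Suc 0)) U g" and x: "x \<in> U" and "i < N" "j < N"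
  shows "partial j (partial i g) x = partial i (partial j g) x"
proof -
  have *: "partial j (partial i (\<lambda>x. inner u (g x))) x = inner u (partial j (partial i g) x)"
    if "i < N" "j < N" for u i j
  proof (rule partial_cong[OF U x that(2)])
    show "inner u (partial i g y) = partial i (\<lambda>x. inner u (g x)) y" if "y \<in> U" for y
      using has_vector_derivative_inner_partial[OF g that \<open>i < N\<close>, of u]
      by (simp add: partial_def[of i "\<lambda>x. inner u (g x)"] vector_derivative_at)
    show "((\<lambda>h. inner u (partial i g (x(j := h)))) has_vector_derivative inner u (partial j (partial i g) x)) (at (x j))"
      by (rule has_vector_derivative_inner_partial[OF Ck_partial[OF g that(1)] x that(2)])
  qed
  have "inner u (partial j (partial i g) x) = inner u (partial i (partial j g) x)" for u
    using Ck2_symmetric_real[OF U Ck_inner[OF U g] x assms(4,5), of u] *[OF assms(4,5)] *[OF assms(5,4)] by simp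
  then show ?thesis by (rule vector_eq_ldot[THEN iffD1, OF allI])
qed

section \<open>Smooth functions on arbitrary subsets\<close>

text \<open>The germ-wise version of \<open>smooth_on_set\<close>: charts and compositions are often
  available only near one point, and this lets each point use its own neighbourhood.\<close>

definition smooth_at :: "nat \<Rightarrow> (nat \<Rightarrow> real) set \<Rightarrow> ((nat \<Rightarrow> real) \<Rightarrow> 'b::real_normed_vector) \<Rightarrow> (nat \<Rightarrow> real) \<Rightarrow> bool" where
  "smooth_at N A f x \<longleftrightarrow> (\<exists>U g. smooth_open N U g \<and> x \<in> U \<and> (\<forall>y\<in>A \<inter> U. g y = f y))"

lemma smooth_on_set_iff: "smooth_on_set N A f \<longleftrightarrow> (\<forall>x\<in>A. smooth_at N A f x)"
  by (simp add: smooth_on_set_def smooth_at_def)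

lemma smooth_on_setD: "smooth_on_set N A f \<Longrightarrow> x \<in> A \<Longrightarrow> smooth_at N A f x"
  by (simp add: smooth_on_set_iff)

lemma smooth_open_subset:
  "smooth_open N U g \<Longrightarrow> openin (Euclidean_space N) V \<Longrightarrow> V \<subseteq> U \<Longrightarrow> smooth_open N V g"
  by (auto simp: smooth_open_def intro: Ck_subset)

lemma smooth_open_RN: "smooth_open N U g \<Longrightarrow> U \<subseteq> RN N"
  by (simp add: smooth_open_def openin_subset)

text \<open>Smoothness at \<open>x\<close> concerns the germ only. Changes of domain or of the
  representing formula pass through this rule, with \<open>W\<close> either everything or a
  neighbourhood on which two descriptions coincide.\<close>

lemma smooth_at_local:
  assumes "smooth_at N A f x" "open W" "x \<in> W" "\<And>y. y \<in> B \<Longrightarrow> y \<in> W \<Longrightarrow> y \<in> A \<and> f' y = f y"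
  shows "smooth_at N B f' x"
proof -
  obtain U g where g: "smooth_open N U g" "x \<in> U" "\<forall>y\<in>A \<inter> U. g y = f y"
    using assms(1) by (auto simp: smooth_at_def)
  obtain T where "open T" "U = T \<inter> RN N" using g(1) by (auto simp: smooth_open_def openin_RN)
  then have "openin (Euclidean_space N) (U \<inter> W)"
    using assms(2) by (auto simp: openin_RN intro!: exI[of _ "T \<inter> W"])
  then have "smooth_open N (U \<inter> W) g" by (rule smooth_open_subset[OF g(1)]) auto
  then show ?thesis using g assms(3,4) by (auto simp: smooth_at_def intro!: exI[of _ "U \<inter> W"] exI[of _ g])
qed

lemma smooth_at_subset: "smooth_at N A f x \<Longrightarrow> B \<subseteq> A \<Longrightarrow> smooth_at N B f x"
  by (auto simp: smooth_at_def)

lemma smooth_on_set_subset: "smooth_on_set N A f \<Longrightarrow> B \<subseteq> A \<Longrightarrow> smooth_on_set N B f"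
  by (auto simp: smooth_on_set_iff intro: smooth_at_subset)

lemma smooth_on_set_cong: "(\<And>x. x \<in> A \<Longrightarrow> f x = g x) \<Longrightarrow> smooth_on_set N A f \<longleftrightarrow> smooth_on_set N A g"
  by (auto simp: smooth_on_set_def)

lemma smooth_at_finite:
  assumes "finite J" "\<And>j. j \<in> J \<Longrightarrow> smooth_at N A (f j) x" "x \<in> RN N"
  shows "\<exists>U g. openin (Euclidean_space N) U \<and> x \<in> U \<and> (\<forall>j\<in>J. smooth_open N U (g j) \<and> (\<forall>y\<in>A \<inter> U. g j y = f j y))"
proof -
  have "\<forall>j\<in>J. \<exists>U g. smooth_open N U g \<and> x \<in> U \<and> (\<forall>y\<in>A \<inter> U. g y = f j y)"
    using assms(2) by (auto simp: smooth_at_def)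
  then obtain U g where g: "\<And>j. j \<in> J \<Longrightarrow> smooth_open N (U j) (g j) \<and> x \<in> U j \<and> (\<forall>y\<in>A \<inter> U j. g j y = f j y)"
    by metis
  \<comment> \<open>Intersecting with \<open>RN N\<close> keeps this set meaningful for empty
    \<open>J\<close>, where the intersection of the family is everything.\<close>
  define W where "W = RN N \<inter> \<Inter>(U ` J)"
  have "openin (Euclidean_space N) W"
    using g assms(1) unfolding W_def
    by (cases "J = {}") (auto intro!: openin_Int openin_Inter simp: smooth_open_def)
  moreover have "x \<in> W" using g assms(3) by (auto simp: W_def)
  ultimately show ?thesis using g
    by (intro exI[of _ W] exI[of _ g]) (auto simp: W_def intro: smooth_open_subset)
qed

lemma smooth_at_2:
  assumes "smooth_at N A f x" "smooth_at N A g x"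
  obtains U f' g' where "smooth_open N U f'" "smooth_open N U g'" "x \<in> U"
    "\<And>y. y \<in> A \<Longrightarrow> y \<in> U \<Longrightarrow> f' y = f y" "\<And>y. y \<in> A \<Longrightarrow> y \<in> U \<Longrightarrow> g' y = g y"
proof -
  obtain U f' where f: "smooth_open N U f'" "x \<in> U" "\<forall>y\<in>A \<inter> U. f' y = f y"
    using assms(1) by (auto simp: smooth_at_def)
  obtain V g' where g: "smooth_open N V g'" "x \<in> V" "\<forall>y\<in>A \<inter> V. g' y = g y"
    using assms(2) by (auto simp: smooth_at_def)
  have "openin (Euclidean_space N) (U \<inter> V)" using f g by (auto simp: smooth_open_def)
  then have "smooth_open N (U \<inter> V) f'" "smooth_open N (U \<inter> V) g'"
    using f(1) g(1) by (auto intro: smooth_open_subset)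
  then show ?thesis using f g by (intro that[of "U \<inter> V" f' g']) auto
qed

lemma smooth_at_RN: "smooth_at N A f x \<Longrightarrow> x \<in> RN N"
  using smooth_open_RN by (fastforce simp: smooth_at_def)

lemma smooth_open_const: "openin (Euclidean_space N) U \<Longrightarrow> smooth_open N U (\<lambda>x. c)"
  by (simp add: smooth_open_def Ck_const)

lemma smooth_open_coord: "openin (Euclidean_space N) U \<Longrightarrow> smooth_open N U (\<lambda>x. x j)"
  by (simp add: smooth_open_def Ck_coord)

lemma smooth_at_const: "x \<in> RN N \<Longrightarrow> smooth_at N A (\<lambda>x. c) x"
  unfolding smooth_at_def
  by (intro exI[of _ "RN N"] exI[of _ "\<lambda>x. c"]) (auto intro: smooth_open_const)

lemma smooth_at_coord: "x \<in> RN N \<Longrightarrow> smooth_at N A (\<lambda>x. x j) x"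
  unfolding smooth_at_def
  by (intro exI[of _ "RN N"] exI[of _ "\<lambda>x. x j"]) (auto intro: smooth_open_coord)

lemma smooth_at_add:
  assumes "smooth_at N A f x" "smooth_at N A g x"
  shows "smooth_at N A (\<lambda>x. f x + g x) x"
proof -
  obtain U f' g' where *: "smooth_open N U f'" "smooth_open N U g'" "x \<in> U"
    "\<And>y. y \<in> A \<Longrightarrow> y \<in> U \<Longrightarrow> f' y = f y" "\<And>y. y \<in> A \<Longrightarrow> y \<in> U \<Longrightarrow> g' y = g y"
    using smooth_at_2[OF assms] by blast
  then show ?thesis unfolding smooth_at_def
    by (intro exI[of _ U] exI[of _ "\<lambda>x. f' x + g' x"]) (auto simp: smooth_open_def Ck_add)
qed

lemma smooth_at_scaleR:
  fixes f :: "(nat \<Rightarrow> real) \<Rightarrow> real"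
  assumes "smooth_at N A f x" "smooth_at N A g x"
  shows "smooth_at N A (\<lambda>x. f x *\<^sub>R g x) x"
proof -
  obtain U f' g' where *: "smooth_open N U f'" "smooth_open N U g'" "x \<in> U"
    "\<And>y. y \<in> A \<Longrightarrow> y \<in> U \<Longrightarrow> f' y = f y" "\<And>y. y \<in> A \<Longrightarrow> y \<in> U \<Longrightarrow> g' y = g y"
    using smooth_at_2[OF assms] by blast
  then show ?thesis unfolding smooth_at_def
    by (intro exI[of _ U] exI[of _ "\<lambda>x. f' x *\<^sub>R g' x"]) (auto simp: smooth_open_def Ck_scaleR)
qed

lemma smooth_at_sum:
  assumes "x \<in> RN N" "\<And>j. j \<in> J \<Longrightarrow> smooth_at N A (f j) x"
  shows "smooth_at N A (\<lambda>x. \<Sum>j\<in>J. f j x) x"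
  using assms(2)
  by (induction J rule: infinite_finite_induct) (auto intro!: smooth_at_const smooth_at_add assms(1))

text \<open>The extension \<open>F'\<close> is handed out along with the composite because
  \<open>deriv_on_compose\<close> differentiates the coordinates of \<open>F\<close> with the very
  extension that enters the composite.\<close>

lemma smooth_at_compose_ext:
  assumes A: "x \<in> A" and B: "F ` A \<subseteq> B" "B \<subseteq> RN M"
    and F: "\<And>j. j < M \<Longrightarrow> smooth_at N A (\<lambda>y. F y j) x" and xR: "x \<in> RN N"
    and g: "smooth_open M V g" "F x \<in> V"
  obtains U F' where "openin (Euclidean_space N) U" "x \<in> U"
    "\<And>j. smooth_open N U (\<lambda>y. F' y j)" "\<And>y. y \<in> U \<Longrightarrow> F' y \<in> V"
    "\<And>y. y \<in> A \<Longrightarrow> y \<in> U \<Longrightarrow> F' y = F y" "smooth_open N U (\<lambda>y. g (F' y))"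
proof -
  have "\<exists>U f. openin (Euclidean_space N) U \<and> x \<in> U \<and>
      (\<forall>j\<in>{..<M}. smooth_open N U (f j) \<and> (\<forall>y\<in>A \<inter> U. f j y = F y j))"
    by (rule smooth_at_finite) (use F xR in auto)
  then obtain U f where f0: "openin (Euclidean_space N) U" "x \<in> U"
    "\<forall>j\<in>{..<M}. smooth_open N U (f j) \<and> (\<forall>y\<in>A \<inter> U. f j y = F y j)" by blast
  then have f: "openin (Euclidean_space N) U" "x \<in> U"
    "\<And>j. j < M \<Longrightarrow> smooth_open N U (f j)" "\<And>j y. j < M \<Longrightarrow> y \<in> A \<Longrightarrow> y \<in> U \<Longrightarrow> f j y = F y j"
    by auto
  \<comment> \<open>The extended coordinates are set to zero from \<open>M\<close> on, which keeps
    \<open>F'\<close> in \<open>RN M\<close> even off \<open>A\<close>.\<close>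
  define F' where "F' y j = (if j < M then f j y else 0)" for y j
  have eq: "F' y = F y" if "y \<in> A" "y \<in> U" for y
    using f(4)[OF _ that] B that by (auto simp: F'_def fun_eq_iff mem_RN subset_iff)
  have sm: "smooth_open N U (\<lambda>y. F' y j)" for j
    using f(1,3) by (cases "j < M") (auto simp: F'_def smooth_open_const)
  have "continuous_on U F'"
    by (rule continuous_on_coordinatewise_then_product)
      (use sm in \<open>auto simp: smooth_open_def intro: Ck_imp_continuous_on\<close>)
  moreover obtain T where T: "open T" "V = T \<inter> RN M" using g(1) by (auto simp: smooth_open_def openin_RN)
  ultimately have "openin (top_of_set U) (U \<inter> F' -` T)" by (intro continuous_openin_preimage_gen)
  then obtain W where W: "open W" "U \<inter> F' -` T = U \<inter> W" by (auto simp: openin_open)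
  obtain T' where T': "open T'" "U = T' \<inter> RN N" using f(1) by (auto simp: openin_RN)
  have o: "openin (Euclidean_space N) (U \<inter> W)"
    using T' W(1) by (auto simp: openin_RN intro!: exI[of _ "T' \<inter> W"])
  have FV: "F' y \<in> V" if "y \<in> U \<inter> W" for y
    using that W(2) T(2) by (auto simp: F'_def mem_RN)
  have sm': "smooth_open N (U \<inter> W) (\<lambda>y. F' y j)" for j
    by (rule smooth_open_subset[OF sm o]) auto
  have "Ck N k (U \<inter> W) (\<lambda>y. g (F' y))" for k
    by (rule Ck_compose[OF o, of M V F']) (use g(1) sm' FV in \<open>auto simp: smooth_open_def\<close>)
  then have "smooth_open N (U \<inter> W) (\<lambda>y. g (F' y))" using o by (simp add: smooth_open_def)
  moreover have "x \<in> U \<inter> W"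
  proof -
    have "F' x \<in> V" using eq[OF A f(2)] g(2) by simp
    then show ?thesis using f(2) W(2) T(2) by blast
  qed
  ultimately show ?thesis using o sm' FV eq by (intro that[of "U \<inter> W" F']) auto
qed

lemma smooth_at_compose:
  assumes "x \<in> A" "F ` A \<subseteq> B" "B \<subseteq> RN M"
    and "\<And>j. j < M \<Longrightarrow> smooth_at N A (\<lambda>y. F y j) x" "x \<in> RN N" and g: "smooth_at M B g (F x)"
  shows "smooth_at N A (\<lambda>y. g (F y)) x"
proof -
  obtain V g' where V: "smooth_open M V g'" "F x \<in> V" "\<forall>y\<in>B \<inter> V. g' y = g y"
    using g by (auto simp: smooth_at_def)
  obtain U F' where "openin (Euclidean_space N) U" "x \<in> U"
    "\<And>j. smooth_open N U (\<lambda>y. F' y j)" "\<And>y. y \<in> U \<Longrightarrow> F' y \<in> V"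
    "\<And>y. y \<in> A \<Longrightarrow> y \<in> U \<Longrightarrow> F' y = F y" "smooth_open N U (\<lambda>y. g' (F' y))"
    using smooth_at_compose_ext[OF assms(1-5) V(1,2)] by blast
  then show ?thesis using V(3) assms(2) unfolding smooth_at_def
    by (intro exI[of _ U] exI[of _ "\<lambda>y. g' (F' y)"]) force
qed

lemma smooth_on_set_compose:
  assumes "F ` A \<subseteq> B" "B \<subseteq> RN M" "A \<subseteq> RN N"
    and "\<And>j. j < M \<Longrightarrow> smooth_on_set N A (\<lambda>y. F y j)" and "smooth_on_set M B g"
  shows "smooth_on_set N A (\<lambda>y. g (F y))"
  using assms unfolding smooth_on_set_iff by (auto intro!: smooth_at_compose[of _ A F B M N g])

lemma smooth_on_set_imp_continuous_on:
  assumes "smooth_on_set N A f" "A \<subseteq> RN N"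
  shows "continuous_on A f"
  unfolding continuous_on_eq_continuous_within
proof (rule ballI)
  fix x assume "x \<in> A"
  then obtain U g where g: "smooth_open N U g" "x \<in> U" "\<forall>y\<in>A \<inter> U. g y = f y"
    using assms by (auto simp: smooth_on_set_def)
  obtain T where T: "open T" "U = T \<inter> RN N" using g(1) by (auto simp: smooth_open_def openin_RN)
  have AT: "A \<inter> U = A \<inter> T" using T assms(2) by auto
  have "continuous_on U g" using g(1) by (auto simp: smooth_open_def intro: Ck_imp_continuous_on)
  then have "continuous_on (A \<inter> U) f" using g(3) by (metis continuous_on_cong continuous_on_subset inf_le2)
  then have "continuous (at x within (A \<inter> T)) f"
    using \<open>x \<in> A\<close> g(2) AT by (auto simp: continuous_on_eq_continuous_within)
  then show "continuous (at x within A) f"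
    using T g(2) at_within_nhd[of x T "A \<inter> T" A] by (auto simp: continuous_within)
qed

section \<open>Directional derivatives on products of simplices and Euclidean spaces\<close>

text \<open>The coordinate formula makes linearity in \<open>v\<close> immediate;
  \<open>dir_deriv_curve\<close> ties it to the derivative along the line through
  \<open>x\<close>.\<close>

definition dir_deriv :: "nat \<Rightarrow> ((nat \<Rightarrow> real) \<Rightarrow> 'b::real_normed_vector) \<Rightarrow> (nat \<Rightarrow> real) \<Rightarrow> (nat \<Rightarrow> real) \<Rightarrow> 'b" where
  "dir_deriv N g x v = (\<Sum>i<N. v i *\<^sub>R partial i g x)"

text \<open>The local model \<Delta>^n \<times> \<real>^m inside one coordinate space, barycentric
  coordinates first. With m = 0 it is the standard simplex itself.\<close>

definition prism :: "nat \<Rightarrow> nat \<Rightarrow> (nat \<Rightarrow> real) set" where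
  "prism n m = {x \<in> RN (Suc n + m). (\<forall>i\<le>n. 0 \<le> x i) \<and> (\<Sum>i\<le>n. x i) = 1}"

definition prism_tangents :: "nat \<Rightarrow> nat \<Rightarrow> (nat \<Rightarrow> real) set" where
  "prism_tangents n m = {v \<in> RN (Suc n + m). (\<Sum>i\<le>n. v i) = 0}"

text \<open>Relatively open subsets of the local model: the images of charts and the domains of
  coordinate expressions have this form.\<close>

definition prism_open :: "nat \<Rightarrow> nat \<Rightarrow> (nat \<Rightarrow> real) set \<Rightarrow> bool" where
  "prism_open n m A \<longleftrightarrow> (\<exists>W. open W \<and> A = prism n m \<inter> W)"

lemma prism_open_subset: "prism_open n m A \<Longrightarrow> A \<subseteq> prism n m"
  by (auto simp: prism_open_def)

lemma prism_open_RN: "prism_open n m A \<Longrightarrow> A \<subseteq> RN (Suc n + m)"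
  using prism_open_subset by (fastforce simp: prism_def)

lemma prism_open_Int: "prism_open n m A \<Longrightarrow> open W \<Longrightarrow> prism_open n m (A \<inter> W)"
  by (auto simp: prism_open_def)

lemma prism_tangents_RN: "v \<in> prism_tangents n m \<Longrightarrow> v \<in> RN (Suc n + m)"
  by (simp add: prism_tangents_def)

lemma prism_tangents_comb:
  "u \<in> prism_tangents n m \<Longrightarrow> w \<in> prism_tangents n m \<Longrightarrow> (\<lambda>l. a * u l + b * w l) \<in> prism_tangents n m"
  by (auto simp: prism_tangents_def mem_RN sum.distrib simp flip: sum_distrib_left)

lemma dir_deriv_curve:
  assumes "smooth_open N U g" "x \<in> U" "v \<in> RN N"
  shows "((\<lambda>h. g (\<lambda>i. x i + h * v i)) has_vector_derivative dir_deriv N g x v) (at 0 within S)"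
proof -
  let ?c = "\<lambda>h i. x i + h * v i"
  have "((\<lambda>h. g (?c h)) has_vector_derivative (\<Sum>i<N. v i *\<^sub>R partial i g (?c 0))) (at 0 within S)"
  proof (rule Ck1_curve)
    show "openin (Euclidean_space N) U" "Ck N (Suc 0) U g" using assms(1) unfolding smooth_open_def by blast+
    show "?c 0 \<in> U" using assms(2) by simp
    show "?c s \<in> RN N" for s using assms smooth_open_RN by (fastforce simp: mem_RN)
    show "((\<lambda>s. ?c s i) has_vector_derivative v i) (at 0 within S)" for i
      unfolding has_real_derivative_iff_has_vector_derivative[symmetric] by (auto intro!: derivative_eq_intros)
  qed
  then show ?thesis by (simp add: dir_deriv_def)
qed

lemma dir_deriv_unique:
  assumes "smooth_open N U g" "x \<in> U" "v \<in> RN N"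
    and "((\<lambda>h. g (\<lambda>i. x i + h * v i)) has_vector_derivative d) (at 0)"
  shows "dir_deriv N g x v = d"
  using dir_deriv_curve[OF assms(1-3), of UNIV] assms(4) by (rule vector_derivative_unique_at)

lemma dir_deriv_sum: "dir_deriv N g x (\<lambda>l. \<Sum>i\<in>I. a i * w i l) = (\<Sum>i\<in>I. a i *\<^sub>R dir_deriv N g x (w i))"
  by (simp add: dir_deriv_def scaleR_sum_left scaleR_sum_right sum.swap[of _ I])

lemma dir_deriv_add: "dir_deriv N g x (\<lambda>l. v l + w l) = dir_deriv N g x v + dir_deriv N g x w"
  by (simp add: dir_deriv_def scaleR_add_left sum.distrib)

text \<open>A segment from \<open>x\<close> in direction \<open>w\<close> lies in \<open>A\<close>,
  where \<open>g\<close> and \<open>h\<close> agree, so both have the same one-sided derivative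
  along it; \<open>x\<close> may be a boundary point of \<open>A\<close>.\<close>

lemma dir_deriv_admissible:
  assumes g: "smooth_open N U g" "smooth_open N V h" "x \<in> U" "x \<in> V"
    and eq: "\<And>y. y \<in> A \<Longrightarrow> y \<in> U \<Longrightarrow> y \<in> V \<Longrightarrow> g y = h y"
    and w: "w \<in> RN N" "d > 0" "\<And>s. 0 \<le> s \<Longrightarrow> s \<le> d \<Longrightarrow> (\<lambda>i. x i + s * w i) \<in> A"
  shows "dir_deriv N g x w = dir_deriv N h x w"
proof -
  let ?c = "\<lambda>s i. x i + s * w i"
  obtain T where T: "open T" "U = T \<inter> RN N" using g(1) by (auto simp: smooth_open_def openin_RN)
  obtain T' where T': "open T'" "V = T' \<inter> RN N" using g(2) by (auto simp: smooth_open_def openin_RN)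
  have cR: "?c s \<in> RN N" for s using g(1,3) w(1) smooth_open_RN by (fastforce simp: mem_RN)
  have "continuous_on UNIV ?c"
    by (rule continuous_on_coordinatewise_then_product) (intro continuous_intros)
  then have "open (?c -` (T \<inter> T'))" using T(1) T'(1) by (auto intro: open_vimage)
  moreover have "0 \<in> ?c -` (T \<inter> T')" using g T T' by auto
  ultimately obtain r where r: "r > 0" "ball 0 r \<subseteq> ?c -` (T \<inter> T')" by (meson open_contains_ball)
  define D where "D = min d (r / 2)"
  have D: "D > 0" using r w by (auto simp: D_def)
  have "g (?c s) = h (?c s)" if "s \<in> {0..D}" for s
  proof (rule eq)
    have "s \<in> ball 0 r" using that r by (auto simp: D_def dist_real_def)
    then have "?c s \<in> T \<inter> T'" using r(2) by blast
    then show "?c s \<in> U" "?c s \<in> V" using T T' cR by auto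
    show "?c s \<in> A" using that w(3) by (auto simp: D_def)
  qed
  then have "((\<lambda>s. g (?c s)) has_vector_derivative dir_deriv N h x w) (at 0 within {0..D})"
    using D by (intro has_vector_derivative_transform[OF _ _ dir_deriv_curve[OF g(2,4) w(1)]]) auto
  moreover have "((\<lambda>s. g (?c s)) has_vector_derivative dir_deriv N g x w) (at 0 within {0..D})"
    by (rule dir_deriv_curve[OF g(1,3) w(1)])
  moreover have "at 0 within {0..D} \<noteq> bot" using D by (simp add: at_within_Icc_at_right)
  ultimately show ?thesis using vector_derivative_unique_within by blast
qed

text \<open>At a point \<open>x\<close> of the prism the tangent space is spanned by the vectors pointing from
  \<open>x\<close> to the vertices and by the vectors along the Euclidean factor; in these directions the
  half-lines starting at \<open>x\<close> stay in the prism for a while.\<close>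

lemma dir_deriv_prism:
  assumes A: "prism_open n m A" and N: "N = Suc n + m" and x: "x \<in> A"
    and g: "smooth_open N U g" "smooth_open N V h" "x \<in> U" "x \<in> V"
    and eq: "\<And>y. y \<in> A \<Longrightarrow> y \<in> U \<Longrightarrow> y \<in> V \<Longrightarrow> g y = h y"
    and v: "v \<in> prism_tangents n m"
  shows "dir_deriv N g x v = dir_deriv N h x v"
proof -
  obtain W where W: "open W" "A = prism n m \<inter> W" using A by (auto simp: prism_open_def)
  have xK: "x \<in> RN N" "\<And>i. i \<le> n \<Longrightarrow> 0 \<le> x i" "(\<Sum>i\<le>n. x i) = 1"
    using x W N by (auto simp: prism_def)
  have adm: "dir_deriv N g x w = dir_deriv N h x w"
    if w: "w \<in> RN N" "\<And>s. 0 \<le> s \<Longrightarrow> s \<le> 1 \<Longrightarrow> (\<lambda>i. x i + s * w i) \<in> prism n m" for w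
  proof -
    let ?c = "\<lambda>s i. x i + s * w i"
    have "continuous_on UNIV ?c"
      by (rule continuous_on_coordinatewise_then_product) (intro continuous_intros)
    then have "open (?c -` W)" using W(1) by (auto intro: open_vimage)
    moreover have "0 \<in> ?c -` W" using x W by auto
    ultimately obtain r where r: "r > 0" "ball 0 r \<subseteq> ?c -` W" by (meson open_contains_ball)
    have "?c s \<in> A" if "0 \<le> s" "s \<le> min 1 (r / 2)" for s
    proof -
      have "s \<in> ball 0 r" using that r by (auto simp: dist_real_def)
      then have "?c s \<in> W" using r(2) by blast
      then show ?thesis using w(2)[of s] that W(2) by simp
    qed
    then show ?thesis using r(1) by (intro dir_deriv_admissible[OF g eq w(1), where d = "min 1 (r / 2)"]) auto
  qed
  \<comment> \<open>\<open>w i\<close> points from the simplex coordinates of \<open>x\<close> to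
    vertex \<open>i\<close> and leaves the Euclidean coordinates alone; \<open>v'\<close> is the
    Euclidean part of \<open>v\<close>.\<close>
  define w where "w i = (\<lambda>j. if j \<le> n then (if j = i then 1 else 0) - x j else 0)" for i
  define v' where "v' = (\<lambda>j. if j \<le> n then 0 else v j)"
  have vs: "(\<Sum>i\<le>n. v i) = 0" "v \<in> RN N" using v N by (auto simp: prism_tangents_def)
  \<comment> \<open>The contributions \<open>v i * x l\<close> add up to zero because the simplex
    coordinates of a tangent vector do, so the base point drops out.\<close>
  have v_eq: "v = (\<lambda>l. (\<Sum>i\<le>n. v i * w i l) + v' l)"
  proof
    fix l
    show "v l = (\<Sum>i\<le>n. v i * w i l) + v' l"
    proof (cases "l \<le> n")
      case True
      have "(\<Sum>i\<le>n. v i * w i l) = (\<Sum>i\<le>n. v i * (if l = i then 1 else 0)) - (\<Sum>i\<le>n. v i) * x l"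
        using True by (simp add: w_def algebra_simps sum_subtractf sum_distrib_left)
      then show ?thesis using True vs(1) by (simp add: v'_def mult_delta_right)
    qed (simp add: w_def v'_def)
  qed
  have "dir_deriv N g x (w i) = dir_deriv N h x (w i)" if "i \<le> n" for i
  proof (rule adm)
    show "w i \<in> RN N" using N by (auto simp: w_def mem_RN)
    fix s :: real assume s: "0 \<le> s" "s \<le> 1"
    have "0 \<le> x j + s * w i j" if "j \<le> n" for j
    proof -
      have "x j + s * w i j = (1 - s) * x j + s * (if j = i then 1 else 0)"
        using that by (simp add: w_def algebra_simps)
      then show ?thesis using s xK(2)[OF that] by simp
    qed
    moreover have "(\<Sum>j\<le>n. x j + s * w i j) = 1"
    proof -
      have "(\<Sum>j\<le>n. w i j) = 0" using xK(3) that by (simp add: w_def sum_subtractf)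
      then show ?thesis using xK(3) by (simp add: sum.distrib flip: sum_distrib_left)
    qed
    ultimately show "(\<lambda>j. x j + s * w i j) \<in> prism n m"
      using xK(1) N by (auto simp: prism_def mem_RN w_def)
  qed
  moreover have "dir_deriv N g x v' = dir_deriv N h x v'"
  proof (rule adm)
    show "v' \<in> RN N" using vs(2) by (auto simp: v'_def mem_RN)
    show "(\<lambda>j. x j + s * v' j) \<in> prism n m" for s
      using xK vs(2) N by (auto simp: prism_def mem_RN v'_def)
  qed
  ultimately show ?thesis
    by (subst (1 2) v_eq) (simp add: dir_deriv_add dir_deriv_sum)
qed

text \<open>This justifies the definite description in \<open>deriv_on\<close>: by
  \<open>dir_deriv_prism\<close> all extensions yield the same value, so any one of them may be used
  to compute it.\<close>

lemma deriv_on_eq: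
  assumes A: "prism_open n m A" and N: "N = Suc n + m" and x: "x \<in> A" and v: "v \<in> prism_tangents n m"
    and g: "smooth_open N U g" "x \<in> U" "\<And>y. y \<in> A \<Longrightarrow> y \<in> U \<Longrightarrow> g y = f y"
  shows "deriv_on N A f x v = dir_deriv N g x v"
  unfolding deriv_on_def
proof (rule the_equality)
  have vR: "v \<in> RN N" using v N by (simp add: prism_tangents_def)
  have vd: "vector_derivative (\<lambda>h. g (\<lambda>i. x i + h * v i)) (at 0) = dir_deriv N g x v"
    if "smooth_open N U g" "x \<in> U" for U and g :: "(nat \<Rightarrow> real) \<Rightarrow> 'a"
    using vector_derivative_at[OF dir_deriv_curve[OF that vR]] .
  show "\<exists>U' g'. smooth_open N U' g' \<and> x \<in> U' \<and> (\<forall>y\<in>A \<inter> U'. g' y = f y) \<and>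
      dir_deriv N g x v = vector_derivative (\<lambda>h. g' (\<lambda>i. x i + h * v i)) (at 0)"
    using g vd[OF g(1,2)] by (intro exI[of _ U] exI[of _ g]) auto
  fix d assume "\<exists>U' g'. smooth_open N U' g' \<and> x \<in> U' \<and> (\<forall>y\<in>A \<inter> U'. g' y = f y) \<and>
      d = vector_derivative (\<lambda>h. g' (\<lambda>i. x i + h * v i)) (at 0)"
  then obtain U' g' where g': "smooth_open N U' g'" "x \<in> U'" "\<forall>y\<in>A \<inter> U'. g' y = f y"
    "d = dir_deriv N g' x v" using vd by auto
  show "d = dir_deriv N g x v" unfolding g'(4)
    by (rule dir_deriv_prism[OF A N x g'(1) g(1) g'(2) g(2) _ v]) (use g'(3) g(3) in auto)
qed

section \<open>Rules of calculus for \<open>deriv_on\<close>\<close>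

context
  fixes n m N :: nat and A
  assumes A: "prism_open n m A" and N: "N = Suc n + m"
begin

lemma prism_open_imp_RN: "x \<in> A \<Longrightarrow> x \<in> RN N"
  using prism_open_RN[OF A] N by auto

text \<open>A smooth extension of \<open>f\<close> near \<open>x\<close>, cut down to
  \<open>W\<close>, extends \<open>f'\<close> as well. This permits passing between a chart image
  and the smaller domain of a coordinate expression.\<close>

lemma deriv_on_cong:
  assumes x: "x \<in> A" and v: "v \<in> prism_tangents n m" and B: "prism_open n m B" "x \<in> B"
    and W: "open W" "x \<in> W" "\<And>y. y \<in> A \<Longrightarrow> y \<in> W \<Longrightarrow> y \<in> B" "\<And>y. y \<in> A \<Longrightarrow> y \<in> W \<Longrightarrow> f' y = f y"
    and f: "smooth_at N B f x"
  shows "deriv_on N A f' x v = deriv_on N B f x v"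
proof -
  obtain U g where g: "smooth_open N U g" "x \<in> U" "\<forall>y\<in>B \<inter> U. g y = f y"
    using f by (auto simp: smooth_at_def)
  obtain T where "open T" "U = T \<inter> RN N" using g(1) by (auto simp: smooth_open_def openin_RN)
  then have "openin (Euclidean_space N) (U \<inter> W)"
    using W(1) by (auto simp: openin_RN intro!: exI[of _ "T \<inter> W"])
  then have g': "smooth_open N (U \<inter> W) g" by (rule smooth_open_subset[OF g(1)]) auto
  have "deriv_on N A f' x v = dir_deriv N g x v"
    using g g' W by (intro deriv_on_eq[OF A N x v g']) auto
  also have "\<dots> = deriv_on N B f x v"
    using g by (intro deriv_on_eq[OF B(1) N B(2) v g(1), symmetric]) auto
  finally show ?thesis .
qed

lemma deriv_on_const: "x \<in> A \<Longrightarrow> v \<in> prism_tangents n m \<Longrightarrow> deriv_on N A (\<lambda>y. c) x v = 0"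
proof -
  assume x: "x \<in> A" and v: "v \<in> prism_tangents n m"
  have s: "smooth_open N (RN N) (\<lambda>y. c)" by (intro smooth_open_const) simp
  have "deriv_on N A (\<lambda>y. c) x v = dir_deriv N (\<lambda>y. c) x v"
    using prism_open_imp_RN[OF x] by (intro deriv_on_eq[OF A N x v s]) auto
  also have "\<dots> = 0"
    using prism_tangents_RN[OF v] N prism_open_imp_RN[OF x] by (intro dir_deriv_unique[OF s]) auto
  finally show ?thesis .
qed

lemma deriv_on_coord: "x \<in> A \<Longrightarrow> v \<in> prism_tangents n m \<Longrightarrow> deriv_on N A (\<lambda>y. y j) x v = v j"
proof -
  assume x: "x \<in> A" and v: "v \<in> prism_tangents n m"
  have s: "smooth_open N (RN N) (\<lambda>y. y j)" by (intro smooth_open_coord) simp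
  have "deriv_on N A (\<lambda>y. y j) x v = dir_deriv N (\<lambda>y. y j) x v"
    using prism_open_imp_RN[OF x] by (intro deriv_on_eq[OF A N x v s]) auto
  also have "\<dots> = v j"
    using prism_tangents_RN[OF v] N prism_open_imp_RN[OF x]
    by (intro dir_deriv_unique[OF s])
      (auto simp flip: has_real_derivative_iff_has_vector_derivative intro!: derivative_eq_intros)
  finally show ?thesis .
qed

lemma deriv_on_add:
  assumes x: "x \<in> A" and v: "v \<in> prism_tangents n m" and "smooth_at N A f x" "smooth_at N A g x"
  shows "deriv_on N A (\<lambda>y. f y + g y) x v = deriv_on N A f x v + deriv_on N A g x v"
proof -
  obtain U f' g' where *: "smooth_open N U f'" "smooth_open N U g'" "x \<in> U"
    "\<And>y. y \<in> A \<Longrightarrow> y \<in> U \<Longrightarrow> f' y = f y" "\<And>y. y \<in> A \<Longrightarrow> y \<in> U \<Longrightarrow> g' y = g y"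
    using smooth_at_2[OF assms(3,4)] by blast
  have s: "smooth_open N U (\<lambda>y. f' y + g' y)" using *(1,2) by (auto simp: smooth_open_def Ck_add)
  have vR: "v \<in> RN N" using prism_tangents_RN[OF v] N by simp
  have "deriv_on N A (\<lambda>y. f y + g y) x v = dir_deriv N (\<lambda>y. f' y + g' y) x v"
    using * by (intro deriv_on_eq[OF A N x v s]) auto
  also have "\<dots> = dir_deriv N f' x v + dir_deriv N g' x v"
    by (intro dir_deriv_unique[OF s] has_vector_derivative_add dir_deriv_curve[OF *(1)] dir_deriv_curve[OF *(2)] *(3) vR)
  also have "dir_deriv N f' x v = deriv_on N A f x v" using * by (intro deriv_on_eq[OF A N x v *(1), symmetric]) auto
  also have "dir_deriv N g' x v = deriv_on N A g x v" using * by (intro deriv_on_eq[OF A N x v *(2), symmetric]) auto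
  finally show ?thesis .
qed

lemma deriv_on_scaleR:
  fixes f :: "(nat \<Rightarrow> real) \<Rightarrow> real"
  assumes x: "x \<in> A" and v: "v \<in> prism_tangents n m" and "smooth_at N A f x" "smooth_at N A g x"
  shows "deriv_on N A (\<lambda>y. f y *\<^sub>R g y) x v = f x *\<^sub>R deriv_on N A g x v + deriv_on N A f x v *\<^sub>R g x"
proof -
  obtain U f' g' where *: "smooth_open N U f'" "smooth_open N U g'" "x \<in> U"
    "\<And>y. y \<in> A \<Longrightarrow> y \<in> U \<Longrightarrow> f' y = f y" "\<And>y. y \<in> A \<Longrightarrow> y \<in> U \<Longrightarrow> g' y = g y"
    using smooth_at_2[OF assms(3,4)] by blast
  have s: "smooth_open N U (\<lambda>y. f' y *\<^sub>R g' y)" using *(1,2) by (auto simp: smooth_open_def Ck_scaleR)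
  have vR: "v \<in> RN N" using prism_tangents_RN[OF v] N by simp
  have "deriv_on N A (\<lambda>y. f y *\<^sub>R g y) x v = dir_deriv N (\<lambda>y. f' y *\<^sub>R g' y) x v"
    using * by (intro deriv_on_eq[OF A N x v s]) auto
  also have "\<dots> = f' x *\<^sub>R dir_deriv N g' x v + dir_deriv N f' x v *\<^sub>R g' x"
    using has_vector_derivative_scaleR[of "\<lambda>h. f' (\<lambda>i. x i + h * v i)" "dir_deriv N f' x v" 0 UNIV
        "\<lambda>h. g' (\<lambda>i. x i + h * v i)" "dir_deriv N g' x v"]
      dir_deriv_curve[OF *(1,3) vR] dir_deriv_curve[OF *(2,3) vR]
    by (intro dir_deriv_unique[OF s *(3) vR]) (simp add: has_real_derivative_iff_has_vector_derivative)
  also have "dir_deriv N f' x v = deriv_on N A f x v" using * by (intro deriv_on_eq[OF A N x v *(1), symmetric]) auto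
  also have "dir_deriv N g' x v = deriv_on N A g x v" using * by (intro deriv_on_eq[OF A N x v *(2), symmetric]) auto
  finally show ?thesis using * x by simp
qed

lemma deriv_on_sum:
  assumes x: "x \<in> A" and v: "v \<in> prism_tangents n m" and "\<And>j. j \<in> J \<Longrightarrow> smooth_at N A (f j) x"
  shows "deriv_on N A (\<lambda>y. \<Sum>j\<in>J. f j y) x v = (\<Sum>j\<in>J. deriv_on N A (f j) x v)"
  using assms(3)
  by (induction J rule: infinite_finite_induct)
    (auto simp: deriv_on_const[OF x v] deriv_on_add[OF x v] smooth_at_sum[OF prism_open_imp_RN[OF x]])

lemma deriv_on_mult_const:
  fixes f :: "(nat \<Rightarrow> real) \<Rightarrow> complex"
  assumes x: "x \<in> A" and v: "v \<in> prism_tangents n m" and f: "smooth_at N A f x"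
  shows "deriv_on N A (\<lambda>y. of_real a * f y) x v = of_real a * deriv_on N A f x v"
  using deriv_on_scaleR[OF x v smooth_at_const[OF prism_open_imp_RN[OF x], of A a] f]
  by (simp add: deriv_on_const[OF x v] scaleR_conv_of_real)

lemma deriv_on_linear:
  assumes x: "x \<in> A" and v: "v \<in> prism_tangents n m" "w \<in> prism_tangents n m" and f: "smooth_at N A f x"
  shows "deriv_on N A f x (\<lambda>l. a * v l + b * w l) = a *\<^sub>R deriv_on N A f x v + b *\<^sub>R deriv_on N A f x w"
proof -
  obtain U g where g: "smooth_open N U g" "x \<in> U" "\<And>y. y \<in> A \<Longrightarrow> y \<in> U \<Longrightarrow> g y = f y"
    using f by (auto simp: smooth_at_def)
  have "dir_deriv N g x (\<lambda>l. a * v l + b * w l) = a *\<^sub>R dir_deriv N g x v + b *\<^sub>R dir_deriv N g x w"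
    by (simp add: dir_deriv_def scaleR_add_left sum.distrib scaleR_sum_right)
  then show ?thesis
    using deriv_on_eq[OF A N x _ g] v prism_tangents_comb[OF v] by simp
qed

text \<open>For an extension \<open>g\<close> of \<open>f\<close> the function sending
  \<open>y\<close> to \<open>dir_deriv N g y v\<close> extends the derivative; hence derivatives in
  fixed directions can be iterated.\<close>

lemma smooth_at_deriv_on:
  assumes v: "v \<in> prism_tangents n m" and f: "smooth_at N A f x"
  shows "smooth_at N A (\<lambda>y. deriv_on N A f y v) x"
proof -
  obtain U g where g: "smooth_open N U g" "x \<in> U" "\<And>y. y \<in> A \<Longrightarrow> y \<in> U \<Longrightarrow> g y = f y"
    using f by (auto simp: smooth_at_def)
  have U: "openin (Euclidean_space N) U" using g(1) by (simp add: smooth_open_def)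
  have "smooth_open N U (\<lambda>y. dir_deriv N g y v)"
    unfolding dir_deriv_def smooth_open_def
  proof (intro conjI allI U Ck_sum Ck_scaleR Ck_const)
    fix k i assume "i \<in> {..<N}"
    then show "Ck N k U (partial i g)" using g(1) Ck_partial[of N k U g i] by (simp add: smooth_open_def del: Ck.simps)
  qed
  moreover have "dir_deriv N g y v = deriv_on N A f y v" if "y \<in> A" "y \<in> U" for y
    by (rule deriv_on_eq[OF A N that(1) v g(1) that(2) g(3), symmetric])
  ultimately show ?thesis using g(2) unfolding smooth_at_def by blast
qed

text \<open>Computed on an extension, both sides are the double sum of second partial derivatives
  with coefficients from \<open>v\<close> and \<open>w\<close>, to which
  \<open>Ck2_symmetric\<close> applies. The directions are constant, so no first-order terms
  arise.\<close>

lemma deriv_on_symmetric: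
  fixes f :: "(nat \<Rightarrow> real) \<Rightarrow> 'b::real_inner"
  assumes x: "x \<in> A" and v: "v \<in> prism_tangents n m" and w: "w \<in> prism_tangents n m"
    and f: "smooth_at N A f x"
  shows "deriv_on N A (\<lambda>y. deriv_on N A f y v) x w = deriv_on N A (\<lambda>y. deriv_on N A f y w) x v"
proof -
  obtain U g where g: "smooth_open N U g" "x \<in> U" "\<And>y. y \<in> A \<Longrightarrow> y \<in> U \<Longrightarrow> g y = f y"
    using f by (auto simp: smooth_at_def)
  have U: "openin (Euclidean_space N) U" using g(1) by (simp add: smooth_open_def)
  have Ckp: "Ck N k U (partial i g)" if "i < N" for k i
    using g(1) Ck_partial[of N k U g i] that by (simp add: smooth_open_def del: Ck.simps)
  have *: "deriv_on N A (\<lambda>y. deriv_on N A f y v) x w = (\<Sum>j<N. \<Sum>i<N. (w j * v i) *\<^sub>R partial j (partial i g) x)"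
    if v: "v \<in> prism_tangents n m" and w: "w \<in> prism_tangents n m" for v w
  proof -
    have sm: "smooth_open N U (\<lambda>y. dir_deriv N g y v)"
      unfolding dir_deriv_def smooth_open_def by (intro conjI allI U Ck_sum Ck_scaleR Ck_const) (simp add: Ckp)
    have "deriv_on N A (\<lambda>y. deriv_on N A f y v) x w = dir_deriv N (\<lambda>y. dir_deriv N g y v) x w"
      using deriv_on_eq[OF A N _ v g(1) _ g(3)] by (intro deriv_on_eq[OF A N x w sm g(2)]) auto
    also have "\<dots> = (\<Sum>i<N. v i *\<^sub>R dir_deriv N (partial i g) x w)"
    proof (rule dir_deriv_unique[OF sm g(2)])
      show "w \<in> RN N" using w N by (simp add: prism_tangents_def)
      then have "((\<lambda>h. \<Sum>i<N. v i *\<^sub>R partial i g (\<lambda>i. x i + h * w i)) has_vector_derivative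
          (\<Sum>i<N. v i *\<^sub>R dir_deriv N (partial i g) x w)) (at 0)"
        by (intro has_vector_derivative_sum bounded_linear.has_vector_derivative[OF bounded_linear_scaleR_right]
            dir_deriv_curve[of N U]) (use g(2) U Ckp in \<open>auto simp: smooth_open_def\<close>)
      then show "((\<lambda>h. dir_deriv N g (\<lambda>i. x i + h * w i) v) has_vector_derivative
          (\<Sum>i<N. v i *\<^sub>R dir_deriv N (partial i g) x w)) (at 0)" by (simp add: dir_deriv_def)
    qed
    also have "\<dots> = (\<Sum>j<N. \<Sum>i<N. (w j * v i) *\<^sub>R partial j (partial i g) x)"
      unfolding dir_deriv_def by (subst sum.swap) (simp add: scaleR_sum_right mult.commute)
    finally show ?thesis .
  qed
  show ?thesis unfolding *[OF v w] *[OF w v]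
  proof (subst sum.swap, intro sum.cong refl)
    fix i j assume "i \<in> {..<N}" "j \<in> {..<N}"
    moreover have "Ck N (Suc (Suc 0)) U g" using g(1) unfolding smooth_open_def by blast
    ultimately have "partial j (partial i g) x = partial i (partial j g) x"
      using Ck2_symmetric[OF U _ g(2), of g i j] by auto
    then show "(w j * v i) *\<^sub>R partial j (partial i g) x = (v i * w j) *\<^sub>R partial i (partial j g) x" by simp
  qed
qed

text \<open>An extension of \<open>f\<close> represents it only near \<open>c t\<close>, so first
  \<open>c s\<close> has to be brought into its domain; then \<open>Ck1_curve\<close> applies.
  Derivatives within \<open>S\<close> are kept for the end points of the segments in Stokes'
  theorem.\<close>

lemma deriv_on_curve:
  assumes c: "\<And>s. s \<in> S \<Longrightarrow> c s \<in> A" and t: "t \<in> S" and f: "smooth_at N A f (c t)"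
    and c': "\<And>i. ((\<lambda>s. c s i) has_vector_derivative c' i) (at t within S)" "c' \<in> prism_tangents n m"
  shows "((\<lambda>s. f (c s)) has_vector_derivative deriv_on N A f (c t) c') (at t within S)"
proof -
  obtain U g where g: "smooth_open N U g" "c t \<in> U" "\<And>y. y \<in> A \<Longrightarrow> y \<in> U \<Longrightarrow> g y = f y"
    using f by (auto simp: smooth_at_def)
  obtain T where T: "open T" "U = T \<inter> RN N" using g(1) by (auto simp: smooth_open_def openin_RN)
  obtain e where e: "e > 0" "\<And>y. y \<in> RN N \<Longrightarrow> (\<forall>i<N. \<bar>y i - c t i\<bar> < e) \<Longrightarrow> y \<in> T"
    using open_contains_box[OF T(1), of "c t" N] g(2) T(2) by blast
  have "\<forall>\<^sub>F s in at t within S. \<forall>i\<in>{..<N}. \<bar>c s i - c t i\<bar> < e"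
  proof (rule eventually_ball_finite, simp, rule ballI)
    fix i
    have "((\<lambda>s. c s i) \<longlongrightarrow> c t i) (at t within S)"
      using has_vector_derivative_continuous[OF c'(1)] by (simp add: continuous_within)
    from tendstoD[OF this e(1)] show "\<forall>\<^sub>F s in at t within S. \<bar>c s i - c t i\<bar> < e" by (simp add: dist_real_def)
  qed
  moreover have "\<forall>\<^sub>F s in at t within S. s \<in> S" by (simp add: eventually_at_filter)
  ultimately have "\<forall>\<^sub>F s in at t within S. c s \<in> T"
    by eventually_elim (use e(2) c prism_open_imp_RN in auto)
  then obtain d where d: "d > 0" "\<And>s. s \<in> S \<Longrightarrow> s \<noteq> t \<Longrightarrow> dist s t < d \<Longrightarrow> c s \<in> T"
    by (auto simp: eventually_at)
  have "deriv_on N A f (c t) c' = dir_deriv N g (c t) c'"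
    by (rule deriv_on_eq[OF A N c[OF t] c'(2) g])
  moreover have "((\<lambda>s. g (c s)) has_vector_derivative dir_deriv N g (c t) c') (at t within S)"
    unfolding dir_deriv_def
    by (rule Ck1_curve[of N U]) (use g c c'(1) prism_open_imp_RN in \<open>auto simp: smooth_open_def simp del: Ck.simps\<close>)
  moreover have "g (c s) = f (c s)" if "s \<in> S" "dist s t < d" for s
  proof (rule g(3)[OF c[OF that(1)]])
    show "c s \<in> U" using d(2)[OF that(1) _ that(2)] g(2) T(2) prism_open_imp_RN[OF c[OF that(1)]] by (cases "s = t") auto
  qed
  ultimately show ?thesis using has_vector_derivative_transform_within[OF _ d(1) t] by metis
qed

text \<open>The chain rule is proved on extensions. The second claim comes from differentiating the
  equations of the prism along \<open>A\<close>: the coordinates of \<open>F\<close> from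
  \<open>M\<close> on are 0, and the first \<open>Suc n'\<close> of them add up to 1.\<close>

lemma deriv_on_compose:
  assumes B: "prism_open n' m' B" and M: "M = Suc n' + m'" and F: "F ` A \<subseteq> B"
    and x: "x \<in> A" and v: "v \<in> prism_tangents n m"
    and sF: "\<And>j. j < M \<Longrightarrow> smooth_at N A (\<lambda>y. F y j) x" and g: "smooth_at M B g (F x)"
  shows "deriv_on N A (\<lambda>y. g (F y)) x v = deriv_on M B g (F x) (tangent_map N A F x v)"
    and "tangent_map N A F x v \<in> prism_tangents n' m'"
proof -
  have BR: "B \<subseteq> RN M" using prism_open_RN[OF B] M by simp
  obtain V g' where V: "smooth_open M V g'" "F x \<in> V" "\<And>y. y \<in> B \<Longrightarrow> y \<in> V \<Longrightarrow> g' y = g y"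
    using g by (auto simp: smooth_at_def)
  obtain U F' where F': "openin (Euclidean_space N) U" "x \<in> U"
    "\<And>j. smooth_open N U (\<lambda>y. F' y j)" "\<And>y. y \<in> U \<Longrightarrow> F' y \<in> V"
    "\<And>y. y \<in> A \<Longrightarrow> y \<in> U \<Longrightarrow> F' y = F y" "smooth_open N U (\<lambda>y. g' (F' y))"
    using smooth_at_compose_ext[OF x F BR sF prism_open_imp_RN[OF x] V(1,2)] by blast
  have vR: "v \<in> RN N" using prism_tangents_RN[OF v] N by simp
  have sFj: "smooth_at N A (\<lambda>y. F y j) x" for j
    unfolding smooth_at_def by (intro exI[of _ U] exI[of _ "\<lambda>y. F' y j"]) (use F'(2,3,5) in auto)
  have tm: "tangent_map N A F x v j = dir_deriv N (\<lambda>y. F' y j) x v" for j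
    unfolding tangent_map_def by (rule deriv_on_eq[OF A N x v F'(3) F'(2)]) (use F'(5) in auto)
  show T: "tangent_map N A F x v \<in> prism_tangents n' m'"
    unfolding prism_tangents_def mem_Collect_eq mem_RN
  proof (intro conjI allI impI)
    fix j assume "Suc n' + m' \<le> j"
    then have "F y j = 0" if "y \<in> A" for y using F BR M that by (auto simp: mem_RN subset_iff image_subset_iff)
    then have "deriv_on N A (\<lambda>y. F y j) x v = deriv_on N A (\<lambda>y. 0) x v"
      by (intro deriv_on_cong[OF x v A x open_UNIV]) (auto intro: smooth_at_const prism_open_imp_RN x)
    then show "tangent_map N A F x v j = 0" by (simp add: tangent_map_def deriv_on_const[OF x v])
  next
    have "(\<Sum>j\<le>n'. F y j) = 1" if "y \<in> A" for y
      using F that prism_open_subset[OF B] by (auto simp: prism_def subset_iff image_subset_iff)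
    then have "deriv_on N A (\<lambda>y. \<Sum>j\<le>n'. F y j) x v = deriv_on N A (\<lambda>y. 1) x v"
      by (intro deriv_on_cong[OF x v A x open_UNIV]) (auto intro: smooth_at_const prism_open_imp_RN x)
    then show "(\<Sum>j\<le>n'. tangent_map N A F x v j) = 0"
      unfolding tangent_map_def by (simp add: deriv_on_const[OF x v] deriv_on_sum[OF x v sFj])
  qed
  have "deriv_on N A (\<lambda>y. g (F y)) x v = dir_deriv N (\<lambda>y. g' (F' y)) x v"
  proof (rule deriv_on_eq[OF A N x v F'(6,2)])
    fix y assume y: "y \<in> A" "y \<in> U"
    then have "F y \<in> V" "F y \<in> B" using F'(4,5)[of y] F by auto
    then show "g' (F' y) = g (F y)" using F'(5)[OF y] V(3) by simp
  qed
  also have "\<dots> = dir_deriv M g' (F x) (tangent_map N A F x v)"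
  proof (rule dir_deriv_unique[OF F'(6,2) vR])
    let ?c = "\<lambda>h i. x i + h * v i"
    \<comment> \<open>The extension \<open>F'\<close> is controlled on \<open>U\<close> only. The
      line through \<open>x\<close> stays in \<open>U\<close> for an open set of parameters, and
      derivatives within an open set are ordinary derivatives.\<close>
    define S where "S = {h. ?c h \<in> U}"
    have F'x: "F' (?c 0) = F x" using F'(5)[OF x F'(2)] by simp
    obtain T where T: "open T" "U = T \<inter> RN N" using F'(1) by (auto simp: openin_RN)
    have "?c h \<in> RN N" for h using prism_open_imp_RN[OF x] vR by (auto simp: mem_RN)
    then have "S = ?c -` T" using T(2) by (auto simp: S_def)
    moreover have "continuous_on UNIV ?c"
      by (rule continuous_on_coordinatewise_then_product) (intro continuous_intros)
    ultimately have S: "open S" using T(1) by (auto intro: open_vimage)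
    have S0: "0 \<in> S" using F'(2) by (simp add: S_def)
    have "((\<lambda>h. g' (F' (?c h))) has_vector_derivative
        (\<Sum>j<M. tangent_map N A F x v j *\<^sub>R partial j g' (F' (?c 0)))) (at 0 within S)"
    proof (rule Ck1_curve)
      show "openin (Euclidean_space M) V" "Ck M (Suc 0) V g'" using V(1) unfolding smooth_open_def by blast+
      show "F' (?c 0) \<in> V" using V(2) F'x by simp
      show "F' (?c h) \<in> RN M" if "h \<in> S" for h
        using that F'(4) smooth_open_RN[OF V(1)] by (auto simp: S_def)
      show "((\<lambda>h. F' (?c h) j) has_vector_derivative tangent_map N A F x v j) (at 0 within S)" for j
        unfolding tm by (rule dir_deriv_curve[OF F'(3,2) vR])
    qed
    then show "((\<lambda>h. g' (F' (?c h))) has_vector_derivative dir_deriv M g' (F x) (tangent_map N A F x v)) (at 0)"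
      unfolding at_within_open[OF S0 S] dir_deriv_def F'x .
  qed
  also have "\<dots> = deriv_on M B g (F x) (tangent_map N A F x v)"
    by (rule deriv_on_eq[OF B M _ T V(1,2) V(3), symmetric]) (use F x in auto)
  finally show "deriv_on N A (\<lambda>y. g (F y)) x v = deriv_on M B g (F x) (tangent_map N A F x v)" .
qed

end

section \<open>Charted spaces\<close>

text \<open>The common part of manifolds, simplices and products of both, so that smooth maps
  between any two of these are treated once. \<open>chart_open_map\<close> lets open subsets of the
  space be seen as relatively open subsets in coordinates.\<close>

locale charted_space =
  fixes X :: "'a charted"
  assumes chart_openin: "(U, \<phi>) \<in> atlas X \<Longrightarrow> openin (space_top X) U"
    and chart_RN: "(U, \<phi>) \<in> atlas X \<Longrightarrow> \<phi> ` U \<subseteq> RN (ambient_dim X)"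
    and chart_inj: "(U, \<phi>) \<in> atlas X \<Longrightarrow> inj_on \<phi> U"
    and chart_open_map: "\<lbrakk>(U, \<phi>) \<in> atlas X; openin (space_top X) W; W \<subseteq> U\<rbrakk> \<Longrightarrow> \<exists>T. open T \<and> \<phi> ` W = \<phi> ` U \<inter> T"
    and chart_cover: "p \<in> topspace (space_top X) \<Longrightarrow> \<exists>U \<phi>. (U, \<phi>) \<in> atlas X \<and> p \<in> U"
    and transition_smooth: "\<lbrakk>(U, \<phi>) \<in> atlas X; (V, \<psi>) \<in> atlas X; j < ambient_dim X\<rbrakk> \<Longrightarrow>
      smooth_on_set (ambient_dim X) (\<phi> ` (U \<inter> V)) (\<lambda>x. \<psi> (inv_into U \<phi> x) j)"
begin

lemma chart_subset: "(U, \<phi>) \<in> atlas X \<Longrightarrow> U \<subseteq> topspace (space_top X)"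
  using chart_openin openin_subset by blast

lemma chart_inv: "(U, \<phi>) \<in> atlas X \<Longrightarrow> p \<in> U \<Longrightarrow> inv_into U \<phi> (\<phi> p) = p"
  by (simp add: chart_inj inv_into_f_f)

lemma chart_image_RN: "(U, \<phi>) \<in> atlas X \<Longrightarrow> p \<in> U \<Longrightarrow> \<phi> p \<in> RN (ambient_dim X)"
  using chart_RN by blast

text \<open>Injectivity turns the equation for images into an equivalence for points; in this form
  an open set of the space becomes a coordinate neighbourhood \<open>T\<close> for
  \<open>smooth_at_local\<close>.\<close>

lemma chart_nhd:
  assumes "(U, \<phi>) \<in> atlas X" "openin (space_top X) W" "W \<subseteq> U"
  shows "\<exists>T. open T \<and> (\<forall>q\<in>U. \<phi> q \<in> T \<longleftrightarrow> q \<in> W)"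
proof -
  obtain T where T: "open T" "\<phi> ` W = \<phi> ` U \<inter> T" using chart_open_map[OF assms] by blast
  have "q \<in> W" if q: "q \<in> U" "\<phi> q \<in> T" for q
  proof -
    have "\<phi> q \<in> \<phi> ` W" using T(2) q by blast
    then show ?thesis using chart_inj[OF assms(1)] q(1) assms(3) by (auto simp: inj_on_def)
  qed
  then show ?thesis using T by blast
qed

end

lemma openin_preimage_chart:
  assumes "continuous_map S T f" "openin S U" "openin T V"
  shows "openin S {q \<in> U. f q \<in> V}"
proof -
  have "openin S {q \<in> topspace S. f q \<in> V}" using assms(1,3) by (rule openin_continuous_map_preimage)
  then have "openin S (U \<inter> {q \<in> topspace S. f q \<in> V})" using assms(2) by blast
  moreover have "U \<inter> {q \<in> topspace S. f q \<in> V} = {q \<in> U. f q \<in> V}" using openin_subset[OF assms(2)] by auto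
  ultimately show ?thesis by simp
qed

text \<open>Asks for a single pair of charts near \<open>p\<close>, where \<open>smooth_map\<close>
  quantifies over all pairs; \<open>smooth_mapI\<close> bridges the gap.\<close>

definition smooth_at_point :: "'a charted \<Rightarrow> 'b charted \<Rightarrow> ('a \<Rightarrow> 'b) \<Rightarrow> 'a \<Rightarrow> bool" where
  "smooth_at_point X Y f p \<longleftrightarrow> (\<exists>U \<phi> V \<psi> W. (U, \<phi>) \<in> atlas X \<and> (V, \<psi>) \<in> atlas Y \<and>
     openin (space_top X) W \<and> p \<in> W \<and> W \<subseteq> U \<and> f ` W \<subseteq> V \<and>
     (\<forall>j<ambient_dim Y. smooth_at (ambient_dim X) (\<phi> ` W) (\<lambda>x. \<psi> (f (inv_into U \<phi> x)) j) (\<phi> p)))"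

lemma smooth_mapD:
  assumes "smooth_map X Y f" "(U, \<phi>) \<in> atlas X" "(V, \<psi>) \<in> atlas Y" "j < ambient_dim Y"
  shows "smooth_on_set (ambient_dim X) (\<phi> ` {p \<in> U. f p \<in> V}) (\<lambda>x. \<psi> (f (inv_into U \<phi> x)) j)"
  using assms unfolding smooth_map_def by blast

lemma smooth_map_continuous: "smooth_map X Y f \<Longrightarrow> continuous_map (space_top X) (space_top Y) f"
  by (simp add: smooth_map_def)

text \<open>By smoothness of the coordinate changes it suffices to find suitable charts around each point.\<close>

lemma smooth_mapI:
  assumes X: "charted_space X" and Y: "charted_space Y"
    and c: "continuous_map (space_top X) (space_top Y) f"
    and s: "\<And>p. p \<in> topspace (space_top X) \<Longrightarrow> smooth_at_point X Y f p"
  shows "smooth_map X Y f"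
  unfolding smooth_map_def
proof (intro conjI c ballI, clarify)
  interpret X: charted_space X by fact
  interpret Y: charted_space Y by fact
  fix U' \<phi>' V' \<psi>' j
  assume U': "(U', \<phi>') \<in> atlas X" and V': "(V', \<psi>') \<in> atlas Y" and j: "j < ambient_dim Y"
  let ?g = "\<lambda>x. \<psi>' (f (inv_into U' \<phi>' x)) j"
  show "smooth_on_set (ambient_dim X) (\<phi>' ` {p \<in> U'. f p \<in> V'}) ?g"
    unfolding smooth_on_set_iff
  proof clarify
    fix p assume p: "p \<in> U'" "f p \<in> V'"
    obtain U \<phi> V \<psi> W where *: "(U, \<phi>) \<in> atlas X" "(V, \<psi>) \<in> atlas Y"
     "openin (space_top X) W" "p \<in> W" "W \<subseteq> U" "f ` W \<subseteq> V"
     "\<And>j. j < ambient_dim Y \<Longrightarrow> smooth_at (ambient_dim X) (\<phi> ` W) (\<lambda>x. \<psi> (f (inv_into U \<phi> x)) j) (\<phi> p)"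
      using s[of p, unfolded smooth_at_point_def] X.chart_subset[OF U'] p(1) by blast
    define W' where "W' = {q \<in> W \<inter> U'. f q \<in> V'}"
    have W'o: "openin (space_top X) W'"
      unfolding W'_def
      by (rule openin_preimage_chart[OF c openin_Int[OF *(3) X.chart_openin[OF U']] Y.chart_openin[OF V']])
    have pW': "p \<in> W'" using p *(4) by (simp add: W'_def)
    have "W' \<subseteq> U'" by (auto simp: W'_def)
    then obtain T where T: "open T" "\<forall>q\<in>U'. \<phi>' q \<in> T \<longleftrightarrow> q \<in> W'"
      using X.chart_nhd[OF U' W'o] by blast
    \<comment> \<open>\<open>F1\<close> changes from the given chart to the good chart of the
      source, and \<open>F2\<close> expresses \<open>f\<close> in the good charts; a change of
      coordinates in the target completes the factorisation.\<close>
    define F1 where "F1 x = \<phi> (inv_into U' \<phi>' x)" for x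
    define F2 where "F2 x = \<psi> (f (inv_into U \<phi> x))" for x
    have F1: "F1 (\<phi>' q) = \<phi> q" if "q \<in> W'" for q
      using that X.chart_inv[OF U'] by (simp add: F1_def W'_def)
    have F2: "F2 (\<phi> q) = \<psi> (f q)" if "q \<in> W'" for q
      using that X.chart_inv[OF *(1)] *(5) by (auto simp: F2_def W'_def)
    have A1: "F1 ` (\<phi>' ` W') \<subseteq> \<phi> ` W'" using F1 by auto
    have A2: "F2 ` (\<phi> ` W') \<subseteq> \<psi> ` (V \<inter> V')" using F2 *(6) by (auto simp: W'_def)
    have R1: "\<phi> ` W' \<subseteq> RN (ambient_dim X)" using X.chart_RN[OF *(1)] *(5) by (auto simp: W'_def)
    have R2: "\<psi> ` (V \<inter> V') \<subseteq> RN (ambient_dim Y)" using Y.chart_RN[OF *(2)] by auto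
    have s1: "smooth_at (ambient_dim X) (\<phi>' ` W') (\<lambda>x. F1 x i) (\<phi>' p)" if "i < ambient_dim X" for i
      unfolding F1_def
      by (rule smooth_at_subset[OF smooth_on_setD[OF X.transition_smooth[OF U' *(1) that]]])
        (use p *(4,5) in \<open>auto simp: W'_def\<close>)
    have s2: "smooth_at (ambient_dim X) (\<phi> ` W') (\<lambda>x. F2 x i) (\<phi> p)" if "i < ambient_dim Y" for i
      unfolding F2_def by (rule smooth_at_subset[OF *(7)[OF that]]) (auto simp: W'_def)
    have s3: "smooth_at (ambient_dim Y) (\<psi> ` (V \<inter> V')) (\<lambda>x. \<psi>' (inv_into V \<psi> x) j) (F2 (\<phi> p))"
      unfolding F2[OF pW']
      by (rule smooth_on_setD[OF Y.transition_smooth[OF *(2) V' j]]) (use p(2) *(4,6) in auto)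
    have s23: "smooth_at (ambient_dim X) (\<phi> ` W') (\<lambda>x. \<psi>' (inv_into V \<psi> (F2 x)) j) (F1 (\<phi>' p))"
      unfolding F1[OF pW']
      by (rule smooth_at_compose[OF _ A2 R2 s2 _ s3]) (use pW' R1 in auto)
    have "smooth_at (ambient_dim X) (\<phi>' ` W') (\<lambda>x. \<psi>' (inv_into V \<psi> (F2 (F1 x))) j) (\<phi>' p)"
      by (rule smooth_at_compose[OF _ A1 R1 s1 _ s23]) (use pW' X.chart_image_RN[OF U' p(1)] in auto)
    then show "smooth_at (ambient_dim X) (\<phi>' ` {p \<in> U'. f p \<in> V'}) ?g (\<phi>' p)"
    proof (rule smooth_at_local[OF _ T(1)])
      show "\<phi>' p \<in> T" using T(2) pW' p(1) by blast
    next
      fix y assume "y \<in> \<phi>' ` {p \<in> U'. f p \<in> V'}" "y \<in> T"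
      then obtain q where q: "q \<in> W'" "y = \<phi>' q" using T(2) by auto
      then have "f q \<in> V" "q \<in> U'" using *(6) by (auto simp: W'_def)
      then show "y \<in> \<phi>' ` W' \<and> ?g y = \<psi>' (inv_into V \<psi> (F2 (F1 y))) j"
        using q F1[OF q(1)] F2[OF q(1)] Y.chart_inv[OF *(2)] X.chart_inv[OF U'] by auto
    qed
  qed
qed

lemma smooth_map_imp_smooth_at_point:
  assumes X: "charted_space X" and Y: "charted_space Y" and f: "smooth_map X Y f"
    and p: "p \<in> topspace (space_top X)"
  shows "smooth_at_point X Y f p"
proof -
  interpret X: charted_space X by fact
  interpret Y: charted_space Y by fact
  obtain U \<phi> where U: "(U, \<phi>) \<in> atlas X" "p \<in> U" using X.chart_cover[OF p] by blast
  have "f p \<in> topspace (space_top Y)" using smooth_map_continuous[OF f] p by (auto simp: continuous_map_def)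
  then obtain V \<psi> where V: "(V, \<psi>) \<in> atlas Y" "f p \<in> V" using Y.chart_cover by blast
  show ?thesis unfolding smooth_at_point_def
  proof (intro exI conjI allI impI)
    show "(U, \<phi>) \<in> atlas X" "(V, \<psi>) \<in> atlas Y" by fact+
    show "openin (space_top X) {q \<in> U. f q \<in> V}"
      by (rule openin_preimage_chart[OF smooth_map_continuous[OF f] X.chart_openin[OF U(1)] Y.chart_openin[OF V(1)]])
    show "smooth_at (ambient_dim X) (\<phi> ` {q \<in> U. f q \<in> V}) (\<lambda>x. \<psi> (f (inv_into U \<phi> x)) j) (\<phi> p)"
      if "j < ambient_dim Y" for j
      by (rule smooth_on_setD[OF smooth_mapD[OF f U(1) V(1) that]]) (use U V in auto)
  qed (use U V in auto)
qed

text \<open>Between two fixed charts of \<open>X\<close> and \<open>Z\<close> the composite can run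
  through several charts of \<open>Y\<close>. Near one point a single chart of \<open>Y\<close> is
  enough, which is all that \<open>smooth_mapI\<close> asks for.\<close>

lemma smooth_map_compose:
  assumes X: "charted_space X" and Y: "charted_space Y" and Z: "charted_space Z"
    and f: "smooth_map X Y f" and g: "smooth_map Y Z g"
  shows "smooth_map X Z (g \<circ> f)"
proof (rule smooth_mapI[OF X Z])
  interpret X: charted_space X by fact
  interpret Y: charted_space Y by fact
  interpret Z: charted_space Z by fact
  note cf = smooth_map_continuous[OF f] and cg = smooth_map_continuous[OF g]
  show cgf: "continuous_map (space_top X) (space_top Z) (g \<circ> f)"
    using cf cg by (rule continuous_map_compose)
  fix p assume p: "p \<in> topspace (space_top X)"
  obtain U \<phi> where U: "(U, \<phi>) \<in> atlas X" "p \<in> U" using X.chart_cover[OF p] by blast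
  have fp: "f p \<in> topspace (space_top Y)" using cf p by (auto simp: continuous_map_def)
  then obtain V \<psi> where V: "(V, \<psi>) \<in> atlas Y" "f p \<in> V" using Y.chart_cover by blast
  have "g (f p) \<in> topspace (space_top Z)" using cg fp by (auto simp: continuous_map_def)
  then obtain V' \<kappa> where V': "(V', \<kappa>) \<in> atlas Z" "g (f p) \<in> V'" using Z.chart_cover by blast
  define W where "W = {q \<in> {q \<in> U. f q \<in> V}. (g \<circ> f) q \<in> V'}"
  have Wo: "openin (space_top X) W" unfolding W_def

    by (rule openin_preimage_chart[OF cgf openin_preimage_chart[OF cf
        X.chart_openin[OF U(1)] Y.chart_openin[OF V(1)]] Z.chart_openin[OF V'(1)]])
  have pW: "p \<in> W" using U V V' by (simp add: W_def)
  define B where "B = \<psi> ` {r \<in> V. g r \<in> V'}"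
  show "smooth_at_point X Z (g \<circ> f) p" unfolding smooth_at_point_def
  proof (intro exI conjI allI impI)
    fix j assume j: "j < ambient_dim Z"
    let ?F = "\<lambda>x. \<psi> (f (inv_into U \<phi> x))"
    have Fq: "?F (\<phi> q) = \<psi> (f q)" if "q \<in> W" for q using that X.chart_inv[OF U(1)] by (simp add: W_def)
    have F: "?F ` (\<phi> ` W) \<subseteq> B" using Fq by (auto simp: W_def B_def)
    have B: "B \<subseteq> RN (ambient_dim Y)" using Y.chart_RN[OF V(1)] by (auto simp: B_def)
    have "smooth_at (ambient_dim X) (\<phi> ` W) (\<lambda>x. \<kappa> (g (inv_into V \<psi> (?F x))) j) (\<phi> p)"
    proof (rule smooth_at_compose[OF _ F B])
      show "smooth_at (ambient_dim X) (\<phi> ` W) (\<lambda>x. ?F x i) (\<phi> p)" if "i < ambient_dim Y" for i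
        by (rule smooth_at_subset[OF smooth_on_setD[OF smooth_mapD[OF f U(1) V(1) that]]])
          (use U V in \<open>auto simp: W_def\<close>)
      show "smooth_at (ambient_dim Y) B (\<lambda>x. \<kappa> (g (inv_into V \<psi> x)) j) (?F (\<phi> p))"
        unfolding Fq[OF pW] B_def
        by (rule smooth_on_setD[OF smooth_mapD[OF g V(1) V'(1) j]]) (use V V' in auto)
    qed (use pW X.chart_image_RN[OF U] in auto)
    then show "smooth_at (ambient_dim X) (\<phi> ` W) (\<lambda>x. \<kappa> ((g \<circ> f) (inv_into U \<phi> x)) j) (\<phi> p)"
      by (rule smooth_at_local[OF _ open_UNIV])
        (use X.chart_inv[OF U(1)] Y.chart_inv[OF V(1)] in \<open>auto simp: W_def\<close>)
  qed (use U V V' Wo pW in \<open>auto simp: W_def\<close>)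
qed

lemma smooth_map_id:
  assumes X: "charted_space X"
  shows "smooth_map X X id"
proof -
  interpret charted_space X by fact
  have "{p \<in> U. p \<in> V} = U \<inter> V" for U V :: "'a set" by auto
  then show ?thesis unfolding smooth_map_def by (auto intro: transition_smooth)
qed

lemma smooth_map_cong:
  assumes X: "charted_space X" and f: "smooth_map X Y f"
    and eq: "\<And>p. p \<in> topspace (space_top X) \<Longrightarrow> g p = f p"
  shows "smooth_map X Y g"
  unfolding smooth_map_def
proof (intro conjI ballI, goal_cases)
  case 1
  show ?case using continuous_map_eq[OF smooth_map_continuous[OF f]] eq by metis
next
  case (2 c)
  interpret charted_space X by fact
  obtain U \<phi> where c: "c = (U, \<phi>)" "(U, \<phi>) \<in> atlas X" using 2 by (cases c) auto
  have gf: "g q = f q" if "q \<in> U" for q using eq chart_subset[OF c(2)] that by blast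
  have "smooth_on_set (ambient_dim X) (\<phi> ` {p \<in> U. g p \<in> V}) (\<lambda>x. \<psi> (g (inv_into U \<phi> x)) j)"
    if V: "(V, \<psi>) \<in> atlas Y" "j < ambient_dim Y" for V \<psi> j
  proof -
    have "{p \<in> U. g p \<in> V} = {p \<in> U. f p \<in> V}" using gf by auto
    then show ?thesis
      using smooth_mapD[OF f c(2) V] by (simp, subst smooth_on_set_cong) (auto simp: chart_inv[OF c(2)] gf)
  qed
  then show ?case unfolding c by auto
qed

lemma space_top_open_sub [simp]: "space_top (open_sub X W) = subtopology (space_top X) W"
  and ambient_dim_open_sub [simp]: "ambient_dim (open_sub X W) = ambient_dim X"
  by (simp_all add: open_sub_def)

lemma atlas_open_sub: "c \<in> atlas (open_sub X W) \<longleftrightarrow> (\<exists>U \<phi>. (U, \<phi>) \<in> atlas X \<and> c = (U \<inter> W, \<phi>))"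
  by (force simp: open_sub_def)

lemma charted_space_open_sub:
  assumes X: "charted_space X" and W: "openin (space_top X) W"
  shows "charted_space (open_sub X W)"
proof -
  interpret X: charted_space X by fact
  \<comment> \<open>Shrinking a chart domain changes \<open>inv_into\<close>, but injectivity on
    \<open>U\<close> makes both inverses agree on the smaller image.\<close>
  have inv: "inv_into (U \<inter> W) \<phi> x = inv_into U \<phi> x" if "(U, \<phi>) \<in> atlas X" "x \<in> \<phi> ` (U \<inter> W)" for U \<phi> x
    using that X.chart_inj[OF that(1)] by (auto simp: inv_into_f_f inj_on_Int)
  show ?thesis
  proof
    fix U \<phi> assume "(U, \<phi>) \<in> atlas (open_sub X W)"
    then obtain U' where U: "(U', \<phi>) \<in> atlas X" "U = U' \<inter> W" by (auto simp: atlas_open_sub)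
    show "openin (space_top (open_sub X W)) U"
      using X.chart_openin[OF U(1)] U(2) by (auto simp: openin_subtopology)
    show "\<phi> ` U \<subseteq> RN (ambient_dim (open_sub X W))" "inj_on \<phi> U"
      using X.chart_RN[OF U(1)] X.chart_inj[OF U(1)] U(2) by (auto simp: inj_on_Int)
    show "\<exists>T. open T \<and> \<phi> ` Q = \<phi> ` U \<inter> T" if "openin (space_top (open_sub X W)) Q" "Q \<subseteq> U" for Q
    proof -
      have "openin (space_top X) Q" using that(1) W by (simp add: openin_open_subtopology)
      moreover have "Q \<subseteq> U'" using that(2) U(2) by auto
      ultimately obtain T where T: "open T" "\<phi> ` Q = \<phi> ` U' \<inter> T" using X.chart_open_map[OF U(1), of Q] by blast
      then have "\<phi> ` Q = \<phi> ` U \<inter> T"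
        using image_mono[OF that(2), of \<phi>] image_mono[of U U' \<phi>] U(2) by blast
      then show ?thesis using T(1) by blast
    qed
    show "smooth_on_set (ambient_dim (open_sub X W)) (\<phi> ` (U \<inter> V)) (\<lambda>x. \<psi> (inv_into U \<phi> x) j)"
      if V0: "(V, \<psi>) \<in> atlas (open_sub X W)" "j < ambient_dim (open_sub X W)" for V \<psi> j
    proof -
      obtain V' where V: "(V', \<psi>) \<in> atlas X" "V = V' \<inter> W" using V0(1) by (auto simp: atlas_open_sub)
      have "smooth_on_set (ambient_dim X) (\<phi> ` (U \<inter> V)) (\<lambda>x. \<psi> (inv_into U' \<phi> x) j)"
        using V0(2) U(2) V(2) by (intro smooth_on_set_subset[OF X.transition_smooth[OF U(1) V(1)]]) auto
      then show ?thesis using inv[OF U(1)] U(2)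
        by (subst smooth_on_set_cong[of _ _ "\<lambda>x. \<psi> (inv_into U' \<phi> x) j"]) auto
    qed
  next
    fix p assume "p \<in> topspace (space_top (open_sub X W))"
    then have p: "p \<in> topspace (space_top X)" "p \<in> W" by auto
    obtain U \<phi> where "(U, \<phi>) \<in> atlas X" "p \<in> U" using X.chart_cover[OF p(1)] by blast
    then show "\<exists>U \<phi>. (U, \<phi>) \<in> atlas (open_sub X W) \<and> p \<in> U"
      using p(2) by (intro exI[of _ "U \<inter> W"] exI[of _ \<phi>]) (auto simp: atlas_open_sub)
  qed
qed

section \<open>Local diffeomorphisms\<close>

lemma smooth_map_from_open_sub:
  assumes "charted_space X" "smooth_map X Y f" "openin (space_top X) W"
  shows "smooth_map (open_sub X W) Y f"
proof -
  interpret X: charted_space X by fact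
  have "smooth_on_set (ambient_dim X) (\<phi> ` {p \<in> U \<inter> W. f p \<in> V}) (\<lambda>x. \<psi> (f (inv_into (U \<inter> W) \<phi> x)) j)"
    if U: "(U, \<phi>) \<in> atlas X" "(V, \<psi>) \<in> atlas Y" "j < ambient_dim Y" for U \<phi> V \<psi> j
  proof -
    have "smooth_on_set (ambient_dim X) (\<phi> ` {p \<in> U \<inter> W. f p \<in> V}) (\<lambda>x. \<psi> (f (inv_into U \<phi> x)) j)"
      by (rule smooth_on_set_subset[OF smooth_mapD[OF assms(2) U]]) auto
    then show ?thesis
      by (subst smooth_on_set_cong[of _ _ "\<lambda>x. \<psi> (f (inv_into U \<phi> x)) j"])
        (use X.chart_inj[OF U(1)] in \<open>auto simp: inv_into_f_f inj_on_Int\<close>)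
  qed
  then show ?thesis using smooth_map_continuous[OF assms(2)]
    unfolding smooth_map_def by (force simp: atlas_open_sub intro: continuous_map_from_subtopology)
qed

lemma smooth_map_into_open_sub:
  assumes X: "charted_space X" and "smooth_map X (open_sub Y W) f"
  shows "smooth_map X Y f"
proof -
  interpret X: charted_space X by fact
  have c: "continuous_map (space_top X) (subtopology (space_top Y) W) f"
    using smooth_map_continuous[OF assms(2)] by simp
  have "smooth_on_set (ambient_dim X) (\<phi> ` {p \<in> U. f p \<in> V}) (\<lambda>x. \<psi> (f (inv_into U \<phi> x)) j)"
    if U: "(U, \<phi>) \<in> atlas X" "U \<subseteq> topspace (space_top X)" "(V, \<psi>) \<in> atlas Y" "j < ambient_dim Y" for U \<phi> V \<psi> j
  proof -
    have "{p \<in> U. f p \<in> V} = {p \<in> U. f p \<in> V \<inter> W}" using c U(2) by (auto simp: continuous_map_def)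
    then show ?thesis
      using smooth_mapD[OF assms(2) U(1), of "V \<inter> W" \<psi> j] U(3,4) by (auto simp: atlas_open_sub)
  qed
  then show ?thesis using c X.chart_subset unfolding smooth_map_def
    by (auto simp: continuous_map_in_subtopology)
qed

text \<open>Frees both maps from their targets \<open>open_sub\<close>, so that \<open>f\<close> and
  its local inverse \<open>g\<close> compose with maps defined on the whole spaces.\<close>

lemma local_diffeo_chart:
  assumes X: "charted_space X" and Y: "charted_space Y" and f: "local_diffeo X Y f"
    and p: "p \<in> topspace (space_top X)"
  obtains U g where "openin (space_top X) U" "p \<in> U" "openin (space_top Y) (f ` U)"
    "smooth_map (open_sub X U) Y f" "smooth_map (open_sub Y (f ` U)) X g" "\<And>q. q \<in> U \<Longrightarrow> g (f q) = q"
proof -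
  obtain U where U: "openin (space_top X) U" "p \<in> U" "openin (space_top Y) (f ` U)"
    "diffeomorphism (open_sub X U) (open_sub Y (f ` U)) f"
    using f p by (auto simp: local_diffeo_def)
  then obtain g where g: "smooth_map (open_sub X U) (open_sub Y (f ` U)) f"
    "smooth_map (open_sub Y (f ` U)) (open_sub X U) g" "\<And>q. q \<in> topspace (space_top X) \<Longrightarrow> q \<in> U \<Longrightarrow> g (f q) = q"
    by (auto simp: diffeomorphism_def)
  show ?thesis
  proof (rule that[OF U(1-3)])
    show "smooth_map (open_sub X U) Y f"
      by (rule smooth_map_into_open_sub[OF charted_space_open_sub[OF X U(1)] g(1)])
    show "smooth_map (open_sub Y (f ` U)) X g"
      by (rule smooth_map_into_open_sub[OF charted_space_open_sub[OF Y U(3)] g(2)])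
    show "g (f q) = q" if "q \<in> U" for q using g(3) openin_subset[OF U(1)] that by blast
  qed
qed

lemma continuous_map_locally:
  assumes "\<And>p. p \<in> topspace S \<Longrightarrow> \<exists>U. openin S U \<and> p \<in> U \<and> continuous_map (subtopology S U) T f"
  shows "continuous_map S T f"
  unfolding continuous_map_def
proof (intro conjI allI impI)
  show "f \<in> topspace S \<rightarrow> topspace T"
  proof
    fix p assume p: "p \<in> topspace S"
    then obtain U where "p \<in> U" "continuous_map (subtopology S U) T f" using assms by blast
    then show "f p \<in> topspace T" using p by (auto simp: continuous_map_def)
  qed
  fix V assume V: "openin T V"
  show "openin S {p \<in> topspace S. f p \<in> V}"
  proof (subst openin_subopen, clarify)
    fix p assume p: "p \<in> topspace S" "f p \<in> V"
    then obtain U where U: "openin S U" "p \<in> U" "continuous_map (subtopology S U) T f" using assms by blast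
    have "openin (subtopology S U) {q \<in> topspace (subtopology S U). f q \<in> V}"
      by (rule openin_continuous_map_preimage[OF U(3) V])
    then have "openin S {q \<in> topspace (subtopology S U). f q \<in> V}"
      using U(1) by (simp add: openin_open_subtopology)
    then show "\<exists>Q. openin S Q \<and> p \<in> Q \<and> Q \<subseteq> {p \<in> topspace S. f p \<in> V}"
      using p U(2) by (intro exI[of _ "{q \<in> topspace (subtopology S U). f q \<in> V}"]) auto
  qed
qed

lemma local_diffeo_continuous:
  assumes "local_diffeo X Y f"
  shows "continuous_map (space_top X) (space_top Y) f"
proof (rule continuous_map_locally)
  fix p assume "p \<in> topspace (space_top X)"
  then obtain U where "openin (space_top X) U" "p \<in> U"
    "diffeomorphism (open_sub X U) (open_sub Y (f ` U)) f"
    using assms by (auto simp: local_diffeo_def)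
  then show "\<exists>U. openin (space_top X) U \<and> p \<in> U \<and> continuous_map (subtopology (space_top X) U) (space_top Y) f"
    by (auto simp: diffeomorphism_def smooth_map_def continuous_map_in_subtopology)
qed

text \<open>Smoothness at a point passes from an open subspace to \<open>X\<close>, as a chart of
  \<open>open_sub\<close> is a chart of \<open>X\<close> with its domain cut down.\<close>

lemma local_diffeo_smooth_map:
  assumes X: "charted_space X" and Y: "charted_space Y" and f: "local_diffeo X Y f"
  shows "smooth_map X Y f"
proof (rule smooth_mapI[OF X Y local_diffeo_continuous[OF f]])
  interpret X: charted_space X by fact
  fix p assume p: "p \<in> topspace (space_top X)"
  obtain U g where U: "openin (space_top X) U" "p \<in> U" "smooth_map (open_sub X U) Y f"
    using local_diffeo_chart[OF X Y f p] by metis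
  have XU: "charted_space (open_sub X U)" by (rule charted_space_open_sub[OF X U(1)])
  have "smooth_at_point (open_sub X U) Y f p"
    by (rule smooth_map_imp_smooth_at_point[OF XU Y U(3)]) (use p U(2) in simp)
  then obtain P \<phi> V \<psi> W where *: "(P, \<phi>) \<in> atlas X" "(V, \<psi>) \<in> atlas Y"
     "openin (subtopology (space_top X) U) W" "p \<in> W" "W \<subseteq> P \<inter> U" "f ` W \<subseteq> V"
     "\<And>j. j < ambient_dim Y \<Longrightarrow> smooth_at (ambient_dim X) (\<phi> ` W) (\<lambda>x. \<psi> (f (inv_into (P \<inter> U) \<phi> x)) j) (\<phi> p)"
    unfolding smooth_at_point_def by (auto simp: atlas_open_sub)
  show "smooth_at_point X Y f p" unfolding smooth_at_point_def
  proof (intro exI conjI allI impI)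
    show "openin (space_top X) W" using *(3) U(1) by (simp add: openin_open_subtopology)
    show "smooth_at (ambient_dim X) (\<phi> ` W) (\<lambda>x. \<psi> (f (inv_into P \<phi> x)) j) (\<phi> p)" if "j < ambient_dim Y" for j
      by (rule smooth_at_local[OF *(7)[OF that] open_UNIV])
        (use X.chart_inj[OF *(1)] *(5) in \<open>auto simp: inv_into_f_f inj_on_Int subset_iff\<close>)
  qed (use * in auto)
qed

text \<open>Near \<open>f p\<close> the preimage of \<open>W\<close> under the continuous local
  inverse is an open set inside the image of \<open>W\<close>.\<close>

lemma local_diffeo_open_map:
  assumes X: "charted_space X" and Y: "charted_space Y" and f: "local_diffeo X Y f"
    and W: "openin (space_top X) W"
  shows "openin (space_top Y) (f ` W)"
proof (subst openin_subopen, clarify)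
  fix p assume p: "p \<in> W"
  then have "p \<in> topspace (space_top X)" using openin_subset[OF W] by blast
  then obtain U g where U: "openin (space_top X) U" "p \<in> U" "openin (space_top Y) (f ` U)"
    "smooth_map (open_sub X U) Y f" "smooth_map (open_sub Y (f ` U)) X g" "\<And>q. q \<in> U \<Longrightarrow> g (f q) = q"
    using local_diffeo_chart[OF X Y f] by metis
  have "continuous_map (subtopology (space_top Y) (f ` U)) (space_top X) g"
    using smooth_map_continuous[OF U(5)] by simp
  then have "openin (subtopology (space_top Y) (f ` U)) {y \<in> topspace (subtopology (space_top Y) (f ` U)). g y \<in> W}"
    using W by (rule openin_continuous_map_preimage)
  then have "openin (space_top Y) {y \<in> topspace (subtopology (space_top Y) (f ` U)). g y \<in> W}"
    using U(3) by (simp add: openin_open_subtopology)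
  moreover have "{y \<in> topspace (subtopology (space_top Y) (f ` U)). g y \<in> W} \<subseteq> f ` W" using U(6) by auto
  moreover have "f p \<in> {y \<in> topspace (subtopology (space_top Y) (f ` U)). g y \<in> W}"
    using openin_subset[OF U(3)] U(2,6) p by auto
  ultimately show "\<exists>T. openin (space_top Y) T \<and> f p \<in> T \<and> T \<subseteq> f ` W" by blast
qed

section \<open>Manifolds, simplices and their products\<close>

locale manifold_space = charted_space X for X :: "'a charted" +
  assumes manifold_tangents: "tangents X = RN (ambient_dim X)"
    and chart_image_openin: "(U, \<phi>) \<in> atlas X \<Longrightarrow> openin (Euclidean_space (ambient_dim X)) (\<phi> ` U)"

text \<open>The setting for all differential forms: it covers \<open>std_simplex n\<close> with
  \<open>m = 0\<close> and \<open>simplex_times n M\<close> with \<open>m\<close> the dimension of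
  \<open>M\<close>.\<close>

locale prism_space = charted_space X for X :: "'a charted" +
  fixes n m :: nat
  assumes prism_dim: "ambient_dim X = Suc n + m"
    and prism_tangents: "tangents X = prism_tangents n m"
    and chart_prism_open: "(U, \<phi>) \<in> atlas X \<Longrightarrow> prism_open n m (\<phi> ` U)"

lemma smooth_manifold_imp_manifold_space:
  assumes "smooth_manifold M"
  shows "manifold_space M"
proof
  have M: "tangents M = RN (ambient_dim M)" "(\<Union>(U, \<phi>)\<in>atlas M. U) = topspace (space_top M)"
    and c0: "\<forall>(U, \<phi>)\<in>atlas M. openin (space_top M) U \<and>
        openin (Euclidean_space (ambient_dim M)) (\<phi> ` U) \<and>
        homeomorphic_map (subtopology (space_top M) U)
          (subtopology (Euclidean_space (ambient_dim M)) (\<phi> ` U)) \<phi>"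
    and tr: "\<forall>(U, \<phi>)\<in>atlas M. \<forall>(V, \<psi>)\<in>atlas M. \<forall>j<ambient_dim M.
        smooth_on_set (ambient_dim M) (\<phi> ` (U \<inter> V)) (\<lambda>x. \<psi> (inv_into U \<phi> x) j)"
    using assms unfolding smooth_manifold_def by simp_all
  have c: "openin (space_top M) U" "openin (Euclidean_space (ambient_dim M)) (\<phi> ` U)"
    "homeomorphic_map (subtopology (space_top M) U) (subtopology (Euclidean_space (ambient_dim M)) (\<phi> ` U)) \<phi>"
    if "(U, \<phi>) \<in> atlas M" for U \<phi>
    using bspec[OF c0 that] by simp_all
  show "tangents M = RN (ambient_dim M)" by fact
  show "\<exists>U \<phi>. (U, \<phi>) \<in> atlas M \<and> p \<in> U" if "p \<in> topspace (space_top M)" for p using that M(2) by blast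
  fix U \<phi> assume U: "(U, \<phi>) \<in> atlas M"
  show "openin (space_top M) U" "openin (Euclidean_space (ambient_dim M)) (\<phi> ` U)" by (fact c[OF U])+
  then show "\<phi> ` U \<subseteq> RN (ambient_dim M)" using openin_subset by blast
  have "topspace (subtopology (space_top M) U) = U" using openin_subset[OF c(1)[OF U]] by auto
  then show "inj_on \<phi> U" using homeomorphic_imp_injective_map[OF c(3)[OF U]] by simp
  show "\<exists>T. open T \<and> \<phi> ` W = \<phi> ` U \<inter> T" if "openin (space_top M) W" "W \<subseteq> U" for W
  proof -
    have "openin (subtopology (space_top M) U) W" using that c(1)[OF U] by (simp add: openin_open_subtopology)
    then have "openin (subtopology (Euclidean_space (ambient_dim M)) (\<phi> ` U)) (\<phi> ` W)"
      using homeomorphic_imp_open_map[OF c(3)[OF U]] by (auto simp: open_map_def)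
    then obtain T where "open T" "\<phi> ` W = T \<inter> RN (ambient_dim M) \<inter> \<phi> ` U"
      by (auto simp: openin_subtopology openin_RN)
    then show ?thesis using \<open>\<phi> ` U \<subseteq> RN (ambient_dim M)\<close> by (intro exI[of _ T]) auto
  qed
  show "smooth_on_set (ambient_dim M) (\<phi> ` (U \<inter> V)) (\<lambda>x. \<psi> (inv_into U \<phi> x) j)"
    if "(V, \<psi>) \<in> atlas M" "j < ambient_dim M" for V \<psi> j
    using bspec[OF tr U] that by fastforce
qed

text \<open>The upper bound 1 on the coordinates of a simplex follows from their being nonnegative
  with sum 1.\<close>

lemma standard_simplex_eq_prism: "standard_simplex n = prism n 0"
proof (intro equalityI subsetI)
  fix x assume "x \<in> prism n 0"
  then have x: "\<And>i. i > n \<Longrightarrow> x i = 0" "\<And>i. i \<le> n \<Longrightarrow> 0 \<le> x i" "(\<Sum>i\<le>n. x i) = 1"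
    by (auto simp: prism_def mem_RN Suc_le_eq)
  have "0 \<le> x i \<and> x i \<le> 1" for i
    using member_le_sum[of i "{..n}" x] x by (cases "i \<le> n") auto
  then show "x \<in> standard_simplex n" using x by (simp add: standard_simplex_def)
qed (auto simp: standard_simplex_def prism_def mem_RN)

lemma standard_simplex_RN: "standard_simplex n \<subseteq> RN (Suc n)"
  by (auto simp: standard_simplex_eq_prism prism_def)

lemma prism_open_standard_simplex: "prism_open n 0 (standard_simplex n)"
  by (auto simp: standard_simplex_eq_prism prism_open_def intro: exI[of _ UNIV])

lemma std_simplex_simps [simp]:
  "space_top (std_simplex n) = subtopology (powertop_real UNIV) (standard_simplex n)"
  "ambient_dim (std_simplex n) = Suc n"
  "tangents (std_simplex n) = prism_tangents n 0"
  "atlas (std_simplex n) = {(standard_simplex n, \<lambda>x. x)}"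
  by (simp_all add: std_simplex_def prism_tangents_def)

lemma prism_space_std_simplex: "prism_space (std_simplex n) n 0"
proof
  show "smooth_on_set (ambient_dim (std_simplex n)) (\<phi> ` (U \<inter> V)) (\<lambda>x. \<psi> (inv_into U \<phi> x) j)"
    if "(U, \<phi>) \<in> atlas (std_simplex n)" "(V, \<psi>) \<in> atlas (std_simplex n)" for U \<phi> V \<psi> j
    using that standard_simplex_RN[of n]
    by (auto simp: smooth_on_set_iff inv_into_f_f[of "\<lambda>x. x", simplified] intro!: smooth_at_local[OF smooth_at_coord open_UNIV])
  fix U \<phi> W
  assume "(U, \<phi>) \<in> atlas (std_simplex n)" "openin (space_top (std_simplex n)) W" "W \<subseteq> U"
  then show "\<exists>T. open T \<and> \<phi> ` W = \<phi> ` U \<inter> T"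
    by (auto simp: openin_subtopology euclidean_product_topology)
qed (use standard_simplex_RN[of n] prism_open_standard_simplex in \<open>auto simp: openin_subtopology_refl\<close>)

lemma smooth_map_std_simplexI:
  assumes "continuous_map (space_top (std_simplex p)) (space_top (std_simplex q)) a"
    and "\<And>j. j \<le> q \<Longrightarrow> smooth_on_set (Suc p) (standard_simplex p) (\<lambda>t. a t j)"
  shows "smooth_map (std_simplex p) (std_simplex q) a"
proof -
  have "a t \<in> standard_simplex q" if "t \<in> standard_simplex p" for t
    using assms(1) that by (auto simp: continuous_map_def)
  then have eq: "{t \<in> standard_simplex p. a t \<in> standard_simplex q} = standard_simplex p" by auto
  have inv: "inv_into A (\<lambda>x. x) x = x" if "x \<in> A" for A and x :: "nat \<Rightarrow> real"
    using inv_into_f_f[of "\<lambda>x. x" A x] that by simp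
  have "smooth_on_set (Suc p) (standard_simplex p) (\<lambda>x. a (inv_into (standard_simplex p) (\<lambda>x. x) x) j)"
    if "j \<le> q" for j
    using assms(2)[OF that] by (subst smooth_on_set_cong[of _ _ "\<lambda>t. a t j"]) (auto simp: inv)
  then show ?thesis using assms(1) unfolding smooth_map_def by (simp add: less_Suc_eq_le eq)
qed

lemma continuous_simplical_face:
  assumes "i \<le> Suc k"
  shows "continuous_map (space_top (std_simplex k)) (space_top (std_simplex (Suc k))) (simplical_face i)"
proof -
  have "simplical_face i t \<in> standard_simplex (Suc k)" if "t \<in> standard_simplex k" for t :: "nat \<Rightarrow> real"
    using simplical_face_in_standard_simplex[of "Suc k" i t] assms that by simp
  moreover have "continuous_map (subtopology (powertop_real UNIV) (standard_simplex k)) euclideanreal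
      (\<lambda>t. simplical_face i t j)" for j
    unfolding simplical_face_def
    by (cases "j < i"; cases "j = i") (auto intro!: continuous_map_from_subtopology continuous_map_product_projection)
  ultimately show ?thesis
    by (auto simp: continuous_map_in_subtopology continuous_map_componentwise_UNIV)
qed

lemma smooth_simplical_face_coord: "smooth_on_set (Suc k) (standard_simplex k) (\<lambda>t. simplical_face i t j)"
  using standard_simplex_RN[of k] unfolding smooth_on_set_iff simplical_face_def
  by (cases "j < i"; cases "j = i") (auto intro!: smooth_at_coord smooth_at_const)

lemma smooth_map_simplical_face:
  assumes "i \<le> Suc k"
  shows "smooth_map (std_simplex k) (std_simplex (Suc k)) (simplical_face i)"
  by (rule smooth_map_std_simplexI[OF continuous_simplical_face[OF assms] smooth_simplical_face_coord])

text \<open>The coordinate map that is built into \<open>simplex_times\<close>, named in order to be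
  inverted: \<open>simplex_part\<close> and \<open>manifold_part\<close> recover its two
  components.\<close>

definition prism_chart :: "nat \<Rightarrow> ('a \<Rightarrow> nat \<Rightarrow> real) \<Rightarrow> (nat \<Rightarrow> real) \<times> 'a \<Rightarrow> nat \<Rightarrow> real" where
  "prism_chart n \<phi> = (\<lambda>(t, p) i. if i \<le> n then t i else \<phi> p (i - Suc n))"

definition simplex_part :: "nat \<Rightarrow> (nat \<Rightarrow> real) \<Rightarrow> nat \<Rightarrow> real" where
  "simplex_part n x = (\<lambda>i. if i \<le> n then x i else 0)"

definition manifold_part :: "nat \<Rightarrow> (nat \<Rightarrow> real) \<Rightarrow> nat \<Rightarrow> real" where
  "manifold_part n x = (\<lambda>i. x (Suc n + i))"

lemma simplex_times_simps [simp]: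
  "space_top (simplex_times n M) = prod_topology (space_top (std_simplex n)) (space_top M)"
  "ambient_dim (simplex_times n M) = Suc n + ambient_dim M"
  by (simp_all add: simplex_times_def del: std_simplex_simps)

lemma atlas_simplex_times:
  "c \<in> atlas (simplex_times n M) \<longleftrightarrow> (\<exists>U \<phi>. (U, \<phi>) \<in> atlas M \<and> c = (standard_simplex n \<times> U, prism_chart n \<phi>))"
  by (force simp: simplex_times_def prism_chart_def)

lemma simplex_part_prism_chart: "t \<in> standard_simplex n \<Longrightarrow> simplex_part n (prism_chart n \<phi> (t, p)) = t"
  by (auto simp: simplex_part_def prism_chart_def standard_simplex_def)

lemma manifold_part_prism_chart: "manifold_part n (prism_chart n \<phi> (t, p)) = \<phi> p"
  by (auto simp: manifold_part_def prism_chart_def)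

lemma prism_chart_RN: "\<phi> p \<in> RN m \<Longrightarrow> prism_chart n \<phi> (t, p) \<in> RN (Suc n + m)"
  by (auto simp: prism_chart_def mem_RN)

lemma manifold_part_RN: "x \<in> RN (Suc n + m) \<Longrightarrow> manifold_part n x \<in> RN m"
  by (auto simp: manifold_part_def mem_RN)

lemma continuous_on_parts: "continuous_on A (simplex_part n)" "continuous_on A (manifold_part n)"
proof -
  have "continuous_on A (\<lambda>x. simplex_part n x i)" "continuous_on A (\<lambda>x. manifold_part n x i)" for i
    unfolding simplex_part_def manifold_part_def
    by (cases "i \<le> n") (auto intro: continuous_on_subset[OF continuous_on_product_coordinates])
  then show "continuous_on A (simplex_part n)" "continuous_on A (manifold_part n)"
    by (auto intro: continuous_on_coordinatewise_then_product)
qed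

text \<open>Since the simplex factor occurs as a whole, the image of a product chart is cut out of
  the prism by its manifold part alone; that it is open in the prism can then be read off.\<close>

lemma prism_chart_image:
  assumes "\<phi> ` U \<subseteq> RN m"
  shows "prism_chart n \<phi> ` (standard_simplex n \<times> U) = {x \<in> prism n m. manifold_part n x \<in> \<phi> ` U}"
proof (intro equalityI subsetI)
  fix x assume "x \<in> prism_chart n \<phi> ` (standard_simplex n \<times> U)"
  then obtain t p where x: "t \<in> standard_simplex n" "p \<in> U" "x = prism_chart n \<phi> (t, p)" by auto
  then have "x \<in> prism n m"
    using assms prism_chart_RN[of \<phi> p m n t] unfolding standard_simplex_eq_prism prism_def
    by (auto simp: prism_chart_def)
  then show "x \<in> {x \<in> prism n m. manifold_part n x \<in> \<phi> ` U}"
    using x by (auto simp: manifold_part_prism_chart)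
next
  fix x assume "x \<in> {x \<in> prism n m. manifold_part n x \<in> \<phi> ` U}"
  then obtain p where x: "x \<in> prism n m" "p \<in> U" "manifold_part n x = \<phi> p" by auto
  have "simplex_part n x \<in> standard_simplex n"
    using x(1) by (auto simp: standard_simplex_eq_prism prism_def simplex_part_def mem_RN)
  moreover have "x = prism_chart n \<phi> (simplex_part n x, p)"
  proof
    fix i show "x i = prism_chart n \<phi> (simplex_part n x, p) i"
      using fun_cong[OF x(3), of "i - Suc n"] by (auto simp: prism_chart_def simplex_part_def manifold_part_def)
  qed
  ultimately show "x \<in> prism_chart n \<phi> ` (standard_simplex n \<times> U)" using x(2) by blast
qed

lemma smooth_manifold_part_coord: "x \<in> RN N \<Longrightarrow> smooth_at N A (\<lambda>y. manifold_part n y j) x"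
  by (simp add: manifold_part_def smooth_at_coord)

lemma smooth_simplex_part_coord: "x \<in> RN N \<Longrightarrow> smooth_at N A (\<lambda>y. simplex_part n y j) x"
  by (cases "j \<le> n") (simp_all add: simplex_part_def smooth_at_coord smooth_at_const)

context manifold_space
begin

lemma inv_prism_chart:
  assumes "(U, \<phi>) \<in> atlas X" "t \<in> standard_simplex n" "p \<in> U"
  shows "inv_into (standard_simplex n \<times> U) (prism_chart n \<phi>) (prism_chart n \<phi> (t, p)) = (t, p)"
proof (rule inv_into_f_f)
  show "inj_on (prism_chart n \<phi>) (standard_simplex n \<times> U)"
  proof (rule inj_onI, clarify)
    fix t p t' p' assume *: "prism_chart n \<phi> (t, p) = prism_chart n \<phi> (t', p')"
      "t \<in> standard_simplex n" "p \<in> U" "t' \<in> standard_simplex n" "p' \<in> U"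
    have "t = t'" using simplex_part_prism_chart[OF *(2), of \<phi> p] simplex_part_prism_chart[OF *(4), of \<phi> p'] *(1) by simp
    moreover have "\<phi> p = \<phi> p'" using manifold_part_prism_chart[of n \<phi>] *(1) by metis
    ultimately show "t = t' \<and> p = p'" using chart_inj[OF assms(1)] *(3,5) by (auto simp: inj_on_def)
  qed
qed (use assms in auto)

lemma prism_space_simplex_times: "prism_space (simplex_times n X) n (ambient_dim X)"
proof
  show "tangents (simplex_times n X) = prism_tangents n (ambient_dim X)"
    using manifold_part_RN[of _ n "ambient_dim X"]
    by (auto simp: simplex_times_def prism_tangents_def manifold_tangents manifold_part_def)
  show "\<exists>P \<Phi>. (P, \<Phi>) \<in> atlas (simplex_times n X) \<and> z \<in> P"
    if z: "z \<in> topspace (space_top (simplex_times n X))" for z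
  proof -
    obtain t p where tp: "z = (t, p)" "t \<in> standard_simplex n" "p \<in> topspace (space_top X)"
      using z by auto
    obtain U \<phi> where "(U, \<phi>) \<in> atlas X" "p \<in> U" using chart_cover[OF tp(3)] by blast
    then show ?thesis using tp(1,2)
      by (intro exI[of _ "standard_simplex n \<times> U"] exI[of _ "prism_chart n \<phi>"]) (auto simp: atlas_simplex_times)
  qed
  fix P \<Phi> assume "(P, \<Phi>) \<in> atlas (simplex_times n X)"
  then obtain U \<phi> where U: "(U, \<phi>) \<in> atlas X" "P = standard_simplex n \<times> U" "\<Phi> = prism_chart n \<phi>"
    by (auto simp: atlas_simplex_times)
  note img = prism_chart_image[OF chart_RN[OF U(1)], of n]
  show "openin (space_top (simplex_times n X)) P"
    using chart_openin[OF U(1)] by (simp add: U(2) openin_prod_Times_iff openin_subtopology_refl)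
  show "\<Phi> ` P \<subseteq> RN (ambient_dim (simplex_times n X))"
    unfolding U(2,3) img by (auto simp: prism_def)
  show "inj_on \<Phi> P"
    unfolding U(2,3) using inv_prism_chart[OF U(1), of _ n] by (intro inj_on_inverseI[of _ "inv_into P \<Phi>"]) (auto simp: U)
  obtain T where T: "open T" "\<phi> ` U = T \<inter> RN (ambient_dim X)"
    using chart_image_openin[OF U(1)] by (auto simp: openin_RN)
  have "\<Phi> ` P = prism n (ambient_dim X) \<inter> manifold_part n -` T"
    unfolding U(2,3) img T(2) using manifold_part_RN[of _ n "ambient_dim X"] by (auto simp: prism_def)
  moreover have "open (manifold_part n -` T)"
    using continuous_on_parts(2)[of UNIV n] T(1) by (auto intro: open_vimage)
  ultimately show "prism_open n (ambient_dim X) (\<Phi> ` P)" unfolding prism_open_def by blast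
  show "\<exists>T. open T \<and> \<Phi> ` W = \<Phi> ` P \<inter> T"
    if W: "openin (space_top (simplex_times n X)) W" "W \<subseteq> P" for W
  proof -
    \<comment> \<open>An open set of the product is covered by boxes \<open>A \<times> B\<close>.
      Each factor is an open condition on one part of the coordinates, and the union over all boxes
      describes the image of \<open>W\<close>.\<close>
    have loc: "\<exists>T. open T \<and> \<Phi> z \<in> T \<and> \<Phi> ` P \<inter> T \<subseteq> \<Phi> ` W" if zW: "z \<in> W" for z
    proof -
      obtain t p where z: "z = (t, p)" by (cases z)
      have "\<exists>A B. openin (space_top (std_simplex n)) A \<and> openin (space_top X) B \<and> t \<in> A \<and> p \<in> B \<and> A \<times> B \<subseteq> W"
        using W(1) zW unfolding z simplex_times_simps openin_prod_topology_alt by simp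
      then obtain A B where AB: "openin (space_top (std_simplex n)) A" "openin (space_top X) B" "t \<in> A" "p \<in> B" "A \<times> B \<subseteq> W"
        by blast
      have tp: "t \<in> standard_simplex n" "p \<in> U" using zW W(2) z U(2) by auto
      obtain TA where TA: "open TA" "A = TA \<inter> standard_simplex n"
        using AB(1) by (auto simp: openin_subtopology euclidean_product_topology)
      obtain TB where TB: "open TB" "\<forall>q\<in>U. \<phi> q \<in> TB \<longleftrightarrow> q \<in> B \<inter> U"
        using chart_nhd[OF U(1) openin_Int[OF AB(2) chart_openin[OF U(1)]]] by auto
      let ?T = "simplex_part n -` TA \<inter> manifold_part n -` TB"
      have "open ?T" using continuous_on_parts[of UNIV n] TA(1) TB(1) by (auto intro!: open_Int open_vimage)
      moreover have "\<Phi> z \<in> ?T"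
        using AB(3,4) TA(2) TB(2) tp by (auto simp: z U(3) simplex_part_prism_chart manifold_part_prism_chart)
      moreover have "\<Phi> ` P \<inter> ?T \<subseteq> \<Phi> ` W"
        using AB(5) TA(2) TB(2)
        by (auto simp: U simplex_part_prism_chart manifold_part_prism_chart intro!: imageI subsetD[OF AB(5)])
      ultimately show ?thesis by blast
    qed
    then obtain T where T: "\<And>z. z \<in> W \<Longrightarrow> open (T z) \<and> \<Phi> z \<in> T z \<and> \<Phi> ` P \<inter> T z \<subseteq> \<Phi> ` W" by metis
    have "open (\<Union>(T ` W))" using T by auto
    moreover have "\<Phi> ` W = \<Phi> ` P \<inter> \<Union>(T ` W)" using T W(2) by blast
    ultimately show ?thesis by blast
  qed
  fix Q \<Psi> j assume "(Q, \<Psi>) \<in> atlas (simplex_times n X)" and j: "j < ambient_dim (simplex_times n X)"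
  then obtain V \<psi> where V: "(V, \<psi>) \<in> atlas X" "Q = standard_simplex n \<times> V" "\<Psi> = prism_chart n \<psi>"
    by (auto simp: atlas_simplex_times)
  let ?N = "Suc n + ambient_dim X"
  have "smooth_at ?N (\<Phi> ` (P \<inter> Q)) (\<lambda>x. \<Psi> (inv_into P \<Phi> x) j) (\<Phi> z)" if "z \<in> P \<inter> Q" for z
  proof -
    obtain t p where z: "z = (t, p)" "t \<in> standard_simplex n" "p \<in> U" "p \<in> V" using \<open>z \<in> P \<inter> Q\<close> U(2) V(2) by auto
    have zR: "\<Phi> z \<in> RN ?N" using prism_chart_RN chart_image_RN[OF U(1) z(3)] by (auto simp: z U(3))
    show ?thesis
    proof (cases "j \<le> n")
      case True
      show ?thesis
        by (rule smooth_at_local[OF smooth_at_coord[OF zR, of UNIV j] open_UNIV])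
          (use inv_prism_chart[OF U(1), of _ n] True in \<open>auto simp: U(2,3) V(2,3) prism_chart_def[of _ \<psi>] prism_chart_def[of _ \<phi>, symmetric]\<close>, simp add: prism_chart_def)
    next
      case False
      have "smooth_at ?N (\<Phi> ` (P \<inter> Q)) (\<lambda>x. \<psi> (inv_into U \<phi> (manifold_part n x)) (j - Suc n)) (\<Phi> z)"
      proof (rule smooth_at_compose[where F = "manifold_part n" and g = "\<lambda>x. \<psi> (inv_into U \<phi> x) (j - Suc n)" and B = "\<phi> ` (U \<inter> V)" and M = "ambient_dim X"])
        show "manifold_part n ` (\<Phi> ` (P \<inter> Q)) \<subseteq> \<phi> ` (U \<inter> V)"
          by (auto simp: U(2,3) V(2) manifold_part_prism_chart)
        show "\<phi> ` (U \<inter> V) \<subseteq> RN (ambient_dim X)" using chart_RN[OF U(1)] by auto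
        have "j - Suc n < ambient_dim X" using j False by simp
        from smooth_on_setD[OF transition_smooth[OF U(1) V(1) this], of "\<phi> p"]
        show "smooth_at (ambient_dim X) (\<phi> ` (U \<inter> V)) (\<lambda>x. \<psi> (inv_into U \<phi> x) (j - Suc n)) (manifold_part n (\<Phi> z))"
          using z by (auto simp: U(3) manifold_part_prism_chart)
      qed (use that zR smooth_manifold_part_coord in auto)
      then show ?thesis
      proof (rule smooth_at_local[OF _ open_UNIV])
        fix y assume "y \<in> \<Phi> ` (P \<inter> Q)"
        then obtain s q where y: "y = prism_chart n \<phi> (s, q)" "s \<in> standard_simplex n" "q \<in> U" "q \<in> V"
          by (auto simp: U(2,3) V(2))
        then show "y \<in> \<Phi> ` (P \<inter> Q) \<and> \<Psi> (inv_into P \<Phi> y) j = \<psi> (inv_into U \<phi> (manifold_part n y)) (j - Suc n)"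
          using False by (auto simp: U V inv_prism_chart[OF U(1)] manifold_part_prism_chart chart_inv[OF U(1)])
            (simp add: prism_chart_def)
      qed simp
    qed
  qed
  then show "smooth_on_set (ambient_dim (simplex_times n X)) (\<Phi> ` (P \<inter> Q)) (\<lambda>x. \<Psi> (inv_into P \<Phi> x) j)"
    by (auto simp: smooth_on_set_iff)
qed simp_all

text \<open>In product charts the map decouples: coordinates up to \<open>q\<close> depend on the
  simplex part only, the others on the manifold part only. It serves for the cofaces paired with
  \<open>id\<close> and for \<open>id\<close> paired with the face maps of the nerve.\<close>

lemma smooth_map_prod:
  fixes Y :: "'b charted"
  assumes Y: "manifold_space Y" and f: "smooth_map X Y f"
    and a: "continuous_map (space_top (std_simplex p)) (space_top (std_simplex q)) a"
    and as: "\<And>j. j \<le> q \<Longrightarrow> smooth_on_set (Suc p) (standard_simplex p) (\<lambda>t. a t j)"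
  shows "smooth_map (simplex_times p X) (simplex_times q Y) (map_prod a f)"
  unfolding smooth_map_def
proof (intro conjI ballI, goal_cases)
  case 1
  have "continuous_map (prod_topology (space_top (std_simplex p)) (space_top X))
     (prod_topology (space_top (std_simplex q)) (space_top Y)) (\<lambda>(x, y). (a x, f y))"
    using a smooth_map_continuous[OF f] by (simp add: continuous_map_prod_top del: std_simplex_simps)
  then show ?case by (simp add: map_prod_def del: std_simplex_simps)
next
  case (2 c)
  interpret Y: manifold_space Y by fact
  have a_in: "a t \<in> standard_simplex q" if "t \<in> standard_simplex p" for t
    using a that by (auto simp: continuous_map_def)
  obtain U \<phi> where U: "(U, \<phi>) \<in> atlas X" "c = (standard_simplex p \<times> U, prism_chart p \<phi>)"
    using 2 by (auto simp: atlas_simplex_times)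
  let ?P = "standard_simplex p \<times> U" and ?\<Phi> = "prism_chart p \<phi>" and ?N = "Suc p + ambient_dim X"
  have "smooth_on_set ?N (?\<Phi> ` {z \<in> ?P. map_prod a f z \<in> standard_simplex q \<times> V})
      (\<lambda>x. prism_chart q \<psi> (map_prod a f (inv_into ?P ?\<Phi> x)) j)"
    if V: "(V, \<psi>) \<in> atlas Y" and j: "j < Suc q + ambient_dim Y" for V \<psi> j
    unfolding smooth_on_set_iff
  proof
    let ?A = "?\<Phi> ` {z \<in> ?P. map_prod a f z \<in> standard_simplex q \<times> V}"
    let ?g = "\<lambda>x. prism_chart q \<psi> (map_prod a f (inv_into ?P ?\<Phi> x)) j"
    fix x assume "x \<in> ?A"
    have A: "\<exists>t r. y = prism_chart p \<phi> (t, r) \<and> t \<in> standard_simplex p \<and> r \<in> U \<and> f r \<in> V" if "y \<in> ?A" for y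
    proof -
      from \<open>y \<in> ?A\<close> obtain z where z0: "y = prism_chart p \<phi> z"
        "z \<in> {z \<in> ?P. map_prod a f z \<in> standard_simplex q \<times> V}" by (rule imageE)
      then have z: "y = prism_chart p \<phi> z" "z \<in> ?P" "map_prod a f z \<in> standard_simplex q \<times> V"
        by simp_all
      obtain t r where "z = (t, r)" by (cases z)
      then show ?thesis using z by (intro exI[of _ t] exI[of _ r]) auto
    qed
    obtain s r where x: "x = prism_chart p \<phi> (s, r)" "s \<in> standard_simplex p" "r \<in> U" "f r \<in> V"
      using A[OF \<open>x \<in> ?A\<close>] by (elim exE conjE) (rule that)
    have xR: "x \<in> RN ?N" using prism_chart_RN chart_image_RN[OF U(1) x(3)] by (auto simp: x(1))
    show "smooth_at ?N ?A ?g x"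
    proof (cases "j \<le> q")
      case True
      have "smooth_at ?N ?A (\<lambda>x. a (simplex_part p x) j) x"
      proof (rule smooth_at_compose[where F = "simplex_part p" and g = "\<lambda>t. a t j" and B = "standard_simplex p" and M = "Suc p"])
        show "simplex_part p ` ?A \<subseteq> standard_simplex p"
          by (auto simp: simplex_part_prism_chart)
        show "smooth_at (Suc p) (standard_simplex p) (\<lambda>t. a t j) (simplex_part p x)"
          unfolding x(1) simplex_part_prism_chart[OF x(2)] by (rule smooth_on_setD[OF as[OF True] x(2)])
      qed (use \<open>x \<in> ?A\<close> xR smooth_simplex_part_coord standard_simplex_RN in auto)
      then show ?thesis
      proof (rule smooth_at_local[OF _ open_UNIV])
        fix y assume "y \<in> ?A"
        from A[OF this] obtain t r where y: "y = prism_chart p \<phi> (t, r)" "t \<in> standard_simplex p" "r \<in> U" "f r \<in> V"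
          by (elim exE conjE) (rule that)
        then show "y \<in> ?A \<and> ?g y = a (simplex_part p y) j"
          using True a_in by (auto simp: inv_prism_chart[OF U(1)] simplex_part_prism_chart) (simp add: prism_chart_def)
      qed simp
    next
      case False
      then have j': "j - Suc q < ambient_dim Y" using j by simp
      have "smooth_at ?N ?A (\<lambda>x. \<psi> (f (inv_into U \<phi> (manifold_part p x))) (j - Suc q)) x"
      proof (rule smooth_at_compose[where F = "manifold_part p" and g = "\<lambda>x. \<psi> (f (inv_into U \<phi> x)) (j - Suc q)" and B = "\<phi> ` {r \<in> U. f r \<in> V}" and M = "ambient_dim X"])
        show "manifold_part p ` ?A \<subseteq> \<phi> ` {r \<in> U. f r \<in> V}"
          by (auto simp: manifold_part_prism_chart)
        show "\<phi> ` {r \<in> U. f r \<in> V} \<subseteq> RN (ambient_dim X)" using chart_RN[OF U(1)] by auto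
        show "smooth_at (ambient_dim X) (\<phi> ` {r \<in> U. f r \<in> V}) (\<lambda>x. \<psi> (f (inv_into U \<phi> x)) (j - Suc q)) (manifold_part p x)"
          using smooth_on_setD[OF smooth_mapD[OF f U(1) V j'], of "\<phi> r"] x by (auto simp: manifold_part_prism_chart)
      qed (use \<open>x \<in> ?A\<close> xR smooth_manifold_part_coord in auto)
      then show ?thesis
      proof (rule smooth_at_local[OF _ open_UNIV])
        fix y assume "y \<in> ?A"
        from A[OF this] obtain t r where y: "y = prism_chart p \<phi> (t, r)" "t \<in> standard_simplex p" "r \<in> U" "f r \<in> V"
          by (elim exE conjE) (rule that)
        then show "y \<in> ?A \<and> ?g y = \<psi> (f (inv_into U \<phi> (manifold_part p y))) (j - Suc q)"
          using False a_in by (auto simp: inv_prism_chart[OF U(1)] manifold_part_prism_chart chart_inv[OF U(1)])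
            (simp add: prism_chart_def)
      qed simp
    qed
  qed
  then show ?case unfolding U(2) by (auto simp: atlas_simplex_times)
qed

end

section \<open>The nerve of a smooth etale groupoid\<close>

lemma mem_nerve_set:
  "(x, g) \<in> nerve_set G n \<longleftrightarrow> x \<in> topspace (space_top (Obj G)) \<and>
     (\<forall>i<n. g i \<in> topspace (space_top (Arr G))) \<and> (\<forall>i\<ge>n. g i = undefined) \<and>
     (0 < n \<longrightarrow> src G (g 0) = x) \<and> (\<forall>i. Suc i < n \<longrightarrow> tgt G (g i) = src G (g (Suc i)))"
  by (auto simp: nerve_set_def PiE_def extensional_def Pi_def)

lemma nerve_simps [simp]:
  "space_top (nerve G n) = nerve_top G n"
  "ambient_dim (nerve G n) = ambient_dim (Obj G)"
  "tangents (nerve G n) = tangents (Obj G)"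
  by (simp_all add: nerve_def)

lemma topspace_nerve [simp]: "topspace (nerve_top G n) = nerve_set G n"
  by (auto simp: nerve_top_def nerve_set_def)

lemma atlas_nerve:
  "(U, \<phi>') \<in> atlas (nerve G n) \<longleftrightarrow> (\<exists>V \<phi>. \<phi>' = \<phi> \<circ> fst \<and> (V, \<phi>) \<in> atlas (Obj G) \<and> openin (nerve_top G n) U \<and>
     inj_on fst U \<and> fst ` U \<subseteq> V \<and> openin (space_top (Obj G)) (fst ` U))"
  by (auto simp: nerve_def)

text \<open>The traces of basic product sets on the fibre product; by \<open>nerve_box_basis\<close>
  they form a basis of \<open>nerve_top G n\<close>.\<close>

definition nerve_box :: "('a, 'b) groupoid \<Rightarrow> nat \<Rightarrow> 'a set \<Rightarrow> (nat \<Rightarrow> 'b set) \<Rightarrow> ('a \<times> (nat \<Rightarrow> 'b)) set" where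
  "nerve_box G n V W = {(x, g) \<in> nerve_set G n. x \<in> V \<and> (\<forall>i<n. g i \<in> W i)}"

lemma openin_nerve_box:
  assumes "openin (space_top (Obj G)) V" "\<And>i. i < n \<Longrightarrow> openin (space_top (Arr G)) (W i)"
  shows "openin (nerve_top G n) (nerve_box G n V W)"
proof -
  have "openin (prod_topology (space_top (Obj G)) (product_topology (\<lambda>_. space_top (Arr G)) {..<n})) (V \<times> (\<Pi>\<^sub>E i\<in>{..<n}. W i))"
    using assms by (simp add: openin_prod_Times_iff openin_PiE)
  moreover have "nerve_box G n V W = (V \<times> (\<Pi>\<^sub>E i\<in>{..<n}. W i)) \<inter> nerve_set G n"
    by (auto simp: nerve_box_def nerve_set_def PiE_def Pi_def)
  ultimately show ?thesis unfolding nerve_top_def openin_subtopology by blast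
qed

lemma nerve_box_basis:
  assumes "openin (nerve_top G n) P" "(x, g) \<in> P"
  obtains V W where "openin (space_top (Obj G)) V" "\<And>i. openin (space_top (Arr G)) (W i)"
    "(x, g) \<in> nerve_box G n V W" "nerve_box G n V W \<subseteq> P"
proof -
  obtain Q where Q: "openin (prod_topology (space_top (Obj G)) (product_topology (\<lambda>_. space_top (Arr G)) {..<n})) Q"
    "P = Q \<inter> nerve_set G n"
    using assms(1) by (auto simp: nerve_top_def openin_subtopology)
  have xQ: "(x, g) \<in> Q" "(x, g) \<in> nerve_set G n" using Q(2) assms(2) by auto
  have "\<exists>V R. openin (space_top (Obj G)) V \<and> openin (product_topology (\<lambda>_. space_top (Arr G)) {..<n}) R \<and>
      x \<in> V \<and> g \<in> R \<and> V \<times> R \<subseteq> Q"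
    using Q(1) xQ(1) unfolding openin_prod_topology_alt by simp
  then obtain V R where VR: "openin (space_top (Obj G)) V"
    "openin (product_topology (\<lambda>_. space_top (Arr G)) {..<n}) R" "x \<in> V" "g \<in> R" "V \<times> R \<subseteq> Q" by blast
  obtain W where W: "g \<in> (\<Pi>\<^sub>E i\<in>{..<n}. W i)" "\<And>i. openin (space_top (Arr G)) (W i)" "(\<Pi>\<^sub>E i\<in>{..<n}. W i) \<subseteq> R"
    using product_topology_open_contains_basis[OF VR(2,4)] by (metis (no_types, lifting))
  show ?thesis
  proof (rule that[OF VR(1) W(2)])
    show "(x, g) \<in> nerve_box G n V W" using xQ(2) VR(3) W(1) by (auto simp: nerve_box_def)
    have "nerve_box G n V W \<subseteq> (V \<times> (\<Pi>\<^sub>E i\<in>{..<n}. W i)) \<inter> nerve_set G n"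
      by (auto simp: nerve_box_def nerve_set_def PiE_def Pi_def)
    then show "nerve_box G n V W \<subseteq> P" using W(3) VR(5) Q(2) by blast
  qed
qed

lemma continuous_map_nerve_fst: "continuous_map (nerve_top G n) (space_top (Obj G)) fst"
  unfolding nerve_top_def by (intro continuous_map_from_subtopology continuous_map_fst)

lemma continuous_map_nerve_arrow:
  assumes "i < n"
  shows "continuous_map (nerve_top G n) (space_top (Arr G)) (\<lambda>p. snd p i)"
proof -
  have "continuous_map (product_topology (\<lambda>_. space_top (Arr G)) {..<n}) (space_top (Arr G)) (\<lambda>g. g i)"
    using assms by (intro continuous_map_product_projection) auto
  then show ?thesis unfolding nerve_top_def
    by (intro continuous_map_from_subtopology continuous_map_snd_of[unfolded o_def] continuous_map_compose[OF continuous_map_snd, unfolded o_def])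
qed

lemma continuous_map_into_nerve:
  assumes "continuous_map S (space_top (Obj G)) (\<lambda>p. fst (f p))"
    and "\<And>i. i < n \<Longrightarrow> continuous_map S (space_top (Arr G)) (\<lambda>p. snd (f p) i)"
    and "\<And>p. p \<in> topspace S \<Longrightarrow> f p \<in> nerve_set G n"
  shows "continuous_map S (nerve_top G n) f"
  unfolding nerve_top_def continuous_map_in_subtopology continuous_map_pairwise
proof (intro conjI)
  show "continuous_map S (product_topology (\<lambda>_. space_top (Arr G)) {..<n}) (snd \<circ> f)"
    unfolding continuous_map_componentwise
  proof (intro conjI ballI)
    show "(snd \<circ> f) ` topspace S \<subseteq> extensional {..<n}"
      using assms(3) by (fastforce simp: nerve_set_def PiE_def)
  qed (use assms(2) in \<open>auto simp: o_def\<close>)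
qed (use assms(1,3) in \<open>auto simp: o_def\<close>)

context smooth_etale_groupoid
begin

interpretation obj: manifold_space "Obj G"
  by (rule smooth_manifold_imp_manifold_space[OF manifold_Obj])

interpretation arr: manifold_space "Arr G"
  by (rule smooth_manifold_imp_manifold_space[OF manifold_Arr])

abbreviation "O_top \<equiv> space_top (Obj G)"
abbreviation "A_top \<equiv> space_top (Arr G)"

lemma continuous_src: "continuous_map A_top O_top (src G)"
  and continuous_tgt: "continuous_map A_top O_top (tgt G)"
  by (rule local_diffeo_continuous[OF etale_src], rule local_diffeo_continuous[OF etale_tgt])

lemma open_src: "openin A_top W \<Longrightarrow> openin O_top (src G ` W)"
  by (rule local_diffeo_open_map[OF arr.charted_space_axioms obj.charted_space_axioms etale_src])

text \<open>Induction on \<open>n\<close>. A composable tuple extends by an arrow of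
  \<open>W n\<close> exactly if the target of its last arrow lies in the image of \<open>W n\<close>
  under \<open>src G\<close>. This image is open, as \<open>src G\<close> is an open map, and its
  preimage under \<open>tgt G\<close> can be absorbed into the preceding factor.\<close>

lemma fst_nerve_box_open:
  assumes "openin O_top V" "\<And>i. i < n \<Longrightarrow> openin A_top (W i)"
  shows "openin O_top (fst ` nerve_box G n V W)"
  using assms(2)
proof (induction n arbitrary: W)
  case 0
  have "V = fst ` nerve_box G 0 V W"
  proof (intro equalityI subsetI)
    fix x assume "x \<in> V"
    then have "(x, \<lambda>_. undefined) \<in> nerve_box G 0 V W"
      using openin_subset[OF assms(1)] by (auto simp: nerve_box_def mem_nerve_set)
    then show "x \<in> fst ` nerve_box G 0 V W" by force
  qed (auto simp: nerve_box_def)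
  then show ?case using assms(1) by simp
next
  case (Suc n)
  have Wn: "openin A_top (W n)" and Wi: "\<And>i. i < n \<Longrightarrow> openin A_top (W i)" using Suc.prems by auto
  have Wsub: "W n \<subseteq> topspace A_top" using openin_subset[OF Wn] .
  show ?case
  proof (cases "n = 0")
    case True
    \<comment> \<open>The first arrow has no predecessor; its source is the starting object
      itself.\<close>
    have "fst ` nerve_box G (Suc n) V W = V \<inter> src G ` W n"
    proof (intro equalityI subsetI)
      fix x assume "x \<in> V \<inter> src G ` W n"
      then obtain h where h: "x \<in> V" "h \<in> W n" "x = src G h" by auto
      then have "(x, \<lambda>i. if i = 0 then h else undefined) \<in> nerve_box G (Suc n) V W"
        using openin_subset[OF assms(1)] Wsub True by (auto simp: nerve_box_def mem_nerve_set)
      then show "x \<in> fst ` nerve_box G (Suc n) V W" by force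
    qed (use True in \<open>force simp: nerve_box_def mem_nerve_set\<close>)
    then show ?thesis using assms(1) open_src[OF Wn] by auto
  next
    case False
    then obtain k where k: "n = Suc k" by (cases n) auto
    define W' where "W' = W(k := {h \<in> W k. tgt G h \<in> src G ` W n})"
    have "openin A_top (W' i)" if "i < n" for i
      using Wi[OF that] openin_preimage_chart[OF continuous_tgt Wi[of k] open_src[OF Wn]] k
      by (simp add: W'_def)
    then have "openin O_top (fst ` nerve_box G n V W')" by (rule Suc.IH)
    moreover have "fst ` nerve_box G (Suc n) V W = fst ` nerve_box G n V W'"
    proof (intro equalityI subsetI)
      fix x assume "x \<in> fst ` nerve_box G (Suc n) V W"
      then obtain g where g: "(x, g) \<in> nerve_set G (Suc n)" "x \<in> V" "\<And>i. i < Suc n \<Longrightarrow> g i \<in> W i"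
        by (auto simp: nerve_box_def)
      have "(x, \<lambda>i. if i < n then g i else undefined) \<in> nerve_box G n V W'"
        using g k by (auto simp: nerve_box_def mem_nerve_set W'_def)
      then show "x \<in> fst ` nerve_box G n V W'" by force
    next
      fix x assume "x \<in> fst ` nerve_box G n V W'"
      then obtain g where g: "(x, g) \<in> nerve_set G n" "x \<in> V" "\<And>i. i < n \<Longrightarrow> g i \<in> W' i"
        by (auto simp: nerve_box_def)
      have gk: "g k \<in> W k" "tgt G (g k) \<in> src G ` W n" using g(3)[of k] k by (auto simp: W'_def)
      then obtain h where h: "h \<in> W n" "tgt G (g k) = src G h" by auto
      have "(x, g(n := h)) \<in> nerve_set G (Suc n)"
        using g(1) h Wsub k by (auto simp: mem_nerve_set less_Suc_eq)
      moreover have "(g(n := h)) i \<in> W i" if "i < Suc n" for i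
        using that g(3)[of i] h(1) gk(1) by (auto simp: W'_def less_Suc_eq split: if_splits)
      ultimately have "(x, g(n := h)) \<in> nerve_box G (Suc n) V W"
        using g(2) by (simp add: nerve_box_def)
      then show "x \<in> fst ` nerve_box G (Suc n) V W" by force
    qed
    ultimately show ?thesis by simp
  qed
qed

lemma fst_nerve_open:
  assumes "openin (nerve_top G n) P"
  shows "openin O_top (fst ` P)"
proof (subst openin_subopen, clarify)
  fix x g assume xg: "(x, g) \<in> P"
  obtain V W where *: "openin O_top V" "\<And>i. openin A_top (W i)"
    "(x, g) \<in> nerve_box G n V W" "nerve_box G n V W \<subseteq> P"
    using nerve_box_basis[OF assms xg] by blast
  have "openin O_top (fst ` nerve_box G n V W)" by (rule fst_nerve_box_open[OF *(1,2)])
  moreover have "x \<in> fst ` nerve_box G n V W" using *(3) by force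
  ultimately show "\<exists>T. openin O_top T \<and> fst (x, g) \<in> T \<and> T \<subseteq> fst ` P"
    using *(4) by (intro exI[of _ "fst ` nerve_box G n V W"]) auto
qed

lemma src_locally_injective:
  assumes "h \<in> topspace A_top"
  shows "\<exists>W. openin A_top W \<and> h \<in> W \<and> inj_on (src G) W"
  using local_diffeo_chart[OF arr.charted_space_axioms obj.charted_space_axioms etale_src assms]
  by (metis inj_on_inverseI)

text \<open>Around each arrow choose a set on which \<open>src G\<close> is injective. Then the
  starting object determines the first arrow, the target of that arrow determines the second one,
  and so on.\<close>

lemma fst_nerve_locally_injective:
  assumes xg: "(x, g) \<in> nerve_set G n" and V: "openin O_top V" "x \<in> V"
  shows "\<exists>U. openin (nerve_top G n) U \<and> (x, g) \<in> U \<and> inj_on fst U \<and> fst ` U \<subseteq> V"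
proof -
  have "\<forall>i. i < n \<longrightarrow> (\<exists>W. openin A_top W \<and> g i \<in> W \<and> inj_on (src G) W)"
    using xg src_locally_injective by (auto simp: mem_nerve_set)
  then obtain W where W: "\<And>i. i < n \<Longrightarrow> openin A_top (W i) \<and> g i \<in> W i \<and> inj_on (src G) (W i)" by metis
  have "inj_on fst (nerve_box G n V W)"
  proof (rule inj_onI)
    fix p q assume pq: "p \<in> nerve_box G n V W" "q \<in> nerve_box G n V W" "fst p = fst q"
    obtain y h h' where yh: "p = (y, h)" "q = (y, h')" using pq(3) by (metis prod.collapse)
    then have h: "(y, h) \<in> nerve_set G n" "(y, h') \<in> nerve_set G n"
      "\<And>i. i < n \<Longrightarrow> h i \<in> W i" "\<And>i. i < n \<Longrightarrow> h' i \<in> W i"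
      using pq by (auto simp: nerve_box_def)
    have "i < n \<Longrightarrow> h i = h' i" for i
    proof (induction i)
      case 0
      then show ?case using h W[OF 0] by (auto simp: mem_nerve_set inj_on_def)
    next
      case (Suc i)
      have "src G (h (Suc i)) = tgt G (h i)" "src G (h' (Suc i)) = tgt G (h' i)" "h i = h' i"
        using h(1,2) Suc by (auto simp: mem_nerve_set)
      then show ?case using h(3,4)[OF Suc.prems] W[OF Suc.prems] by (auto simp: inj_on_def)
    qed
    moreover have "i \<ge> n \<Longrightarrow> h i = h' i" for i using h(1,2) by (auto simp: mem_nerve_set)
    ultimately have "h = h'" by (metis ext leI)
    then show "p = q" using yh by simp
  qed
  then show ?thesis
    using openin_nerve_box[OF V(1), of n W] W xg V(2)
    by (intro exI[of _ "nerve_box G n V W"]) (auto simp: nerve_box_def)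
qed

lemma nerve_chart_exists:
  assumes "p \<in> nerve_set G n"
  obtains U V \<phi> where "(U, \<phi> \<circ> fst) \<in> atlas (nerve G n)" "p \<in> U" "(V, \<phi>) \<in> atlas (Obj G)" "fst ` U \<subseteq> V" "inj_on fst U"
proof -
  obtain x g where p: "p = (x, g)" by (cases p)
  have "x \<in> topspace O_top" using assms by (simp add: p mem_nerve_set)
  then obtain V \<phi> where V: "(V, \<phi>) \<in> atlas (Obj G)" "x \<in> V" using obj.chart_cover by blast
  obtain U where U: "openin (nerve_top G n) U" "p \<in> U" "inj_on fst U" "fst ` U \<subseteq> V"
    using fst_nerve_locally_injective[of x g n V] assms obj.chart_openin[OF V(1)] V(2) by (auto simp: p)
  show ?thesis
    by (rule that[of U \<phi> V]) (use U V fst_nerve_open[OF U(1)] in \<open>auto simp: atlas_nerve\<close>)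
qed

text \<open>Through \<open>fst\<close>, which is open and injective on chart domains, every
  requirement reduces to the same one for charts of the objects; in particular the coordinate
  changes are restrictions of those of \<open>Obj G\<close>.\<close>

lemma manifold_space_nerve: "manifold_space (nerve G n)"
proof
  show "tangents (nerve G n) = RN (ambient_dim (nerve G n))" by (simp add: obj.manifold_tangents)
  show "\<exists>U \<phi>. (U, \<phi>) \<in> atlas (nerve G n) \<and> p \<in> U" if "p \<in> topspace (space_top (nerve G n))" for p
    using that nerve_chart_exists[of p n] by (metis nerve_simps(1) topspace_nerve)
  fix U \<phi>' assume "(U, \<phi>') \<in> atlas (nerve G n)"
  then obtain V \<phi> where U: "\<phi>' = \<phi> \<circ> fst" "(V, \<phi>) \<in> atlas (Obj G)" "openin (nerve_top G n) U"
    "inj_on fst U" "fst ` U \<subseteq> V" "openin O_top (fst ` U)" by (auto simp: atlas_nerve)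
  have iU: "\<phi>' ` U = \<phi> ` (fst ` U)" by (auto simp: U(1))
  show "openin (space_top (nerve G n)) U" using U(3) by simp
  show inj: "inj_on \<phi>' U" unfolding U(1)
    using U(4) inj_on_subset[OF obj.chart_inj[OF U(2)] U(5)] by (rule comp_inj_on)
  show "\<phi>' ` U \<subseteq> RN (ambient_dim (nerve G n))" using obj.chart_RN[OF U(2)] U(5) by (auto simp: U(1))
  have img: "\<exists>T. open T \<and> \<phi>' ` W = \<phi>' ` U \<inter> T \<and> \<phi>' ` W = \<phi> ` V \<inter> T" if W: "openin (nerve_top G n) W" "W \<subseteq> U" for W
  proof -
    have fW: "fst ` W \<subseteq> V" using W(2) U(5) by auto
    obtain T where T: "open T" "\<forall>y\<in>V. \<phi> y \<in> T \<longleftrightarrow> y \<in> fst ` W"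
      using obj.chart_nhd[OF U(2) fst_nerve_open[OF W(1)] fW] by blast
    have "\<phi>' ` W = \<phi> ` V \<inter> T" using T(2) fW by (force simp: U(1))
    moreover have "\<phi>' ` W \<subseteq> \<phi>' ` U" "\<phi>' ` U \<subseteq> \<phi> ` V" using W(2) U(5) by (auto simp: U(1))
    ultimately have "\<phi>' ` W = \<phi>' ` U \<inter> T" by auto
    then show ?thesis using T(1) \<open>\<phi>' ` W = \<phi> ` V \<inter> T\<close> by (intro exI[of _ T] conjI)
  qed
  show "\<exists>T. open T \<and> \<phi>' ` W = \<phi>' ` U \<inter> T" if "openin (space_top (nerve G n)) W" "W \<subseteq> U" for W
    using img[of W] that by auto
  obtain T where T: "open T" "\<phi>' ` U = \<phi> ` V \<inter> T" using img[OF U(3)] by auto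
  obtain S where "open S" "\<phi> ` V = S \<inter> RN (ambient_dim (Obj G))"
    using obj.chart_image_openin[OF U(2)] by (auto simp: openin_RN)
  then show "openin (Euclidean_space (ambient_dim (nerve G n))) (\<phi>' ` U)"
    using T by (auto simp: openin_RN intro!: exI[of _ "S \<inter> T"])
  fix U2 \<phi>2' j assume "(U2, \<phi>2') \<in> atlas (nerve G n)" and j: "j < ambient_dim (nerve G n)"
  then obtain V2 \<phi>2 where U2: "\<phi>2' = \<phi>2 \<circ> fst" "(V2, \<phi>2) \<in> atlas (Obj G)" "fst ` U2 \<subseteq> V2"
    by (auto simp: atlas_nerve)
  have sm: "smooth_on_set (ambient_dim (Obj G)) (\<phi>' ` (U \<inter> U2)) (\<lambda>x. \<phi>2 (inv_into V \<phi> x) j)"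
    using j U(5) U2(3)
    by (intro smooth_on_set_subset[OF obj.transition_smooth[OF U(2) U2(2)]]) (auto simp: U(1) intro!: imageI)
  have eq: "\<phi>2' (inv_into U \<phi>' x) j = \<phi>2 (inv_into V \<phi> x) j" if "x \<in> \<phi>' ` (U \<inter> U2)" for x
  proof -
    obtain q where q: "q \<in> U" "x = \<phi>' q" using \<open>x \<in> \<phi>' ` (U \<inter> U2)\<close> by auto
    have "inv_into V \<phi> (\<phi> (fst q)) = fst q" using obj.chart_inv[OF U(2)] U(5) q(1) by auto
    then show ?thesis using inv_into_f_f[OF inj q(1)] by (simp add: q(2)) (simp add: U(1) U2(1))
  qed
  show "smooth_on_set (ambient_dim (nerve G n)) (\<phi>' ` (U \<inter> U2)) (\<lambda>x. \<phi>2' (inv_into U \<phi>' x) j)"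
    unfolding nerve_simps
    using sm smooth_on_set_cong[of "\<phi>' ` (U \<inter> U2)" "\<lambda>x. \<phi>2' (inv_into U \<phi>' x) j" "\<lambda>x. \<phi>2 (inv_into V \<phi> x) j"] eq
    by blast
qed

text \<open>In charts a point of the nerve is its starting object. So a continuous map is smooth
  once it moves the starting objects, locally, by a smooth map \<open>h\<close>.\<close>

lemma smooth_map_nerveI:
  assumes c: "continuous_map (nerve_top G n) (nerve_top G k) f"
    and h: "\<And>p. p \<in> nerve_set G n \<Longrightarrow> \<exists>R Q h. openin (nerve_top G n) R \<and> p \<in> R \<and> openin O_top Q \<and>
      smooth_map (open_sub (Obj G) Q) (Obj G) h \<and> (\<forall>q\<in>R. fst q \<in> Q \<and> fst (f q) = h (fst q))"
  shows "smooth_map (nerve G n) (nerve G k) f"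
proof -
  interpret n: manifold_space "nerve G n" by (rule manifold_space_nerve)
  interpret k: manifold_space "nerve G k" by (rule manifold_space_nerve)
  show ?thesis
  proof (rule smooth_mapI[OF n.charted_space_axioms k.charted_space_axioms])
    show "continuous_map (space_top (nerve G n)) (space_top (nerve G k)) f" using c by simp
    fix p assume "p \<in> topspace (space_top (nerve G n))"
    then have p: "p \<in> nerve_set G n" by simp
    have fp: "f p \<in> nerve_set G k" using c p by (auto simp: continuous_map_def)
    obtain R Q h where *: "openin (nerve_top G n) R" "p \<in> R" "openin O_top Q"
      "smooth_map (open_sub (Obj G) Q) (Obj G) h" "\<And>q. q \<in> R \<Longrightarrow> fst q \<in> Q \<and> fst (f q) = h (fst q)"
      using h[OF p] by blast
    obtain U V \<phi> where U: "(U, \<phi> \<circ> fst) \<in> atlas (nerve G n)" "p \<in> U" "(V, \<phi>) \<in> atlas (Obj G)" "fst ` U \<subseteq> V" "inj_on fst U"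
      using nerve_chart_exists[OF p] .
    obtain U' V' \<psi> where U': "(U', \<psi> \<circ> fst) \<in> atlas (nerve G k)" "f p \<in> U'" "(V', \<psi>) \<in> atlas (Obj G)"
        "fst ` U' \<subseteq> V'" "inj_on fst U'"
      using nerve_chart_exists[OF fp] .
    define W where "W = {q \<in> U \<inter> R. f q \<in> U'}"
    have Wo: "openin (nerve_top G n) W" unfolding W_def
      using openin_preimage_chart[OF c openin_Int[OF _ *(1)], of U U'] n.chart_openin[OF U(1)] k.chart_openin[OF U'(1)]
      by simp
    show "smooth_at_point (nerve G n) (nerve G k) f p" unfolding smooth_at_point_def
    proof (intro exI conjI allI impI)
      show "(U, \<phi> \<circ> fst) \<in> atlas (nerve G n)" "(U', \<psi> \<circ> fst) \<in> atlas (nerve G k)" by fact+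
      fix j assume "j < ambient_dim (nerve G k)"
      then have j: "j < ambient_dim (Obj G)" by simp
      have inv: "inv_into (V \<inter> Q) \<phi> (\<phi> y) = y" if "y \<in> V" "y \<in> Q" for y
        using obj.chart_inj[OF U(3)] that by (auto simp: inv_into_f_f inj_on_Int)
      have "(V \<inter> Q, \<phi>) \<in> atlas (open_sub (Obj G) Q)" using U(3) by (auto simp: atlas_open_sub)
      from smooth_mapD[OF *(4) this U'(3) j]
      have s: "smooth_on_set (ambient_dim (Obj G)) (\<phi> ` {y \<in> V \<inter> Q. h y \<in> V'}) (\<lambda>x. \<psi> (h (inv_into (V \<inter> Q) \<phi> x)) j)"
        by simp
      have W: "fst q \<in> V" "fst q \<in> Q" "h (fst q) \<in> V'" "fst (f q) = h (fst q)" "q \<in> U" if "q \<in> W" for q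
        using that *(5)[of q] U(4) U'(4) by (auto simp: W_def image_subset_iff)
      have pW: "p \<in> W" using U(2) *(2) U'(2) by (simp add: W_def)
      have "smooth_at (ambient_dim (Obj G)) (\<phi> ` {y \<in> V \<inter> Q. h y \<in> V'}) (\<lambda>x. \<psi> (h (inv_into (V \<inter> Q) \<phi> x)) j) (\<phi> (fst p))"
        by (rule smooth_on_setD[OF s]) (use W[OF pW] in auto)
      then have "smooth_at (ambient_dim (Obj G)) ((\<phi> \<circ> fst) ` W)
          (\<lambda>x. (\<psi> \<circ> fst) (f (inv_into U (\<phi> \<circ> fst) x)) j) (\<phi> (fst p))"
      proof (rule smooth_at_local[OF _ open_UNIV])
        fix y assume "y \<in> (\<phi> \<circ> fst) ` W"
        then obtain q where q: "q \<in> W" "y = (\<phi> \<circ> fst) q" by blast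
        show "y \<in> \<phi> ` {y \<in> V \<inter> Q. h y \<in> V'} \<and>
            (\<psi> \<circ> fst) (f (inv_into U (\<phi> \<circ> fst) y)) j = \<psi> (h (inv_into (V \<inter> Q) \<phi> y)) j"
          using W[OF q(1)] unfolding q(2) n.chart_inv[OF U(1) W(5)[OF q(1)]] by (auto simp: inv)
      qed simp
      then show "smooth_at (ambient_dim (nerve G n)) ((\<phi> \<circ> fst) ` W)
          (\<lambda>x. (\<psi> \<circ> fst) (f (inv_into U (\<phi> \<circ> fst) x)) j) ((\<phi> \<circ> fst) p)" by simp
    qed (use U U' Wo *(2) in \<open>auto simp: W_def\<close>)
  qed
qed

text \<open>Closure under composition is contained in the continuity of the composition map on the
  nerve in degree 2.\<close>

lemma arr_comp_closed:
  assumes "g \<in> topspace A_top" "h \<in> topspace A_top" "tgt G g = src G h"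
  shows "arr_comp G g h \<in> topspace A_top"
proof -
  have "src G g \<in> topspace O_top" using continuous_src assms(1) by (auto simp: continuous_map_def)
  then have "(src G g, \<lambda>i. if i = 0 then g else if i = 1 then h else undefined) \<in> nerve_set G 2"
    using assms by (auto simp: mem_nerve_set less_2_cases_iff)
  then show ?thesis
    using local_diffeo_continuous[OF etale_comp] by (force simp: continuous_map_def)
qed

section \<open>Smoothness of the face maps of the nerve\<close>

lemma nerve_face_in_nerve_set:
  assumes p: "(x, g) \<in> nerve_set G (Suc k)" and i: "i \<le> Suc k"
  shows "nerve_face G (Suc k) i (x, g) \<in> nerve_set G k"
proof -
  have g: "\<And>i. i < Suc k \<Longrightarrow> g i \<in> topspace A_top" "src G (g 0) = x" "x \<in> topspace O_top"
    "\<And>i. Suc i < Suc k \<Longrightarrow> tgt G (g i) = src G (g (Suc i))"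
    using p by (auto simp: mem_nerve_set)
  consider "i = 0" | "i = Suc k" | "0 < i" "i < Suc k" using i by linarith
  then show ?thesis
  proof cases
    case 1
    have "tgt G (g 0) \<in> topspace O_top" using continuous_tgt g(1)[of 0] by (auto simp: continuous_map_def)
    then show ?thesis using g by (auto simp: 1 nerve_face_def mem_nerve_set)
  next
    case 2
    then show ?thesis using g by (auto simp: nerve_face_def mem_nerve_set)
  next
    case 3
    then obtain l where l: "i = Suc l" "Suc l < Suc k" by (cases i) auto
    have c: "arr_comp G (g l) (g (Suc l)) \<in> topspace A_top"
      "src G (arr_comp G (g l) (g (Suc l))) = src G (g l)"
      "tgt G (arr_comp G (g l) (g (Suc l))) = tgt G (g (Suc l))"
      using arr_comp_closed src_comp tgt_comp g(1)[of l] g(1)[of "Suc l"] g(4)[of l] l by auto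
    define g' where "g' j = (if j < l then g j else if j = l then arr_comp G (g l) (g (Suc l)) else g (Suc j))" for j
    have eq: "nerve_face G (Suc k) i (x, g) = (x, \<lambda>j\<in>{..<k}. g' j)"
      using l by (auto simp: nerve_face_def g'_def restrict_def fun_eq_iff)
    have "g' j \<in> topspace A_top" if "j < k" for j using g(1) c that by (auto simp: g'_def)
    moreover have "src G (g' 0) = x" using g(2) c l by (auto simp: g'_def)
    moreover have "tgt G (g' j) = src G (g' (Suc j))" if "Suc j < k" for j
    proof -
      consider "Suc j < l" | "Suc j = l" | "j = l" | "l < j" by linarith
      then show ?thesis using g(4) c that l by cases (auto simp: g'_def)
    qed
    ultimately show ?thesis unfolding eq using g(3) by (auto simp: mem_nerve_set)
  qed
qed

lemma continuous_nerve_face: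
  assumes i: "i \<le> Suc k"
  shows "continuous_map (nerve_top G (Suc k)) (nerve_top G k) (nerve_face G (Suc k) i)"
proof (rule continuous_map_into_nerve)
  show "nerve_face G (Suc k) i p \<in> nerve_set G k" if "p \<in> topspace (nerve_top G (Suc k))" for p
    using that nerve_face_in_nerve_set[OF _ i] by (cases p) auto
  have "continuous_map (nerve_top G (Suc k)) O_top (\<lambda>p. tgt G (snd p 0))"
    using continuous_map_compose[OF continuous_map_nerve_arrow[of 0 "Suc k"] continuous_tgt] by (simp add: o_def)
  moreover have "(\<lambda>p. fst (nerve_face G (Suc k) i p)) = (if i = 0 then \<lambda>p. tgt G (snd p 0) else fst)"
    by (auto simp: nerve_face_def fun_eq_iff)
  ultimately show "continuous_map (nerve_top G (Suc k)) O_top (\<lambda>p. fst (nerve_face G (Suc k) i p))"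
    using continuous_map_nerve_fst by auto
  fix j assume j: "j < k"
  have a: "continuous_map (nerve_top G (Suc k)) A_top (\<lambda>p. snd p l)" if "l \<le> k" for l
    using that by (intro continuous_map_nerve_arrow) auto
  consider "i = 0" | "i = Suc k" | "0 < i" "i < Suc k" "j \<noteq> i - 1" | "0 < i" "i < Suc k" "j = i - 1" using i by linarith
  then show "continuous_map (nerve_top G (Suc k)) A_top (\<lambda>p. snd (nerve_face G (Suc k) i p) j)"
  proof cases
    case 1
    then show ?thesis using a[of "Suc j"] j by (simp add: nerve_face_def case_prod_unfold)
  next
    case 2
    then show ?thesis using a[of j] j by (simp add: nerve_face_def case_prod_unfold)
  next
    case 3
    then show ?thesis using a[of j] a[of "Suc j"] j by (cases "j < i - 1") (auto simp: nerve_face_def case_prod_unfold)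
  next
    case 4
    \<comment> \<open>The two arrows to be composed are turned into a point of the nerve in degree
      2, where composition is known to be continuous.\<close>
    let ?f = "\<lambda>p::'a \<times> (nat \<Rightarrow> 'b). (src G (snd p j), \<lambda>l::nat. if l = 0 then snd p j else if l = 1 then snd p (Suc j) else undefined)"
    have "continuous_map (nerve_top G (Suc k)) (nerve_top G 2) ?f"
    proof (rule continuous_map_into_nerve)
      show "continuous_map (nerve_top G (Suc k)) O_top (\<lambda>p. fst (?f p))"
        using continuous_map_compose[OF a[of j] continuous_src] j by (simp add: o_def)
      show "continuous_map (nerve_top G (Suc k)) A_top (\<lambda>p. snd (?f p) l)" if "l < 2" for l :: nat
        using a[of j] a[of "Suc j"] j that by (auto simp: less_2_cases_iff)
      show "?f p \<in> nerve_set G 2" if "p \<in> topspace (nerve_top G (Suc k))" for p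
        using that j continuous_map_image_subset_topspace[OF continuous_src]
        by (cases p) (auto simp: mem_nerve_set less_2_cases_iff)
    qed
    from continuous_map_compose[OF this local_diffeo_continuous[OF etale_comp, unfolded nerve_simps]]
    have "continuous_map (nerve_top G (Suc k)) A_top ((\<lambda>(x, g). arr_comp G (g 0) (g 1)) \<circ> ?f)" .
    then have "continuous_map (nerve_top G (Suc k)) A_top (\<lambda>p. arr_comp G (snd p j) (snd p (Suc j)))"
      by (simp add: o_def)
    then show ?thesis using 4 by (auto simp: nerve_face_def case_prod_unfold)
  qed
qed

text \<open>For \<open>i > 0\<close> the face map keeps the starting object and covers the identity
  of the objects. For \<open>i = 0\<close> it passes to the target of the first arrow, which locally
  is \<open>tgt G\<close> after a smooth section of \<open>src G\<close>.\<close>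

lemma smooth_nerve_face:
  assumes i: "i \<le> Suc k"
  shows "smooth_map (nerve G (Suc k)) (nerve G k) (nerve_face G (Suc k) i)"
proof (rule smooth_map_nerveI[OF continuous_nerve_face[OF i]])
  fix p assume p: "p \<in> nerve_set G (Suc k)"
  show "\<exists>R Q h. openin (nerve_top G (Suc k)) R \<and> p \<in> R \<and> openin O_top Q \<and>
      smooth_map (open_sub (Obj G) Q) (Obj G) h \<and>
      (\<forall>q\<in>R. fst q \<in> Q \<and> fst (nerve_face G (Suc k) i q) = h (fst q))"
  proof (cases "i = 0")
    case True
    obtain x g where xg: "p = (x, g)" by (cases p)
    have "g 0 \<in> topspace A_top" using p by (auto simp: xg mem_nerve_set)
    then obtain P s where P: "openin A_top P" "g 0 \<in> P" "openin O_top (src G ` P)"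
      "smooth_map (open_sub (Obj G) (src G ` P)) (Arr G) s" "\<And>q. q \<in> P \<Longrightarrow> s (src G q) = q"
      using local_diffeo_chart[OF arr.charted_space_axioms obj.charted_space_axioms etale_src] by metis
    define R where "R = {q \<in> nerve_set G (Suc k). snd q 0 \<in> P}"
    have "openin (nerve_top G (Suc k)) R"
      using openin_preimage_chart[OF continuous_map_nerve_arrow[of 0 "Suc k" G] openin_topspace P(1)]
      by (simp add: R_def)
    moreover have "p \<in> R" using p P(2) by (simp add: R_def xg)
    moreover have "smooth_map (open_sub (Obj G) (src G ` P)) (Obj G) (tgt G \<circ> s)"
      by (rule smooth_map_compose[OF charted_space_open_sub[OF obj.charted_space_axioms P(3)] arr.charted_space_axioms
            obj.charted_space_axioms P(4)
            local_diffeo_smooth_map[OF arr.charted_space_axioms obj.charted_space_axioms etale_tgt]])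
    moreover have "fst q \<in> src G ` P \<and> fst (nerve_face G (Suc k) i q) = (tgt G \<circ> s) (fst q)" if "q \<in> R" for q
    proof -
      have "snd q 0 \<in> P" "src G (snd q 0) = fst q" using that by (cases q; simp add: R_def mem_nerve_set)+
      moreover have "s (fst q) = snd q 0" using P(5)[of "snd q 0"] calculation by simp
      ultimately show ?thesis using True imageI[of "snd q 0" P "src G"] by (auto simp: nerve_face_def case_prod_unfold)
    qed
    ultimately show ?thesis using P(3) by blast
  next
    case False
    have "smooth_map (open_sub (Obj G) (topspace O_top)) (Obj G) id"
      by (rule smooth_map_from_open_sub[OF obj.charted_space_axioms smooth_map_id[OF obj.charted_space_axioms]]) simp
    moreover have "fst q \<in> topspace O_top \<and> fst (nerve_face G (Suc k) i q) = id (fst q)" if "q \<in> nerve_set G (Suc k)" for q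
      using that False by (cases q) (auto simp: mem_nerve_set nerve_face_def)
    ultimately show ?thesis using p
      by (intro exI[of _ "nerve_set G (Suc k)"] exI[of _ "topspace O_top"] exI[of _ id])
        (auto simp: openin_topspace[of "nerve_top G (Suc k)", simplified])
  qed
qed

end

section \<open>Alternating multilinear functions\<close>

lemma alternating_multilinear_comb:
  assumes "alternating_multilinear T \<alpha>" "set vs \<subseteq> T" "i < length vs" "u \<in> T" "w \<in> T"
  shows "\<alpha> (vs[i := (\<lambda>l. a * u l + b * w l)]) =
    complex_of_real a * \<alpha> (vs[i := u]) + complex_of_real b * \<alpha> (vs[i := w])"
  using assms unfolding alternating_multilinear_def by blast

lemma alternating_multilinear_repeat:
  assumes "alternating_multilinear T \<alpha>" "set vs \<subseteq> T" "i < j" "j < length vs" "vs ! i = vs ! j"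
  shows "\<alpha> vs = 0"
  using assms unfolding alternating_multilinear_def by blast

lemma alternating_multilinear_add:
  assumes "alternating_multilinear T \<alpha>" "set vs \<subseteq> T" "i < length vs" "u \<in> T" "w \<in> T"
  shows "\<alpha> (vs[i := (\<lambda>l. u l + w l)]) = \<alpha> (vs[i := u]) + \<alpha> (vs[i := w])"
  using alternating_multilinear_comb[OF assms, of 1 1] by simp

lemma alternating_multilinear_zero:
  assumes "alternating_multilinear T \<alpha>" "set vs \<subseteq> T" "i < length vs"
  shows "\<alpha> (vs[i := (\<lambda>l. 0)]) = 0"
proof -
  have "vs ! i \<in> T" using assms(2,3) by auto
  from alternating_multilinear_comb[OF assms this this, of 0 0] show ?thesis by simp
qed

text \<open>Membership of the sum in \<open>T\<close> is proved alongside, because the induction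
  step splits off one summand by \<open>alternating_multilinear_comb\<close>, which needs the
  remaining sum in \<open>T\<close>.\<close>

lemma alternating_multilinear_sum:
  assumes \<alpha>: "alternating_multilinear T \<alpha>" "set vs \<subseteq> T" "i < length vs"
    and T: "\<And>u w. u \<in> T \<Longrightarrow> w \<in> T \<Longrightarrow> (\<lambda>l. u l + w l) \<in> T" "\<And>a u. u \<in> T \<Longrightarrow> (\<lambda>l. a * u l) \<in> T" "(\<lambda>l. 0) \<in> T"
    and b: "\<And>k. k \<in> K \<Longrightarrow> b k \<in> T" and "finite K"
  shows "\<alpha> (vs[i := (\<lambda>l. \<Sum>k\<in>K. a k * b k l)]) = (\<Sum>k\<in>K. complex_of_real (a k) * \<alpha> (vs[i := b k]))
    \<and> (\<lambda>l. \<Sum>k\<in>K. a k * b k l) \<in> T"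
  using \<open>finite K\<close> b
proof (induction K rule: finite_induct)
  case empty
  then show ?case using alternating_multilinear_zero[OF \<alpha>] T(3) by simp
next
  case (insert k K)
  have IH: "(\<lambda>l. \<Sum>k\<in>K. a k * b k l) \<in> T"
    "\<alpha> (vs[i := (\<lambda>l. \<Sum>k\<in>K. a k * b k l)]) = (\<Sum>k\<in>K. complex_of_real (a k) * \<alpha> (vs[i := b k]))"
    using insert by auto
  have bk: "b k \<in> T" using insert by simp
  show ?case
    using insert.hyps IH T(1)[OF T(2)[OF bk, of "a k"] IH(1)]
      alternating_multilinear_comb[OF \<alpha> bk IH(1), of "a k" 1]
    by simp
qed

text \<open>Expand the vanishing value on two adjacent copies of s + b; the terms with a repeated
  argument drop out.\<close>

lemma alternating_multilinear_swap:
  assumes \<alpha>: "alternating_multilinear T \<alpha>" and T: "\<And>u w. u \<in> T \<Longrightarrow> w \<in> T \<Longrightarrow> (\<lambda>l. u l + w l) \<in> T"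
    and "set us \<subseteq> T" "s \<in> T" "b \<in> T" "set ws \<subseteq> T"
  shows "\<alpha> (us @ s # b # ws) = - \<alpha> (us @ b # s # ws)"
proof -
  let ?c = "\<lambda>l. s l + b l" and ?i = "length us"
  have c: "?c \<in> T" using T assms by blast
  have upd: "(us @ x # y # ws)[?i := z] = us @ z # y # ws" "(us @ x # y # ws)[Suc ?i := z] = us @ x # z # ws" for x y z
    by (simp_all add: list_update_append)
  have rep: "\<alpha> (us @ x # x # ws) = 0" if "x \<in> T" for x
    by (rule alternating_multilinear_repeat[OF \<alpha>, of _ ?i "Suc ?i"]) (use that assms in \<open>auto simp: nth_append\<close>)
  have "0 = \<alpha> (us @ ?c # ?c # ws)" using rep[OF c] by simp
  also have "\<dots> = \<alpha> (us @ s # ?c # ws) + \<alpha> (us @ b # ?c # ws)"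
    using alternating_multilinear_add[OF \<alpha>, of "us @ s # ?c # ws" ?i s b] assms c by (simp add: upd)
  also have "\<alpha> (us @ s # ?c # ws) = \<alpha> (us @ s # s # ws) + \<alpha> (us @ s # b # ws)"
    using alternating_multilinear_add[OF \<alpha>, of "us @ s # s # ws" "Suc ?i" s b] assms by (simp add: upd)
  also have "\<alpha> (us @ b # ?c # ws) = \<alpha> (us @ b # s # ws) + \<alpha> (us @ b # b # ws)"
    using alternating_multilinear_add[OF \<alpha>, of "us @ b # s # ws" "Suc ?i" s b] assms by (simp add: upd)
  finally show ?thesis using rep assms by (simp add: eq_neg_iff_add_eq_0)
qed

lemma alternating_multilinear_move:
  assumes \<alpha>: "alternating_multilinear T \<alpha>" and T: "\<And>u w. u \<in> T \<Longrightarrow> w \<in> T \<Longrightarrow> (\<lambda>l. u l + w l) \<in> T"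
    and "set us \<subseteq> T" "s \<in> T" "set bs \<subseteq> T" "set ws \<subseteq> T"
  shows "\<alpha> (us @ s # bs @ ws) = (- 1) ^ length bs * \<alpha> (us @ bs @ s # ws)"
  using assms(3,5)
proof (induction bs arbitrary: us)
  case (Cons b bs)
  have "\<alpha> (us @ s # b # bs @ ws) = - \<alpha> (us @ b # s # bs @ ws)"
    by (rule alternating_multilinear_swap[OF \<alpha> T]) (use Cons.prems assms in auto)
  also have "\<alpha> (us @ b # s # bs @ ws) = (- 1) ^ length bs * \<alpha> ((us @ [b]) @ bs @ s # ws)"
    using Cons.IH[of "us @ [b]"] Cons.prems by simp
  finally show ?case by simp
qed simp

text \<open>The omission of the i-th argument, which \<open>ext_deriv\<close> writes out with
  \<open>take\<close> and \<open>drop\<close>.\<close>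

definition remove_at :: "nat \<Rightarrow> 'a list \<Rightarrow> 'a list" where
  "remove_at i xs = take i xs @ drop (Suc i) xs"

lemma length_remove_at [simp]: "i < length xs \<Longrightarrow> length (remove_at i xs) = length xs - 1"
  by (simp add: remove_at_def)

lemma set_remove_at: "set (remove_at i xs) \<subseteq> set xs"
  unfolding remove_at_def using set_take_subset set_drop_subset by fastforce

lemma map_remove_at: "map f (remove_at i xs) = remove_at i (map f xs)"
  by (simp add: remove_at_def take_map drop_map)

lemma nth_remove_at:
  "i < length xs \<Longrightarrow> j < length xs - 1 \<Longrightarrow> remove_at i xs ! j = xs ! (if j < i then j else Suc j)"
  by (auto simp: remove_at_def nth_append min_def)

lemma remove_at_update:
  assumes "i < length xs" "j < length xs - 1"
  shows "(remove_at i xs)[j := x] = remove_at i (xs[(if j < i then j else Suc j) := x])"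
  by (rule nth_equalityI) (use assms in \<open>auto simp: nth_remove_at nth_list_update\<close>)

lemma remove_at_update_append:
  "remove_at (length A) ((A @ a # B @ b # C)[length A + Suc (length B) := s]) = A @ B @ s # C"
  "remove_at (length A + Suc (length B)) ((A @ a # B @ b # C)[length A := s]) = A @ s # B @ C"
  by (simp_all add: remove_at_def list_update_append)

text \<open>The two lists differ by moving \<open>s\<close> past the \<open>j - i - 1\<close>
  arguments strictly between the two positions; the sign of this move times (-1)^j is the negative
  of (-1)^i.\<close>

lemma alternating_remove_update:
  assumes \<alpha>: "alternating_multilinear T \<alpha>" and T: "\<And>u w. u \<in> T \<Longrightarrow> w \<in> T \<Longrightarrow> (\<lambda>l. u l + w l) \<in> T"
    and us: "set us \<subseteq> T" and s: "s \<in> T" and ij: "i < j" "j < length us"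
  shows "(- 1) ^ i * \<alpha> (remove_at i (us[j := s])) + (- 1) ^ j * \<alpha> (remove_at j (us[i := s])) = 0"
proof -
  define A where "A = take i us"
  define B where "B = take (j - Suc i) (drop (Suc i) us)"
  define C where "C = drop (Suc j) us"
  have sub: "set A \<subseteq> T" "set B \<subseteq> T" "set C \<subseteq> T"
    using us by (auto simp: A_def B_def C_def dest!: in_set_takeD in_set_dropD)
  have us_eq: "us = A @ us ! i # B @ us ! j # C"
  proof -
    have "drop (Suc i) us = B @ drop (j - Suc i) (drop (Suc i) us)" by (simp only: B_def append_take_drop_id)
    also have "drop (j - Suc i) (drop (Suc i) us) = us ! j # C"
      using ij by (simp add: C_def Cons_nth_drop_Suc)
    finally show ?thesis using ij id_take_nth_drop[of i us] by (simp add: A_def)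
  qed
  have len: "length A = i" "length B = j - Suc i" using ij by (auto simp: A_def B_def)
  have j_eq: "j = length A + Suc (length B)" using len ij by simp
  have 1: "remove_at i (us[j := s]) = A @ B @ s # C"
  proof -
    have "remove_at i (us[j := s]) =
        remove_at (length A) ((A @ us ! i # B @ us ! j # C)[length A + Suc (length B) := s])"
      by (subst us_eq[symmetric], subst j_eq[symmetric], subst len(1), rule refl)
    then show ?thesis by (simp only: remove_at_update_append)
  qed
  have 2: "remove_at j (us[i := s]) = A @ s # B @ C"
  proof -
    have "remove_at j (us[i := s]) =
        remove_at (length A + Suc (length B)) ((A @ us ! i # B @ us ! j # C)[length A := s])"
      by (subst us_eq[symmetric], subst j_eq[symmetric], subst len(1), rule refl)
    then show ?thesis by (simp only: remove_at_update_append)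
  qed
  have "\<alpha> (A @ s # B @ C) = (- 1) ^ (j - Suc i) * \<alpha> (A @ B @ s # C)"
    unfolding len(2)[symmetric] by (rule alternating_multilinear_move[OF \<alpha> T sub(1) s sub(2,3)])
  moreover have "(- 1 :: complex) ^ j * (- 1) ^ (j - Suc i) = - ((- 1) ^ i)"
  proof -
    obtain k where k: "j = Suc (i + k)" using ij less_imp_Suc_add by blast
    have "(- 1 :: complex) ^ k * (- 1) ^ k = 1" by (simp flip: power_add)
    then show ?thesis by (simp add: k power_add)
  qed
  ultimately show ?thesis unfolding 1 2 by (simp add: mult.assoc[symmetric])
qed

text \<open>The inner index skips \<open>i\<close>, so it enumerates all
  \<open>j \<noteq> i\<close>. Double sums of this shape occur whenever an argument or a vertex is
  omitted twice; the same cancellation gives d d = 0 for forms and for cochains.\<close>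

lemma antisymmetric_sum_zero:
  fixes t :: "nat \<Rightarrow> nat \<Rightarrow> complex"
  assumes "\<And>i j. i < n \<Longrightarrow> j < n \<Longrightarrow> i \<noteq> j \<Longrightarrow> t j i = - t i j"
  shows "(\<Sum>i<n. \<Sum>j<n - 1. t i (if j < i then j else Suc j)) = 0"
proof -
  have "(\<Sum>j<n - 1. t i (if j < i then j else Suc j)) = (\<Sum>j\<in>{..<n} - {i}. t i j)" if "i < n" for i
    by (rule sum.reindex_bij_witness[of _ "\<lambda>j. if j < i then j else j - 1" "\<lambda>j. if j < i then j else Suc j"])
      (use that in auto)
  also have "\<dots> i = (\<Sum>j<n. if i = j then 0 else t i j)" for i
    by (rule sum.mono_neutral_cong_left) auto
  finally have 1: "(\<Sum>i<n. \<Sum>j<n - 1. t i (if j < i then j else Suc j)) = (\<Sum>i<n. \<Sum>j<n. if i = j then 0 else t i j)"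
    by (intro sum.cong[OF refl]) blast
  have "(\<Sum>i<n. \<Sum>j<n. if i = j then 0 else t i j) = (\<Sum>j<n. \<Sum>i<n. if i = j then 0 else t i j)"
    by (rule sum.swap)
  also have "\<dots> = (\<Sum>j<n. \<Sum>i<n. - (if j = i then 0 else t j i))"
  proof (intro sum.cong refl)
    fix i j assume "j \<in> {..<n}" "i \<in> {..<n}"
    then show "(if i = j then 0 else t i j) = - (if j = i then 0 else t j i)" using assms[of j i] by simp
  qed
  also have "\<dots> = - (\<Sum>j<n. \<Sum>i<n. if j = i then 0 else t j i)"
    by (simp add: sum_negf)
  finally show ?thesis unfolding 1 by simp
qed

text \<open>Meant for \<open>s i j\<close> the second derivative of a coordinate map along the i-th
  and j-th argument: by its symmetry these terms cancel when an exterior derivative is pulled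
  back.\<close>

lemma alternating_symmetric_sum_zero:
  assumes \<alpha>: "alternating_multilinear T \<alpha>" and T: "\<And>u w. u \<in> T \<Longrightarrow> w \<in> T \<Longrightarrow> (\<lambda>l. u l + w l) \<in> T"
    and us: "set us \<subseteq> T" and s: "\<And>i j. i < length us \<Longrightarrow> j < length us \<Longrightarrow> s i j \<in> T \<and> s i j = s j i"
  shows "(\<Sum>i<length us. (- 1) ^ i * (\<Sum>j<length us - 1.
    \<alpha> ((remove_at i us)[j := s i (if j < i then j else Suc j)]))) = 0"
proof -
  let ?n = "length us"
  define t where "t i j = (- 1) ^ i * \<alpha> (remove_at i (us[j := s i j]))" for i j
  have anti: "t i j + t j i = 0" if "i < j" "j < ?n" for i j
  proof -
    have *: "s i j \<in> T \<and> s i j = s j i" by (rule s) (use that in auto)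
    show ?thesis unfolding t_def conjunct2[OF *, symmetric]
      by (rule alternating_remove_update[OF \<alpha> T us conjunct1[OF *] that])
  qed
  have "(\<Sum>i<?n. (- 1) ^ i * (\<Sum>j<?n - 1. \<alpha> ((remove_at i us)[j := s i (if j < i then j else Suc j)]))) =
      (\<Sum>i<?n. \<Sum>j<?n - 1. t i (if j < i then j else Suc j))"
    unfolding sum_distrib_left by (intro sum.cong refl) (simp add: t_def remove_at_update)
  also have "\<dots> = 0"
  proof (rule antisymmetric_sum_zero)
    fix i j assume "i < ?n" "j < ?n" "i \<noteq> j"
    then show "t j i = - t i j" using anti[of i j] anti[of j i]
      by (cases i j rule: linorder_cases) (auto simp: eq_neg_iff_add_eq_0 add.commute)
  qed
  finally show ?thesis .
qed

section \<open>The Leibniz rule for multilinear functions\<close>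

text \<open>A basis of the tangent space: e_l - e_0 for the simplex coordinates l \<ge> 1 and e_l
  for the Euclidean ones. With this choice the coefficients of a tangent vector are its own
  coordinates \<open>w l\<close> for \<open>l \<ge> 1\<close>.\<close>

definition prism_basis :: "nat \<Rightarrow> nat \<Rightarrow> nat \<Rightarrow> real" where
  "prism_basis n l = (\<lambda>j. if j = l then 1 else if j = 0 \<and> l \<le> n then - 1 else 0)"

lemma prism_basis_in: "l \<in> {1..<Suc n + m} \<Longrightarrow> prism_basis n l \<in> prism_tangents n m"
proof -
  assume l: "l \<in> {1..<Suc n + m}"
  have "(\<Sum>i\<le>n. prism_basis n l i) = 0"
  proof (cases "l \<le> n")
    case True
    have "(\<Sum>i\<le>n. prism_basis n l i) = (\<Sum>i\<le>n. (if i = l then 1 else 0) - (if i = 0 then 1 else 0))"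
      using True l by (intro sum.cong) (auto simp: prism_basis_def)
    then show ?thesis using True by (simp add: sum_subtractf)
  next
    case False
    then show ?thesis by (intro sum.neutral) (auto simp: prism_basis_def)
  qed
  then show ?thesis using l by (auto simp: prism_tangents_def mem_RN prism_basis_def)
qed

lemma prism_basis_expansion:
  assumes "w \<in> prism_tangents n m"
  shows "w = (\<lambda>j. \<Sum>l\<in>{1..<Suc n + m}. w l * prism_basis n l j)"
proof
  fix j
  have w: "\<And>i. i \<ge> Suc n + m \<Longrightarrow> w i = 0" "(\<Sum>i\<le>n. w i) = 0"
    using assms by (auto simp: prism_tangents_def mem_RN)
  show "w j = (\<Sum>l\<in>{1..<Suc n + m}. w l * prism_basis n l j)"
  proof (cases "j = 0")
    case True
    have "(\<Sum>l\<in>{1..<Suc n + m}. w l * prism_basis n l j) = (\<Sum>l\<in>{1..n}. - w l)"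
      by (rule sum.mono_neutral_cong_right) (auto simp: prism_basis_def True)
    also have "\<dots> = w 0" using w(2) by (simp add: sum_negf atMost_atLeast0 sum.atLeast_Suc_atMost)
    finally show ?thesis using True by simp
  next
    case False
    have "(\<Sum>l\<in>{1..<Suc n + m}. w l * prism_basis n l j) = (\<Sum>l\<in>{1..<Suc n + m}. if j = l then w l else 0)"
      by (intro sum.cong) (auto simp: prism_basis_def False)
    also have "\<dots> = (if j \<in> {1..<Suc n + m} then w j else 0)" by simp
    finally show ?thesis using False w(1)[of j] by auto
  qed
qed

lemma prism_tangents_add: "u \<in> prism_tangents n m \<Longrightarrow> w \<in> prism_tangents n m \<Longrightarrow> (\<lambda>l. u l + w l) \<in> prism_tangents n m"
  using prism_tangents_comb[of u n m w 1 1] by simp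

lemma prism_tangents_scale: "u \<in> prism_tangents n m \<Longrightarrow> (\<lambda>l. a * u l) \<in> prism_tangents n m"
  using prism_tangents_comb[of u n m u a 0] by simp

lemma prism_tangents_zero: "(\<lambda>l. 0) \<in> prism_tangents n m"
  by (simp add: prism_tangents_def mem_RN)

lemma alternating_multilinear_basis:
  assumes "alternating_multilinear (prism_tangents n m) \<alpha>" "set vs \<subseteq> prism_tangents n m" "i < length vs"
    and w: "w \<in> prism_tangents n m"
  shows "\<alpha> (vs[i := w]) = (\<Sum>l\<in>{1..<Suc n + m}. complex_of_real (w l) * \<alpha> (vs[i := prism_basis n l]))"
proof -
  have "\<alpha> (vs[i := w]) = \<alpha> (vs[i := (\<lambda>j. \<Sum>l\<in>{1..<Suc n + m}. w l * prism_basis n l j)])"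
    using prism_basis_expansion[OF w] by (rule arg_cong)
  also have "\<dots> = (\<Sum>l\<in>{1..<Suc n + m}. complex_of_real (w l) * \<alpha> (vs[i := prism_basis n l]))"
    by (rule conjunct1[OF alternating_multilinear_sum[OF assms(1-3) prism_tangents_add prism_tangents_scale
          prism_tangents_zero prism_basis_in finite_atLeastLessThan]])
  finally show ?thesis .
qed

context
  fixes n m N :: nat and A
  assumes A: "prism_open n m A" and N: "N = Suc n + m"
begin

text \<open>The tangent space is given by linear equations, which the family \<open>W\<close> of
  tangent vectors satisfies identically on \<open>A\<close>; hence its derivatives satisfy them
  too.\<close>

lemma tangent_map_into_tangents:
  assumes W: "\<And>y. y \<in> A \<Longrightarrow> W y \<in> prism_tangents n' m'" "\<And>j. smooth_on_set N A (\<lambda>y. W y j)"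
    and x: "x \<in> A" and v: "v \<in> prism_tangents n m"
  shows "tangent_map N A W x v \<in> prism_tangents n' m'"
  unfolding prism_tangents_def mem_Collect_eq mem_RN
proof (intro conjI allI impI)
  note xR = prism_open_imp_RN[OF A N x]
  have z: "deriv_on N A f x v = 0" if "\<And>y. y \<in> A \<Longrightarrow> f y = 0" for f :: "(nat \<Rightarrow> real) \<Rightarrow> real"
  proof -
    have "deriv_on N A f x v = deriv_on N A (\<lambda>y. 0) x v"
      by (intro deriv_on_cong[OF A N x v A x open_UNIV]) (auto intro: smooth_at_const xR that)
    then show ?thesis by (simp add: deriv_on_const[OF A N x v])
  qed
  fix j assume "Suc n' + m' \<le> j"
  then show "tangent_map N A W x v j = 0"
    unfolding tangent_map_def using W(1) by (intro z) (auto simp: prism_tangents_def mem_RN)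
next
  note xR = prism_open_imp_RN[OF A N x]
  have z: "deriv_on N A f x v = 0" if "\<And>y. y \<in> A \<Longrightarrow> f y = 0" for f :: "(nat \<Rightarrow> real) \<Rightarrow> real"
  proof -
    have "deriv_on N A f x v = deriv_on N A (\<lambda>y. 0) x v"
      by (intro deriv_on_cong[OF A N x v A x open_UNIV]) (auto intro: smooth_at_const xR that)
    then show ?thesis by (simp add: deriv_on_const[OF A N x v])
  qed
  have "(\<Sum>j\<le>n'. tangent_map N A W x v j) = deriv_on N A (\<lambda>y. \<Sum>j\<le>n'. W y j) x v"
    unfolding tangent_map_def
    by (rule deriv_on_sum[OF A N x v, symmetric]) (rule smooth_on_setD[OF W(2) x])
  also have "\<dots> = 0" by (rule z) (use W(1) in \<open>auto simp: prism_tangents_def\<close>)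
  finally show "(\<Sum>j\<le>n'. tangent_map N A W x v j) = 0" .
qed

lemma tangent_map_const: "x \<in> A \<Longrightarrow> v \<in> prism_tangents n m \<Longrightarrow> tangent_map N A (\<lambda>y. w) x v = (\<lambda>j. 0)"
  unfolding tangent_map_def by (simp add: deriv_on_const[OF A N])

lemma deriv_on_eq_on:
  assumes "x \<in> A" "v \<in> prism_tangents n m" "smooth_at N A f x" "\<And>y. y \<in> A \<Longrightarrow> f' y = f y"
  shows "deriv_on N A f' x v = deriv_on N A f x v"
  by (rule deriv_on_cong[OF A N assms(1,2) A assms(1) open_UNIV]) (use assms in auto)

text \<open>The slots are made constant one after the other by expanding their entries in a basis.\<close>

lemma leibniz:
  assumes ml: "\<And>y. y \<in> A \<Longrightarrow> alternating_multilinear (prism_tangents n' m') (\<Phi> y)"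
    and sm: "\<And>ws. set ws \<subseteq> prism_tangents n' m' \<Longrightarrow> smooth_on_set N A (\<lambda>y. \<Phi> y ws)"
    and Ws: "\<And>W y. W \<in> set Ws \<Longrightarrow> y \<in> A \<Longrightarrow> W y \<in> prism_tangents n' m'"
      "\<And>W j. W \<in> set Ws \<Longrightarrow> smooth_on_set N A (\<lambda>y. W y j)"
  shows "smooth_on_set N A (\<lambda>y. \<Phi> y (map (\<lambda>W. W y) Ws)) \<and>
    (\<forall>x\<in>A. \<forall>v\<in>prism_tangents n m. deriv_on N A (\<lambda>y. \<Phi> y (map (\<lambda>W. W y) Ws)) x v =
      deriv_on N A (\<lambda>y. \<Phi> y (map (\<lambda>W. W x) Ws)) x v +
      (\<Sum>j<length Ws. \<Phi> x ((map (\<lambda>W. W x) Ws)[j := tangent_map N A (Ws ! j) x v])))"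
proof -
  let ?T = "prism_tangents n' m'"
  \<comment> \<open>Generalised for an induction on \<open>q\<close>: the slots from
    \<open>q\<close> on hold constant vector fields, the slots before may still vary. The claim is
    the case \<open>q = length Ws\<close>.\<close>
  have "smooth_on_set N A (\<lambda>y. \<Phi> y (map (\<lambda>W. W y) Ws)) \<and>
    (\<forall>x\<in>A. \<forall>v\<in>prism_tangents n m. deriv_on N A (\<lambda>y. \<Phi> y (map (\<lambda>W. W y) Ws)) x v =
      deriv_on N A (\<lambda>y. \<Phi> y (map (\<lambda>W. W x) Ws)) x v +
      (\<Sum>j<length Ws. \<Phi> x ((map (\<lambda>W. W x) Ws)[j := tangent_map N A (Ws ! j) x v])))"
    if "\<And>i. q \<le> i \<Longrightarrow> i < length Ws \<Longrightarrow> \<exists>w. Ws ! i = (\<lambda>_. w)"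
      "\<And>W y. W \<in> set Ws \<Longrightarrow> y \<in> A \<Longrightarrow> W y \<in> ?T"
      "\<And>W j. W \<in> set Ws \<Longrightarrow> smooth_on_set N A (\<lambda>y. W y j)" for q and Ws
    using that
  proof (induction q arbitrary: Ws)
    case 0
    have const: "W y = W x" if "W \<in> set Ws" for W x y
      using that 0(1) by (auto simp: in_set_conv_nth) metis
    then have eq: "map (\<lambda>W. W y) Ws = map (\<lambda>W. W x) Ws" for x y by auto
    have sub: "set (map (\<lambda>W. W x) Ws) \<subseteq> ?T" if "x \<in> A" for x using 0(2) that by auto
    have "smooth_on_set N A (\<lambda>y. \<Phi> y (map (\<lambda>W. W y) Ws))"
    proof (cases "A = {}")
      case False
      then obtain x where x: "x \<in> A" by auto
      have "(\<lambda>y. \<Phi> y (map (\<lambda>W. W y) Ws)) = (\<lambda>y. \<Phi> y (map (\<lambda>W. W x) Ws))"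
        by (rule ext, rule arg_cong[OF eq])
      then show ?thesis using sm[OF sub[OF x]] by simp
    qed (simp add: smooth_on_set_def)
    moreover have "\<Phi> x ((map (\<lambda>W. W x) Ws)[j := tangent_map N A (Ws ! j) x v]) = 0"
      if x: "x \<in> A" and v: "v \<in> prism_tangents n m" and j: "j < length Ws" for x v j
    proof -
      obtain w where "Ws ! j = (\<lambda>_. w)" using 0(1) j by blast
      then have "tangent_map N A (Ws ! j) x v = (\<lambda>j. 0)" using tangent_map_const[OF x v] by simp
      then show ?thesis using alternating_multilinear_zero[OF ml[OF x] sub[OF x], of j] j by simp
    qed
    moreover have "deriv_on N A (\<lambda>y. \<Phi> y (map (\<lambda>W. W y) Ws)) x v = deriv_on N A (\<lambda>y. \<Phi> y (map (\<lambda>W. W x) Ws)) x v" for x v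
    proof -
      have "(\<lambda>y. \<Phi> y (map (\<lambda>W. W y) Ws)) = (\<lambda>y. \<Phi> y (map (\<lambda>W. W x) Ws))"
        by (rule ext, rule arg_cong[OF eq])
      then show ?thesis by simp
    qed
    ultimately show ?case by (auto intro!: sum.neutral)
  next
    case (Suc q)
    show ?case
    proof (cases "q < length Ws")
      case False
      then show ?thesis using Suc by (intro Suc.IH) auto
    next
      case q: True
      define L where "L = {1..<Suc n' + m'}"
      \<comment> \<open>Slot \<open>q\<close> is frozen to a basis vector, which brings the
        induction hypothesis into play; the coordinates \<open>w l\<close> of the original entry
        become scalar factors.\<close>
      define Ws' where "Ws' l = Ws[q := (\<lambda>_. prism_basis n' l)]" for l
      define S where "S x = map (\<lambda>W. W x) Ws" for x :: "nat \<Rightarrow> real"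
      define w where "w l y = (Ws ! q) y l" for l y
      have bT: "prism_basis n' l \<in> ?T" if "l \<in> L" for l using that by (auto simp: L_def intro: prism_basis_in)
      have IH: "smooth_on_set N A (\<lambda>y. \<Phi> y (map (\<lambda>W. W y) (Ws' l))) \<and>
        (\<forall>x\<in>A. \<forall>v\<in>prism_tangents n m. deriv_on N A (\<lambda>y. \<Phi> y (map (\<lambda>W. W y) (Ws' l))) x v =
          deriv_on N A (\<lambda>y. \<Phi> y (map (\<lambda>W. W x) (Ws' l))) x v +
          (\<Sum>j<length (Ws' l). \<Phi> x ((map (\<lambda>W. W x) (Ws' l))[j := tangent_map N A ((Ws' l) ! j) x v])))"
        if l: "l \<in> L" for l
      proof (rule Suc.IH)
        show "\<exists>w. Ws' l ! i = (\<lambda>_. w)" if "q \<le> i" "i < length (Ws' l)" for i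
          using that Suc.prems(1)[of i] q by (cases "i = q") (auto simp: Ws'_def)
        fix W assume "W \<in> set (Ws' l)"
        then have W: "W = (\<lambda>_. prism_basis n' l) \<or> W \<in> set Ws"
          using set_update_subset_insert[of Ws q] by (auto simp: Ws'_def)
        show "W y \<in> ?T" if "y \<in> A" for y using W bT[OF l] Suc.prems(2) that by auto
        show "smooth_on_set N A (\<lambda>y. W y j)" for j
          using W Suc.prems(3) prism_open_imp_RN[OF A N] by (auto simp: smooth_on_set_iff intro: smooth_at_const)
      qed
      have mW': "map (\<lambda>W. W y) (Ws' l) = (S y)[q := prism_basis n' l]" for y l
        by (simp add: Ws'_def S_def map_update)
      have lenS: "length (S y) = length Ws" for y by (simp add: S_def)
      have ST: "set (S y) \<subseteq> ?T" if "y \<in> A" for y using Suc.prems(2) that by (auto simp: S_def)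
      have STb: "set ((S y)[q := prism_basis n' l]) \<subseteq> ?T" if "y \<in> A" "l \<in> L" for y l
        using set_update_subset_insert[of "S y" q] ST[OF that(1)] bT[OF that(2)] by blast
      have Sq: "(S y)[q := (Ws ! q) y] = S y" for y
        using list_update_id[of "S y" q] q by (simp add: S_def)
      have qT: "(Ws ! q) y \<in> ?T" if "y \<in> A" for y using Suc.prems(2)[OF nth_mem[OF q] that] .
      have weq: "w l = (\<lambda>y. (Ws ! q) y l)" for l by (simp add: w_def fun_eq_iff)
      have smw: "smooth_on_set N A (w l)" for l
        unfolding weq by (rule Suc.prems(3)[OF nth_mem[OF q]])
      have exp: "\<Phi> y (ss[q := u]) = (\<Sum>l\<in>L. complex_of_real (u l) * \<Phi> y (ss[q := prism_basis n' l]))"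
        if "y \<in> A" "set ss \<subseteq> ?T" "length ss = length Ws" "u \<in> ?T" for y ss u
        unfolding L_def by (rule alternating_multilinear_basis[OF ml[OF that(1)] that(2) _ that(4)]) (use q that in simp)
      have main: "\<Phi> y (S y) = (\<Sum>l\<in>L. w l y *\<^sub>R \<Phi> y ((S y)[q := prism_basis n' l]))" if "y \<in> A" for y
        using exp[OF that ST[OF that] lenS qT[OF that]] Sq by (simp add: w_def scaleR_conv_of_real)
      have sml: "smooth_on_set N A (\<lambda>y. \<Phi> y ((S y)[q := prism_basis n' l]))" if "l \<in> L" for l
        using IH[OF that] by (simp add: mW')
      have smt: "smooth_at N A (\<lambda>y. \<Sum>l\<in>L. w l y *\<^sub>R \<Phi> y ((S y)[q := prism_basis n' l])) x" if "x \<in> A" for x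
        by (intro smooth_at_sum smooth_at_scaleR prism_open_imp_RN[OF A N that] smooth_on_setD[OF smw that]
            smooth_on_setD[OF sml that])
      have "smooth_on_set N A (\<lambda>y. \<Phi> y (S y))"
        unfolding smooth_on_set_iff by (intro ballI smooth_at_local[OF smt open_UNIV]) (auto simp: main)
      moreover have "deriv_on N A (\<lambda>y. \<Phi> y (S y)) x v = deriv_on N A (\<lambda>y. \<Phi> y (S x)) x v +
          (\<Sum>j<length Ws. \<Phi> x ((S x)[j := tangent_map N A (Ws ! j) x v]))"
        if x: "x \<in> A" and v: "v \<in> prism_tangents n m" for x v
      proof -
        let ?D = "\<lambda>j. tangent_map N A (Ws ! j) x v"
        have DT: "?D j \<in> ?T" if "j < length Ws" for j
          using Suc.prems(2,3)[OF nth_mem[OF that]] by (intro tangent_map_into_tangents[OF _ _ x v])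
        have smc: "smooth_at N A (\<lambda>y. \<Phi> y ((S x)[q := prism_basis n' l])) x" if "l \<in> L" for l
          by (rule smooth_on_setD[OF sm[OF STb[OF x that]] x])
        have "deriv_on N A (\<lambda>y. \<Phi> y (S y)) x v =
            deriv_on N A (\<lambda>y. \<Sum>l\<in>L. w l y *\<^sub>R \<Phi> y ((S y)[q := prism_basis n' l])) x v"
          by (rule deriv_on_eq_on[OF x v smt[OF x] main])
        also have "\<dots> = (\<Sum>l\<in>L. deriv_on N A (\<lambda>y. w l y *\<^sub>R \<Phi> y ((S y)[q := prism_basis n' l])) x v)"
          by (intro deriv_on_sum[OF A N x v] smooth_at_scaleR smooth_on_setD[OF smw x] smooth_on_setD[OF sml x])
        also have "\<dots> = (\<Sum>l\<in>L. w l x *\<^sub>R deriv_on N A (\<lambda>y. \<Phi> y ((S y)[q := prism_basis n' l])) x v +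
            deriv_on N A (w l) x v *\<^sub>R \<Phi> x ((S x)[q := prism_basis n' l]))"
          by (intro sum.cong refl deriv_on_scaleR[OF A N x v] smooth_on_setD[OF smw x] smooth_on_setD[OF sml x])
        also have "\<dots> = (\<Sum>l\<in>L. w l x *\<^sub>R deriv_on N A (\<lambda>y. \<Phi> y ((S y)[q := prism_basis n' l])) x v) +
            \<Phi> x ((S x)[q := ?D q])"
          using exp[OF x ST[OF x] lenS DT[OF q]]
          by (simp add: sum.distrib tangent_map_def weq scaleR_conv_of_real)
        also have "(\<Sum>l\<in>L. w l x *\<^sub>R deriv_on N A (\<lambda>y. \<Phi> y ((S y)[q := prism_basis n' l])) x v) =
          (\<Sum>l\<in>L. w l x *\<^sub>R (deriv_on N A (\<lambda>y. \<Phi> y ((S x)[q := prism_basis n' l])) x v +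
            (\<Sum>j\<in>{..<length Ws} - {q}. \<Phi> x ((S x)[q := prism_basis n' l, j := ?D j]))))"
        proof (intro sum.cong refl arg_cong2[where f = scaleR])
          fix l assume l: "l \<in> L"
          have "deriv_on N A (\<lambda>y. \<Phi> y ((S y)[q := prism_basis n' l])) x v =
             deriv_on N A (\<lambda>y. \<Phi> y ((S x)[q := prism_basis n' l])) x v +
             (\<Sum>j<length Ws. \<Phi> x ((S x)[q := prism_basis n' l, j := tangent_map N A (Ws' l ! j) x v]))"
            using IH[OF l] x v by (simp add: mW') (simp add: Ws'_def)
          \<comment> \<open>Slot \<open>q\<close> is constant in \<open>Ws' l\<close>, so its
            derivative vanishes here; its true contribution has already been produced by
            differentiating the factors \<open>w l\<close>.\<close>
          also have "(\<Sum>j<length Ws. \<Phi> x ((S x)[q := prism_basis n' l, j := tangent_map N A (Ws' l ! j) x v])) =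
             (\<Sum>j\<in>{..<length Ws} - {q}. \<Phi> x ((S x)[q := prism_basis n' l, j := ?D j]))"
          proof (rule sum.mono_neutral_cong_right)
            have "tangent_map N A (Ws' l ! q) x v = (\<lambda>j. 0)"
              using q by (simp add: Ws'_def tangent_map_const[OF x v])
            then show "\<forall>j\<in>{..<length Ws} - ({..<length Ws} - {q}).
                \<Phi> x ((S x)[q := prism_basis n' l, j := tangent_map N A (Ws' l ! j) x v]) = 0"
              using alternating_multilinear_zero[OF ml[OF x] STb[OF x l], of q] q by (auto simp: lenS)
          qed (auto simp: Ws'_def)
          finally show "deriv_on N A (\<lambda>y. \<Phi> y ((S y)[q := prism_basis n' l])) x v =
             deriv_on N A (\<lambda>y. \<Phi> y ((S x)[q := prism_basis n' l])) x v +
             (\<Sum>j\<in>{..<length Ws} - {q}. \<Phi> x ((S x)[q := prism_basis n' l, j := ?D j]))" .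
        qed
        also have "\<dots> = (\<Sum>l\<in>L. w l x *\<^sub>R deriv_on N A (\<lambda>y. \<Phi> y ((S x)[q := prism_basis n' l])) x v) +
            (\<Sum>j\<in>{..<length Ws} - {q}. \<Sum>l\<in>L. w l x *\<^sub>R \<Phi> x ((S x)[q := prism_basis n' l, j := ?D j]))"
          by (subst sum.swap) (simp add: scaleR_add_right sum.distrib scaleR_sum_right)
        also have "(\<Sum>l\<in>L. w l x *\<^sub>R deriv_on N A (\<lambda>y. \<Phi> y ((S x)[q := prism_basis n' l])) x v) =
            deriv_on N A (\<lambda>y. \<Phi> y (S x)) x v"
        proof -
          have 1: "\<Phi> y (S x) = (\<Sum>l\<in>L. of_real (w l x) * \<Phi> y ((S x)[q := prism_basis n' l]))" if "y \<in> A" for y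
            using exp[OF that ST[OF x] lenS qT[OF x]] Sq[of x] by (simp add: w_def)
          have 2: "smooth_at N A (\<lambda>y. of_real (w l x) * \<Phi> y ((S x)[q := prism_basis n' l])) x" if "l \<in> L" for l
            using smooth_at_scaleR[OF smooth_at_const[OF prism_open_imp_RN[OF A N x]] smc[OF that], of "w l x"]
            by (simp add: scaleR_conv_of_real)
          have "deriv_on N A (\<lambda>y. \<Phi> y (S x)) x v =
              deriv_on N A (\<lambda>y. \<Sum>l\<in>L. of_real (w l x) * \<Phi> y ((S x)[q := prism_basis n' l])) x v"
            by (rule deriv_on_eq_on[OF x v smooth_at_sum[OF prism_open_imp_RN[OF A N x] 2] 1])
          also have "\<dots> = (\<Sum>l\<in>L. of_real (w l x) * deriv_on N A (\<lambda>y. \<Phi> y ((S x)[q := prism_basis n' l])) x v)"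
            by (simp add: deriv_on_sum[OF A N x v 2] deriv_on_mult_const[OF A N x v smc])
          finally show ?thesis by (simp add: scaleR_conv_of_real)
        qed
        \<comment> \<open>Summing over the basis with the coefficients \<open>w l x\<close> restores
          the original entry of slot \<open>q\<close>.\<close>
        also have "(\<Sum>j\<in>{..<length Ws} - {q}. \<Sum>l\<in>L. w l x *\<^sub>R \<Phi> x ((S x)[q := prism_basis n' l, j := ?D j])) =
            (\<Sum>j\<in>{..<length Ws} - {q}. \<Phi> x ((S x)[j := ?D j]))"
        proof (intro sum.cong refl)
          fix j assume j: "j \<in> {..<length Ws} - {q}"
          have s1: "set ((S x)[j := ?D j]) \<subseteq> ?T"
            using set_update_subset_insert[of "S x" j] ST[OF x] DT[of j] j by blast
          have "\<Phi> x ((S x)[j := ?D j]) = \<Phi> x ((S x)[j := ?D j, q := (Ws ! q) x])"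
            using j Sq[of x] by (metis DiffD2 insertI1 list_update_swap)
          also have "\<dots> = (\<Sum>l\<in>L. of_real (w l x) * \<Phi> x ((S x)[j := ?D j, q := prism_basis n' l]))"
            using exp[OF x s1 _ qT[OF x]] by (simp add: lenS w_def)
          finally show "(\<Sum>l\<in>L. w l x *\<^sub>R \<Phi> x ((S x)[q := prism_basis n' l, j := ?D j])) = \<Phi> x ((S x)[j := ?D j])"
            using j by (simp add: scaleR_conv_of_real list_update_swap[of q j])
        qed
        finally show ?thesis
          using q by (simp add: sum.remove[of "{..<length Ws}" q])
      qed
      ultimately show ?thesis by (simp add: S_def)
    qed
  qed
  from this[of "length Ws" Ws] show ?thesis using Ws by auto
qed

end

section \<open>Pullback of differential forms\<close>

definition chart_rep :: "'a set \<Rightarrow> ('a \<Rightarrow> nat \<Rightarrow> real) \<Rightarrow> ('b \<Rightarrow> nat \<Rightarrow> real) \<Rightarrow> ('a \<Rightarrow> 'b) \<Rightarrow> (nat \<Rightarrow> real) \<Rightarrow> nat \<Rightarrow> real" where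
  "chart_rep U \<phi> \<psi> f = (\<lambda>y. \<psi> (f (inv_into U \<phi> y)))"

definition chart_dom :: "'a set \<Rightarrow> ('a \<Rightarrow> nat \<Rightarrow> real) \<Rightarrow> 'b set \<Rightarrow> ('a \<Rightarrow> 'b) \<Rightarrow> (nat \<Rightarrow> real) set" where
  "chart_dom U \<phi> V f = \<phi> ` {q \<in> U. f q \<in> V}"

text \<open>The chart of the target that \<open>pullback\<close> selects; it depends on the image
  point alone. For forms the selection is immaterial by \<open>pullback_chart\<close>.\<close>

definition target_chart :: "'a charted \<Rightarrow> 'a \<Rightarrow> 'a chart" where
  "target_chart Y p = (SOME c. c \<in> atlas Y \<and> p \<in> fst c)"

lemma (in charted_space) target_chart:
  assumes "p \<in> topspace (space_top X)" "target_chart X p = (V, \<psi>)"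
  shows "(V, \<psi>) \<in> atlas X" "p \<in> V"
proof -
  have "\<exists>c. c \<in> atlas X \<and> p \<in> fst c" using chart_cover[OF assms(1)] by auto
  then have "target_chart X p \<in> atlas X \<and> p \<in> fst (target_chart X p)"
    unfolding target_chart_def by (rule someI_ex)
  then show "(V, \<psi>) \<in> atlas X" "p \<in> V" using assms(2) by auto
qed

locale prism_map = X: prism_space X n m + Y: prism_space Y n' m'
  for X :: "'a charted" and n m and Y :: "'b charted" and n' m' +
  fixes f :: "'a \<Rightarrow> 'b"
  assumes smooth: "smooth_map X Y f"
begin

lemma f_in: "q \<in> topspace (space_top X) \<Longrightarrow> f q \<in> topspace (space_top Y)"
  using smooth_map_continuous[OF smooth] by (auto simp: continuous_map_def)

lemma f_in_chart: "(U, \<phi>) \<in> atlas X \<Longrightarrow> q \<in> U \<Longrightarrow> f q \<in> topspace (space_top Y)"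
  using X.chart_subset f_in by blast

context
  fixes U \<phi> V \<psi>
  assumes U: "(U, \<phi>) \<in> atlas X" and V: "(V, \<psi>) \<in> atlas Y"
begin

lemma chart_dom_nhd: "\<exists>T. open T \<and> (\<forall>q\<in>U. \<phi> q \<in> T \<longleftrightarrow> f q \<in> V)"
proof -
  have "openin (space_top X) {q \<in> U. f q \<in> V}"
    by (rule openin_preimage_chart[OF smooth_map_continuous[OF smooth] X.chart_openin[OF U] Y.chart_openin[OF V]])
  from X.chart_nhd[OF U this] show ?thesis by auto
qed

lemma chart_dom_prism_open: "prism_open n m (chart_dom U \<phi> V f)"
proof -
  obtain T where T: "open T" "\<forall>q\<in>U. \<phi> q \<in> T \<longleftrightarrow> f q \<in> V" using chart_dom_nhd by blast
  have "chart_dom U \<phi> V f = \<phi> ` U \<inter> T" using T(2) by (auto simp: chart_dom_def)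
  then show ?thesis using prism_open_Int[OF X.chart_prism_open[OF U] T(1)] by simp
qed

lemma chart_rep_eq: "q \<in> U \<Longrightarrow> chart_rep U \<phi> \<psi> f (\<phi> q) = \<psi> (f q)"
  by (simp add: chart_rep_def X.chart_inv[OF U])

lemma chart_rep_maps: "chart_rep U \<phi> \<psi> f ` chart_dom U \<phi> V f \<subseteq> \<psi> ` V"
  by (auto simp: chart_dom_def chart_rep_eq)

lemma chart_rep_smooth: "smooth_on_set (ambient_dim X) (chart_dom U \<phi> V f) (\<lambda>y. chart_rep U \<phi> \<psi> f y j)"
proof (cases "j < ambient_dim Y")
  case True
  then show ?thesis using smooth_mapD[OF smooth U V] by (simp add: chart_dom_def chart_rep_def)
next
  case False
  have "chart_rep U \<phi> \<psi> f y j = 0" if "y \<in> chart_dom U \<phi> V f" for y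
    using chart_rep_maps Y.chart_RN[OF V] that False by (force simp: mem_RN)
  moreover have "smooth_on_set (ambient_dim X) (chart_dom U \<phi> V f) (\<lambda>y. 0 :: real)"
    using X.chart_RN[OF U] by (auto simp: smooth_on_set_iff chart_dom_def intro!: smooth_at_const)
  ultimately show ?thesis by (subst smooth_on_set_cong[of _ _ "\<lambda>y. 0"]) auto
qed

text \<open>Only the second claim of \<open>deriv_on_compose\<close> is wanted; a constant function
  takes the place of its outer function.\<close>

lemma chart_rep_tangent:
  assumes x: "x \<in> chart_dom U \<phi> V f" and v: "v \<in> tangents X"
  shows "tangent_map (ambient_dim X) (chart_dom U \<phi> V f) (chart_rep U \<phi> \<psi> f) x v \<in> tangents Y"
proof -
  have "chart_rep U \<phi> \<psi> f x \<in> RN (ambient_dim Y)" using chart_rep_maps Y.chart_RN[OF V] x by blast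
  from deriv_on_compose(2)[OF chart_dom_prism_open X.prism_dim Y.chart_prism_open[OF V] Y.prism_dim chart_rep_maps
      x _ smooth_on_setD[OF chart_rep_smooth x] smooth_at_const[OF this, of _ "0::real"]]
  show ?thesis using v by (simp add: X.prism_tangents Y.prism_tangents)
qed

end

lemma pullback_target_chart:
  assumes "(U, \<phi>) \<in> atlas X" "q \<in> U" "set vs \<subseteq> tangents X" "target_chart Y (f q) = (V, \<psi>)"
  shows "pullback X Y f \<omega> (U, \<phi>) (\<phi> q) vs = \<omega> (V, \<psi>) (\<psi> (f q))
    (map (tangent_map (ambient_dim X) (chart_dom U \<phi> V f) (chart_rep U \<phi> \<psi> f) (\<phi> q)) vs)"
proof -
  have "form_arg X (U, \<phi>) (\<phi> q) vs" using assms by (auto simp: form_arg_def)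
  then show ?thesis using assms(4)
    by (simp add: pullback_def target_chart_def Let_def X.chart_inv[OF assms(1,2)] chart_dom_def chart_rep_def)
qed

end

text \<open>The composite may be defined where the chain through the middle chart is not. Therefore
  all derivatives are compared on the common part \<open>A\<close> of the two domains, where
  \<open>deriv_on_compose\<close> applies.\<close>

lemma prism_map_compose_tangent:
  assumes f: "prism_map X n m Y n' m' f" and g: "prism_map Y n' m' Z n'' m'' g"
    and U: "(U, \<phi>) \<in> atlas X" and V: "(V, \<psi>) \<in> atlas Y" and W: "(W, \<kappa>) \<in> atlas Z"
    and q: "q \<in> U" "f q \<in> V" "g (f q) \<in> W" and v: "v \<in> tangents X"
  shows "tangent_map (ambient_dim X) (chart_dom U \<phi> W (g \<circ> f)) (chart_rep U \<phi> \<kappa> (g \<circ> f)) (\<phi> q) v =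
    tangent_map (ambient_dim Y) (chart_dom V \<psi> W g) (chart_rep V \<psi> \<kappa> g) (\<psi> (f q))
      (tangent_map (ambient_dim X) (chart_dom U \<phi> V f) (chart_rep U \<phi> \<psi> f) (\<phi> q) v)"
proof -
  interpret f: prism_map X n m Y n' m' f by fact
  interpret g: prism_map Y n' m' Z n'' m'' g by fact
  interpret gf: prism_map X n m Z n'' m'' "g \<circ> f"
    by (unfold_locales, rule smooth_map_compose[OF f.X.charted_space_axioms f.Y.charted_space_axioms
          g.Y.charted_space_axioms f.smooth g.smooth])
  define A1 where "A1 = chart_dom U \<phi> V f"
  define A2 where "A2 = chart_dom V \<psi> W g"
  define A3 where "A3 = chart_dom U \<phi> W (g \<circ> f)"
  define A where "A = A1 \<inter> A3"
  define F1 where "F1 = chart_rep U \<phi> \<psi> f"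
  define F2 where "F2 = chart_rep V \<psi> \<kappa> g"
  define F3 where "F3 = chart_rep U \<phi> \<kappa> (g \<circ> f)"
  let ?N = "ambient_dim X" and ?M = "ambient_dim Y"
  have o1: "prism_open n m A1" unfolding A1_def by (rule f.chart_dom_prism_open[OF U V])
  have o2: "prism_open n' m' A2" unfolding A2_def by (rule g.chart_dom_prism_open[OF V W])
  have o3: "prism_open n m A3" unfolding A3_def by (rule gf.chart_dom_prism_open[OF U W])
  obtain T where T: "open T" "\<forall>q\<in>U. \<phi> q \<in> T \<longleftrightarrow> f q \<in> V" using f.chart_dom_nhd[OF U V] by blast
  have AT: "A = A3 \<inter> T" using T(2) f.X.chart_inj[OF U] by (auto simp: A_def A1_def A3_def chart_dom_def inj_on_def)
  then have o: "prism_open n m A" using prism_open_Int[OF o3 T(1)] by simp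
  have A_cases: "\<exists>r. y = \<phi> r \<and> r \<in> U \<and> f r \<in> V \<and> g (f r) \<in> W" if "y \<in> A" for y
    using that T(2) unfolding AT by (auto simp: A3_def chart_dom_def)
  have F: "F1 y \<in> A2 \<and> F3 y = F2 (F1 y)" if "y \<in> A" for y
  proof -
    obtain r where r: "y = \<phi> r" "r \<in> U" "f r \<in> V" "g (f r) \<in> W" using A_cases[OF \<open>y \<in> A\<close>] by blast
    then show ?thesis
      by (auto simp: F1_def F2_def F3_def A2_def chart_dom_def f.chart_rep_eq[OF U V] g.chart_rep_eq[OF V W] gf.chart_rep_eq[OF U W])
  qed
  have x: "\<phi> q \<in> A" "\<phi> q \<in> A1" "\<phi> q \<in> A3" "\<phi> q \<in> T" using q T(2) by (auto simp: A_def A1_def A3_def chart_dom_def)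
  have vT: "v \<in> prism_tangents n m" using v by (simp add: f.X.prism_tangents)
  have s1: "smooth_at ?N A1 (\<lambda>y. F1 y j) (\<phi> q)" for j
    unfolding A1_def F1_def by (rule smooth_on_setD[OF f.chart_rep_smooth[OF U V]]) (use x in \<open>simp add: A1_def\<close>)
  have s1A: "smooth_at ?N A (\<lambda>y. F1 y j) (\<phi> q)" for j
    by (rule smooth_at_subset[OF s1]) (simp add: A_def)
  have F1q: "F1 (\<phi> q) = \<psi> (f q)" using q by (simp add: F1_def f.chart_rep_eq[OF U V])
  have s2: "smooth_at ?M A2 (\<lambda>y. F2 y j) (F1 (\<phi> q))" for j
    unfolding A2_def F2_def
    by (rule smooth_on_setD[OF g.chart_rep_smooth[OF V W]]) (use F[OF x(1)] in \<open>simp add: A2_def\<close>)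
  have s3: "smooth_at ?N A3 (\<lambda>y. F3 y j) (\<phi> q)" for j
    unfolding A3_def F3_def by (rule smooth_on_setD[OF gf.chart_rep_smooth[OF U W]]) (use x in \<open>simp add: A3_def\<close>)
  have s23: "smooth_at ?N A (\<lambda>y. F2 (F1 y) j) (\<phi> q)" for j
    by (rule smooth_at_local[OF s3 open_UNIV]) (use F in \<open>auto simp: A_def\<close>)
  have FA: "F1 ` A \<subseteq> A2" using F by auto
  show ?thesis
    unfolding A1_def[symmetric] A2_def[symmetric] A3_def[symmetric] F1_def[symmetric] F2_def[symmetric] F3_def[symmetric]
  proof
    fix j
    have t1: "tangent_map ?N A F1 (\<phi> q) v = tangent_map ?N A1 F1 (\<phi> q) v"
      unfolding tangent_map_def
      by (rule ext, rule deriv_on_cong[OF o f.X.prism_dim x(1) vT o1 x(2) open_UNIV]) (use s1 in \<open>auto simp: A_def\<close>)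
    have "tangent_map ?N A3 F3 (\<phi> q) v j = deriv_on ?N A (\<lambda>y. F2 (F1 y) j) (\<phi> q) v"
      unfolding tangent_map_def
      by (rule deriv_on_cong[OF o3 f.X.prism_dim x(3) vT o x(1) T(1) x(4)]) (use F s23 in \<open>auto simp: AT\<close>)
    also have "\<dots> = deriv_on ?M A2 (\<lambda>y. F2 y j) (F1 (\<phi> q)) (tangent_map ?N A F1 (\<phi> q) v)"
      by (rule deriv_on_compose(1)[OF o f.X.prism_dim o2 f.Y.prism_dim FA x(1) vT s1A s2])
    finally show "tangent_map ?N A3 F3 (\<phi> q) v j = tangent_map ?M A2 F2 (\<psi> (f q)) (tangent_map ?N A1 F1 (\<phi> q) v) j"
      unfolding t1 F1q by (simp add: tangent_map_def[of ?M])
  qed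
qed

lemma pullback_outside: "\<not> form_arg X c x vs \<Longrightarrow> pullback X Y f \<omega> c x vs = 0"
  by (simp add: pullback_def)

text \<open>Both sides evaluate \<open>\<omega>\<close> in the chart selected at the point
  \<open>g (f q)\<close>, so only the tangent vectors have to be compared, by the chain
  rule.\<close>

lemma pullback_compose:
  assumes f: "prism_map X n m Y n' m' f" and g: "prism_map Y n' m' Z n'' m'' g"
  shows "pullback X Y f (pullback Y Z g \<omega>) = pullback X Z (g \<circ> f) \<omega>"
proof (intro ext)
  interpret f: prism_map X n m Y n' m' f by fact
  interpret g: prism_map Y n' m' Z n'' m'' g by fact
  interpret gf: prism_map X n m Z n'' m'' "g \<circ> f"
    by (unfold_locales, rule smooth_map_compose[OF f.X.charted_space_axioms f.Y.charted_space_axioms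
          g.Y.charted_space_axioms f.smooth g.smooth])
  fix c x vs
  show "pullback X Y f (pullback Y Z g \<omega>) c x vs = pullback X Z (g \<circ> f) \<omega> c x vs"
  proof (cases "form_arg X c x vs")
    case True
    obtain U \<phi> where c: "c = (U, \<phi>)" by (cases c)
    obtain q where q: "(U, \<phi>) \<in> atlas X" "q \<in> U" "x = \<phi> q" and vs: "set vs \<subseteq> tangents X"
      using True by (auto simp: form_arg_def c)
    obtain V \<psi> where tV: "target_chart Y (f q) = (V, \<psi>)" by fastforce
    obtain W \<kappa> where tW: "target_chart Z (g (f q)) = (W, \<kappa>)" by fastforce
    note V = f.Y.target_chart[OF f.f_in_chart[OF q(1,2)] tV]
    note W = g.Y.target_chart[OF g.f_in_chart[OF V] tW]
    let ?T1 = "tangent_map (ambient_dim X) (chart_dom U \<phi> V f) (chart_rep U \<phi> \<psi> f) (\<phi> q)"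
    have "\<phi> q \<in> chart_dom U \<phi> V f" using q V by (auto simp: chart_dom_def)
    then have T1: "set (map ?T1 vs) \<subseteq> tangents Y" using f.chart_rep_tangent[OF q(1) V(1)] vs by auto
    have "pullback X Y f (pullback Y Z g \<omega>) c x vs = \<omega> (W, \<kappa>) (\<kappa> (g (f q)))
      (map (tangent_map (ambient_dim Y) (chart_dom V \<psi> W g) (chart_rep V \<psi> \<kappa> g) (\<psi> (f q))) (map ?T1 vs))"
      unfolding c q(3) f.pullback_target_chart[OF q(1,2) vs tV]
      by (rule g.pullback_target_chart[OF V T1 tW])
    also have "map (tangent_map (ambient_dim Y) (chart_dom V \<psi> W g) (chart_rep V \<psi> \<kappa> g) (\<psi> (f q))) (map ?T1 vs) =
        map (tangent_map (ambient_dim X) (chart_dom U \<phi> W (g \<circ> f)) (chart_rep U \<phi> \<kappa> (g \<circ> f)) (\<phi> q)) vs"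
      using prism_map_compose_tangent[OF f g q(1) V(1) W(1) q(2) V(2) W(2)] vs by auto
    also have "\<omega> (W, \<kappa>) (\<kappa> (g (f q))) \<dots> = pullback X Z (g \<circ> f) \<omega> c x vs"
      unfolding c q(3) using gf.pullback_target_chart[OF q(1,2) vs] tW by simp
    finally show ?thesis .
  qed (simp add: pullback_outside)
qed

text \<open>Used because \<open>simplex_map\<close> and \<open>singular_face\<close> are restricted
  to the standard simplex and agree with composites of maps only there.\<close>

lemma pullback_cong:
  assumes "prism_space X n m" "\<And>p. p \<in> topspace (space_top X) \<Longrightarrow> f p = f' p"
  shows "pullback X Y f = pullback X Y f'"
proof (intro ext)
  interpret prism_space X n m by fact
  fix \<omega> c x vs
  show "pullback X Y f \<omega> c x vs = pullback X Y f' \<omega> c x vs"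
  proof (cases "form_arg X c x vs")
    case True
    obtain U \<phi> where c: "c = (U, \<phi>)" by (cases c)
    have U: "(U, \<phi>) \<in> atlas X" "x \<in> \<phi> ` U" using True by (auto simp: form_arg_def c)
    have eq: "f q = f' q" if "q \<in> U" for q using assms(2) chart_subset[OF U(1)] that by blast
    have 1: "f (inv_into U \<phi> x) = f' (inv_into U \<phi> x)" using U(2) by (intro eq inv_into_into)
    have 2: "{q \<in> U. f q \<in> V} = {q \<in> U. f' q \<in> V}" for V using eq by auto
    have A: "prism_open n m (\<phi> ` U)" by (rule chart_prism_open[OF U(1)])
    have 3: "deriv_on N (\<phi> ` {q \<in> U. f' q \<in> V}) (\<lambda>y. \<psi> (f (inv_into U \<phi> y)) j) x v =
        deriv_on N (\<phi> ` {q \<in> U. f' q \<in> V}) (\<lambda>y. \<psi> (f' (inv_into U \<phi> y)) j) x v" for N V and \<psi> :: "'b \<Rightarrow> nat \<Rightarrow> real" and j v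
    proof -
      have "f (inv_into U \<phi> y) = f' (inv_into U \<phi> y)" if "y \<in> \<phi> ` {q \<in> U. f' q \<in> V}" for y
        using that by (intro eq inv_into_into) auto
      then show ?thesis unfolding deriv_on_def by (intro arg_cong[where f = The] ext) auto
    qed
    show ?thesis using True
      unfolding pullback_def c Let_def tangent_map_def case_prod_unfold by (simp add: 1 2 3)
  qed (simp add: pullback_outside)
qed

lemma forms_outside: "\<omega> \<in> forms X k \<Longrightarrow> \<not> (form_arg X c x vs \<and> int (length vs) = k) \<Longrightarrow> \<omega> c x vs = 0"
  unfolding forms_def mem_Collect_eq by (drule conjunct1) blast

lemma forms_multilinear:
  "\<omega> \<in> forms X k \<Longrightarrow> (U, \<phi>) \<in> atlas X \<Longrightarrow> x \<in> \<phi> ` U \<Longrightarrow> alternating_multilinear (tangents X) (\<omega> (U, \<phi>) x)"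
  unfolding forms_def by blast

lemma forms_smooth:
  "\<omega> \<in> forms X k \<Longrightarrow> (U, \<phi>) \<in> atlas X \<Longrightarrow> set vs \<subseteq> tangents X \<Longrightarrow>
    smooth_on_set (ambient_dim X) (\<phi> ` U) (\<lambda>x. \<omega> (U, \<phi>) x vs)"
  unfolding forms_def by blast

lemma forms_transition:
  assumes "\<omega> \<in> forms X k" "(U, \<phi>) \<in> atlas X" "(V, \<psi>) \<in> atlas X" "p \<in> U" "p \<in> V" "set vs \<subseteq> tangents X"
  shows "\<omega> (U, \<phi>) (\<phi> p) vs = \<omega> (V, \<psi>) (\<psi> p)
    (map (tangent_map (ambient_dim X) (chart_dom U \<phi> V id) (chart_rep U \<phi> \<psi> id) (\<phi> p)) vs)"
proof -
  have "chart_dom U \<phi> V id = \<phi> ` (U \<inter> V)" "chart_rep U \<phi> \<psi> id = (\<lambda>x. \<psi> (inv_into U \<phi> x))"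
    by (auto simp: chart_dom_def chart_rep_def)
  moreover have "\<forall>(U, \<phi>)\<in>atlas X. \<forall>(V, \<psi>)\<in>atlas X. \<forall>p\<in>U \<inter> V. \<forall>vs. set vs \<subseteq> tangents X \<longrightarrow>
      \<omega> (U, \<phi>) (\<phi> p) vs = \<omega> (V, \<psi>) (\<psi> p)
        (map (tangent_map (ambient_dim X) (\<phi> ` (U \<inter> V)) (\<lambda>x. \<psi> (inv_into U \<phi> x)) (\<phi> p)) vs)"
    using assms(1) unfolding forms_def by simp
  from bspec[OF this assms(2), unfolded prod.case, THEN bspec, OF assms(3), unfolded prod.case]
  have "\<omega> (U, \<phi>) (\<phi> p) vs = \<omega> (V, \<psi>) (\<psi> p)
        (map (tangent_map (ambient_dim X) (\<phi> ` (U \<inter> V)) (\<lambda>x. \<psi> (inv_into U \<phi> x)) (\<phi> p)) vs)"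
    using assms(4-6) by blast
  ultimately show ?thesis by simp
qed

section \<open>Coordinate form of the pullback and its compatibility with
  \<open>ext_deriv\<close>\<close>

context prism_map
begin

text \<open>The transition law of forms is invariance under the identity map read in two charts of
  the target. Composing with it by the chain rule replaces the selected chart by an arbitrary
  one.\<close>

lemma pullback_chart:
  assumes \<omega>: "\<omega> \<in> forms Y k" and U: "(U, \<phi>) \<in> atlas X" "q \<in> U" and V: "(V, \<psi>) \<in> atlas Y" "f q \<in> V"
    and vs: "set vs \<subseteq> tangents X"
  shows "pullback X Y f \<omega> (U, \<phi>) (\<phi> q) vs = \<omega> (V, \<psi>) (\<psi> (f q))
    (map (tangent_map (ambient_dim X) (chart_dom U \<phi> V f) (chart_rep U \<phi> \<psi> f) (\<phi> q)) vs)"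
proof -
  obtain V0 \<psi>0 where t: "target_chart Y (f q) = (V0, \<psi>0)" by fastforce
  note V0 = Y.target_chart[OF f_in_chart[OF U] t]
  interpret id: prism_map Y n' m' Y n' m' id
    by (unfold_locales, rule smooth_map_id[OF Y.charted_space_axioms])
  let ?T = "tangent_map (ambient_dim X) (chart_dom U \<phi> V0 f) (chart_rep U \<phi> \<psi>0 f) (\<phi> q)"
  have "\<phi> q \<in> chart_dom U \<phi> V0 f" using U V0 by (auto simp: chart_dom_def)
  then have T: "set (map ?T vs) \<subseteq> tangents Y" using chart_rep_tangent[OF U(1) V0(1)] vs by auto
  have "pullback X Y f \<omega> (U, \<phi>) (\<phi> q) vs = \<omega> (V, \<psi>) (\<psi> (f q))
    (map (tangent_map (ambient_dim Y) (chart_dom V0 \<psi>0 V id) (chart_rep V0 \<psi>0 \<psi> id) (\<psi>0 (f q))) (map ?T vs))"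
    unfolding pullback_target_chart[OF U vs t] by (rule forms_transition[OF \<omega> V0(1) V(1) V0(2) V(2) T])
  also have "map (tangent_map (ambient_dim Y) (chart_dom V0 \<psi>0 V id) (chart_rep V0 \<psi>0 \<psi> id) (\<psi>0 (f q))) (map ?T vs) =
      map (tangent_map (ambient_dim X) (chart_dom U \<phi> V f) (chart_rep U \<phi> \<psi> f) (\<phi> q)) vs"
    using prism_map_compose_tangent[OF prism_map_axioms id.prism_map_axioms U(1) V0(1) V(1) U(2) V0(2)] V(2) vs
    by auto
  finally show ?thesis .
qed

context
  fixes \<omega> k U \<phi>
  assumes \<omega>: "\<omega> \<in> forms Y k" and U: "(U, \<phi>) \<in> atlas X"
begin

lemma pullback_multilinear:
  assumes "x \<in> \<phi> ` U"
  shows "alternating_multilinear (tangents X) (pullback X Y f \<omega> (U, \<phi>) x)"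
proof -
  obtain q where q: "q \<in> U" "x = \<phi> q" using assms by auto
  obtain V \<psi> where V: "(V, \<psi>) \<in> atlas Y" "f q \<in> V" using Y.chart_cover[OF f_in_chart[OF U q(1)]] by blast
  let ?A = "chart_dom U \<phi> V f" and ?F = "chart_rep U \<phi> \<psi> f"
  let ?T = "tangent_map (ambient_dim X) ?A ?F x"
  have x: "x \<in> ?A" using q V by (auto simp: chart_dom_def)
  have T: "?T v \<in> tangents Y" if "v \<in> tangents X" for v by (rule chart_rep_tangent[OF U V(1) x that])
  have eq: "pullback X Y f \<omega> (U, \<phi>) x vs = \<omega> (V, \<psi>) (\<psi> (f q)) (map ?T vs)" if "set vs \<subseteq> tangents X" for vs
    using pullback_chart[OF \<omega> U q(1) V that] q(2) by simp
  have \<alpha>: "alternating_multilinear (tangents Y) (\<omega> (V, \<psi>) (\<psi> (f q)))"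
    by (rule forms_multilinear[OF \<omega> V(1)]) (use V in auto)
  have lin: "?T (\<lambda>l. a * u l + b * w l) = (\<lambda>l. a * ?T u l + b * ?T w l)" if "u \<in> tangents X" "w \<in> tangents X" for a b u w
    using that unfolding X.prism_tangents tangent_map_def
    by (intro ext) (simp add: deriv_on_linear[OF chart_dom_prism_open[OF U V(1)] X.prism_dim x _ _ smooth_on_setD[OF chart_rep_smooth[OF U V(1)] x]])
  show ?thesis unfolding alternating_multilinear_def
  proof (intro conjI allI impI)
    fix vs i u w a b
    assume vs: "set vs \<subseteq> tangents X" "i < length vs" "u \<in> tangents X" "w \<in> tangents X"
    have c: "(\<lambda>l. a * u l + b * w l) \<in> tangents X"
      using vs(3,4) by (simp add: X.prism_tangents prism_tangents_comb)
    have sub: "set (vs[i := z]) \<subseteq> tangents X" if "z \<in> tangents X" for z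
      using set_update_subset_insert[of vs i z] vs(1) that by blast
    have mT: "set (map ?T vs) \<subseteq> tangents Y" using vs(1) T by auto
    show "pullback X Y f \<omega> (U, \<phi>) x (vs[i := \<lambda>l. a * u l + b * w l]) =
      complex_of_real a * pullback X Y f \<omega> (U, \<phi>) x (vs[i := u]) + complex_of_real b * pullback X Y f \<omega> (U, \<phi>) x (vs[i := w])"
      unfolding eq[OF sub[OF c]] eq[OF sub[OF vs(3)]] eq[OF sub[OF vs(4)]] map_update lin[OF vs(3,4)]
      by (rule alternating_multilinear_comb[OF \<alpha> mT _ T[OF vs(3)] T[OF vs(4)]]) (use vs(2) in simp)
  next
    fix vs i j assume vs: "set vs \<subseteq> tangents X" "i < j" "j < length vs" "vs ! i = vs ! j"
    show "pullback X Y f \<omega> (U, \<phi>) x vs = 0"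
      unfolding eq[OF vs(1)] by (rule alternating_multilinear_repeat[OF \<alpha>, of _ i j]) (use vs T in auto)
  qed
qed

text \<open>In coordinates the pullback is \<open>\<omega>\<close> at \<open>F y\<close>, evaluated
  on arguments that vary with \<open>y\<close>. The Leibniz rule separates the derivative of
  \<open>\<omega>\<close>, which leads to the pullback of the exterior derivative, from terms with
  second derivatives of \<open>F\<close>.\<close>

lemma pullback_leibniz:
  assumes V: "(V, \<psi>) \<in> atlas Y" and vs: "set vs \<subseteq> tangents X"
  defines "A \<equiv> chart_dom U \<phi> V f" and "F \<equiv> chart_rep U \<phi> \<psi> f" and "N \<equiv> ambient_dim X"
  shows "smooth_on_set N A (\<lambda>y. \<omega> (V, \<psi>) (F y) (map (tangent_map N A F y) vs))"
    and "x \<in> A \<Longrightarrow> v \<in> tangents X \<Longrightarrow> deriv_on N A (\<lambda>y. \<omega> (V, \<psi>) (F y) (map (tangent_map N A F y) vs)) x v =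
      deriv_on (ambient_dim Y) (\<psi> ` V) (\<lambda>z. \<omega> (V, \<psi>) z (map (tangent_map N A F x) vs)) (F x) (tangent_map N A F x v) +
      (\<Sum>j<length vs. \<omega> (V, \<psi>) (F x) ((map (tangent_map N A F x) vs)
         [j := tangent_map N A (\<lambda>y. tangent_map N A F y (vs ! j)) x v]))"
proof -
  have A: "prism_open n m A" and N: "N = Suc n + m"
    unfolding A_def N_def by (rule chart_dom_prism_open[OF U V], rule X.prism_dim)
  have F: "F ` A \<subseteq> \<psi> ` V" unfolding A_def F_def by (rule chart_rep_maps[OF U V])
  have sF: "smooth_on_set N A (\<lambda>y. F y j)" for j
    unfolding A_def F_def N_def by (rule chart_rep_smooth[OF U V])
  have B: "prism_open n' m' (\<psi> ` V)" by (rule Y.chart_prism_open[OF V])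
  define Ws where "Ws = map (\<lambda>v y. tangent_map N A F y v) vs"
  have mW: "map (\<lambda>W. W y) Ws = map (tangent_map N A F y) vs" for y by (simp add: Ws_def o_def)
  have T: "tangent_map N A F y v \<in> prism_tangents n' m'" if "y \<in> A" "v \<in> tangents X" for y v
    using chart_rep_tangent[OF U V that(1)[unfolded A_def] that(2)]
    by (simp add: A_def F_def N_def Y.prism_tangents)
  have sm: "smooth_on_set N A (\<lambda>y. \<omega> (V, \<psi>) (F y) ws)" if "set ws \<subseteq> prism_tangents n' m'" for ws
  proof (rule smooth_on_set_compose[OF F Y.chart_RN[OF V] _ sF])
    show "A \<subseteq> RN N" using prism_open_RN[OF A] N by simp
    show "smooth_on_set (ambient_dim Y) (\<psi> ` V) (\<lambda>z. \<omega> (V, \<psi>) z ws)"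
      using that by (intro forms_smooth[OF \<omega> V]) (simp add: Y.prism_tangents)
  qed
  have L: "smooth_on_set N A (\<lambda>y. \<omega> (V, \<psi>) (F y) (map (\<lambda>W. W y) Ws)) \<and>
    (\<forall>x\<in>A. \<forall>v\<in>prism_tangents n m. deriv_on N A (\<lambda>y. \<omega> (V, \<psi>) (F y) (map (\<lambda>W. W y) Ws)) x v =
      deriv_on N A (\<lambda>y. \<omega> (V, \<psi>) (F y) (map (\<lambda>W. W x) Ws)) x v +
      (\<Sum>j<length Ws. \<omega> (V, \<psi>) (F x) ((map (\<lambda>W. W x) Ws)[j := tangent_map N A (Ws ! j) x v])))"
  proof (rule leibniz[OF A N, where n' = n' and m' = m'])
    show "alternating_multilinear (prism_tangents n' m') (\<omega> (V, \<psi>) (F y))" if "y \<in> A" for y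
      using forms_multilinear[OF \<omega> V, of "F y"] F that by (auto simp: Y.prism_tangents)
    show "W y \<in> prism_tangents n' m'" if "W \<in> set Ws" "y \<in> A" for W y
      using that T vs by (auto simp: Ws_def)
    show "smooth_on_set N A (\<lambda>y. W y j)" if W: "W \<in> set Ws" for W j
    proof -
      obtain v where v: "v \<in> prism_tangents n m" "W = (\<lambda>y. tangent_map N A F y v)"
        using W vs by (auto simp: Ws_def X.prism_tangents)
      show ?thesis unfolding v(2) tangent_map_def smooth_on_set_iff
        by (intro ballI smooth_at_deriv_on[OF A N v(1)] smooth_on_setD[OF sF])
    qed
  qed (rule sm)
  show "smooth_on_set N A (\<lambda>y. \<omega> (V, \<psi>) (F y) (map (tangent_map N A F y) vs))"
    using conjunct1[OF L] by (simp add: mW)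
  assume x: "x \<in> A" and v: "v \<in> tangents X"
  have "deriv_on N A (\<lambda>y. \<omega> (V, \<psi>) (F y) (map (tangent_map N A F y) vs)) x v =
      deriv_on N A (\<lambda>y. \<omega> (V, \<psi>) (F y) (map (tangent_map N A F x) vs)) x v +
      (\<Sum>j<length Ws. \<omega> (V, \<psi>) (F x) ((map (tangent_map N A F x) vs)[j := tangent_map N A (Ws ! j) x v]))"
    using conjunct2[OF L] x v by (simp add: mW X.prism_tangents)
  also have "(\<Sum>j<length Ws. \<omega> (V, \<psi>) (F x) ((map (tangent_map N A F x) vs)[j := tangent_map N A (Ws ! j) x v])) =
      (\<Sum>j<length vs. \<omega> (V, \<psi>) (F x) ((map (tangent_map N A F x) vs)
         [j := tangent_map N A (\<lambda>y. tangent_map N A F y (vs ! j)) x v]))"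
    by (simp add: Ws_def)
  also have "deriv_on N A (\<lambda>y. \<omega> (V, \<psi>) (F y) (map (tangent_map N A F x) vs)) x v =
      deriv_on (ambient_dim Y) (\<psi> ` V) (\<lambda>z. \<omega> (V, \<psi>) z (map (tangent_map N A F x) vs)) (F x) (tangent_map N A F x v)"
  proof (rule deriv_on_compose(1)[OF A N B Y.prism_dim F x _ smooth_on_setD[OF sF x]])
    show "v \<in> prism_tangents n m" using v by (simp add: X.prism_tangents)
    have "set (map (tangent_map N A F x) vs) \<subseteq> tangents Y"
      using T[OF x] vs by (auto simp: Y.prism_tangents)
    from smooth_on_setD[OF forms_smooth[OF \<omega> V this]]
    show "smooth_at (ambient_dim Y) (\<psi> ` V) (\<lambda>z. \<omega> (V, \<psi>) z (map (tangent_map N A F x) vs)) (F x)"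
      using F x by auto
  qed
  finally show "deriv_on N A (\<lambda>y. \<omega> (V, \<psi>) (F y) (map (tangent_map N A F y) vs)) x v =
      deriv_on (ambient_dim Y) (\<psi> ` V) (\<lambda>z. \<omega> (V, \<psi>) z (map (tangent_map N A F x) vs)) (F x) (tangent_map N A F x v) +
      (\<Sum>j<length vs. \<omega> (V, \<psi>) (F x) ((map (tangent_map N A F x) vs)
         [j := tangent_map N A (\<lambda>y. tangent_map N A F y (vs ! j)) x v]))" .
qed

lemma pullback_chart_dom:
  assumes V: "(V, \<psi>) \<in> atlas Y" and vs: "set vs \<subseteq> tangents X" and y: "y \<in> chart_dom U \<phi> V f"
  shows "pullback X Y f \<omega> (U, \<phi>) y vs = \<omega> (V, \<psi>) (chart_rep U \<phi> \<psi> f y)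
    (map (tangent_map (ambient_dim X) (chart_dom U \<phi> V f) (chart_rep U \<phi> \<psi> f) y) vs)"
proof -
  obtain q where q: "q \<in> U" "f q \<in> V" "y = \<phi> q" using y by (auto simp: chart_dom_def)
  show ?thesis using pullback_chart[OF \<omega> U q(1) V q(2) vs] by (simp add: q(3) chart_rep_eq[OF U V q(1)])
qed

lemma pullback_smooth:
  assumes vs: "set vs \<subseteq> tangents X"
  shows "smooth_on_set (ambient_dim X) (\<phi> ` U) (\<lambda>y. pullback X Y f \<omega> (U, \<phi>) y vs)"
  unfolding smooth_on_set_iff
proof clarify
  fix q assume q: "q \<in> U"
  obtain V \<psi> where V: "(V, \<psi>) \<in> atlas Y" "f q \<in> V" using Y.chart_cover[OF f_in_chart[OF U q]] by blast
  obtain T where T: "open T" "\<forall>q\<in>U. \<phi> q \<in> T \<longleftrightarrow> f q \<in> V" using chart_dom_nhd[OF U V(1)] by blast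
  show "smooth_at (ambient_dim X) (\<phi> ` U) (\<lambda>y. pullback X Y f \<omega> (U, \<phi>) y vs) (\<phi> q)"
  proof (rule smooth_at_local[OF smooth_on_setD[OF pullback_leibniz(1)[OF V(1) vs]] T(1)])
    show "\<phi> q \<in> chart_dom U \<phi> V f" "\<phi> q \<in> T" using q V T(2) by (auto simp: chart_dom_def)
    fix y assume "y \<in> \<phi> ` U" "y \<in> T"
    then have y: "y \<in> chart_dom U \<phi> V f" using T(2) by (auto simp: chart_dom_def)
    then show "y \<in> chart_dom U \<phi> V f \<and> pullback X Y f \<omega> (U, \<phi>) y vs = \<omega> (V, \<psi>) (chart_rep U \<phi> \<psi> f y)
        (map (tangent_map (ambient_dim X) (chart_dom U \<phi> V f) (chart_rep U \<phi> \<psi> f) y) vs)"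
      using pullback_chart_dom[OF V(1) vs y] by simp
  qed
qed

text \<open>Naturality of the exterior derivative. By \<open>pullback_leibniz\<close> the two sides
  differ by second derivatives of \<open>F\<close> inserted into one slot, and these cancel by their
  symmetry through \<open>alternating_symmetric_sum_zero\<close>.\<close>

lemma pullback_ext_deriv:
  assumes vs: "set vs \<subseteq> tangents X" and x: "x \<in> \<phi> ` U"
  shows "pullback X Y f (ext_deriv Y \<omega>) (U, \<phi>) x vs = (\<Sum>i<length vs. (- 1) ^ i *
    deriv_on (ambient_dim X) (\<phi> ` U) (\<lambda>y. pullback X Y f \<omega> (U, \<phi>) y (remove_at i vs)) x (vs ! i))"
proof -
  obtain q where q: "q \<in> U" "x = \<phi> q" using x by auto
  obtain V \<psi> where t: "target_chart Y (f q) = (V, \<psi>)" by fastforce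
  note V = Y.target_chart[OF f_in_chart[OF U q(1)] t]
  define A where "A = chart_dom U \<phi> V f"
  define F where "F = chart_rep U \<phi> \<psi> f"
  define N where "N = ambient_dim X"
  define us where "us = map (tangent_map N A F x) vs"
  define \<alpha> where "\<alpha> = \<omega> (V, \<psi>) (F x)"
  \<comment> \<open>The second derivative of the coordinate map in the directions
    \<open>vs ! i\<close> and \<open>vs ! j\<close>.\<close>
  define s where "s i j = tangent_map N A (\<lambda>y. tangent_map N A F y (vs ! j)) x (vs ! i)" for i j
  obtain T where T: "open T" "\<forall>q\<in>U. \<phi> q \<in> T \<longleftrightarrow> f q \<in> V" using chart_dom_nhd[OF U V(1)] by blast
  have A: "prism_open n m A" and N: "N = Suc n + m"
    unfolding A_def N_def by (rule chart_dom_prism_open[OF U V(1)], rule X.prism_dim)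
  have xA: "x \<in> A" "x \<in> T" using q V T(2) by (auto simp: chart_dom_def A_def)
  have Fx: "F x = \<psi> (f q)" using q by (simp add: F_def chart_rep_eq[OF U V(1)])
  have \<alpha>: "alternating_multilinear (tangents Y) \<alpha>"
    unfolding \<alpha>_def Fx by (rule forms_multilinear[OF \<omega> V(1)]) (use V in auto)
  have sF: "smooth_on_set N A (\<lambda>y. F y j)" for j
    unfolding A_def F_def N_def by (rule chart_rep_smooth[OF U V(1)])
  have TF: "tangent_map N A F y v \<in> tangents Y" if "y \<in> A" "v \<in> tangents X" for y v
    using chart_rep_tangent[OF U V(1) that(1)[unfolded A_def] that(2)] by (simp add: A_def F_def N_def)
  have us: "set us \<subseteq> tangents Y" using TF[OF xA(1)] vs by (auto simp: us_def)
  have len: "length us = length vs" by (simp add: us_def)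
  have vi: "vs ! i \<in> tangents X" if "i < length vs" for i using vs nth_mem[OF that] by blast
  have s: "s i j \<in> tangents Y \<and> s i j = s j i" if "i < length us" "j < length us" for i j
  proof
    have vij: "vs ! i \<in> prism_tangents n m" "vs ! j \<in> prism_tangents n m"
      using vi that by (auto simp: len X.prism_tangents)
    have smT: "smooth_on_set N A (\<lambda>y. tangent_map N A F y (vs ! j) l)" for l
      unfolding tangent_map_def smooth_on_set_iff
      by (intro ballI smooth_at_deriv_on[OF A N vij(2)] smooth_on_setD[OF sF])
    show "s i j \<in> tangents Y" unfolding s_def Y.prism_tangents
      by (rule tangent_map_into_tangents[OF A N _ smT xA(1) vij(1)])
        (use TF vi that in \<open>auto simp: len Y.prism_tangents\<close>)
    show "s i j = s j i" unfolding s_def tangent_map_def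
      by (rule ext) (rule deriv_on_symmetric[OF A N xA(1) vij(2,1) smooth_on_setD[OF sF xA(1)]])
  qed
  have D: "deriv_on N (\<phi> ` U) (\<lambda>y. pullback X Y f \<omega> (U, \<phi>) y (remove_at i vs)) x (vs ! i) =
      deriv_on (ambient_dim Y) (\<psi> ` V) (\<lambda>z. \<omega> (V, \<psi>) z (remove_at i us)) (F x) (us ! i) +
      (\<Sum>j<length vs - 1. \<alpha> ((remove_at i us)[j := s i (if j < i then j else Suc j)]))" if i: "i < length vs" for i
  proof -
    have sub: "set (remove_at i vs) \<subseteq> tangents X" using set_remove_at[of i vs] vs by blast
    note pl = pullback_leibniz[OF V(1) sub, folded A_def F_def N_def]
    have vij: "vs ! i \<in> prism_tangents n m" using vi[OF i] by (simp add: X.prism_tangents)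
    have "deriv_on N (\<phi> ` U) (\<lambda>y. pullback X Y f \<omega> (U, \<phi>) y (remove_at i vs)) x (vs ! i) =
        deriv_on N A (\<lambda>y. \<omega> (V, \<psi>) (F y) (map (tangent_map N A F y) (remove_at i vs))) x (vs ! i)"
    proof (rule deriv_on_cong[OF X.chart_prism_open[OF U] N x vij A xA(1) T(1) xA(2) _ _ smooth_on_setD[OF pl(1) xA(1)]])
      fix y assume "y \<in> \<phi> ` U" "y \<in> T"
      then show y: "y \<in> A" using T(2) by (auto simp: chart_dom_def A_def)
      show "pullback X Y f \<omega> (U, \<phi>) y (remove_at i vs) = \<omega> (V, \<psi>) (F y) (map (tangent_map N A F y) (remove_at i vs))"
        unfolding A_def F_def N_def by (rule pullback_chart_dom[OF V(1) sub y[unfolded A_def]])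
    qed
    also have "\<dots> = deriv_on (ambient_dim Y) (\<psi> ` V) (\<lambda>z. \<omega> (V, \<psi>) z (remove_at i us)) (F x) (us ! i) +
      (\<Sum>j<length vs - 1. \<alpha> ((remove_at i us)[j := tangent_map N A (\<lambda>y. tangent_map N A F y (remove_at i vs ! j)) x (vs ! i)]))"
      using pl(2)[OF xA(1) vi[OF i]] i by (simp add: map_remove_at us_def \<alpha>_def)
    also have "(\<Sum>j<length vs - 1. \<alpha> ((remove_at i us)[j := tangent_map N A (\<lambda>y. tangent_map N A F y (remove_at i vs ! j)) x (vs ! i)])) =
      (\<Sum>j<length vs - 1. \<alpha> ((remove_at i us)[j := s i (if j < i then j else Suc j)]))"
      by (intro sum.cong refl) (use i in \<open>simp add: s_def nth_remove_at\<close>)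
    finally show ?thesis .
  qed
  have "(\<Sum>i<length vs. (- 1) ^ i *
      deriv_on N (\<phi> ` U) (\<lambda>y. pullback X Y f \<omega> (U, \<phi>) y (remove_at i vs)) x (vs ! i)) =
    (\<Sum>i<length vs. (- 1) ^ i * deriv_on (ambient_dim Y) (\<psi> ` V) (\<lambda>z. \<omega> (V, \<psi>) z (remove_at i us)) (F x) (us ! i)) +
    (\<Sum>i<length us. (- 1) ^ i * (\<Sum>j<length us - 1. \<alpha> ((remove_at i us)[j := s i (if j < i then j else Suc j)])))"
    by (simp add: D len distrib_left sum.distrib)
  also have "(\<Sum>i<length us. (- 1) ^ i * (\<Sum>j<length us - 1. \<alpha> ((remove_at i us)[j := s i (if j < i then j else Suc j)]))) = 0"
    by (rule alternating_symmetric_sum_zero[OF \<alpha> _ us s]) (simp add: Y.prism_tangents prism_tangents_add)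
  also have "(\<Sum>i<length vs. (- 1) ^ i * deriv_on (ambient_dim Y) (\<psi> ` V) (\<lambda>z. \<omega> (V, \<psi>) z (remove_at i us)) (F x) (us ! i)) + 0 =
      ext_deriv Y \<omega> (V, \<psi>) (F x) us"
    using us V by (simp add: ext_deriv_def form_arg_def Fx remove_at_def us_def)
  also have "\<dots> = pullback X Y f (ext_deriv Y \<omega>) (U, \<phi>) x vs"
    unfolding q(2) pullback_target_chart[OF U q(1) vs t] using Fx by (simp add: us_def A_def F_def N_def q(2))
  finally show ?thesis by (simp add: N_def)
qed

end

end

lemma ext_deriv_add:
  assumes X: "prism_space X n m" and \<omega>: "\<omega> \<in> forms X k" "\<omega>' \<in> forms X k"
  shows "ext_deriv X (\<omega> + \<omega>') = ext_deriv X \<omega> + ext_deriv X \<omega>'"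
proof (intro ext)
  interpret prism_space X n m by fact
  fix c x vs
  show "ext_deriv X (\<omega> + \<omega>') c x vs = (ext_deriv X \<omega> + ext_deriv X \<omega>') c x vs"
  proof (cases "form_arg X c x vs")
    case True
    obtain U \<phi> where c: "c = (U, \<phi>)" by (cases c)
    have U: "(U, \<phi>) \<in> atlas X" "x \<in> \<phi> ` U" "set vs \<subseteq> tangents X" using True by (auto simp: form_arg_def c)
    have "deriv_on (ambient_dim X) (\<phi> ` U) (\<lambda>y. \<omega> (U, \<phi>) y (remove_at i vs) + \<omega>' (U, \<phi>) y (remove_at i vs)) x (vs ! i) =
       deriv_on (ambient_dim X) (\<phi> ` U) (\<lambda>y. \<omega> (U, \<phi>) y (remove_at i vs)) x (vs ! i) +
       deriv_on (ambient_dim X) (\<phi> ` U) (\<lambda>y. \<omega>' (U, \<phi>) y (remove_at i vs)) x (vs ! i)" if i: "i < length vs" for i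
    proof (rule deriv_on_add[OF chart_prism_open[OF U(1)] prism_dim U(2)])
      show "vs ! i \<in> prism_tangents n m" using U(3) nth_mem[OF i] by (auto simp: prism_tangents)
      have "set (remove_at i vs) \<subseteq> tangents X" using set_remove_at[of i vs] U(3) by blast
      then show "smooth_at (ambient_dim X) (\<phi> ` U) (\<lambda>y. \<omega> (U, \<phi>) y (remove_at i vs)) x"
        "smooth_at (ambient_dim X) (\<phi> ` U) (\<lambda>y. \<omega>' (U, \<phi>) y (remove_at i vs)) x"
        using smooth_on_setD[OF forms_smooth[OF _ U(1)] U(2)] \<omega> by auto
    qed
    then show ?thesis using True
      by (simp add: ext_deriv_def c remove_at_def[symmetric] distrib_left sum.distrib)
  qed (simp add: ext_deriv_def)
qed

lemma ext_deriv_zero: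
  assumes "prism_space X n m"
  shows "ext_deriv X 0 = 0"
proof (intro ext)
  interpret prism_space X n m by fact
  fix c x vs
  show "ext_deriv X 0 c x vs = 0 c x vs"
  proof (cases "form_arg X c x vs")
    case True
    obtain U \<phi> where c: "c = (U, \<phi>)" by (cases c)
    have U: "(U, \<phi>) \<in> atlas X" "x \<in> \<phi> ` U" "set vs \<subseteq> tangents X" using True by (auto simp: form_arg_def c)
    have "deriv_on (ambient_dim X) (\<phi> ` U) (\<lambda>y. 0 :: complex) x (vs ! i) = 0" if i: "i < length vs" for i
    proof (rule deriv_on_const[OF chart_prism_open[OF U(1)] prism_dim U(2)])
      show "vs ! i \<in> prism_tangents n m" using U(3) nth_mem[OF i] by (auto simp: prism_tangents)
    qed
    then show ?thesis by (simp add: ext_deriv_def c)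
  qed (simp add: ext_deriv_def)
qed

section \<open>Stokes' theorem on the standard simplex\<close>

text \<open>Expand every difference w - a. A term in which \<open>a\<close> occurs twice vanishes,
  so only the terms with at most one \<open>a\<close> survive.\<close>

lemma alternating_multilinear_translate:
  assumes \<alpha>: "alternating_multilinear T \<alpha>"
    and T: "\<And>u w a b. u \<in> T \<Longrightarrow> w \<in> T \<Longrightarrow> (\<lambda>l. a * u l + b * w l) \<in> T"
    and "set us \<subseteq> T" "set ws \<subseteq> T" "a \<in> T"
  shows "\<alpha> (us @ map (\<lambda>w l. w l - a l) ws) = \<alpha> (us @ ws) - (\<Sum>j<length ws. \<alpha> (us @ ws[j := a]))"
  using assms(3,4)
proof (induction ws arbitrary: us)
  case (Cons w ws)
  let ?m = "map (\<lambda>w l. w l - a l) ws"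
  have wT: "w \<in> T" "set ws \<subseteq> T" using Cons.prems by auto
  have d: "(\<lambda>l. u l - a l) \<in> T" if "u \<in> T" for u using T[OF that \<open>a \<in> T\<close>, of 1 "-1"] by simp
  have mT: "set ?m \<subseteq> T" using wT d by auto
  have "\<alpha> (us @ (\<lambda>l. w l - a l) # ?m) = \<alpha> (us @ w # ?m) - \<alpha> (us @ a # ?m)"
    using alternating_multilinear_comb[OF \<alpha>, of "us @ w # ?m" "length us" w a 1 "-1"]
      Cons.prems(1) wT mT \<open>a \<in> T\<close> by (simp add: list_update_append)
  also have "\<alpha> (us @ w # ?m) = \<alpha> (us @ w # ws) - (\<Sum>j<length ws. \<alpha> (us @ w # ws[j := a]))"
    using Cons.IH[of "us @ [w]"] Cons.prems by simp
  also have "\<alpha> (us @ a # ?m) = \<alpha> (us @ a # ws) - (\<Sum>j<length ws. \<alpha> (us @ a # ws[j := a]))"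
    using Cons.IH[of "us @ [a]"] Cons.prems \<open>a \<in> T\<close> by simp
  also have "(\<Sum>j<length ws. \<alpha> (us @ a # ws[j := a])) = 0"
  proof (intro sum.neutral ballI)
    fix j assume j: "j \<in> {..<length ws}"
    have "set (us @ a # ws[j := a]) \<subseteq> T"
      using set_update_subset_insert[of ws j a] Cons.prems(1) wT(2) \<open>a \<in> T\<close> by auto
    then show "\<alpha> (us @ a # ws[j := a]) = 0"
      by (rule alternating_multilinear_repeat[OF \<alpha>, of _ "length us" "length us + Suc j"])
        (use j in \<open>auto simp: nth_append\<close>)
  qed
  finally have "\<alpha> (us @ map (\<lambda>w l. w l - a l) (w # ws)) =
      \<alpha> (us @ w # ws) - (\<Sum>j<length ws. \<alpha> (us @ w # ws[j := a])) - \<alpha> (us @ a # ws)" by simp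
  then show ?case by (simp add: sum.lessThan_Suc_shift del: sum.lessThan_Suc)
qed simp

text \<open>Meant for the face opposite to vertex 0: its edges are differences of edges at vertex 0,
  with \<open>a\<close> the first of these. Moving \<open>a\<close> to the front in each term of
  \<open>alternating_multilinear_translate\<close> produces the alternating signs.\<close>

lemma alternating_multilinear_face0:
  assumes \<alpha>: "alternating_multilinear T \<alpha>"
    and T: "\<And>u w a b. u \<in> T \<Longrightarrow> w \<in> T \<Longrightarrow> (\<lambda>l. a * u l + b * w l) \<in> T"
    and ws: "set ws \<subseteq> T" "a \<in> T"
  shows "\<alpha> (map (\<lambda>w l. w l - a l) ws) = (\<Sum>i<Suc (length ws). (- 1) ^ i * \<alpha> (remove_at i (a # ws)))"
proof -
  have Ta: "(\<lambda>l. u l + w l) \<in> T" if "u \<in> T" "w \<in> T" for u w using T[OF that, of 1 1] by simp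
  have "(- 1) ^ Suc j * \<alpha> (remove_at (Suc j) (a # ws)) = - \<alpha> (ws[j := a])" if j: "j < length ws" for j
  proof -
    have sub: "set (take j ws) \<subseteq> T" "set (drop (Suc j) ws) \<subseteq> T"
      using ws(1) by (auto dest!: in_set_takeD in_set_dropD)
    have "\<alpha> (remove_at (Suc j) (a # ws)) = \<alpha> ([] @ a # take j ws @ drop (Suc j) ws)"
      by (simp add: remove_at_def)
    also have "\<dots> = (- 1) ^ length (take j ws) * \<alpha> ([] @ take j ws @ a # drop (Suc j) ws)"
      by (rule alternating_multilinear_move[OF \<alpha> Ta _ ws(2) sub]) simp_all
    also have "\<dots> = (- 1) ^ j * \<alpha> (ws[j := a])" using j by (simp add: upd_conv_take_nth_drop)
    finally show ?thesis by (simp add: mult.assoc[symmetric] flip: power_add)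
  qed
  then have "(\<Sum>i<Suc (length ws). (- 1) ^ i * \<alpha> (remove_at i (a # ws))) = \<alpha> ws - (\<Sum>j<length ws. \<alpha> (ws[j := a]))"
    by (simp add: sum.lessThan_Suc_shift remove_at_def[of 0] sum_negf del: sum.lessThan_Suc power_Suc)
  moreover have "\<alpha> ([] @ map (\<lambda>w l. w l - a l) ws) = \<alpha> ([] @ ws) - (\<Sum>j<length ws. \<alpha> ([] @ ws[j := a]))"
  proof (rule alternating_multilinear_translate[OF \<alpha>])
    show "(\<lambda>l. c * u l + d * w l) \<in> T" if "u \<in> T" "w \<in> T" for u w c d using that by (rule T)
  qed (use ws in simp_all)
  ultimately show ?thesis by (simp only: append_Nil)
qed

section \<open>Integration over the standard simplex\<close>

interpretation lborel_product: product_sigma_finite "\<lambda>_::nat. lborel :: real measure" ..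

text \<open>The integral occurring in \<open>integrate_form\<close>, for an integrand given as a
  function of barycentric coordinates.\<close>

definition simplex_integral :: "nat \<Rightarrow> ((nat \<Rightarrow> real) \<Rightarrow> complex) \<Rightarrow> complex" where
  "simplex_integral k g =
     (LINT x : {x. bary k x \<in> standard_simplex k} | PiM {1..k} (\<lambda>_. lborel). g (bary k x))"

lemma bary_in_simplex_iff:
  "bary k x \<in> standard_simplex k \<longleftrightarrow> (\<forall>j\<in>{1..k}. 0 \<le> x j) \<and> (\<Sum>j=1..k. x j) \<le> 1"
proof -
  have s: "(\<Sum>j\<le>k. bary k x j) = 1"
  proof -
    have "(\<Sum>j\<le>k. bary k x j) = bary k x 0 + (\<Sum>j=1..k. bary k x j)"
      by (simp add: atMost_atLeast0 sum.atLeast_Suc_atMost)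
    also have "(\<Sum>j=1..k. bary k x j) = (\<Sum>j=1..k. x j)" by (rule sum.cong) (auto simp: bary_def)
    finally show ?thesis by (simp add: bary_def)
  qed
  have r: "bary k x \<in> RN (Suc k)" by (auto simp: bary_def mem_RN)
  show ?thesis unfolding standard_simplex_eq_prism prism_def using s r
    by (auto simp: bary_def) 
qed

lemma bary_measurable: "bary k \<in> borel_measurable (PiM {1..k} (\<lambda>_. lborel))"
proof (rule measurable_coordinatewise_then_product)
  fix i
  consider "i = 0" | "1 \<le> i" "i \<le> k" | "i > k" by linarith
  then show "(\<lambda>x. bary k x i) \<in> borel_measurable (PiM {1..k} (\<lambda>_. lborel))"
    by cases (auto simp: bary_def)
qed

lemma compact_standard_simplex: "compact (standard_simplex k)"
  using compactin_standard_simplex[of k] by (simp add: euclidean_product_topology compactin_euclidean_iff)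

lemma standard_simplex_borel: "standard_simplex k \<in> sets borel"
  by (rule borel_closed) (rule compact_imp_closed[OF compact_standard_simplex])

lemma measurable_simplex_indicator:
  fixes f :: "(nat \<Rightarrow> real) \<Rightarrow> complex"
  assumes "continuous_on (standard_simplex k) f" "b \<in> borel_measurable M"
  shows "(\<lambda>x. indicator (standard_simplex k) (b x) *\<^sub>R f (b x)) \<in> borel_measurable M"
proof -
  have "(\<lambda>y. indicator (standard_simplex k) y *\<^sub>R f y) \<in> borel_measurable borel"
    by (rule borel_measurable_continuous_on_indicator[OF standard_simplex_borel assms(1)])
  from measurable_compose[OF assms(2) this] show ?thesis .
qed

text \<open>A continuous function on the compact simplex is bounded, and in the coordinates x_1,
  ..., x_k the simplex lies in the unit cube.\<close>

lemma simplex_integrable: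
  fixes g :: "(nat \<Rightarrow> real) \<Rightarrow> complex"
  assumes "continuous_on (standard_simplex k) g"
  shows "integrable (PiM {1..k} (\<lambda>_. lborel)) (\<lambda>x. indicator (standard_simplex k) (bary k x) *\<^sub>R g (bary k x))"
proof -
  let ?M = "PiM {1..k} (\<lambda>_. lborel :: real measure)"
  let ?B = "PiE {1..k} (\<lambda>_. {0..1 :: real})"
  have "compact (g ` standard_simplex k)"
    by (rule compact_continuous_image[OF assms compact_standard_simplex])
  from compact_imp_bounded[OF this] obtain C where "\<forall>z\<in>g ` standard_simplex k. norm z \<le> C"
    unfolding bounded_iff ..
  then have C: "norm (g y) \<le> C" if "y \<in> standard_simplex k" for y using that by blast
  have B: "?B \<in> sets ?M" by (intro sets_PiM_I_finite) auto
  have "emeasure ?M ?B = (\<Prod>i\<in>{1..k}. emeasure lborel {0..1 :: real})"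
    by (intro lborel_product.emeasure_PiM) auto
  then have fin: "emeasure ?M ?B < \<infinity>" by simp
  show ?thesis
  proof (rule Bochner_Integration.integrable_bound)
    show "integrable ?M (\<lambda>x. indicator ?B x *\<^sub>R C)"
      by (rule integrable_scaleR_left) (use B fin in \<open>simp add: integrable_indicator_iff\<close>)
    show "(\<lambda>x. indicator (standard_simplex k) (bary k x) *\<^sub>R g (bary k x)) \<in> borel_measurable ?M"
      by (rule measurable_simplex_indicator[OF assms bary_measurable])
    show "AE x in ?M. norm (indicator (standard_simplex k) (bary k x) *\<^sub>R g (bary k x)) \<le> norm (indicator ?B x *\<^sub>R C)"
    proof (rule AE_I2)
      fix x assume x: "x \<in> space ?M"
      show "norm (indicator (standard_simplex k) (bary k x) *\<^sub>R g (bary k x)) \<le> norm (indicator ?B x *\<^sub>R C)"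
      proof (cases "bary k x \<in> standard_simplex k")
        case True
        have "x j \<le> 1 \<and> 0 \<le> x j" if "j \<in> {1..k}" for j
          using True that member_le_sum[of j "{1..k}" x] unfolding bary_in_simplex_iff by force
        then have "x \<in> ?B" using x by (auto simp: space_PiM PiE_def)
        then show ?thesis using True C[OF True] by auto
      qed simp
    qed
  qed
qed

lemma simplex_integral_eq:
  "simplex_integral k g = (LINT x | PiM {1..k} (\<lambda>_. lborel). indicator (standard_simplex k) (bary k x) *\<^sub>R g (bary k x))"
  by (simp add: simplex_integral_def set_lebesgue_integral_def indicator_def)

lemma simplex_integral_cong:
  "(\<And>y. y \<in> standard_simplex k \<Longrightarrow> f y = g y) \<Longrightarrow> simplex_integral k f = simplex_integral k g"
  unfolding simplex_integral_eq by (intro Bochner_Integration.integral_cong) (auto simp: indicator_def)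

lemma simplex_integral_sum:
  assumes "\<And>i. i \<in> I \<Longrightarrow> continuous_on (standard_simplex k) (f i)"
  shows "simplex_integral k (\<lambda>y. \<Sum>i\<in>I. f i y) = (\<Sum>i\<in>I. simplex_integral k (f i))"
  unfolding simplex_integral_eq scaleR_sum_right
  by (rule Bochner_Integration.integral_sum) (rule simplex_integrable[OF assms])

lemma simplex_integral_add:
  assumes "continuous_on (standard_simplex k) f" "continuous_on (standard_simplex k) g"
  shows "simplex_integral k (\<lambda>y. f y + g y) = simplex_integral k f + simplex_integral k g"
  unfolding simplex_integral_eq scaleR_add_right
  by (rule Bochner_Integration.integral_add) (intro simplex_integrable assms)+

lemma simplex_integral_mult: "simplex_integral k (\<lambda>y. c * f y) = c * simplex_integral k f"
  unfolding simplex_integral_eq by (simp flip: integral_mult_right_zero)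

definition vertex_swap :: "nat \<Rightarrow> (nat \<Rightarrow> real) \<Rightarrow> nat \<Rightarrow> real" where
  "vertex_swap i y = (\<lambda>j. if j = 0 then y i else if j = i then y 0 else y j)"

lemma vertex_swap_simplex:
  assumes i: "1 \<le> i" "i \<le> k"
  shows "vertex_swap i y \<in> standard_simplex k \<longleftrightarrow> y \<in> standard_simplex k"
proof -
  have "(\<Sum>j\<le>k. vertex_swap i y j) = (\<Sum>j\<le>k. y j)"
    by (rule sum.reindex_bij_witness[of _ "Transposition.transpose 0 i" "Transposition.transpose 0 i"])
      (use i in \<open>auto simp: vertex_swap_def Transposition.transpose_def split: if_splits\<close>)
  moreover have "(\<forall>j\<le>k. 0 \<le> vertex_swap i y j) \<longleftrightarrow> (\<forall>j\<le>k. 0 \<le> y j)"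
    using i by (auto simp: vertex_swap_def)
  moreover have "vertex_swap i y \<in> RN (Suc k) \<longleftrightarrow> y \<in> RN (Suc k)"
    using i by (auto simp: vertex_swap_def mem_RN)
  ultimately show ?thesis unfolding standard_simplex_eq_prism prism_def by simp
qed

lemma bary_fun_upd:
  assumes i: "1 \<le> i" "i \<le> k"
  shows "bary k (x(i := h)) = (\<lambda>j. if j = 0 then 1 - (\<Sum>j\<in>{1..k} - {i}. x j) - h else if j = i then h else bary k x j)"
proof -
  have "(\<Sum>j=1..k. (x(i := h)) j) = h + (\<Sum>j\<in>{1..k} - {i}. x j)"
    using i by (subst sum.remove[of _ i]) auto
  then show ?thesis using i by (auto simp: bary_def fun_eq_iff)
qed

text \<open>With all coordinates but the i-th fixed, exchanging the vertices 0 and \<open>i\<close>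
  is the reflection h \<mapsto> c - h of a line, where c is what the fixed coordinates leave of the
  total 1. It preserves Lebesgue measure, and Fubini's theorem does the rest.\<close>

lemma simplex_integral_swap:
  assumes g: "continuous_on (standard_simplex k) g" and i: "1 \<le> i" "i \<le> k"
  shows "simplex_integral k (\<lambda>y. g (vertex_swap i y)) = simplex_integral k g"
proof -
  let ?J = "{1..k} - {i}"
  have ins: "{1..k} = insert i ?J" using i by auto
  have cs: "continuous_on (standard_simplex k) (\<lambda>y. g (vertex_swap i y))"
  proof (rule continuous_on_compose2[OF g])
    show "continuous_on (standard_simplex k) (vertex_swap i)"
    proof (rule continuous_on_coordinatewise_then_product)
      fix j show "continuous_on (standard_simplex k) (\<lambda>y. vertex_swap i y j)"
        unfolding vertex_swap_def
        by (cases "j = 0"; cases "j = i") (auto intro: continuous_on_subset[OF continuous_on_product_coordinates])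
    qed
  qed (use vertex_swap_simplex[OF i] in auto)
  define G where "G g x = indicator (standard_simplex k) (bary k x) *\<^sub>R g (bary k x)" for g :: "(nat \<Rightarrow> real) \<Rightarrow> complex" and x
  have int: "integrable (PiM (insert i ?J) (\<lambda>_. lborel)) (G g)" if "continuous_on (standard_simplex k) g" for g
    unfolding ins[symmetric] G_def by (rule simplex_integrable[OF that])
  have "simplex_integral k (\<lambda>y. g (vertex_swap i y)) = integral\<^sup>L (PiM (insert i ?J) (\<lambda>_. lborel)) (G (\<lambda>y. g (vertex_swap i y)))"
    unfolding simplex_integral_eq G_def ins[symmetric] ..
  also have "\<dots> = (LINT x|PiM ?J (\<lambda>_. lborel). LINT h|lborel. G (\<lambda>y. g (vertex_swap i y)) (x(i := h)))"
    by (rule lborel_product.product_integral_insert[OF _ _ int[OF cs]]) auto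
  also have "\<dots> = (LINT x|PiM ?J (\<lambda>_. lborel). LINT h|lborel. G g (x(i := h)))"
  proof (rule Bochner_Integration.integral_cong[OF refl])
    fix x :: "nat \<Rightarrow> real"
    let ?c = "1 - (\<Sum>j\<in>?J. x j)"
    have sw: "bary k (x(i := ?c - h)) = vertex_swap i (bary k (x(i := h)))" for h
      unfolding bary_fun_upd[OF i] vertex_swap_def using i by auto
    have "(LINT h|lborel. G g (x(i := h))) = \<bar>-1\<bar> *\<^sub>R (LINT h|lborel. G g (x(i := ?c + (-1) * h)))"
      by (rule lborel_integral_real_affine) simp
    also have "\<dots> = (LINT h|lborel. G (\<lambda>y. g (vertex_swap i y)) (x(i := h)))"
      using sw vertex_swap_simplex[OF i] by (simp add: G_def indicator_def)
    finally show "(LINT h|lborel. G (\<lambda>y. g (vertex_swap i y)) (x(i := h))) = (LINT h|lborel. G g (x(i := h)))" by simp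
  qed
  also have "\<dots> = integral\<^sup>L (PiM (insert i ?J) (\<lambda>_. lborel)) (G g)"
    by (rule lborel_product.product_integral_insert[OF _ _ int[OF g], symmetric]) auto
  also have "\<dots> = simplex_integral k g"
    unfolding simplex_integral_eq G_def ins[symmetric] ..
  finally show ?thesis .
qed

text \<open>Parametrises the face opposite to vertex 0 by the points where segments in direction e_i
  - e_0 leave the simplex: the coordinate number 0 of \<open>y\<close> is moved to position
  \<open>i\<close>.\<close>

definition cyclic_face :: "nat \<Rightarrow> (nat \<Rightarrow> real) \<Rightarrow> nat \<Rightarrow> real" where
  "cyclic_face i y = (\<lambda>j. if j = 0 then 0 else if j < i then y j else if j = i then y 0 else y (j - 1))"

lemma cyclic_face_1: "cyclic_face 1 y = simplical_face 0 y"
  by (auto simp: cyclic_face_def simplical_face_def fun_eq_iff)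

lemma cyclic_face_Suc: "1 \<le> i \<Longrightarrow> cyclic_face (Suc i) y = cyclic_face i (vertex_swap i y)"
  by (auto simp: cyclic_face_def vertex_swap_def fun_eq_iff less_Suc_eq)

lemma continuous_on_simplical_face: "continuous_on A (simplical_face i :: (nat \<Rightarrow> real) \<Rightarrow> nat \<Rightarrow> real)"
proof (rule continuous_on_coordinatewise_then_product)
  fix j show "continuous_on A (\<lambda>y::nat \<Rightarrow> real. simplical_face i y j)"
    unfolding simplical_face_def
    by (cases "j < i"; cases "j = i") (auto intro: continuous_on_subset[OF continuous_on_product_coordinates])
qed

lemma continuous_on_cyclic_face: "continuous_on A (cyclic_face i)"
proof (rule continuous_on_coordinatewise_then_product)
  fix j show "continuous_on A (\<lambda>y. cyclic_face i y j)"
    unfolding cyclic_face_def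
    by (cases "j = 0"; cases "j < i"; cases "j = i") (auto intro: continuous_on_subset[OF continuous_on_product_coordinates])
qed

lemma simplical_face_simplex: "i \<le> Suc k \<Longrightarrow> y \<in> standard_simplex k \<Longrightarrow> simplical_face i y \<in> standard_simplex (Suc k)"
  using simplical_face_in_standard_simplex[of "Suc k" i y] by simp

lemma cyclic_face_simplex:
  "1 \<le> i \<Longrightarrow> i \<le> Suc k \<Longrightarrow> y \<in> standard_simplex k \<Longrightarrow> cyclic_face i y \<in> standard_simplex (Suc k)"
proof (induction i arbitrary: y rule: dec_induct)
  case base
  then show ?case using simplical_face_simplex[of 0 k y] by (simp add: cyclic_face_1[simplified])
next
  case (step i)
  then show ?case using vertex_swap_simplex[of i k y] by (simp add: cyclic_face_Suc)
qed

text \<open>Consecutive parametrisations differ by exchanging the vertices 0 and \<open>i\<close>,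
  which does not change the integral; for \<open>i = 1\<close> the parametrisation is the face map
  itself.\<close>

lemma simplex_integral_cyclic_face:
  assumes g: "continuous_on (standard_simplex (Suc k)) g" and i: "1 \<le> i" "i \<le> Suc k"
  shows "simplex_integral k (\<lambda>y. g (cyclic_face i y)) = simplex_integral k (\<lambda>y. g (simplical_face 0 y))"
  using i
proof (induction i rule: dec_induct)
  case base
  then show ?case by (simp add: cyclic_face_1[simplified])
next
  case (step i)
  have "continuous_on (standard_simplex k) (\<lambda>y. g (cyclic_face i y))"
    by (rule continuous_on_compose2[OF g continuous_on_cyclic_face]) (use step cyclic_face_simplex in auto)
  from simplex_integral_swap[OF this, of i] show ?case using step by (simp add: cyclic_face_Suc)
qed

text \<open>Fubini's theorem in direction \<open>i\<close> leaves an integral over the indices 1,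
  ..., k + 1 without \<open>i\<close>; renumbering them as 1, ..., k has to preserve the product
  measure.\<close>

lemma lborel_PiM_reindex:
  fixes I J :: "nat set"
  assumes "finite I" "bij_betw \<rho> J I"
  shows "distr (PiM I (\<lambda>_. lborel :: real measure)) (PiM J (\<lambda>_. lborel)) (\<lambda>x. \<lambda>j\<in>J. x (\<rho> j)) = PiM J (\<lambda>_::nat. lborel)"
proof (rule lborel_product.PiM_eqI)
  show J: "finite J" using assms bij_betw_finite by blast
  have m: "(\<lambda>x. \<lambda>j\<in>J. x (\<rho> j)) \<in> measurable (PiM I (\<lambda>_. lborel :: real measure)) (PiM J (\<lambda>_. lborel))"
    using assms(2) by (intro measurable_restrict measurable_component_singleton) (auto simp: bij_betw_def)
  fix A :: "nat \<Rightarrow> real set" assume A: "\<And>i. i \<in> J \<Longrightarrow> A i \<in> sets lborel"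
  let ?\<sigma> = "the_inv_into J \<rho>"
  have \<sigma>: "?\<sigma> i \<in> J" "\<rho> (?\<sigma> i) = i" if "i \<in> I" for i
    using assms(2) that by (auto simp: bij_betw_def f_the_inv_into_f intro: the_inv_into_into)
  have \<sigma>': "?\<sigma> (\<rho> j) = j" "\<rho> j \<in> I" if "j \<in> J" for j
    using assms(2) that by (auto simp: bij_betw_def the_inv_into_f_f)
  have "emeasure (distr (PiM I (\<lambda>_. lborel)) (PiM J (\<lambda>_. lborel)) (\<lambda>x. \<lambda>j\<in>J. x (\<rho> j))) (PiE J A) =
      emeasure (PiM I (\<lambda>_. lborel)) ((\<lambda>x. \<lambda>j\<in>J. x (\<rho> j)) -` PiE J A \<inter> space (PiM I (\<lambda>_. lborel)))"
    by (rule emeasure_distr[OF m]) (use A J in \<open>auto intro: sets_PiM_I_finite\<close>)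
  also have "(\<lambda>x. \<lambda>j\<in>J. x (\<rho> j)) -` PiE J A \<inter> space (PiM I (\<lambda>_. lborel)) = PiE I (\<lambda>i. A (?\<sigma> i))"
  proof (intro equalityI subsetI)
    fix x assume x: "x \<in> (\<lambda>x. \<lambda>j\<in>J. x (\<rho> j)) -` PiE J A \<inter> space (PiM I (\<lambda>_. lborel))"
    then have "x (\<rho> j) \<in> A j" if "j \<in> J" for j using that by (auto simp: PiE_def Pi_def)
    then have "x i \<in> A (?\<sigma> i)" if "i \<in> I" for i using \<sigma>[OF that] by metis
    then show "x \<in> PiE I (\<lambda>i. A (?\<sigma> i))" using x by (auto simp: space_PiM PiE_def)
  next
    fix x assume x: "x \<in> PiE I (\<lambda>i. A (?\<sigma> i))"
    then have "x (\<rho> j) \<in> A j" if "j \<in> J" for j using \<sigma>'[OF that] by (auto simp: PiE_def Pi_def dest: spec[of _ "\<rho> j"])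
    then show "x \<in> (\<lambda>x. \<lambda>j\<in>J. x (\<rho> j)) -` PiE J A \<inter> space (PiM I (\<lambda>_. lborel))"
      using x by (auto simp: space_PiM PiE_def)
  qed
  also have "emeasure (PiM I (\<lambda>_. lborel)) (PiE I (\<lambda>i. A (?\<sigma> i))) = (\<Prod>i\<in>I. emeasure lborel (A (?\<sigma> i)))"
    by (rule lborel_product.emeasure_PiM[OF assms(1)]) (use A \<sigma> in auto)
  also have "\<dots> = (\<Prod>j\<in>J. emeasure lborel (A j))"
    by (rule prod.reindex_bij_witness[of _ \<rho> ?\<sigma>]) (use \<sigma> \<sigma>' in auto)
  finally show "emeasure (distr (PiM I (\<lambda>_. lborel)) (PiM J (\<lambda>_. lborel)) (\<lambda>x. \<lambda>j\<in>J. x (\<rho> j))) (PiE J A) =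
      (\<Prod>j\<in>J. emeasure lborel (A j))" .
qed simp

lemma edge_vector_tangent: "1 \<le> i \<Longrightarrow> i \<le> k \<Longrightarrow> edge_vector i \<in> prism_tangents k 0"
proof -
  assume "1 \<le> i" "i \<le> k"
  moreover from this have "prism_basis k i = edge_vector i"
    by (auto simp: prism_basis_def edge_vector_def fun_eq_iff)
  ultimately show ?thesis using prism_basis_in[of i k 0] by auto
qed

text \<open>Integration along the edge from vertex \<open>0\<close> to vertex \<open>i\<close>. On the face opposite to vertex \<open>0\<close>
  this yields a parametrisation depending on \<open>i\<close>; they all give the same integral.\<close>

lemma simplex_integral_deriv:
  assumes f: "smooth_on_set (Suc (Suc k)) (standard_simplex (Suc k)) f" and i: "1 \<le> i" "i \<le> Suc k"
  shows "simplex_integral (Suc k) (\<lambda>y. deriv_on (Suc (Suc k)) (standard_simplex (Suc k)) f y (edge_vector i)) =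
    simplex_integral k (\<lambda>y. f (simplical_face 0 y)) - simplex_integral k (\<lambda>y. f (simplical_face i y))"
proof -
  let ?K = "Suc k"
  let ?S = "standard_simplex ?K"
  let ?J = "{1..?K} - {i}"
  let ?F = "\<lambda>y. deriv_on (Suc ?K) ?S f y (edge_vector i)"
  have A: "prism_open ?K 0 ?S" by (rule prism_open_standard_simplex)
  have N: "Suc ?K = Suc ?K + 0" by simp
  have SR: "?S \<subseteq> RN (Suc ?K)" by (rule standard_simplex_RN)
  have cf: "continuous_on ?S f" by (rule smooth_on_set_imp_continuous_on[OF f SR])
  have ev: "edge_vector i \<in> prism_tangents ?K 0" by (rule edge_vector_tangent[OF i])
  have "smooth_on_set (Suc ?K) ?S ?F"
    unfolding smooth_on_set_iff by (intro ballI smooth_at_deriv_on[OF A N ev] smooth_on_setD[OF f])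
  then have cF: "continuous_on ?S ?F" by (rule smooth_on_set_imp_continuous_on[OF _ SR])
  have ins: "{1..?K} = insert i ?J" using i by auto
  define G where "G x = indicator ?S (bary ?K x) *\<^sub>R ?F (bary ?K x)" for x
  \<comment> \<open>The end points of the segment in direction \<open>i\<close>: at
    \<open>b0\<close> the coordinate x_i vanishes, at \<open>b1\<close> the coordinate x_0.\<close>
  define b0 where "b0 x = bary ?K (x(i := 0))" for x
  define b1 where "b1 x = bary ?K (x(i := 1 - (\<Sum>j\<in>?J. x j)))" for x
  have bS: "bary ?K (x(i := h)) \<in> ?S \<longleftrightarrow> (\<forall>j\<in>?J. 0 \<le> x j) \<and> 0 \<le> h \<and> h \<le> 1 - (\<Sum>j\<in>?J. x j)" for x h
  proof -
    have "(\<Sum>j=1..?K. (x(i := h)) j) = h + (\<Sum>j\<in>?J. x j)" using i by (subst sum.remove[of _ i]) auto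
    then show ?thesis unfolding bary_in_simplex_iff using i by (auto simp: ins)
  qed
  \<comment> \<open>The fundamental theorem of calculus on this segment. If the remaining
    coordinates lie outside the projection of the simplex, the segment is empty and both sides are
    0.\<close>
  have inner: "(LINT h|lborel. G (x(i := h))) =
      indicator ?S (b1 x) *\<^sub>R f (b1 x) - indicator ?S (b0 x) *\<^sub>R f (b0 x)" for x
  proof (cases "(\<forall>j\<in>?J. 0 \<le> x j) \<and> (\<Sum>j\<in>?J. x j) \<le> 1")
    case True
    let ?s = "1 - (\<Sum>j\<in>?J. x j)"
    let ?c = "\<lambda>h. bary ?K (x(i := h))"
    have c_in: "?c h \<in> ?S \<longleftrightarrow> h \<in> {0..?s}" for h using True by (auto simp: bS)
    have cj: "((\<lambda>h. ?c h j) has_vector_derivative edge_vector i j) (at h within {0..?s})" for h j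
      unfolding bary_fun_upd[OF i] edge_vector_def has_real_derivative_iff_has_vector_derivative[symmetric]
      using i by (cases "j = 0"; cases "j = i") (auto intro!: derivative_eq_intros)
    have der: "((\<lambda>h. f (?c h)) has_vector_derivative ?F (?c h)) (at h within {0..?s})" if "0 \<le> h" "h \<le> ?s" for h
      by (rule deriv_on_curve[OF A N _ _ _ cj ev]) (use c_in that smooth_on_setD[OF f] in auto)
    have cc: "continuous_on {0..?s} ?c"
    proof (rule continuous_on_coordinatewise_then_product)
      show "continuous_on {0..?s} (\<lambda>h. ?c h j)" for j
        using has_vector_derivative_continuous[OF cj] by (simp add: continuous_on_eq_continuous_within)
    qed
    have "continuous_on {0..?s} (\<lambda>h. ?F (?c h))"
    proof (rule continuous_on_compose2[of ?S ?F "{0..?s}" ?c, OF cF cc])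
      show "?c ` {0..?s} \<subseteq> ?S" using c_in by blast
    qed
    moreover have "0 \<le> ?s" using True by simp
    ultimately have "(LINT h|lborel. indicator {0..?s} h *\<^sub>R ?F (?c h)) = f (?c ?s) - f (?c 0)"
      using integral_FTC_Icc[of 0 ?s "\<lambda>h. f (?c h)" "\<lambda>h. ?F (?c h)", OF _ der] by blast
    moreover have "G (x(i := h)) = indicator {0..?s} h *\<^sub>R ?F (?c h)" for h
      using c_in[of h] by (simp add: G_def indicator_def)
    moreover have "?c ?s \<in> ?S" "?c 0 \<in> ?S" using c_in True by auto
    ultimately show ?thesis by (simp add: b0_def b1_def)
  next
    case False
    have "G (x(i := h)) = 0" for h using False bS[of x h] by (auto simp: G_def)
    moreover have "b0 x \<notin> ?S" "b1 x \<notin> ?S" using False by (auto simp: b0_def b1_def bS)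
    ultimately show ?thesis by simp
  qed
  have "integrable (PiM (insert i ?J) (\<lambda>_. lborel)) G"
    unfolding ins[symmetric] G_def by (rule simplex_integrable[OF cF])
  then have "integral\<^sup>L (PiM (insert i ?J) (\<lambda>_. lborel)) G =
      (LINT x|PiM ?J (\<lambda>_. lborel). LINT h|lborel. G (x(i := h)))"
    by (intro lborel_product.product_integral_insert) auto
  then have *: "integral\<^sup>L (PiM {1..?K} (\<lambda>_. lborel)) G = (LINT x|PiM ?J (\<lambda>_. lborel).
      indicator ?S (b1 x) *\<^sub>R f (b1 x) - indicator ?S (b0 x) *\<^sub>R f (b0 x))"
    unfolding inner ins[symmetric] .
  have "simplex_integral ?K ?F = integral\<^sup>L (PiM {1..?K} (\<lambda>_. lborel)) G"
    by (simp add: simplex_integral_eq G_def[abs_def])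
  also have "\<dots> = (LINT x|PiM ?J (\<lambda>_. lborel).
      indicator ?S (b1 x) *\<^sub>R f (b1 x) - indicator ?S (b0 x) *\<^sub>R f (b0 x))" by (rule *)
  also have "\<dots> = (LINT x|PiM {1..k} (\<lambda>_. lborel).
      indicator ?S (cyclic_face i (bary k x)) *\<^sub>R f (cyclic_face i (bary k x)) -
      indicator ?S (simplical_face i (bary k x)) *\<^sub>R f (simplical_face i (bary k x)))"
  proof -
    \<comment> \<open>\<open>\<rho>\<close> closes the gap at index \<open>i\<close>; under this
      renumbering \<open>b0\<close> and \<open>b1\<close> turn into \<open>simplical_face i\<close>
      and \<open>cyclic_face i\<close>.\<close>
    define \<rho> where "\<rho> j = (if j < i then j else j - 1)" for j
    define \<rho>' where "\<rho>' j = (if j < i then j else Suc j)" for j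
    define t where "t x = (\<lambda>j\<in>?J. x (\<rho> j))" for x :: "nat \<Rightarrow> real"
    have \<rho>: "bij_betw \<rho> ?J {1..k}"
      by (rule bij_betw_byWitness[of _ \<rho>']) (use i in \<open>auto simp: \<rho>_def \<rho>'_def\<close>)
    have tm: "t \<in> measurable (PiM {1..k} (\<lambda>_. lborel)) (PiM ?J (\<lambda>_. lborel))"
      unfolding t_def using \<rho> by (intro measurable_restrict measurable_component_singleton) (auto simp: bij_betw_def)
    have ts: "(\<Sum>j\<in>?J. t x j) = (\<Sum>j=1..k. x j)" for x
      using sum.reindex_bij_betw[OF \<rho>, of x] by (simp add: t_def)
    have tb: "b0 (t x) = simplical_face i (bary k x)" "b1 (t x) = cyclic_face i (bary k x)" for x
    proof -
      have tj: "bary ?K (t x) j = x (\<rho> j)" if "1 \<le> j" "j \<le> ?K" "j \<noteq> i" for j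
        using that by (simp add: bary_def t_def)
      have t0: "bary ?K (t x) j = 0" if "j > ?K" for j using that by (simp add: bary_def)
      show "b0 (t x) = simplical_face i (bary k x)"
      proof
        fix j
        consider "j = 0" | "1 \<le> j" "j \<le> ?K" "j \<noteq> i" | "j = i" | "j > ?K" by linarith
        then show "b0 (t x) j = simplical_face i (bary k x) j"
          using i by cases (auto simp: b0_def bary_fun_upd[OF i] ts[simplified] tj t0 simplical_face_def \<rho>_def, auto simp: bary_def)
      qed
      show "b1 (t x) = cyclic_face i (bary k x)"
      proof
        fix j
        consider "j = 0" | "1 \<le> j" "j \<le> ?K" "j \<noteq> i" | "j = i" | "j > ?K" by linarith
        then show "b1 (t x) j = cyclic_face i (bary k x) j"
          using i by cases (auto simp: b1_def bary_fun_upd[OF i] ts[simplified] tj t0 cyclic_face_def \<rho>_def, auto simp: bary_def)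
      qed
    qed
    have updm: "(\<lambda>x. bary ?K (x(i := h x))) \<in> borel_measurable (PiM ?J (\<lambda>_. lborel))"
      if "h \<in> borel_measurable (PiM ?J (\<lambda>_. lborel))" for h
    proof (rule measurable_coordinatewise_then_product)
      fix j
      have mc: "(\<lambda>x. x l) \<in> borel_measurable (PiM ?J (\<lambda>_. lborel))" if "l \<in> ?J" for l
        using measurable_component_singleton[of l ?J "\<lambda>_. lborel"] that by simp
      have sm: "(\<lambda>x. \<Sum>j\<in>?J. x j) \<in> borel_measurable (PiM ?J (\<lambda>_. lborel))"
        by (rule borel_measurable_sum[OF mc])
      consider "j = 0" | "j \<in> ?J" | "j = i" | "j > ?K" using i by force
      then show "(\<lambda>x. bary ?K (x(i := h x)) j) \<in> borel_measurable (PiM ?J (\<lambda>_. lborel))"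
      proof cases
        case 1
        have "(\<lambda>x. bary ?K (x(i := h x)) j) = (\<lambda>x. 1 - (\<Sum>j\<in>?J. x j) - h x)"
          using 1 by (simp add: bary_fun_upd[OF i] del: One_nat_def)
        then show ?thesis
          using borel_measurable_diff[OF borel_measurable_diff[OF borel_measurable_const sm] that] by (simp only:)
      next
        case 2
        then have "(\<lambda>x. bary ?K (x(i := h x)) j) = (\<lambda>x. x j)"
          using i by (auto simp: bary_fun_upd[OF i] bary_def)
        then show ?thesis using mc[OF 2] by (simp only:)
      next
        case 3
        then have "(\<lambda>x. bary ?K (x(i := h x)) j) = h"
          using i by (auto simp: bary_fun_upd[OF i])
        then show ?thesis using that by (simp only:)
      next
        case 4
        then have "(\<lambda>x. bary ?K (x(i := h x)) j) = (\<lambda>x. 0)"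
          using i by (auto simp: bary_fun_upd[OF i] bary_def)
        then show ?thesis by simp
      qed
    qed
    have m0: "b0 \<in> borel_measurable (PiM ?J (\<lambda>_. lborel))" unfolding b0_def by (rule updm) simp
    have m1: "b1 \<in> borel_measurable (PiM ?J (\<lambda>_. lborel))" unfolding b1_def
      by (rule updm) (intro borel_measurable_diff borel_measurable_const borel_measurable_sum,
        use measurable_component_singleton[of _ ?J "\<lambda>_. lborel"] in simp)
    have "(LINT x|PiM ?J (\<lambda>_. lborel). indicator ?S (b1 x) *\<^sub>R f (b1 x) - indicator ?S (b0 x) *\<^sub>R f (b0 x)) =
      (LINT x|distr (PiM {1..k} (\<lambda>_. lborel)) (PiM ?J (\<lambda>_. lborel)) t.
        indicator ?S (b1 x) *\<^sub>R f (b1 x) - indicator ?S (b0 x) *\<^sub>R f (b0 x))"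
    proof -
      have "t = (\<lambda>x. \<lambda>j\<in>?J. x (\<rho> j))" by (simp add: t_def fun_eq_iff)
      then have "distr (PiM {1..k} (\<lambda>_. lborel)) (PiM ?J (\<lambda>_. lborel)) t = PiM ?J (\<lambda>_. lborel)"
        using lborel_PiM_reindex[OF finite_atLeastAtMost \<rho>] by (simp only:)
      then show ?thesis by (simp only:)
    qed
    also have "\<dots> = (LINT x|PiM {1..k} (\<lambda>_. lborel).
        indicator ?S (b1 (t x)) *\<^sub>R f (b1 (t x)) - indicator ?S (b0 (t x)) *\<^sub>R f (b0 (t x)))"
      by (rule integral_distr[OF tm]) (intro borel_measurable_diff measurable_simplex_indicator cf m0 m1)
    finally show ?thesis unfolding tb .
  qed
  \<comment> \<open>Both face parametrisations reflect membership: if the image of a point lies in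
    the large simplex, the point lies in the small one. So the indicator functions agree.\<close>
  also have "\<dots> = (LINT x|PiM {1..k} (\<lambda>_. lborel).
      indicator (standard_simplex k) (bary k x) *\<^sub>R f (cyclic_face i (bary k x)) -
      indicator (standard_simplex k) (bary k x) *\<^sub>R f (simplical_face i (bary k x)))"
  proof (intro Bochner_Integration.integral_cong refl)
    fix x
    have "simplical_face i (bary k x) \<in> ?S \<longleftrightarrow> bary k x \<in> standard_simplex k" (is "?l \<longleftrightarrow> ?r")
    proof
      assume ?l
      have "0 \<le> bary k x j" if "j \<le> k" for j
      proof -
        have "0 \<le> simplical_face i (bary k x) (if j < i then j else Suc j)"
          using \<open>?l\<close> by (auto simp: standard_simplex_def)
        then show ?thesis by (auto simp: simplical_face_def split: if_splits)
      qed
      then have "\<forall>j\<in>{1..k}. 0 \<le> x j" "(\<Sum>j=1..k. x j) \<le> 1"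
        by (force simp: bary_def dest: spec)+
      then show ?r by (simp add: bary_in_simplex_iff)
    qed (use simplical_face_simplex i in auto)
    moreover have "cyclic_face i (bary k x) \<in> ?S \<longleftrightarrow> bary k x \<in> standard_simplex k" (is "?l \<longleftrightarrow> ?r")
    proof
      assume ?l
      have "0 \<le> bary k x j" if "j \<le> k" for j
      proof -
        have "0 \<le> cyclic_face i (bary k x) (if j = 0 then i else if j < i then j else Suc j)"
          using \<open>?l\<close> by (auto simp: standard_simplex_def)
        then show ?thesis using i by (auto simp: cyclic_face_def split: if_splits)
      qed
      then have "\<forall>j\<in>{1..k}. 0 \<le> x j" "(\<Sum>j=1..k. x j) \<le> 1"
        by (force simp: bary_def dest: spec)+
      then show ?r by (simp add: bary_in_simplex_iff)
    qed (use cyclic_face_simplex i in auto)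
    ultimately show "indicator ?S (cyclic_face i (bary k x)) *\<^sub>R f (cyclic_face i (bary k x)) -
        indicator ?S (simplical_face i (bary k x)) *\<^sub>R f (simplical_face i (bary k x)) =
      indicator (standard_simplex k) (bary k x) *\<^sub>R f (cyclic_face i (bary k x)) -
        indicator (standard_simplex k) (bary k x) *\<^sub>R f (simplical_face i (bary k x))"
      by (simp add: indicator_def)
  qed
  also have "\<dots> = simplex_integral k (\<lambda>y. f (cyclic_face i y)) - simplex_integral k (\<lambda>y. f (simplical_face i y))"
    unfolding simplex_integral_eq
  proof (intro Bochner_Integration.integral_diff simplex_integrable)
    show "continuous_on (standard_simplex k) (\<lambda>y. f (cyclic_face i y))"
      by (rule continuous_on_compose2[OF cf continuous_on_cyclic_face]) (use i cyclic_face_simplex in auto)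
    show "continuous_on (standard_simplex k) (\<lambda>y. f (simplical_face i y))"
      by (rule continuous_on_compose2[OF cf continuous_on_simplical_face]) (use i simplical_face_simplex in auto)
  qed
  also have "simplex_integral k (\<lambda>y. f (cyclic_face i y)) = simplex_integral k (\<lambda>y. f (simplical_face 0 y))"
    by (rule simplex_integral_cyclic_face[OF cf i])
  finally show ?thesis .
qed

lemma simplical_face_edge_vector:
  assumes "1 \<le> i" "1 \<le> j"
  shows "simplical_face i (edge_vector j) = edge_vector (if j < i then j else Suc j)"
  using assms by (auto simp: simplical_face_def edge_vector_def fun_eq_iff)

lemma simplical_face_0_edge_vector:
  assumes "1 \<le> j"
  shows "simplical_face 0 (edge_vector j) = (\<lambda>l. edge_vector (Suc j) l - edge_vector 1 l)"
  using assms by (auto simp: simplical_face_def edge_vector_def fun_eq_iff)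

lemma map_simplical_face_edges:
  assumes "1 \<le> i" "i \<le> Suc k"
  shows "map (simplical_face i) (map edge_vector [1..<Suc k]) = remove_at (i - 1) (map edge_vector [1..<Suc (Suc k)])"
  by (rule nth_equalityI) (use assms in \<open>auto simp: nth_remove_at simplical_face_edge_vector simp del: upt_Suc\<close>)

lemma map_simplical_face_0_edges:
  "map (simplical_face 0) (map edge_vector [1..<Suc k]) =
    map (\<lambda>w l. w l - edge_vector 1 l) (map edge_vector [2..<Suc (Suc k)])"
  by (rule nth_equalityI) (auto simp: simplical_face_0_edge_vector simp del: upt_Suc)

text \<open>Summand \<open>i\<close> is a derivative along edge \<open>Suc i\<close>, and its
  integral is a term on face 0 minus a term on face \<open>Suc i\<close>. The latter are the
  remaining faces with their signs; the former add up to the integral over face 0 by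
  \<open>alternating_multilinear_face0\<close>.\<close>

lemma stokes_simplex:
  fixes \<eta> :: "(nat \<Rightarrow> real) \<Rightarrow> (nat \<Rightarrow> real) list \<Rightarrow> complex"
  assumes ml: "\<And>y. y \<in> standard_simplex (Suc k) \<Longrightarrow> alternating_multilinear (prism_tangents (Suc k) 0) (\<eta> y)"
    and sm: "\<And>vs. set vs \<subseteq> prism_tangents (Suc k) 0 \<Longrightarrow>
      smooth_on_set (Suc (Suc k)) (standard_simplex (Suc k)) (\<lambda>y. \<eta> y vs)"
  defines "es \<equiv> map edge_vector [1..<Suc (Suc k)]"
  shows "simplex_integral (Suc k) (\<lambda>y. \<Sum>i<Suc k. (- 1) ^ i *
      deriv_on (Suc (Suc k)) (standard_simplex (Suc k)) (\<lambda>z. \<eta> z (remove_at i es)) y (es ! i)) =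
    (\<Sum>i\<le>Suc k. (- 1) ^ i *
      simplex_integral k (\<lambda>y. \<eta> (simplical_face i y) (map (simplical_face i) (map edge_vector [1..<Suc k]))))"
proof -
  let ?S = "standard_simplex (Suc k)" and ?T = "prism_tangents (Suc k) 0"
  have A: "prism_open (Suc k) 0 ?S" by (rule prism_open_standard_simplex)
  have N: "Suc (Suc k) = Suc (Suc k) + 0" by simp
  have esT: "set es \<subseteq> ?T" using edge_vector_tangent[of _ "Suc k"] by (auto simp: es_def)
  have rT: "set (remove_at i es) \<subseteq> ?T" for i using set_remove_at[of i es] esT by blast
  have esi: "es ! i = edge_vector (Suc i)" if "i < Suc k" for i
    using that by (simp add: es_def nth_append del: upt_Suc)
  have evT: "edge_vector (Suc i) \<in> ?T" if "i < Suc k" for i using edge_vector_tangent[of "Suc i" "Suc k"] that by simp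
  have cD: "continuous_on ?S (\<lambda>y. (- 1) ^ i * deriv_on (Suc (Suc k)) ?S (\<lambda>z. \<eta> z (remove_at i es)) y (es ! i))"
    if i: "i < Suc k" for i
  proof -
    have "smooth_on_set (Suc (Suc k)) ?S (\<lambda>y. deriv_on (Suc (Suc k)) ?S (\<lambda>z. \<eta> z (remove_at i es)) y (es ! i))"
      unfolding smooth_on_set_iff esi[OF i]
      by (intro ballI smooth_at_deriv_on[OF A N evT[OF i]] smooth_on_setD[OF sm[OF rT]])
    then show ?thesis by (intro continuous_on_mult_left smooth_on_set_imp_continuous_on[OF _ standard_simplex_RN])
  qed
  have c0: "continuous_on (standard_simplex k) (\<lambda>y. (- 1) ^ i * \<eta> (simplical_face 0 y) (remove_at i es))" for i
    by (intro continuous_on_mult_left continuous_on_compose2[OF smooth_on_set_imp_continuous_on[OF sm[OF rT] standard_simplex_RN]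
          continuous_on_simplical_face]) (use simplical_face_simplex in auto)
  define P where "P i = simplex_integral k (\<lambda>y. \<eta> (simplical_face 0 y) (remove_at i es))" for i
  define Q where "Q i = simplex_integral k (\<lambda>y. \<eta> (simplical_face (Suc i) y) (remove_at i es))" for i
  have "simplex_integral (Suc k) (\<lambda>y. \<Sum>i<Suc k. (- 1) ^ i *
      deriv_on (Suc (Suc k)) ?S (\<lambda>z. \<eta> z (remove_at i es)) y (es ! i)) =
    (\<Sum>i<Suc k. (- 1) ^ i * simplex_integral (Suc k) (\<lambda>y. deriv_on (Suc (Suc k)) ?S (\<lambda>z. \<eta> z (remove_at i es)) y (es ! i)))"
    by (subst simplex_integral_sum) (use cD simplex_integral_mult in \<open>auto intro!: sum.cong\<close>)
  also have "\<dots> = (\<Sum>i<Suc k. (- 1) ^ i * (P i - Q i))"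
  proof (intro sum.cong refl arg_cong2[where f = "(*)"])
    fix i assume "i \<in> {..<Suc k}"
    then have i: "i < Suc k" by simp
    show "simplex_integral (Suc k) (\<lambda>y. deriv_on (Suc (Suc k)) ?S (\<lambda>z. \<eta> z (remove_at i es)) y (es ! i)) = P i - Q i"
      unfolding esi[OF i] P_def Q_def by (rule simplex_integral_deriv[OF sm[OF rT]]) (use i in auto)
  qed
  also have "\<dots> = (\<Sum>i<Suc k. (- 1) ^ i * P i) + (\<Sum>i<Suc k. (- 1) ^ Suc i * Q i)"
    by (simp add: sum.distrib[symmetric] algebra_simps)
  \<comment> \<open>Face 0 does not contain vertex 0: its edges are e_(j+1) - e_1, and expanding the
    form on them accounts for the whole alternating sum at once.\<close>
  also have "(\<Sum>i<Suc k. (- 1) ^ i * P i) =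
      simplex_integral k (\<lambda>y. \<eta> (simplical_face 0 y) (map (simplical_face 0) (map edge_vector [1..<Suc k])))"
  proof -
    have "(\<Sum>i<Suc k. (- 1) ^ i * P i) = simplex_integral k (\<lambda>y. \<Sum>i<Suc k. (- 1) ^ i * \<eta> (simplical_face 0 y) (remove_at i es))"
      unfolding P_def by (subst simplex_integral_sum) (use c0 simplex_integral_mult in \<open>auto intro!: sum.cong\<close>)
    also have "\<dots> = simplex_integral k (\<lambda>y. \<eta> (simplical_face 0 y) (map (simplical_face 0) (map edge_vector [1..<Suc k])))"
    proof (rule simplex_integral_cong)
      fix y assume "y \<in> standard_simplex k"
      then have y: "simplical_face 0 y \<in> ?S" by (intro simplical_face_simplex) auto
      let ?ws = "map edge_vector [2..<Suc (Suc k)]"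
      have es_eq: "es = edge_vector 1 # ?ws"
        unfolding es_def by (subst upt_conv_Cons) (auto simp: numeral_2_eq_2)
      have "\<eta> (simplical_face 0 y) (map (\<lambda>w l. w l - edge_vector 1 l) ?ws) =
          (\<Sum>i<Suc (length ?ws). (- 1) ^ i * \<eta> (simplical_face 0 y) (remove_at i (edge_vector 1 # ?ws)))"
        by (rule alternating_multilinear_face0[OF ml[OF y] prism_tangents_comb]) (use esT es_eq in auto)
      moreover have "length ?ws = k" by (simp del: upt_Suc)
      ultimately show "(\<Sum>i<Suc k. (- 1) ^ i * \<eta> (simplical_face 0 y) (remove_at i es)) =
          \<eta> (simplical_face 0 y) (map (simplical_face 0) (map edge_vector [1..<Suc k]))"
        unfolding map_simplical_face_0_edges es_eq by simp
    qed
    finally show ?thesis .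
  qed
  also have "(\<Sum>i<Suc k. (- 1) ^ Suc i * Q i) = (\<Sum>i<Suc k. (- 1) ^ Suc i *
      simplex_integral k (\<lambda>y. \<eta> (simplical_face (Suc i) y) (map (simplical_face (Suc i)) (map edge_vector [1..<Suc k]))))"
  proof (intro sum.cong refl arg_cong2[where f = "(*)"])
    fix i assume "i \<in> {..<Suc k}"
    then show "Q i = simplex_integral k (\<lambda>y. \<eta> (simplical_face (Suc i) y) (map (simplical_face (Suc i)) (map edge_vector [1..<Suc k])))"
      using map_simplical_face_edges[of "Suc i" k] by (simp add: Q_def es_def del: upt_Suc)
  qed
  finally show ?thesis
    by (simp add: sum.atMost_Suc_shift lessThan_Suc_atMost del: sum.lessThan_Suc sum.atMost_Suc upt_Suc)
qed

section \<open>Exterior derivative and integration of forms\<close>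

lemma remove_at_remove_at:
  assumes "i < j" "j < length xs"
  shows "remove_at i (remove_at j xs) = remove_at (j - 1) (remove_at i xs)"
  by (rule nth_equalityI) (use assms in \<open>auto simp: nth_remove_at\<close>)

text \<open>Antisymmetry of the double sum: second derivatives commute, while the two orders of
  omitting the arguments \<open>i\<close> and \<open>j\<close> come with opposite signs.\<close>

lemma ext_deriv_ext_deriv:
  assumes X: "prism_space X n m" and \<omega>: "\<omega> \<in> forms X k"
  shows "ext_deriv X (ext_deriv X \<omega>) = 0"
proof (intro ext)
  interpret prism_space X n m by fact
  fix c x vs
  show "ext_deriv X (ext_deriv X \<omega>) c x vs = 0 c x vs"
  proof (cases "form_arg X c x vs")
    case True
    obtain U \<phi> where c: "c = (U, \<phi>)" by (cases c)
    have U: "(U, \<phi>) \<in> atlas X" "x \<in> \<phi> ` U" "set vs \<subseteq> tangents X" using True by (auto simp: form_arg_def c)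
    let ?N = "ambient_dim X" and ?A = "\<phi> ` U" and ?n = "length vs"
    note A = chart_prism_open[OF U(1)]
    have vi: "vs ! i \<in> prism_tangents n m" if "i < ?n" for i
      using U(3) nth_mem[OF that] by (auto simp: prism_tangents)
    define D where "D ws v y = deriv_on ?N ?A (\<lambda>z. \<omega> (U, \<phi>) z ws) y v" for ws v y
    have sm0: "smooth_at ?N ?A (\<lambda>z. \<omega> (U, \<phi>) z ws) y" if "set ws \<subseteq> set vs" "y \<in> ?A" for ws y
      using smooth_on_setD[OF forms_smooth[OF \<omega> U(1)] that(2)] that(1) U(3) by blast
    have smD: "smooth_at ?N ?A (D ws v) y" if "set ws \<subseteq> set vs" "v \<in> prism_tangents n m" "y \<in> ?A" for ws v y
      unfolding D_def by (rule smooth_at_deriv_on[OF A prism_dim that(2) sm0[OF that(1,3)]])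
    have sub: "set (remove_at j (remove_at i vs)) \<subseteq> set vs" for i j
      using set_remove_at[of j "remove_at i vs"] set_remove_at[of i vs] by blast
    define E where "E i j = D (remove_at j (remove_at i vs))" for i j
    \<comment> \<open>Here \<open>j\<close> is the position in the full list; after the omission of
      \<open>i\<close> a later position is lowered by one.\<close>
    define S where "S i j = deriv_on ?N ?A (E i (if j < i then j else j - 1) (vs ! j)) x (vs ! i)" for i j
    have summand: "deriv_on ?N ?A (\<lambda>y. ext_deriv X \<omega> (U, \<phi>) y (remove_at i vs)) x (vs ! i) =
        (\<Sum>j<?n - 1. (- 1) ^ j * S i (if j < i then j else Suc j))" if i: "i < ?n" for i
    proof -
      let ?v = "\<lambda>j. vs ! (if j < i then j else Suc j)"
      have vj: "?v j \<in> prism_tangents n m" if "j < ?n - 1" for j using that i by (intro vi) auto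
      have cont: "smooth_at ?N ?A (\<lambda>y. of_real ((- 1) ^ j) * E i j (?v j) y) x" if "j < ?n - 1" for j
        using smooth_at_scaleR[OF smooth_at_const[OF prism_open_imp_RN[OF A prism_dim U(2)]] smD[OF sub vj[OF that] U(2)], of "(- 1) ^ j"]
        by (simp add: E_def scaleR_conv_of_real)
      have "deriv_on ?N ?A (\<lambda>y. ext_deriv X \<omega> (U, \<phi>) y (remove_at i vs)) x (vs ! i) =
          deriv_on ?N ?A (\<lambda>y. \<Sum>j<?n - 1. of_real ((- 1) ^ j) * E i j (?v j) y) x (vs ! i)"
      proof (rule deriv_on_eq_on[OF A prism_dim U(2) vi[OF i]])
        show "smooth_at ?N ?A (\<lambda>y. \<Sum>j<?n - 1. of_real ((- 1) ^ j) * E i j (?v j) y) x"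
          by (rule smooth_at_sum[OF prism_open_imp_RN[OF A prism_dim U(2)]]) (use cont in auto)
        fix y assume y: "y \<in> ?A"
        have "form_arg X (U, \<phi>) y (remove_at i vs)"
          using y U set_remove_at[of i vs] by (auto simp: form_arg_def)
        then show "ext_deriv X \<omega> (U, \<phi>) y (remove_at i vs) = (\<Sum>j<?n - 1. of_real ((- 1) ^ j) * E i j (?v j) y)"
          using i by (auto simp: ext_deriv_def remove_at_def[symmetric] E_def D_def nth_remove_at intro!: sum.cong)
      qed
      also have "\<dots> = (\<Sum>j<?n - 1. of_real ((- 1) ^ j) * deriv_on ?N ?A (E i j (?v j)) x (vs ! i))"
        by (subst deriv_on_sum[OF A prism_dim U(2) vi[OF i] cont])
          (auto simp only: deriv_on_mult_const[OF A prism_dim U(2) vi[OF i] smD[OF sub vj U(2)], folded E_def]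
            lessThan_iff intro!: sum.cong)
      also have "\<dots> = (\<Sum>j<?n - 1. (- 1) ^ j * S i (if j < i then j else Suc j))"
        by (intro sum.cong refl) (auto simp: S_def)
      finally show ?thesis .
    qed
    define t where "t i j = (- 1) ^ i * ((- 1) ^ (if j < i then j else j - 1) * S i j)" for i j
    have sym: "S i j = S j i" if "i < j" "j < ?n" for i j
    proof -
      show ?thesis
        unfolding S_def E_def D_def using that
          deriv_on_symmetric[OF A prism_dim U(2) vi[of j] vi[of i] sm0[OF sub[of i j] U(2)]]
        by (simp add: remove_at_remove_at[OF that])
    qed
    have anti: "t j i = - t i j" if "i < j" "j < ?n" for i j
      using sym[OF that] that(1) by (cases j) (auto simp: t_def)
    have "ext_deriv X (ext_deriv X \<omega>) c x vs = (\<Sum>i<?n. \<Sum>j<?n - 1. t i (if j < i then j else Suc j))"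
      using True unfolding ext_deriv_def[of X "ext_deriv X \<omega>"] c
      by (auto simp: remove_at_def[symmetric] summand t_def sum_distrib_left intro!: sum.cong)
    also have "\<dots> = 0"
    proof (rule antisymmetric_sum_zero)
      fix i j assume "i < ?n" "j < ?n" "i \<noteq> j"
      then show "t j i = - t i j" using anti[of i j] anti[of j i] by (cases i j rule: linorder_cases) auto
    qed
    finally show ?thesis by simp
  qed (simp add: ext_deriv_def)
qed

section \<open>The group of forms and integration over smooth simplices\<close>

lemma pullback_add: "pullback X Y f (\<omega> + \<omega>') = pullback X Y f \<omega> + pullback X Y f \<omega>'"
  and pullback_uminus: "pullback X Y f (- \<omega>) = - pullback X Y f \<omega>"
  and pullback_zero: "pullback X Y f 0 = 0"
  by (intro ext; simp add: pullback_def Let_def case_prod_unfold)+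

lemma formsI:
  assumes "\<And>c x vs. \<not> (form_arg X c x vs \<and> int (length vs) = k) \<Longrightarrow> \<omega> c x vs = 0"
    and "\<And>U \<phi> x. (U, \<phi>) \<in> atlas X \<Longrightarrow> x \<in> \<phi> ` U \<Longrightarrow> alternating_multilinear (tangents X) (\<omega> (U, \<phi>) x)"
    and "\<And>U \<phi> vs. (U, \<phi>) \<in> atlas X \<Longrightarrow> set vs \<subseteq> tangents X \<Longrightarrow>
      smooth_on_set (ambient_dim X) (\<phi> ` U) (\<lambda>x. \<omega> (U, \<phi>) x vs)"
    and "\<And>U \<phi> V \<psi> p vs. (U, \<phi>) \<in> atlas X \<Longrightarrow> (V, \<psi>) \<in> atlas X \<Longrightarrow> p \<in> U \<Longrightarrow> p \<in> V \<Longrightarrow> set vs \<subseteq> tangents X \<Longrightarrow>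
      \<omega> (U, \<phi>) (\<phi> p) vs = \<omega> (V, \<psi>) (\<psi> p)
        (map (tangent_map (ambient_dim X) (chart_dom U \<phi> V id) (chart_rep U \<phi> \<psi> id) (\<phi> p)) vs)"
  shows "\<omega> \<in> forms X k"
proof -
  have "chart_dom U \<phi> V id = \<phi> ` (U \<inter> V)" "chart_rep U \<phi> \<psi> id = (\<lambda>x. \<psi> (inv_into U \<phi> x))"
    for U V \<phi> and \<psi> :: "'a \<Rightarrow> nat \<Rightarrow> real"
    by (auto simp: chart_dom_def chart_rep_def)
  note tr = assms(4)[unfolded this]
  show ?thesis unfolding forms_def mem_Collect_eq
  proof (intro conjI allI impI)
    show "\<forall>(U, \<phi>)\<in>atlas X. (\<forall>x\<in>\<phi> ` U. alternating_multilinear (tangents X) (\<omega> (U, \<phi>) x)) \<and>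
        (\<forall>vs. set vs \<subseteq> tangents X \<longrightarrow> smooth_on_set (ambient_dim X) (\<phi> ` U) (\<lambda>x. \<omega> (U, \<phi>) x vs))"
      using assms(2,3) by blast
    show "\<forall>(U, \<phi>)\<in>atlas X. \<forall>(V, \<psi>)\<in>atlas X. \<forall>p\<in>U \<inter> V. \<forall>vs. set vs \<subseteq> tangents X \<longrightarrow>
        \<omega> (U, \<phi>) (\<phi> p) vs = \<omega> (V, \<psi>) (\<psi> p)
          (map (tangent_map (ambient_dim X) (\<phi> ` (U \<inter> V)) (\<lambda>x. \<psi> (inv_into U \<phi> x)) (\<phi> p)) vs)"
      using tr by blast
  qed (rule assms(1))
qed

lemma zero_in_forms:
  assumes "prism_space X n m"
  shows "0 \<in> forms X k"
proof -
  interpret prism_space X n m by fact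
  show ?thesis
    by (rule formsI)
      (auto simp: alternating_multilinear_def smooth_on_set_iff intro!: smooth_at_const chart_image_RN)
qed

lemma uminus_in_forms:
  assumes "\<omega> \<in> forms X k"
  shows "- \<omega> \<in> forms X k"
proof (rule formsI)
  show "alternating_multilinear (tangents X) ((- \<omega>) (U, \<phi>) x)" if "(U, \<phi>) \<in> atlas X" "x \<in> \<phi> ` U" for U \<phi> x
    using forms_multilinear[OF assms that] by (auto simp: alternating_multilinear_def)
  show "smooth_on_set (ambient_dim X) (\<phi> ` U) (\<lambda>x. (- \<omega>) (U, \<phi>) x vs)"
    if "(U, \<phi>) \<in> atlas X" "set vs \<subseteq> tangents X" for U \<phi> vs
    unfolding smooth_on_set_iff
  proof
    fix x assume "x \<in> \<phi> ` U"
    then have "smooth_at (ambient_dim X) (\<phi> ` U) (\<lambda>x. \<omega> (U, \<phi>) x vs) x"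
      by (rule smooth_on_setD[OF forms_smooth[OF assms that]])
    from smooth_at_scaleR[OF smooth_at_const[OF smooth_at_RN[OF this]] this, of "-1"]
    show "smooth_at (ambient_dim X) (\<phi> ` U) (\<lambda>x. (- \<omega>) (U, \<phi>) x vs) x" by simp
  qed
  show "(- \<omega>) (U, \<phi>) (\<phi> p) vs = (- \<omega>) (V, \<psi>) (\<psi> p)
      (map (tangent_map (ambient_dim X) (chart_dom U \<phi> V id) (chart_rep U \<phi> \<psi> id) (\<phi> p)) vs)"
    if "(U, \<phi>) \<in> atlas X" "(V, \<psi>) \<in> atlas X" "p \<in> U" "p \<in> V" "set vs \<subseteq> tangents X" for U \<phi> V \<psi> p vs
    using forms_transition[OF assms that] by simp
qed (use forms_outside[OF assms] in simp)

lemma add_in_forms: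
  assumes "\<omega> \<in> forms X k" "\<omega>' \<in> forms X k"
  shows "\<omega> + \<omega>' \<in> forms X k"
proof (rule formsI)
  show "alternating_multilinear (tangents X) ((\<omega> + \<omega>') (U, \<phi>) x)" if "(U, \<phi>) \<in> atlas X" "x \<in> \<phi> ` U" for U \<phi> x
    using forms_multilinear[OF assms(1) that] forms_multilinear[OF assms(2) that]
    by (simp add: alternating_multilinear_def algebra_simps)
  show "smooth_on_set (ambient_dim X) (\<phi> ` U) (\<lambda>x. (\<omega> + \<omega>') (U, \<phi>) x vs)"
    if "(U, \<phi>) \<in> atlas X" "set vs \<subseteq> tangents X" for U \<phi> vs
    using forms_smooth[OF assms(1) that] forms_smooth[OF assms(2) that]
    by (simp add: smooth_on_set_iff smooth_at_add)
  show "(\<omega> + \<omega>') (U, \<phi>) (\<phi> p) vs = (\<omega> + \<omega>') (V, \<psi>) (\<psi> p)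
      (map (tangent_map (ambient_dim X) (chart_dom U \<phi> V id) (chart_rep U \<phi> \<psi> id) (\<phi> p)) vs)"
    if "(U, \<phi>) \<in> atlas X" "(V, \<psi>) \<in> atlas X" "p \<in> U" "p \<in> V" "set vs \<subseteq> tangents X" for U \<phi> V \<psi> p vs
    using forms_transition[OF assms(1) that] forms_transition[OF assms(2) that] by simp
qed (use forms_outside[OF assms(1)] forms_outside[OF assms(2)] in simp)

lemma forms_negative: "k < 0 \<Longrightarrow> forms X k \<subseteq> {0}"
  using forms_outside[of _ X k] by (force simp: fun_eq_iff)

lemma integrate_form_eq:
  "integrate_form X k \<sigma> \<omega> = simplex_integral k (\<lambda>y.
     pullback (std_simplex k) X \<sigma> \<omega> (standard_simplex k, \<lambda>x. x) y (map edge_vector [1..<Suc k]))"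
  unfolding integrate_form_def simplex_integral_def ..

lemma smooth_simplicesD:
  assumes "\<sigma> \<in> smooth_simplices X k"
  shows "0 \<le> k" "singular_simplex (nat k) (space_top X) \<sigma>" "smooth_map (std_simplex (nat k)) X \<sigma>"
  using assms by (auto simp: smooth_simplices_def)

lemma prism_map_smooth_simplex:
  assumes "prism_space X n m" "\<sigma> \<in> smooth_simplices X (int k)"
  shows "prism_map (std_simplex k) k 0 X n m \<sigma>"
proof -
  interpret prism_space X n m by fact
  interpret S: prism_space "std_simplex k" k 0 by (rule prism_space_std_simplex)
  show ?thesis by unfold_locales (use smooth_simplicesD[OF assms(2)] in simp)
qed

lemma simplex_map_smooth:
  assumes "prism_map X n m Y n' m' f" "\<sigma> \<in> smooth_simplices X k"
  shows "simplex_map (nat k) f \<sigma> \<in> smooth_simplices Y k"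
proof -
  interpret prism_map X n m Y n' m' f by fact
  interpret S: prism_space "std_simplex (nat k)" "nat k" 0 by (rule prism_space_std_simplex)
  note \<sigma> = smooth_simplicesD[OF assms(2)]
  have "smooth_map (std_simplex (nat k)) Y (f \<circ> \<sigma>)"
    by (rule smooth_map_compose[OF S.charted_space_axioms X.charted_space_axioms Y.charted_space_axioms \<sigma>(3) smooth])
  then have "smooth_map (std_simplex (nat k)) Y (simplex_map (nat k) f \<sigma>)"
    by (rule smooth_map_cong[OF S.charted_space_axioms]) (simp add: simplex_map_def euclidean_product_topology)
  then show ?thesis
    using \<sigma> singular_simplex_simplex_map[OF \<sigma>(2) smooth_map_continuous[OF smooth]]
    by (simp add: smooth_simplices_def)
qed

lemma prism_map_simplical_face:
  assumes "i \<le> Suc k"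
  shows "prism_map (std_simplex k) k 0 (std_simplex (Suc k)) (Suc k) 0 (simplical_face i)"
proof -
  interpret S: prism_space "std_simplex k" k 0 by (rule prism_space_std_simplex)
  interpret T: prism_space "std_simplex (Suc k)" "Suc k" 0 by (rule prism_space_std_simplex)
  show ?thesis by unfold_locales (rule smooth_map_simplical_face[OF assms])
qed

lemma singular_face_smooth:
  assumes "prism_space X n m" "\<sigma> \<in> smooth_simplices X (int (Suc k))" "i \<le> Suc k"
  shows "singular_face (Suc k) i \<sigma> \<in> smooth_simplices X (int k)"
proof -
  interpret prism_map "std_simplex (Suc k)" "Suc k" 0 X n m \<sigma>
    by (rule prism_map_smooth_simplex[OF assms(1,2)])
  interpret F: prism_map "std_simplex k" k 0 "std_simplex (Suc k)" "Suc k" 0 "simplical_face i"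
    by (rule prism_map_simplical_face[OF assms(3)])
  have "smooth_map (std_simplex k) X (\<sigma> \<circ> simplical_face i)"
    by (rule smooth_map_compose[OF F.X.charted_space_axioms X.charted_space_axioms Y.charted_space_axioms F.smooth smooth])
  then have "smooth_map (std_simplex k) X (singular_face (Suc k) i \<sigma>)"
    by (rule smooth_map_cong[OF F.X.charted_space_axioms]) (simp add: singular_face_def)
  then show ?thesis
    using singular_simplex_singular_face[of "Suc k" "space_top X" \<sigma> i] smooth_simplicesD[OF assms(2)] assms(3)
    by (simp add: smooth_simplices_def nat_add_distrib)
qed

text \<open>Both integrals are defined by pulling \<open>\<omega>\<close> back to the standard
  simplex along the same composite map, so functoriality takes the place of a substitution
  rule.\<close>

lemma integrate_form_simplex_map:
  assumes "prism_map X n m Y n' m' f" "\<sigma> \<in> smooth_simplices X (int k)"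
  shows "integrate_form Y k (simplex_map k f \<sigma>) \<omega> = integrate_form X k \<sigma> (pullback X Y f \<omega>)"
proof -
  interpret prism_map X n m Y n' m' f by fact
  have "pullback (std_simplex k) X \<sigma> (pullback X Y f \<omega>) = pullback (std_simplex k) Y (f \<circ> \<sigma>) \<omega>"
    by (rule pullback_compose[OF prism_map_smooth_simplex[OF X.prism_space_axioms assms(2)] assms(1)])
  moreover have "pullback (std_simplex k) Y (simplex_map k f \<sigma>) = pullback (std_simplex k) Y (f \<circ> \<sigma>)"
    by (rule pullback_cong[OF prism_space_std_simplex]) (simp add: simplex_map_def)
  ultimately show ?thesis unfolding integrate_form_eq by simp
qed

context
  fixes X :: "'a charted" and n m k \<sigma>
  assumes X: "prism_space X n m" and \<sigma>: "\<sigma> \<in> smooth_simplices X (int k)"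
begin

interpretation prism_map "std_simplex k" k 0 X n m \<sigma> by (rule prism_map_smooth_simplex[OF X \<sigma>])

lemma continuous_on_integrand:
  assumes "\<omega> \<in> forms X j"
  shows "continuous_on (standard_simplex k) (\<lambda>y.
    pullback (std_simplex k) X \<sigma> \<omega> (standard_simplex k, \<lambda>x. x) y (map edge_vector [1..<Suc k]))"
proof -
  have a: "(standard_simplex k, \<lambda>x. x) \<in> atlas (std_simplex k)" by simp
  have "set (map edge_vector [1..<Suc k]) \<subseteq> tangents (std_simplex k)"
    using edge_vector_tangent[of _ k] by (auto simp del: upt_Suc)
  from pullback_smooth[OF assms a this] show ?thesis
    by (intro smooth_on_set_imp_continuous_on[OF _ standard_simplex_RN]) simp
qed

lemma integrate_form_add:
  assumes "\<omega> \<in> forms X j" "\<omega>' \<in> forms X j"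
  shows "integrate_form X k \<sigma> (\<omega> + \<omega>') = integrate_form X k \<sigma> \<omega> + integrate_form X k \<sigma> \<omega>'"
  unfolding integrate_form_eq pullback_add plus_fun_apply
  by (rule simplex_integral_add; rule continuous_on_integrand; rule assms)

end

text \<open>A coface map is the restriction of a linear map and hence its own derivative. The map
  \<open>f\<close> stands for its coordinate expression, which is known to agree with it on the
  simplex only.\<close>

lemma tangent_map_simplical_face:
  assumes "y \<in> standard_simplex k" "v \<in> prism_tangents k 0" "\<And>z. z \<in> standard_simplex k \<Longrightarrow> f z = simplical_face i z"
  shows "tangent_map (Suc k) (standard_simplex k) f y v = simplical_face i v"
proof
  fix j
  have N: "Suc k = Suc k + 0" by simp
  note A = prism_open_standard_simplex[of k]
  have yR: "y \<in> RN (Suc k)" using assms(1) standard_simplex_RN by blast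
  have eq: "deriv_on (Suc k) (standard_simplex k) (\<lambda>z. f z j) y v = d"
    if "smooth_at (Suc k) (standard_simplex k) g y" "\<And>z. z \<in> standard_simplex k \<Longrightarrow> simplical_face i z j = g z"
      "deriv_on (Suc k) (standard_simplex k) g y v = d" for g d
    unfolding that(3)[symmetric] by (rule deriv_on_eq_on[OF A N assms(1,2) that(1)]) (simp add: assms(3) that(2))
  show "tangent_map (Suc k) (standard_simplex k) f y v j = simplical_face i v j"
    unfolding tangent_map_def
  proof (cases j i rule: linorder_cases)
    case less
    show "deriv_on (Suc k) (standard_simplex k) (\<lambda>z. f z j) y v = simplical_face i v j"
      by (rule eq[where g = "\<lambda>z. z j"])
        (use less in \<open>simp_all add: simplical_face_def smooth_at_coord[OF yR] deriv_on_coord[OF A N assms(1,2)]\<close>)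
  next
    case equal
    show "deriv_on (Suc k) (standard_simplex k) (\<lambda>z. f z j) y v = simplical_face i v j"
      by (rule eq[where g = "\<lambda>z. 0"])
        (use equal in \<open>simp_all add: simplical_face_def smooth_at_const[OF yR] deriv_on_const[OF A N assms(1,2)]\<close>)
  next
    case greater
    show "deriv_on (Suc k) (standard_simplex k) (\<lambda>z. f z j) y v = simplical_face i v j"
      by (rule eq[where g = "\<lambda>z. z (j - 1)"])
        (use greater in \<open>simp_all add: simplical_face_def smooth_at_coord[OF yR] deriv_on_coord[OF A N assms(1,2)]\<close>)
  qed
qed

text \<open>Stokes' theorem for smooth simplices: \<open>pullback_ext_deriv\<close> moves the
  exterior derivative to the standard simplex, \<open>stokes_simplex\<close> is applied there, and
  functoriality of the pullback recognises the faces of \<open>\<sigma>\<close>.\<close>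

lemma integrate_form_ext_deriv:
  assumes X: "prism_space X n m" and \<sigma>: "\<sigma> \<in> smooth_simplices X (int (Suc k))" and \<omega>: "\<omega> \<in> forms X j"
  shows "integrate_form X (Suc k) \<sigma> (ext_deriv X \<omega>) =
    (\<Sum>i\<le>Suc k. (- 1) ^ i * integrate_form X k (singular_face (Suc k) i \<sigma>) \<omega>)"
proof -
  interpret prism_map "std_simplex (Suc k)" "Suc k" 0 X n m \<sigma> by (rule prism_map_smooth_simplex[OF X \<sigma>])
  let ?S = "standard_simplex (Suc k)"
  have a: "(?S, \<lambda>x. x) \<in> atlas (std_simplex (Suc k))" by simp
  define es where "es = map edge_vector [1..<Suc (Suc k)]"
  define \<eta> where "\<eta> y vs = pullback (std_simplex (Suc k)) X \<sigma> \<omega> (?S, \<lambda>x. x) y vs" for y vs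
  have es: "set es \<subseteq> tangents (std_simplex (Suc k))"
    using edge_vector_tangent[of _ "Suc k"] by (auto simp: es_def simp del: upt_Suc)
  have len: "length es = Suc k" by (simp add: es_def del: upt_Suc)
  have "integrate_form X (Suc k) \<sigma> (ext_deriv X \<omega>) = simplex_integral (Suc k) (\<lambda>y. \<Sum>i<Suc k. (- 1) ^ i *
      deriv_on (Suc (Suc k)) ?S (\<lambda>z. \<eta> z (remove_at i es)) y (es ! i))"
    unfolding integrate_form_eq es_def[symmetric] \<eta>_def
  proof (rule simplex_integral_cong)
    fix y assume "y \<in> ?S"
    then show "pullback (std_simplex (Suc k)) X \<sigma> (ext_deriv X \<omega>) (?S, \<lambda>x. x) y es =
        (\<Sum>i<Suc k. (- 1) ^ i * deriv_on (Suc (Suc k)) ?S (\<lambda>z. pullback (std_simplex (Suc k)) X \<sigma> \<omega> (?S, \<lambda>x. x) z (remove_at i es)) y (es ! i))"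
      using pullback_ext_deriv[OF \<omega> a es, of y] by (simp only: len image_ident std_simplex_simps)
  qed
  also have "\<dots> = (\<Sum>i\<le>Suc k. (- 1) ^ i *
      simplex_integral k (\<lambda>y. \<eta> (simplical_face i y) (map (simplical_face i) (map edge_vector [1..<Suc k]))))"
    unfolding es_def
  proof (rule stokes_simplex)
    show "alternating_multilinear (prism_tangents (Suc k) 0) (\<eta> y)" if "y \<in> ?S" for y
      using pullback_multilinear[OF \<omega> a, of y] that by (simp add: \<eta>_def[abs_def])
    show "smooth_on_set (Suc (Suc k)) ?S (\<lambda>y. \<eta> y vs)" if "set vs \<subseteq> prism_tangents (Suc k) 0" for vs
      using pullback_smooth[OF \<omega> a, of vs] that by (simp add: \<eta>_def)
  qed
  also have "\<dots> = (\<Sum>i\<le>Suc k. (- 1) ^ i * integrate_form X k (singular_face (Suc k) i \<sigma>) \<omega>)"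
  proof (intro sum.cong refl arg_cong2[where f = "(*)"])
    fix i assume "i \<in> {..Suc k}"
    then have i: "i \<le> Suc k" by simp
    interpret F: prism_map "std_simplex k" k 0 "std_simplex (Suc k)" "Suc k" 0 "simplical_face i"
      by (rule prism_map_simplical_face[OF i])
    show "simplex_integral k (\<lambda>y. \<eta> (simplical_face i y) (map (simplical_face i) (map edge_vector [1..<Suc k]))) =
        integrate_form X k (singular_face (Suc k) i \<sigma>) \<omega>"
      unfolding integrate_form_eq
    proof (rule simplex_integral_cong)
      fix y assume y: "y \<in> standard_simplex k"
      let ?es = "map edge_vector [1..<Suc k]"
      have es': "set ?es \<subseteq> tangents (std_simplex k)"
        using edge_vector_tangent[of _ k] by (auto simp del: upt_Suc)
      have ak: "(standard_simplex k, \<lambda>x. x) \<in> atlas (std_simplex k)" by simp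
      \<comment> \<open>The simplex has a single chart, so the selection made by
        \<open>target_chart\<close> is forced.\<close>
      have t: "target_chart (std_simplex (Suc k)) (simplical_face i y) = (?S, \<lambda>x. x)"
        using X.target_chart[of "simplical_face i y"] simplical_face_simplex[OF i y]
        by (cases "target_chart (std_simplex (Suc k)) (simplical_face i y)") auto
      have inv: "inv_into (standard_simplex k) (\<lambda>x. x) z = z" if "z \<in> standard_simplex k" for z
        using that by (metis inj_on_id2 inv_into_f_f)
      have dom: "chart_dom (standard_simplex k) (\<lambda>x. x) ?S (simplical_face i) = standard_simplex k"
        using simplical_face_simplex[OF i] by (auto simp: chart_dom_def)
      have rep: "chart_rep (standard_simplex k) (\<lambda>x. x) (\<lambda>x. x) (simplical_face i) z = simplical_face i z"
        if "z \<in> standard_simplex k" for z using that by (simp add: chart_rep_def inv)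
      have "pullback (std_simplex k) X (singular_face (Suc k) i \<sigma>) = pullback (std_simplex k) X (\<sigma> \<circ> simplical_face i)"
        by (rule pullback_cong[OF prism_space_std_simplex]) (simp add: singular_face_def)
      then have "pullback (std_simplex k) X (singular_face (Suc k) i \<sigma>) \<omega> =
          pullback (std_simplex k) (std_simplex (Suc k)) (simplical_face i) (pullback (std_simplex (Suc k)) X \<sigma> \<omega>)"
        using pullback_compose[OF F.prism_map_axioms prism_map_axioms] by simp
      then have "pullback (std_simplex k) X (singular_face (Suc k) i \<sigma>) \<omega> (standard_simplex k, \<lambda>x. x) y ?es =
          \<eta> (simplical_face i y) (map (tangent_map (Suc k) (standard_simplex k)
            (chart_rep (standard_simplex k) (\<lambda>x. x) (\<lambda>x. x) (simplical_face i)) y) ?es)"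
        using F.pullback_target_chart[OF ak y es' t] by (simp add: dom \<eta>_def del: upt_Suc)
      also have "map (tangent_map (Suc k) (standard_simplex k)
            (chart_rep (standard_simplex k) (\<lambda>x. x) (\<lambda>x. x) (simplical_face i)) y) ?es = map (simplical_face i) ?es"
        using es' by (intro map_cong refl tangent_map_simplical_face[OF y _ rep]) (auto simp del: upt_Suc)
      finally show "\<eta> (simplical_face i y) (map (simplical_face i) ?es) =
          pullback (std_simplex k) X (singular_face (Suc k) i \<sigma>) \<omega> (standard_simplex k, \<lambda>x. x) y ?es" by simp
    qed
  qed
  finally show ?thesis .
qed

section \<open>Cochain complexes of abelian groups\<close>

lemma comm_group_restrict:
  assumes "comm_group G" "subgroup H G"
  shows "comm_group (G\<lparr>carrier := H\<rparr>)"
proof -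
  interpret comm_group G by fact
  show ?thesis
    by (rule group.group_comm_groupI[OF subgroup.subgroup_is_group[OF assms(2) is_group]])
      (use subgroup.subset[OF assms(2)] m_comm in auto)
qed

lemma comm_group_DirProd: "comm_group G \<Longrightarrow> comm_group H \<Longrightarrow> comm_group (G \<times>\<times> H)"
  by (rule group.group_comm_groupI[OF DirProd_group])
    (auto simp: comm_group.axioms(2) comm_monoid.m_comm[OF comm_group.axioms(1)])

locale group_complex =
  fixes C :: "'x cochain_complex"
  assumes comm_grp: "comm_group (grp C k)"
    and diff_hom: "diff C k \<in> hom (grp C k) (grp C (k + 1))"
    and diff_diff: "x \<in> carrier (grp C k) \<Longrightarrow> diff C (k + 1) (diff C k x) = \<one>\<^bsub>grp C (k + 1 + 1)\<^esub>"
begin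

lemma group_grp: "group (grp C k)"
  using comm_grp comm_group.axioms(2) by blast

lemma group_hom_diff: "group_hom (grp C k) (grp C (k + 1)) (diff C k)"
  by (simp add: group_hom_def group_hom_axioms_def group_grp diff_hom)

lemma diff_closed: "x \<in> carrier (grp C k) \<Longrightarrow> diff C k x \<in> carrier (grp C (k + 1))"
  using diff_hom by (auto simp: hom_def)

lemma diff_one: "diff C k \<one>\<^bsub>grp C k\<^esub> = \<one>\<^bsub>grp C (k + 1)\<^esub>"
  by (rule group_hom.hom_one[OF group_hom_diff])

lemma diff_mult: "x \<in> carrier (grp C k) \<Longrightarrow> y \<in> carrier (grp C k) \<Longrightarrow>
    diff C k (x \<otimes>\<^bsub>grp C k\<^esub> y) = diff C k x \<otimes>\<^bsub>grp C (k + 1)\<^esub> diff C k y"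
  by (rule hom_mult[OF diff_hom])

lemma diff_inv: "x \<in> carrier (grp C k) \<Longrightarrow> diff C k (inv\<^bsub>grp C k\<^esub> x) = inv\<^bsub>grp C (k + 1)\<^esub> diff C k x"
  by (rule group_hom.hom_inv[OF group_hom_diff])

lemma subgroup_cocycles: "subgroup (kernel (grp C k) (grp C (k + 1)) (diff C k)) (grp C k)"
  by (rule group_hom.subgroup_kernel[OF group_hom_diff])

lemma carrier_cocycles: "carrier (cocycles C k) = {x \<in> carrier (grp C k). diff C k x = \<one>\<^bsub>grp C (k + 1)\<^esub>}"
  by (simp add: cocycles_def kernel_def)

lemma cocycles_simps:
  "monoid.mult (cocycles C k) = monoid.mult (grp C k)" "one (cocycles C k) = one (grp C k)"
  by (simp_all add: cocycles_def)

lemma comm_group_cocycles: "comm_group (cocycles C k)"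
  unfolding cocycles_def by (rule comm_group_restrict[OF comm_grp subgroup_cocycles])

lemma subgroup_coboundaries: "subgroup (coboundaries C k) (cocycles C k)"
proof -
  interpret d: group_hom "grp C (k - 1)" "grp C k" "diff C (k - 1)"
    using group_hom_diff[of "k - 1"] by simp
  have s: "subgroup (coboundaries C k) (grp C k)"
    unfolding coboundaries_def by (rule d.img_is_subgroup)
  have "coboundaries C k \<subseteq> kernel (grp C k) (grp C (k + 1)) (diff C k)"
    unfolding coboundaries_def kernel_def using diff_diff[of _ "k - 1"] by auto
  then show ?thesis unfolding cocycles_def
    by (rule group.subgroup_incl[OF group_grp s subgroup_cocycles])
qed

end

locale group_complex_map = A: group_complex A + B: group_complex B
  for A :: "'x cochain_complex" and B :: "'y cochain_complex" +
  fixes f :: "int \<Rightarrow> 'x \<Rightarrow> 'y"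
  assumes map_hom: "f k \<in> hom (grp A k) (grp B k)"
    and map_diff: "x \<in> carrier (grp A k) \<Longrightarrow> f (k + 1) (diff A k x) = diff B k (f k x)"
begin

lemma group_hom_map: "group_hom (grp A k) (grp B k) (f k)"
  by (simp add: group_hom_def group_hom_axioms_def A.group_grp B.group_grp map_hom)

lemma map_closed: "x \<in> carrier (grp A k) \<Longrightarrow> f k x \<in> carrier (grp B k)"
  using map_hom by (auto simp: hom_def)

lemma map_one: "f k \<one>\<^bsub>grp A k\<^esub> = \<one>\<^bsub>grp B k\<^esub>"
  by (rule group_hom.hom_one[OF group_hom_map])

lemma map_mult: "x \<in> carrier (grp A k) \<Longrightarrow> y \<in> carrier (grp A k) \<Longrightarrow>
    f k (x \<otimes>\<^bsub>grp A k\<^esub> y) = f k x \<otimes>\<^bsub>grp B k\<^esub> f k y"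
  by (rule hom_mult[OF map_hom])

lemma map_inv: "x \<in> carrier (grp A k) \<Longrightarrow> f k (inv\<^bsub>grp A k\<^esub> x) = inv\<^bsub>grp B k\<^esub> f k x"
  by (rule group_hom.hom_inv[OF group_hom_map])

lemma mapping_cone_simps:
  "grp (mapping_cone A B f) k = grp A k \<times>\<times> grp B (k - 1)"
  "diff (mapping_cone A B f) k (a, b) = (diff A k a, f k a \<otimes>\<^bsub>grp B k\<^esub> inv\<^bsub>grp B k\<^esub> (diff B (k - 1) b))"
  by (simp_all add: mapping_cone_def)

text \<open>The square of the differential has the second component f(da) - d(f a) + d d b, which
  vanishes since \<open>f\<close> commutes with the differentials.\<close>

lemma group_complex_mapping_cone: "group_complex (mapping_cone A B f)"
proof (rule group_complex.intro)
  fix k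
  interpret Bk: comm_group "grp B k" by (rule B.comm_grp)
  interpret Bk1: comm_group "grp B (k + 1)" by (rule B.comm_grp)
  have dB: "diff B (k - 1) b \<in> carrier (grp B k)" if "b \<in> carrier (grp B (k - 1))" for b
    using B.diff_closed[OF that] by simp
  show "comm_group (grp (mapping_cone A B f) k)"
    unfolding mapping_cone_simps by (intro comm_group_DirProd A.comm_grp B.comm_grp)
  show "diff (mapping_cone A B f) k \<in> hom (grp (mapping_cone A B f) k) (grp (mapping_cone A B f) (k + 1))"
    unfolding mapping_cone_simps
  proof (rule homI)
    fix x assume "x \<in> carrier (grp A k \<times>\<times> grp B (k - 1))"
    then show "diff (mapping_cone A B f) k x \<in> carrier (grp A (k + 1) \<times>\<times> grp B (k + 1 - 1))"
      using A.diff_closed map_closed dB by (auto simp: mapping_cone_simps)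
  next
    fix x y assume xy: "x \<in> carrier (grp A k \<times>\<times> grp B (k - 1))" "y \<in> carrier (grp A k \<times>\<times> grp B (k - 1))"
    obtain a b a' b' where ab: "x = (a, b)" "y = (a', b')" by (metis surj_pair)
    have c: "a \<in> carrier (grp A k)" "a' \<in> carrier (grp A k)" "b \<in> carrier (grp B (k - 1))" "b' \<in> carrier (grp B (k - 1))"
      using xy by (auto simp: ab)
    have "diff B (k - 1) (b \<otimes>\<^bsub>grp B (k - 1)\<^esub> b') = diff B (k - 1) b \<otimes>\<^bsub>grp B k\<^esub> diff B (k - 1) b'"
      using B.diff_mult[OF c(3,4)] by simp
    then show "diff (mapping_cone A B f) k (x \<otimes>\<^bsub>grp A k \<times>\<times> grp B (k - 1)\<^esub> y) =
        diff (mapping_cone A B f) k x \<otimes>\<^bsub>grp A (k + 1) \<times>\<times> grp B (k + 1 - 1)\<^esub> diff (mapping_cone A B f) k y"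
      using c dB[OF c(3)] dB[OF c(4)] map_closed[OF c(1)] map_closed[OF c(2)]
      by (simp add: ab mapping_cone_simps A.diff_mult map_mult Bk.inv_mult Bk.m_ac)
  qed
  fix x assume "x \<in> carrier (grp (mapping_cone A B f) k)"
  then obtain a b where ab: "x = (a, b)" "a \<in> carrier (grp A k)" "b \<in> carrier (grp B (k - 1))"
    by (auto simp: mapping_cone_simps)
  have "diff B k (inv\<^bsub>grp B k\<^esub> diff B (k - 1) b) = \<one>\<^bsub>grp B (k + 1)\<^esub>"
    using B.diff_inv[OF dB[OF ab(3)]] B.diff_diff[OF ab(3)] by simp
  then have "diff B k (f k a \<otimes>\<^bsub>grp B k\<^esub> inv\<^bsub>grp B k\<^esub> (diff B (k - 1) b)) = diff B k (f k a)"
    using B.diff_mult[OF map_closed[OF ab(2)] Bk.inv_closed[OF dB[OF ab(3)]]] B.diff_closed[OF map_closed[OF ab(2)]] by simp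
  then show "diff (mapping_cone A B f) (k + 1) (diff (mapping_cone A B f) k x) = \<one>\<^bsub>grp (mapping_cone A B f) (k + 1 + 1)\<^esub>"
    using A.diff_diff[OF ab(2)] map_diff[OF ab(2)] B.diff_closed[OF map_closed[OF ab(2)]]
    by (simp add: ab(1) mapping_cone_simps add.commute[of 1])
qed

end

lemma direct_sum_simps:
  "grp (direct_sum A B) k = grp A k \<times>\<times> grp B k"
  "diff (direct_sum A B) k (a, b) = (diff A k a, diff B k b)"
  by (simp_all add: direct_sum_def)

lemma truncation_simps:
  "k \<le> j \<Longrightarrow> grp (truncation k A) j = grp A j"
  "j < k \<Longrightarrow> grp (truncation k A) j = (grp A j)\<lparr>carrier := {\<one>\<^bsub>grp A j\<^esub>}\<rparr>"
  "diff (truncation k A) = diff A"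
  by (simp_all add: truncation_def)

lemma group_complex_direct_sum:
  assumes "group_complex A" "group_complex B"
  shows "group_complex (direct_sum A B)"
proof -
  interpret A: group_complex A by fact
  interpret B: group_complex B by fact
  show ?thesis
  proof (rule group_complex.intro)
    fix k
    show "comm_group (grp (direct_sum A B) k)"
      unfolding direct_sum_def by (simp add: comm_group_DirProd A.comm_grp B.comm_grp)
    show "diff (direct_sum A B) k \<in> hom (grp (direct_sum A B) k) (grp (direct_sum A B) (k + 1))"
      unfolding direct_sum_def
      by (auto simp: hom_def A.diff_closed B.diff_closed A.diff_mult B.diff_mult)
    show "diff (direct_sum A B) (k + 1) (diff (direct_sum A B) k x) = \<one>\<^bsub>grp (direct_sum A B) (k + 1 + 1)\<^esub>"
      if "x \<in> carrier (grp (direct_sum A B) k)" for x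
      using that by (auto simp: direct_sum_def A.diff_diff B.diff_diff)
  qed
qed

text \<open>Below degree \<open>k\<close> only neutral elements remain, so the differential into
  degree \<open>k\<close> becomes trivial as well.\<close>

lemma group_complex_truncation:
  assumes "group_complex A"
  shows "group_complex (truncation k A)"
proof -
  interpret A: group_complex A by fact
  have t: "subgroup {\<one>\<^bsub>grp A j\<^esub>} (grp A j)" for j
    by (rule group.triv_subgroup[OF A.group_grp])
  show ?thesis
  proof (rule group_complex.intro)
    fix j
    show "comm_group (grp (truncation k A) j)"
      using comm_group_restrict[OF A.comm_grp t] A.comm_grp by (simp add: truncation_def)
    show "diff (truncation k A) j \<in> hom (grp (truncation k A) j) (grp (truncation k A) (j + 1))"
    proof -
      interpret m: comm_group "grp A j" by (rule A.comm_grp)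
      interpret n: comm_group "grp A (j + 1)" by (rule A.comm_grp)
      show ?thesis using A.diff_hom[of j] by (auto simp: truncation_def hom_def A.diff_one)
    qed
    show "diff (truncation k A) (j + 1) (diff (truncation k A) j x) = \<one>\<^bsub>grp (truncation k A) (j + 1 + 1)\<^esub>"
      if "x \<in> carrier (grp (truncation k A) j)" for x
      using that A.diff_diff by (auto simp: truncation_def A.diff_one split: if_splits)
  qed
qed

lemma group_complex_map_truncation:
  assumes "group_complex_map A B f"
  shows "group_complex_map (truncation k A) B f"
proof -
  interpret f: group_complex_map A B f by fact
  interpret T: group_complex "truncation k A" by (rule group_complex_truncation[OF f.A.group_complex_axioms])
  show ?thesis
  proof
    fix j
    interpret m: comm_group "grp A j" by (rule f.A.comm_grp)
    interpret n: comm_group "grp B j" by (rule f.B.comm_grp)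
    show "f j \<in> hom (grp (truncation k A) j) (grp B j)"
      using f.map_hom[of j] by (auto simp: truncation_def hom_def f.map_one)
    show "f (j + 1) (diff (truncation k A) j x) = diff B j (f j x)" if "x \<in> carrier (grp (truncation k A) j)" for x
      using that f.map_diff by (auto simp: truncation_def split: if_splits)
  qed
qed

section \<open>Quotients by images\<close>

text \<open>\<open>\<Xi>\<close> is the inverse of the isomorphism \<open>K2 Mod B' \<cong> K1 Mod B1\<close> induced by \<open>p\<close>, where \<open>B'\<close> is the preimage
  of \<open>B1\<close>, followed by the projection to \<open>K2 Mod B2\<close>. Its kernel is \<open>p ` B2\<close> modulo \<open>B1\<close>.\<close>

lemma factor_group_correspondence:
  assumes K1: "comm_group K1" and K2: "comm_group K2" and E: "group E"
    and B1: "subgroup B1 K1" and B2: "subgroup B2 K2"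
    and p: "p \<in> hom K2 K1" "p ` carrier K2 = carrier K1"
    and pB: "\<And>x. x \<in> carrier K2 \<Longrightarrow> p x \<in> B1 \<Longrightarrow> x \<in> B2"
    and q: "q \<in> hom E K1"
    and qp: "\<And>e. e \<in> carrier E \<Longrightarrow> \<exists>x\<in>B2. \<exists>b\<in>B1. q e = b \<otimes>\<^bsub>K1\<^esub> p x"
    and pq: "\<And>x. x \<in> B2 \<Longrightarrow> \<exists>e\<in>carrier E. \<exists>b\<in>B1. p x = b \<otimes>\<^bsub>K1\<^esub> q e"
  shows "\<exists>\<Xi>\<in>hom (K1 Mod B1) (K2 Mod B2). \<Xi> ` carrier (K1 Mod B1) = carrier (K2 Mod B2) \<and>
    (K1 Mod B1)\<lparr>carrier := kernel (K1 Mod B1) (K2 Mod B2) \<Xi>\<rparr> \<cong> E Mod {e \<in> carrier E. q e \<in> B1}"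
proof -
  interpret K1: comm_group K1 by fact
  interpret K2: comm_group K2 by fact
  interpret E: group E by fact
  interpret B1: subgroup B1 K1 by fact
  interpret B2: subgroup B2 K2 by fact
  interpret N1: normal B1 K1 by (rule K1.subgroup_imp_normal[OF B1])
  interpret N2: normal B2 K2 by (rule K2.subgroup_imp_normal[OF B2])
  interpret F1: group "K1 Mod B1" by (rule N1.factorgroup_is_group)
  interpret F2: group "K2 Mod B2" by (rule N2.factorgroup_is_group)
  interpret p: group_hom K2 K1 p by unfold_locales (rule p(1))
  have qc: "q e \<in> carrier K1" if "e \<in> carrier E" for e using q that by (auto simp: hom_def)
  have rc1: "X \<in> carrier (K1 Mod B1) \<longleftrightarrow> (\<exists>x\<in>carrier K2. X = B1 #>\<^bsub>K1\<^esub> p x)" for X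
    by (auto simp: FactGroup_def RCOSETS_def p(2)[symmetric])
  have rc2: "X \<in> carrier (K2 Mod B2) \<longleftrightarrow> (\<exists>x\<in>carrier K2. X = B2 #>\<^bsub>K2\<^esub> x)" for X
    by (auto simp: FactGroup_def RCOSETS_def)
  have absorb1: "B1 #>\<^bsub>K1\<^esub> (b \<otimes>\<^bsub>K1\<^esub> x) = B1 #>\<^bsub>K1\<^esub> x" if "b \<in> B1" "x \<in> carrier K1" for b x
    using K1.repr_independence[OF _ that(2) B1, of "b \<otimes>\<^bsub>K1\<^esub> x"] that by (auto simp: r_coset_def)
  \<comment> \<open>A preimage under \<open>p\<close> of some element of the coset is chosen; by
    \<open>pB\<close> the resulting coset does not depend on the choice.\<close>
  define \<Xi> where "\<Xi> X = B2 #>\<^bsub>K2\<^esub> (SOME y. y \<in> carrier K2 \<and> p y \<in> X)" for X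
  have \<Xi>: "\<Xi> (B1 #>\<^bsub>K1\<^esub> p x) = B2 #>\<^bsub>K2\<^esub> x" if x: "x \<in> carrier K2" for x
  proof -
    define y where "y = (SOME y. y \<in> carrier K2 \<and> p y \<in> B1 #>\<^bsub>K1\<^esub> p x)"
    have "\<exists>y. y \<in> carrier K2 \<and> p y \<in> B1 #>\<^bsub>K1\<^esub> p x" using x K1.rcos_self[OF p.hom_closed[OF x] B1] by auto
    then have "y \<in> carrier K2 \<and> p y \<in> B1 #>\<^bsub>K1\<^esub> p x" unfolding y_def by (rule someI_ex)
    then have y: "y \<in> carrier K2" "p y \<in> B1 #>\<^bsub>K1\<^esub> p x" by blast+
    obtain b where b: "b \<in> B1" "p y = b \<otimes>\<^bsub>K1\<^esub> p x" using y(2) by (auto simp: r_coset_def)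
    have "p (y \<otimes>\<^bsub>K2\<^esub> inv\<^bsub>K2\<^esub> x) = b"
      using b x y(1) by (simp add: K1.m_assoc)
    then have "y \<otimes>\<^bsub>K2\<^esub> inv\<^bsub>K2\<^esub> x \<in> B2" using b(1) x y(1) pB by simp
    then have "y \<in> B2 #>\<^bsub>K2\<^esub> x"
      unfolding r_coset_def using x y(1) by (auto simp: K2.m_assoc intro!: bexI[of _ "y \<otimes>\<^bsub>K2\<^esub> inv\<^bsub>K2\<^esub> x"])
    then show ?thesis unfolding \<Xi>_def y_def[symmetric] using K2.repr_independence[OF _ x B2] by simp
  qed
  have hom: "\<Xi> \<in> hom (K1 Mod B1) (K2 Mod B2)"
  proof (rule homI)
    show "\<Xi> X \<in> carrier (K2 Mod B2)" if "X \<in> carrier (K1 Mod B1)" for X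
      using that \<Xi> by (auto simp: rc1 rc2)
    fix X Y assume "X \<in> carrier (K1 Mod B1)" "Y \<in> carrier (K1 Mod B1)"
    then obtain x y where xy: "x \<in> carrier K2" "X = B1 #>\<^bsub>K1\<^esub> p x" "y \<in> carrier K2" "Y = B1 #>\<^bsub>K1\<^esub> p y"
      by (auto simp: rc1)
    have "X \<otimes>\<^bsub>K1 Mod B1\<^esub> Y = B1 #>\<^bsub>K1\<^esub> p (x \<otimes>\<^bsub>K2\<^esub> y)"
      using xy by (simp add: N1.rcos_sum)
    then have "\<Xi> (X \<otimes>\<^bsub>K1 Mod B1\<^esub> Y) = B2 #>\<^bsub>K2\<^esub> (x \<otimes>\<^bsub>K2\<^esub> y)"
      using \<Xi>[of "x \<otimes>\<^bsub>K2\<^esub> y"] xy(1,3) by (simp del: p.hom_mult)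
    also have "\<dots> = \<Xi> X \<otimes>\<^bsub>K2 Mod B2\<^esub> \<Xi> Y"
      using xy by (simp add: \<Xi> N2.rcos_sum)
    finally show "\<Xi> (X \<otimes>\<^bsub>K1 Mod B1\<^esub> Y) = \<Xi> X \<otimes>\<^bsub>K2 Mod B2\<^esub> \<Xi> Y" .
  qed
  have surj: "\<Xi> ` carrier (K1 Mod B1) = carrier (K2 Mod B2)"
  proof (intro equalityI subsetI)
    fix Y assume "Y \<in> carrier (K2 Mod B2)"
    then obtain x where x: "x \<in> carrier K2" "Y = B2 #>\<^bsub>K2\<^esub> x" by (auto simp: rc2)
    then have "\<Xi> (B1 #>\<^bsub>K1\<^esub> p x) = Y" "B1 #>\<^bsub>K1\<^esub> p x \<in> carrier (K1 Mod B1)" using \<Xi> by (auto simp: rc1)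
    then show "Y \<in> \<Xi> ` carrier (K1 Mod B1)" by blast
  qed (use hom in \<open>auto simp: hom_def\<close>)
  define Ker where "Ker = kernel (K1 Mod B1) (K2 Mod B2) \<Xi>"
  interpret \<Xi>: group_hom "K1 Mod B1" "K2 Mod B2" \<Xi> by unfold_locales (rule hom)
  have Ker_sub: "subgroup Ker (K1 Mod B1)" unfolding Ker_def by (rule \<Xi>.subgroup_kernel)
  let ?KG = "(K1 Mod B1)\<lparr>carrier := Ker\<rparr>"
  interpret KG: group ?KG by (rule subgroup.subgroup_is_group[OF Ker_sub F1.is_group])
  have Ker: "X \<in> Ker \<longleftrightarrow> (\<exists>x\<in>B2. X = B1 #>\<^bsub>K1\<^esub> p x)" for X
  proof
    assume "X \<in> Ker"
    then obtain x where x: "x \<in> carrier K2" "X = B1 #>\<^bsub>K1\<^esub> p x" "\<Xi> X = B2"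
      by (auto simp: Ker_def kernel_def rc1)
    then have "B2 #>\<^bsub>K2\<^esub> x = B2" using \<Xi> by simp
    then have "x \<in> B2" using K2.rcos_self[OF x(1) B2] by simp
    then show "\<exists>x\<in>B2. X = B1 #>\<^bsub>K1\<^esub> p x" using x(2) by blast
  next
    assume "\<exists>x\<in>B2. X = B1 #>\<^bsub>K1\<^esub> p x"
    then obtain x where x: "x \<in> B2" "X = B1 #>\<^bsub>K1\<^esub> p x" by blast
    then have "x \<in> carrier K2" using B2.subset by blast
    then show "X \<in> Ker" using x \<Xi> K2.coset_join2[OF _ B2 x(1)] rc1 by (auto simp: Ker_def kernel_def)
  qed
  \<comment> \<open>By \<open>qp\<close> the image of \<open>?h\<close> lies in the kernel of
    \<open>\<Xi>\<close>, by \<open>pq\<close> it is all of it; the isomorphism theorem for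
    \<open>?h\<close> then presents this kernel as a quotient of \<open>E\<close>.\<close>
  let ?h = "\<lambda>e. B1 #>\<^bsub>K1\<^esub> q e"
  have hKer: "?h ` carrier E = Ker"
  proof (intro equalityI subsetI)
    fix X assume "X \<in> ?h ` carrier E"
    then obtain e where e: "e \<in> carrier E" "X = ?h e" by blast
    obtain x b where xb: "x \<in> B2" "b \<in> B1" "q e = b \<otimes>\<^bsub>K1\<^esub> p x" using qp[OF e(1)] by blast
    have "p x \<in> carrier K1" using xb(1) B2.subset by auto
    then show "X \<in> Ker" using e xb absorb1 by (auto simp: Ker)
  next
    fix X assume "X \<in> Ker"
    then obtain x where x: "x \<in> B2" "X = B1 #>\<^bsub>K1\<^esub> p x" by (auto simp: Ker)
    obtain e b where "e \<in> carrier E" "b \<in> B1" "p x = b \<otimes>\<^bsub>K1\<^esub> q e" using pq[OF x(1)] by blast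
    then show "X \<in> ?h ` carrier E" using x absorb1 qc by auto
  qed
  have "?h \<in> hom E ?KG"
  proof (rule homI)
    show "?h e \<in> carrier ?KG" if "e \<in> carrier E" for e using hKer that by auto
    show "?h (e \<otimes>\<^bsub>E\<^esub> e') = ?h e \<otimes>\<^bsub>?KG\<^esub> ?h e'" if "e \<in> carrier E" "e' \<in> carrier E" for e e'
      using hom_mult[OF q that] qc that by (simp add: N1.rcos_sum)
  qed
  then interpret h: group_hom E ?KG ?h by unfold_locales
  have "kernel E ?KG ?h = {e \<in> carrier E. q e \<in> B1}"
    using qc K1.coset_join2[OF _ B1] K1.rcos_self[OF _ B1] by (auto simp: kernel_def)
  then have "E Mod {e \<in> carrier E. q e \<in> B1} \<cong> ?KG"
    using h.FactGroup_iso hKer by simp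
  then have "?KG \<cong> E Mod {e \<in> carrier E. q e \<in> B1}"
    by (rule group.iso_sym[OF normal.factorgroup_is_group[OF h.normal_kernel], unfolded \<open>kernel E ?KG ?h = _\<close>])
  then show ?thesis using hom surj unfolding Ker_def by blast
qed

section \<open>Differential characters and multiplicative cohomology of an abstract integration map\<close>

text \<open>The algebra behind the theorem: \<open>L\<close>, \<open>C\<close> and \<open>Q\<close>
  stand for the cochains with values in \<Lambda>, \<complex> and \<complex>/\<Lambda>,
  \<open>A\<close> for the forms of one filtration step and \<open>I\<close> for integration. In
  each degree 0 \<rightarrow> L \<rightarrow> C \<rightarrow> Q \<rightarrow> 0 is exact.\<close>

locale integration_setup =
  C: group_complex C + Q: group_complex Q + I: group_complex_map A C I + \<pi>: group_complex_map C Q \<pi>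
  for C :: "'c cochain_complex" and Q :: "'q cochain_complex" and A :: "'f cochain_complex" and I \<pi> +
  fixes L :: "'c cochain_complex"
  assumes L_sub: "subgroup (carrier (grp L k)) (grp C k)"
    and L_grp: "grp L k = (grp C k)\<lparr>carrier := carrier (grp L k)\<rparr>"
    and L_diff: "c \<in> carrier (grp L k) \<Longrightarrow> diff L k c = diff C k c"
    and L_diff_closed: "c \<in> carrier (grp L k) \<Longrightarrow> diff C k c \<in> carrier (grp L (k + 1))"
    and \<pi>_surj: "\<pi> k ` carrier (grp C k) = carrier (grp Q k)"
    and \<pi>_kernel: "c \<in> carrier (grp C k) \<Longrightarrow> \<pi> k c = \<one>\<^bsub>grp Q k\<^esub> \<longleftrightarrow> c \<in> carrier (grp L k)"
begin

lemma L_in_C: "c \<in> carrier (grp L k) \<Longrightarrow> c \<in> carrier (grp C k)"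
  using subgroup.subset[OF L_sub] by blast

lemma L_simps: "monoid.mult (grp L k) = monoid.mult (grp C k)" "one (grp L k) = one (grp C k)"
  by (subst L_grp, simp)+

sublocale L: group_complex L
proof (rule group_complex.intro)
  fix k
  show "comm_group (grp L k)" by (subst L_grp) (rule comm_group_restrict[OF C.comm_grp L_sub])
  show "diff L k \<in> hom (grp L k) (grp L (k + 1))"
    by (rule homI) (auto simp: L_diff L_diff_closed L_simps C.diff_mult L_in_C
        subgroup.m_closed[OF L_sub])
  show "diff L (k + 1) (diff L k x) = \<one>\<^bsub>grp L (k + 1 + 1)\<^esub>" if "x \<in> carrier (grp L k)" for x
    using that by (simp add: L_diff L_diff_closed L_simps C.diff_diff L_in_C)
qed

abbreviation "char_map \<equiv> \<lambda>j w. \<pi> j (I j w)"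
abbreviation "mult_map \<equiv> \<lambda>j (c, w). c \<otimes>\<^bsub>grp C j\<^esub> inv\<^bsub>grp C j\<^esub> (I j w)"

lemma char_map_complex_map: "group_complex_map A Q char_map"
proof
  show "(\<lambda>w. \<pi> k (I k w)) \<in> hom (grp A k) (grp Q k)" for k
    by (rule homI) (simp_all add: I.map_closed \<pi>.map_closed I.map_mult \<pi>.map_mult)
  show "\<pi> (k + 1) (I (k + 1) (diff A k x)) = diff Q k (\<pi> k (I k x))" if "x \<in> carrier (grp A k)" for k x
    using that by (simp add: I.map_diff \<pi>.map_diff I.map_closed)
qed

lemma mult_map_complex_map: "group_complex_map (direct_sum L A) C mult_map"
proof -
  interpret S: group_complex "direct_sum L A"
    by (rule group_complex_direct_sum[OF L.group_complex_axioms I.A.group_complex_axioms])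
  show ?thesis
  proof
    fix k
    interpret Ck: comm_group "grp C k" by (rule C.comm_grp)
    interpret Ck1: comm_group "grp C (k + 1)" by (rule C.comm_grp)
    show "mult_map k \<in> hom (grp (direct_sum L A) k) (grp C k)"
      by (rule homI) (auto simp: direct_sum_def L_in_C I.map_closed L_simps I.map_mult Ck.inv_mult Ck.m_ac)
    show "mult_map (k + 1) (diff (direct_sum L A) k x) = diff C k (mult_map k x)"
      if "x \<in> carrier (grp (direct_sum L A) k)" for x
      using that by (auto simp: direct_sum_def L_in_C L_diff I.map_diff C.diff_mult C.diff_inv I.map_closed)
  qed
qed

text \<open>The cocycle groups of both cones are fed into
  \<open>factor_group_correspondence\<close>. There \<open>pB\<close> says that a cocycle lying over
  a coboundary of \<open>K1\<close> is a coboundary, while \<open>qp\<close> and \<open>pq\<close>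
  match the coboundaries of \<open>K2\<close>, modulo those of \<open>K1\<close>, with the image of
  \<open>q\<close>.\<close>

theorem characters_onto_multiplicative_cohomology:
  fixes k :: int
  defines "K1 \<equiv> mapping_cone (truncation k A) Q char_map"
    and "K2 \<equiv> mapping_cone (direct_sum L A) C mult_map"
  shows "\<exists>\<Xi>\<in>hom (cohomology K1 k) (cohomology K2 k).
    \<Xi> ` carrier (cohomology K1 k) = carrier (cohomology K2 k) \<and>
    (cohomology K1 k)\<lparr>carrier := kernel (cohomology K1 k) (cohomology K2 k) \<Xi>\<rparr> \<cong>
    grp A (k - 1) Mod {w \<in> carrier (grp A (k - 1)). diff A (k - 1) w = \<one>\<^bsub>grp A k\<^esub> \<and>
      cohomology_class C (k - 1) (I (k - 1) w) \<in>
        cohomology_map C (k - 1) (\<lambda>_ c. c) ` carrier (cohomology L (k - 1))}"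
proof -
  interpret m1: group_complex_map "truncation k A" Q char_map
    by (rule group_complex_map_truncation[OF char_map_complex_map])
  interpret m2: group_complex_map "direct_sum L A" C mult_map by (rule mult_map_complex_map)
  interpret K1: group_complex K1 unfolding K1_def by (rule m1.group_complex_mapping_cone)
  interpret K2: group_complex K2 unfolding K2_def by (rule m2.group_complex_mapping_cone)
  interpret Ck: comm_group "grp C k" by (rule C.comm_grp)
  interpret Cl: comm_group "grp C (k - 1)" by (rule C.comm_grp)
  interpret Qk: comm_group "grp Q k" by (rule Q.comm_grp)
  interpret Ql: comm_group "grp Q (k - 1)" by (rule Q.comm_grp)
  interpret Ak: comm_group "grp A k" by (rule I.A.comm_grp)
  interpret Al: comm_group "grp A (k - 1)" by (rule I.A.comm_grp)
  interpret Ll: subgroup "carrier (grp L (k - 1))" "grp C (k - 1)" by (rule L_sub)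
  let ?dC = "diff C (k - 1)" and ?dQ = "diff Q (k - 1)" and ?dA = "diff A (k - 1)"
  let ?\<pi> = "\<pi> (k - 1)" and ?I = "I (k - 1)"
  have dC: "?dC c \<in> carrier (grp C k)" if "c \<in> carrier (grp C (k - 1))" for c using C.diff_closed[OF that] by simp
  have dQ: "?dQ c \<in> carrier (grp Q k)" if "c \<in> carrier (grp Q (k - 1))" for c using Q.diff_closed[OF that] by simp
  have dA: "?dA c \<in> carrier (grp A k)" if "c \<in> carrier (grp A (k - 1))" for c using I.A.diff_closed[OF that] by simp
  have dC_mult: "?dC (x \<otimes>\<^bsub>grp C (k - 1)\<^esub> y) = ?dC x \<otimes>\<^bsub>grp C k\<^esub> ?dC y"
    if "x \<in> carrier (grp C (k - 1))" "y \<in> carrier (grp C (k - 1))" for x y using C.diff_mult[OF that] by simp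
  have dC_inv: "?dC (inv\<^bsub>grp C (k - 1)\<^esub> x) = inv\<^bsub>grp C k\<^esub> ?dC x" if "x \<in> carrier (grp C (k - 1))" for x
    using C.diff_inv[OF that] by simp
  have dA_mult: "?dA (x \<otimes>\<^bsub>grp A (k - 1)\<^esub> y) = ?dA x \<otimes>\<^bsub>grp A k\<^esub> ?dA y"
    if "x \<in> carrier (grp A (k - 1))" "y \<in> carrier (grp A (k - 1))" for x y using I.A.diff_mult[OF that] by simp
  have d\<pi>: "\<pi> k (?dC c) = ?dQ (?\<pi> c)" if "c \<in> carrier (grp C (k - 1))" for c using \<pi>.map_diff[OF that] by simp
  have dI: "I k (?dA w) = ?dC (?I w)" if "w \<in> carrier (grp A (k - 1))" for w using I.map_diff[OF that] by simp
  have ddC: "diff C k (?dC c) = \<one>\<^bsub>grp C (k + 1)\<^esub>" if "c \<in> carrier (grp C (k - 1))" for c using C.diff_diff[OF that] by simp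
  have ddA: "diff A k (?dA c) = \<one>\<^bsub>grp A (k + 1)\<^esub>" if "c \<in> carrier (grp A (k - 1))" for c using I.A.diff_diff[OF that] by simp
  have d2C: "?dC (diff C (k - 2) c) = \<one>\<^bsub>grp C k\<^esub>" "diff C (k - 2) c \<in> carrier (grp C (k - 1))"
    if "c \<in> carrier (grp C (k - 2))" for c using C.diff_diff[OF that] C.diff_closed[OF that] by simp_all
  have d2\<pi>: "?\<pi> (diff C (k - 2) c) = diff Q (k - 2) (\<pi> (k - 2) c)" if "c \<in> carrier (grp C (k - 2))" for c
    using \<pi>.map_diff[OF that] by simp
  have dL: "?dC c \<in> carrier (grp L k)" if "c \<in> carrier (grp L (k - 1))" for c using L_diff_closed[OF that] by simp
  have \<pi>_lift: "\<exists>c\<in>carrier (grp C j). b = \<pi> j c" if "b \<in> carrier (grp Q j)" for b j using that \<pi>_surj[of j] by blast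
  have Z1: "(w, b) \<in> carrier (cocycles K1 k) \<longleftrightarrow> w \<in> carrier (grp A k) \<and> b \<in> carrier (grp Q (k - 1)) \<and>
      diff A k w = \<one>\<^bsub>grp A (k + 1)\<^esub> \<and> \<pi> k (I k w) \<otimes>\<^bsub>grp Q k\<^esub> inv\<^bsub>grp Q k\<^esub> (?dQ b) = \<one>\<^bsub>grp Q k\<^esub>" for w b
    unfolding K1.carrier_cocycles unfolding K1_def by (auto simp: m1.mapping_cone_simps truncation_simps)
  have Z2: "((a, w), h) \<in> carrier (cocycles K2 k) \<longleftrightarrow> a \<in> carrier (grp L k) \<and> w \<in> carrier (grp A k) \<and>
      h \<in> carrier (grp C (k - 1)) \<and> diff C k a = \<one>\<^bsub>grp C (k + 1)\<^esub> \<and> diff A k w = \<one>\<^bsub>grp A (k + 1)\<^esub> \<and>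
      a \<otimes>\<^bsub>grp C k\<^esub> inv\<^bsub>grp C k\<^esub> (I k w) \<otimes>\<^bsub>grp C k\<^esub> inv\<^bsub>grp C k\<^esub> (?dC h) = \<one>\<^bsub>grp C k\<^esub>" for a w h
    unfolding K2.carrier_cocycles unfolding K2_def
    by (auto simp: m2.mapping_cone_simps direct_sum_simps L_simps L_diff)
  \<comment> \<open>The truncation leaves only the neutral form in degree \<open>k - 1\<close>, so
    coboundaries come from \<open>Q\<close> alone. The sign in the differential of the cone is
    absorbed by inverting \<open>b\<close>.\<close>
  have B1: "x \<in> coboundaries K1 k \<longleftrightarrow> (\<exists>b\<in>carrier (grp Q (k - 2)). x = (\<one>\<^bsub>grp A k\<^esub>, diff Q (k - 2) b))" for x
  proof -
    interpret Qm: comm_group "grp Q (k - 2)" by (rule Q.comm_grp)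
    have one: "?dA \<one>\<^bsub>grp A (k - 1)\<^esub> = \<one>\<^bsub>grp A k\<^esub>" using I.A.diff_one[of "k - 1"] by simp
    have dQ2: "diff Q (k - 2) b \<in> carrier (grp Q (k - 1))" if "b \<in> carrier (grp Q (k - 2))" for b
      using Q.diff_closed[OF that] by simp
    have dQ2i: "diff Q (k - 2) (inv\<^bsub>grp Q (k - 2)\<^esub> b) = inv\<^bsub>grp Q (k - 1)\<^esub> diff Q (k - 2) b"
      if "b \<in> carrier (grp Q (k - 2))" for b
      using Q.diff_inv[OF that] by simp
    have "x \<in> coboundaries K1 k \<longleftrightarrow>
        (\<exists>b\<in>carrier (grp Q (k - 2)). x = (\<one>\<^bsub>grp A k\<^esub>, inv\<^bsub>grp Q (k - 1)\<^esub> (diff Q (k - 2) b)))"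
      unfolding coboundaries_def K1_def
      by (auto simp: m1.mapping_cone_simps truncation_simps image_iff one I.map_one \<pi>.map_one dQ2)
    also have "\<dots> \<longleftrightarrow> (\<exists>b\<in>carrier (grp Q (k - 2)). x = (\<one>\<^bsub>grp A k\<^esub>, diff Q (k - 2) b))"
      using dQ2i dQ2 Qm.inv_closed Qm.inv_inv by metis
    finally show ?thesis .
  qed
  have B2: "x \<in> coboundaries K2 k \<longleftrightarrow> (\<exists>a\<in>carrier (grp L (k - 1)). \<exists>w\<in>carrier (grp A (k - 1)). \<exists>h\<in>carrier (grp C (k - 2)).
      x = ((?dC a, ?dA w), a \<otimes>\<^bsub>grp C (k - 1)\<^esub> inv\<^bsub>grp C (k - 1)\<^esub> (?I w) \<otimes>\<^bsub>grp C (k - 1)\<^esub>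
        inv\<^bsub>grp C (k - 1)\<^esub> (diff C (k - 2) h)))" for x
  proof -
    define T where "T a w h = ((?dC a, ?dA w), a \<otimes>\<^bsub>grp C (k - 1)\<^esub> inv\<^bsub>grp C (k - 1)\<^esub> (?I w) \<otimes>\<^bsub>grp C (k - 1)\<^esub>
        inv\<^bsub>grp C (k - 1)\<^esub> (diff C (k - 2) h))" for a w h
    have D: "diff K2 (k - 1) ((a, w), h) = T a w h" if "a \<in> carrier (grp L (k - 1))" for a w h
      using that unfolding K2_def T_def by (simp add: m2.mapping_cone_simps direct_sum_simps L_diff)
    have Cr: "carrier (grp K2 (k - 1)) =
        (carrier (grp L (k - 1)) \<times> carrier (grp A (k - 1))) \<times> carrier (grp C (k - 2))"
      unfolding K2_def by (simp add: m2.mapping_cone_simps direct_sum_simps)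
    have "x \<in> coboundaries K2 k \<longleftrightarrow> (\<exists>a\<in>carrier (grp L (k - 1)). \<exists>w\<in>carrier (grp A (k - 1)).
        \<exists>h\<in>carrier (grp C (k - 2)). x = T a w h)"
    proof
      assume "x \<in> coboundaries K2 k"
      then obtain z where z: "z \<in> carrier (grp K2 (k - 1))" "x = diff K2 (k - 1) z"
        unfolding coboundaries_def by blast
      obtain a w h where "z = ((a, w), h)" by (metis surj_pair)
      then show "\<exists>a\<in>carrier (grp L (k - 1)). \<exists>w\<in>carrier (grp A (k - 1)). \<exists>h\<in>carrier (grp C (k - 2)). x = T a w h"
        using z D Cr by auto
    next
      assume "\<exists>a\<in>carrier (grp L (k - 1)). \<exists>w\<in>carrier (grp A (k - 1)). \<exists>h\<in>carrier (grp C (k - 2)). x = T a w h"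
      then obtain a w h where *: "a \<in> carrier (grp L (k - 1))" "w \<in> carrier (grp A (k - 1))"
        "h \<in> carrier (grp C (k - 2))" "x = T a w h" by blast
      then have "((a, w), h) \<in> carrier (grp K2 (k - 1))" "x = diff K2 (k - 1) ((a, w), h)"
        using D Cr by auto
      then show "x \<in> coboundaries K2 k" unfolding coboundaries_def by blast
    qed
    then show ?thesis unfolding T_def .
  qed
  \<comment> \<open>The inverse reconciles the two cone conditions: a cocycle of \<open>K2\<close>
    satisfies a - I w = dh, a cocycle of \<open>K1\<close> satisfies \<pi> (I w) = db.\<close>
  define p where "p = (\<lambda>((a :: 'c, w :: 'f), h). (w, inv\<^bsub>grp Q (k - 1)\<^esub> (?\<pi> h)))"
  define q where "q w = (?dA w, ?\<pi> (?I w))" for w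
  have mult1: "(w, b) \<otimes>\<^bsub>cocycles K1 k\<^esub> (w', b') = (w \<otimes>\<^bsub>grp A k\<^esub> w', b \<otimes>\<^bsub>grp Q (k - 1)\<^esub> b')" for w b w' b'
    unfolding K1.cocycles_simps unfolding K1_def by (simp add: m1.mapping_cone_simps truncation_simps)
  have mult2: "((a, w), h) \<otimes>\<^bsub>cocycles K2 k\<^esub> ((a', w'), h') =
      ((a \<otimes>\<^bsub>grp C k\<^esub> a', w \<otimes>\<^bsub>grp A k\<^esub> w'), h \<otimes>\<^bsub>grp C (k - 1)\<^esub> h')" for a w h a' w' h'
    unfolding K2.cocycles_simps unfolding K2_def by (simp add: m2.mapping_cone_simps direct_sum_simps L_simps)
  have p_in: "p x \<in> carrier (cocycles K1 k)" if "x \<in> carrier (cocycles K2 k)" for x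
  proof -
    obtain a w h where x: "x = ((a, w), h)" by (metis surj_pair)
    have *: "a \<in> carrier (grp L k)" "w \<in> carrier (grp A k)" "h \<in> carrier (grp C (k - 1))"
      "diff A k w = \<one>\<^bsub>grp A (k + 1)\<^esub>"
      "a \<otimes>\<^bsub>grp C k\<^esub> inv\<^bsub>grp C k\<^esub> (I k w) \<otimes>\<^bsub>grp C k\<^esub> inv\<^bsub>grp C k\<^esub> (?dC h) = \<one>\<^bsub>grp C k\<^esub>"
      using that unfolding x Z2 by auto
    have c: "a \<in> carrier (grp C k)" "I k w \<in> carrier (grp C k)" "?dC h \<in> carrier (grp C k)"
      using *(1-3) L_in_C I.map_closed dC by auto
    have "I k w \<otimes>\<^bsub>grp C k\<^esub> ?dC h = a"
      using *(5) c by (metis Ck.inv_closed Ck.inv_mult Ck.m_assoc Ck.m_closed Ck.inv_equality Ck.inv_inv)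
    then have "\<pi> k (I k w) \<otimes>\<^bsub>grp Q k\<^esub> ?dQ (?\<pi> h) = \<one>\<^bsub>grp Q k\<^esub>"
      using \<pi>.map_mult[OF c(2,3)] \<pi>_kernel[OF c(1)] *(1) d\<pi>[OF *(3)] by simp
    moreover have "?dQ (inv\<^bsub>grp Q (k - 1)\<^esub> (?\<pi> h)) = inv\<^bsub>grp Q k\<^esub> (?dQ (?\<pi> h))"
      using Q.diff_inv[OF \<pi>.map_closed[OF *(3)]] by simp
    ultimately show ?thesis
      unfolding x p_def using *(2,4) \<pi>.map_closed[OF *(3)] dQ by (simp add: Z1)
  qed
  have p_hom: "p \<in> hom (cocycles K2 k) (cocycles K1 k)"
  proof (rule homI[OF p_in])
    fix x y assume xy: "x \<in> carrier (cocycles K2 k)" "y \<in> carrier (cocycles K2 k)"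
    obtain a w h a' w' h' where *: "x = ((a, w), h)" "y = ((a', w'), h')" by (metis surj_pair)
    have "h \<in> carrier (grp C (k - 1))" "h' \<in> carrier (grp C (k - 1))" using xy unfolding * Z2 by auto
    then show "p (x \<otimes>\<^bsub>cocycles K2 k\<^esub> y) = p x \<otimes>\<^bsub>cocycles K1 k\<^esub> p y"
      unfolding * mult2 by (simp add: p_def mult1 \<pi>.map_mult \<pi>.map_closed Ql.inv_mult)
  qed
  have p_surj: "\<exists>x\<in>carrier (cocycles K2 k). p x = y" if "y \<in> carrier (cocycles K1 k)" for y
  proof -
    obtain w b where y: "y = (w, b)" by (metis surj_pair)
    have *: "w \<in> carrier (grp A k)" "b \<in> carrier (grp Q (k - 1))" "diff A k w = \<one>\<^bsub>grp A (k + 1)\<^esub>"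
      "\<pi> k (I k w) \<otimes>\<^bsub>grp Q k\<^esub> inv\<^bsub>grp Q k\<^esub> (?dQ b) = \<one>\<^bsub>grp Q k\<^esub>" using that unfolding y Z1 by auto
    obtain c where c: "c \<in> carrier (grp C (k - 1))" "b = ?\<pi> c" using \<pi>_lift[OF *(2)] by blast
    \<comment> \<open>The value forced by the cocycle equation of \<open>K2\<close> with h = - c;
      that it lies in \<open>L\<close> is the cocycle condition for \<open>(w, b)\<close>.\<close>
    define a where "a = I k w \<otimes>\<^bsub>grp C k\<^esub> inv\<^bsub>grp C k\<^esub> (?dC c)"
    have Iw: "I k w \<in> carrier (grp C k)" by (rule I.map_closed[OF *(1)])
    have a: "a \<in> carrier (grp C k)" using Iw dC[OF c(1)] by (simp add: a_def)
    have "\<pi> k a = \<one>\<^bsub>grp Q k\<^esub>"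
      unfolding a_def using *(4) Iw dC[OF c(1)] by (simp add: \<pi>.map_mult \<pi>.map_inv d\<pi> c)
    then have aL: "a \<in> carrier (grp L k)" using \<pi>_kernel[OF a] by simp
    interpret Cn: comm_group "grp C (k + 1)" by (rule C.comm_grp)
    have "diff C k (I k w) = \<one>\<^bsub>grp C (k + 1)\<^esub>"
      using I.map_diff[OF *(1)] *(3) I.map_one by simp
    then have da: "diff C k a = \<one>\<^bsub>grp C (k + 1)\<^esub>"
      unfolding a_def using Iw dC[OF c(1)] ddC[OF c(1)] by (simp add: C.diff_mult C.diff_inv)
    have "a \<otimes>\<^bsub>grp C k\<^esub> inv\<^bsub>grp C k\<^esub> (I k w) = inv\<^bsub>grp C k\<^esub> (?dC c)"
      unfolding a_def using Iw dC[OF c(1)]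
      by (metis Ck.inv_closed Ck.m_assoc Ck.m_comm Ck.r_inv Ck.r_one)
    then have "a \<otimes>\<^bsub>grp C k\<^esub> inv\<^bsub>grp C k\<^esub> (I k w) \<otimes>\<^bsub>grp C k\<^esub> inv\<^bsub>grp C k\<^esub> (?dC (inv\<^bsub>grp C (k - 1)\<^esub> c)) =
        \<one>\<^bsub>grp C k\<^esub>"
      using dC[OF c(1)] c(1) by (simp add: dC_inv)
    then have "((a, w), inv\<^bsub>grp C (k - 1)\<^esub> c) \<in> carrier (cocycles K2 k)"
      unfolding Z2 using aL *(1,3) c(1) da by simp
    moreover have "p ((a, w), inv\<^bsub>grp C (k - 1)\<^esub> c) = y"
      using c \<pi>.map_closed[OF c(1)] by (simp add: p_def y \<pi>.map_inv)
    ultimately show ?thesis by blast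
  qed
  have pB: "x \<in> coboundaries K2 k" if x: "x \<in> carrier (cocycles K2 k)" "p x \<in> coboundaries K1 k" for x
  proof -
    obtain a w h where xe: "x = ((a, w), h)" by (metis surj_pair)
    have *: "a \<in> carrier (grp L k)" "h \<in> carrier (grp C (k - 1))"
      "a \<otimes>\<^bsub>grp C k\<^esub> inv\<^bsub>grp C k\<^esub> (I k w) \<otimes>\<^bsub>grp C k\<^esub> inv\<^bsub>grp C k\<^esub> (?dC h) = \<one>\<^bsub>grp C k\<^esub>"
      using x(1) unfolding xe Z2 by auto
    obtain b where b: "b \<in> carrier (grp Q (k - 2))" "w = \<one>\<^bsub>grp A k\<^esub>"
      "inv\<^bsub>grp Q (k - 1)\<^esub> (?\<pi> h) = diff Q (k - 2) b"
      using x(2) unfolding xe p_def B1 by auto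
    obtain c where c: "c \<in> carrier (grp C (k - 2))" "b = \<pi> (k - 2) c" using \<pi>_lift[OF b(1)] by blast
    note dc = d2C[OF c(1)]
    \<comment> \<open>The form part is trivial, and - \<pi> h is the reduction of dc. Hence h + dc
      reduces to 0, so it lies in \<open>L\<close>, and its coboundary is \<open>a\<close>.\<close>
    define a' where "a' = h \<otimes>\<^bsub>grp C (k - 1)\<^esub> diff C (k - 2) c"
    have a'C: "a' \<in> carrier (grp C (k - 1))" using *(2) dc by (simp add: a'_def)
    have "?\<pi> a' = ?\<pi> h \<otimes>\<^bsub>grp Q (k - 1)\<^esub> inv\<^bsub>grp Q (k - 1)\<^esub> (?\<pi> h)"
      unfolding a'_def using *(2) dc b(3) c(2) d2\<pi>[OF c(1)] by (simp add: \<pi>.map_mult)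
    then have a'L: "a' \<in> carrier (grp L (k - 1))"
      using \<pi>_kernel[OF a'C] \<pi>.map_closed[OF *(2)] by simp
    have aC: "a \<in> carrier (grp C k)" by (rule L_in_C[OF *(1)])
    have "a = ?dC h" using *(3) aC dC[OF *(2)] unfolding b(2) I.map_one
      by (simp add: Ck.inv_solve_right[symmetric]) (metis Ck.inv_equality Ck.inv_inv Ck.inv_closed)
    then have "a = ?dC a'" unfolding a'_def using *(2) dc dC[OF *(2)] by (simp add: dC_mult)
    moreover have "h = a' \<otimes>\<^bsub>grp C (k - 1)\<^esub> inv\<^bsub>grp C (k - 1)\<^esub> (?I \<one>\<^bsub>grp A (k - 1)\<^esub>) \<otimes>\<^bsub>grp C (k - 1)\<^esub>
        inv\<^bsub>grp C (k - 1)\<^esub> (diff C (k - 2) c)"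
      unfolding a'_def I.map_one using *(2) dc by (simp add: Cl.m_assoc)
    moreover have "w = ?dA \<one>\<^bsub>grp A (k - 1)\<^esub>" using b(2) I.A.diff_one[of "k - 1"] by simp
    ultimately show ?thesis unfolding xe B2 using a'L c(1) by blast
  qed
  have q_in: "q w \<in> carrier (cocycles K1 k)" if w: "w \<in> carrier (grp A (k - 1))" for w
    unfolding q_def Z1
    using dA[OF w] I.map_closed[OF w] \<pi>.map_closed ddA[OF w] dI[OF w] d\<pi>[OF I.map_closed[OF w]] dQ by simp
  have q_hom: "q \<in> hom (grp A (k - 1)) (cocycles K1 k)"
    by (rule homI[OF q_in]) (simp_all add: q_def mult1 dA_mult I.map_mult \<pi>.map_mult I.map_closed)
  \<comment> \<open>\<open>\<pi>\<close> kills the part with values in \<open>L\<close>, and the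
    part from degree \<open>k - 2\<close> becomes a coboundary of \<open>K1\<close>; what remains of
    a coboundary of \<open>K2\<close> is \<open>q w\<close>. Both \<open>qp\<close> and
    \<open>pq\<close> follow from this formula.\<close>
  have p_cobound: "p ((?dC a, ?dA w), a \<otimes>\<^bsub>grp C (k - 1)\<^esub> inv\<^bsub>grp C (k - 1)\<^esub> (?I w) \<otimes>\<^bsub>grp C (k - 1)\<^esub>
      inv\<^bsub>grp C (k - 1)\<^esub> (diff C (k - 2) h)) = (\<one>\<^bsub>grp A k\<^esub>, diff Q (k - 2) (\<pi> (k - 2) h)) \<otimes>\<^bsub>cocycles K1 k\<^esub> q w"
    if "a \<in> carrier (grp L (k - 1))" "w \<in> carrier (grp A (k - 1))" "h \<in> carrier (grp C (k - 2))" for a w h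
  proof -
    have c: "a \<in> carrier (grp C (k - 1))" "?I w \<in> carrier (grp C (k - 1))" "diff C (k - 2) h \<in> carrier (grp C (k - 1))"
      using that L_in_C I.map_closed d2C by auto
    have "?\<pi> a = \<one>\<^bsub>grp Q (k - 1)\<^esub>" using \<pi>_kernel[OF c(1)] that(1) by simp
    then show ?thesis
      using c dA[OF that(2)] \<pi>.map_closed[OF c(2)] \<pi>.map_closed[OF c(3)]
      by (simp add: p_def q_def mult1 \<pi>.map_mult \<pi>.map_inv Ql.inv_mult Ql.m_comm d2\<pi>[OF that(3)])
  qed
  have qp: "\<exists>x\<in>coboundaries K2 k. \<exists>b\<in>coboundaries K1 k. q w = b \<otimes>\<^bsub>cocycles K1 k\<^esub> p x"
    if w: "w \<in> carrier (grp A (k - 1))" for w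
  proof -
    interpret Cm: comm_group "grp C (k - 2)" by (rule C.comm_grp)
    let ?o = "\<one>\<^bsub>grp C (k - 1)\<^esub>" and ?o2 = "\<one>\<^bsub>grp C (k - 2)\<^esub>"
    let ?x = "((?dC ?o, ?dA w), ?o \<otimes>\<^bsub>grp C (k - 1)\<^esub> inv\<^bsub>grp C (k - 1)\<^esub> (?I w) \<otimes>\<^bsub>grp C (k - 1)\<^esub>
        inv\<^bsub>grp C (k - 1)\<^esub> (diff C (k - 2) ?o2))"
    have x: "?x \<in> coboundaries K2 k" unfolding B2 using w Ll.one_closed Cm.one_closed by blast
    have o: "(\<one>\<^bsub>grp A k\<^esub>, diff Q (k - 2) (\<pi> (k - 2) ?o2)) = \<one>\<^bsub>cocycles K1 k\<^esub>"
      unfolding K1.cocycles_simps unfolding K1_def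
      using Q.diff_one[of "k - 2"] \<pi>.map_one by (simp add: m1.mapping_cone_simps truncation_simps)
    interpret Z: comm_group "cocycles K1 k" by (rule K1.comm_group_cocycles)
    have "p ?x = q w"
      using p_cobound[OF Ll.one_closed w Cm.one_closed] q_in[OF w] unfolding o by simp
    then have "q w = \<one>\<^bsub>cocycles K1 k\<^esub> \<otimes>\<^bsub>cocycles K1 k\<^esub> p ?x" using q_in[OF w] by simp
    then show ?thesis using x subgroup.one_closed[OF K1.subgroup_coboundaries] by blast
  qed
  have pq: "\<exists>w\<in>carrier (grp A (k - 1)). \<exists>b\<in>coboundaries K1 k. p x = b \<otimes>\<^bsub>cocycles K1 k\<^esub> q w"
    if "x \<in> coboundaries K2 k" for x
  proof -
    obtain a w h where *: "a \<in> carrier (grp L (k - 1))" "w \<in> carrier (grp A (k - 1))" "h \<in> carrier (grp C (k - 2))"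
      "x = ((?dC a, ?dA w), a \<otimes>\<^bsub>grp C (k - 1)\<^esub> inv\<^bsub>grp C (k - 1)\<^esub> (?I w) \<otimes>\<^bsub>grp C (k - 1)\<^esub>
        inv\<^bsub>grp C (k - 1)\<^esub> (diff C (k - 2) h))"
      using \<open>x \<in> coboundaries K2 k\<close> unfolding B2 by blast
    have "(\<one>\<^bsub>grp A k\<^esub>, diff Q (k - 2) (\<pi> (k - 2) h)) \<in> coboundaries K1 k"
      unfolding B1 using \<pi>.map_closed[OF *(3)] by blast
    then show ?thesis using p_cobound[OF *(1-3)] *(2) unfolding *(4) by blast
  qed
  \<comment> \<open>In both directions the relation behind this is I w = dc + a with a cocycle
    \<open>a\<close> of \<open>L\<close>; applying \<open>\<pi>\<close> removes \<open>a\<close>,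
    and lifting along \<open>\<pi>\<close> recovers it.\<close>
  have int: "q w \<in> coboundaries K1 k \<longleftrightarrow> ?dA w = \<one>\<^bsub>grp A k\<^esub> \<and>
      cohomology_class C (k - 1) (?I w) \<in> cohomology_map C (k - 1) (\<lambda>_ c. c) ` carrier (cohomology L (k - 1))"
    if w: "w \<in> carrier (grp A (k - 1))" for w
  proof -
    interpret ZC: comm_group "cocycles C (k - 1)" by (rule C.comm_group_cocycles)
    interpret ZL: comm_group "cocycles L (k - 1)" by (rule L.comm_group_cocycles)
    interpret BC: subgroup "coboundaries C (k - 1)" "cocycles C (k - 1)" by (rule C.subgroup_coboundaries)
    interpret BL: subgroup "coboundaries L (k - 1)" "cocycles L (k - 1)" by (rule L.subgroup_coboundaries)
    have IwC: "?I w \<in> carrier (grp C (k - 1))" by (rule I.map_closed[OF w])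
    have BLC: "coboundaries L (k - 1) \<subseteq> coboundaries C (k - 1)"
      unfolding coboundaries_def using L_diff L_in_C by force
    have BCe: "x \<in> coboundaries C (k - 1) \<longleftrightarrow> (\<exists>c\<in>carrier (grp C (k - 2)). x = diff C (k - 2) c)" for x
      unfolding coboundaries_def by auto
    have ZLC: "z \<in> carrier (cocycles C (k - 1)) \<and> z \<in> carrier (grp L (k - 1))" if "z \<in> carrier (cocycles L (k - 1))" for z
      using that unfolding L.carrier_cocycles C.carrier_cocycles by (auto simp: L_in_C L_simps L_diff)
    \<comment> \<open>\<open>cohomology_map\<close> picks a representative of the class over
      \<open>L\<close>; another choice changes it by a coboundary of \<open>L\<close>, which is also
      one of \<open>C\<close>.\<close>
    have cls: "cohomology_map C (k - 1) (\<lambda>_ c. c) (coboundaries L (k - 1) #>\<^bsub>cocycles L (k - 1)\<^esub> a) =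
        coboundaries C (k - 1) #>\<^bsub>cocycles C (k - 1)\<^esub> a" if a: "a \<in> carrier (cocycles L (k - 1))" for a
    proof -
      let ?X = "coboundaries L (k - 1) #>\<^bsub>cocycles L (k - 1)\<^esub> a"
      have "a \<in> ?X" by (rule ZL.rcos_self[OF a L.subgroup_coboundaries])
      then have "(SOME z. z \<in> ?X) \<in> ?X" by (rule someI)
      then obtain l where "l \<in> coboundaries L (k - 1)" "(SOME z. z \<in> ?X) = l \<otimes>\<^bsub>cocycles L (k - 1)\<^esub> a"
        by (auto simp: r_coset_def)
      then have "(SOME z. z \<in> ?X) = l \<otimes>\<^bsub>cocycles C (k - 1)\<^esub> a"
        by (simp only: L.cocycles_simps C.cocycles_simps L_simps)
      then have "(SOME z. z \<in> ?X) \<in> coboundaries C (k - 1) #>\<^bsub>cocycles C (k - 1)\<^esub> a"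
        using BLC \<open>l \<in> _\<close> unfolding r_coset_def by blast
      then show ?thesis
        unfolding cohomology_map_def cohomology_class_def
        using ZC.repr_independence[OF _ conjunct1[OF ZLC[OF a]] C.subgroup_coboundaries] by simp
    qed
    show ?thesis
    proof
      assume "q w \<in> coboundaries K1 k"
      then obtain b where b: "b \<in> carrier (grp Q (k - 2))" "?dA w = \<one>\<^bsub>grp A k\<^esub>" "?\<pi> (?I w) = diff Q (k - 2) b"
        unfolding q_def B1 by auto
      obtain c where c: "c \<in> carrier (grp C (k - 2))" "b = \<pi> (k - 2) c" using \<pi>_lift[OF b(1)] by blast
      note dc = d2C[OF c(1)]
      define a where "a = ?I w \<otimes>\<^bsub>grp C (k - 1)\<^esub> inv\<^bsub>grp C (k - 1)\<^esub> (diff C (k - 2) c)"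
      have aC: "a \<in> carrier (grp C (k - 1))" using IwC dc by (simp add: a_def)
      have "?\<pi> a = \<one>\<^bsub>grp Q (k - 1)\<^esub>"
        unfolding a_def using IwC dc b(3) c(2) d2\<pi>[OF c(1)] \<pi>.map_closed[OF dc(2)]
        by (simp add: \<pi>.map_mult \<pi>.map_inv)
      then have aL: "a \<in> carrier (grp L (k - 1))" using \<pi>_kernel[OF aC] by simp
      have dIw: "?dC (?I w) = \<one>\<^bsub>grp C k\<^esub>" using dI[OF w] b(2) I.map_one by simp
      have "?dC a = \<one>\<^bsub>grp C k\<^esub>" unfolding a_def using IwC dc dIw by (simp add: dC_mult dC_inv)
      then have aZ: "a \<in> carrier (cocycles L (k - 1))"
        unfolding L.carrier_cocycles using aL by (simp add: L_diff L_simps)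
      have "?I w = diff C (k - 2) c \<otimes>\<^bsub>grp C (k - 1)\<^esub> a"
        unfolding a_def using IwC dc by (metis Cl.inv_closed Cl.m_comm Cl.m_assoc Cl.l_inv Cl.r_one)
      then have "?I w \<in> coboundaries C (k - 1) #>\<^bsub>cocycles C (k - 1)\<^esub> a"
        using c(1) BCe[of "diff C (k - 2) c"] by (auto simp: r_coset_def C.cocycles_simps)
      then have "cohomology_class C (k - 1) (?I w) = cohomology_map C (k - 1) (\<lambda>_ c. c)
          (coboundaries L (k - 1) #>\<^bsub>cocycles L (k - 1)\<^esub> a)"
        unfolding cls[OF aZ] cohomology_class_def
        using ZC.repr_independence[OF _ conjunct1[OF ZLC[OF aZ]] C.subgroup_coboundaries] by simp
      moreover have "coboundaries L (k - 1) #>\<^bsub>cocycles L (k - 1)\<^esub> a \<in> carrier (cohomology L (k - 1))"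
        using aZ by (auto simp: cohomology_def FactGroup_def RCOSETS_def)
      ultimately show "?dA w = \<one>\<^bsub>grp A k\<^esub> \<and> cohomology_class C (k - 1) (?I w) \<in>
          cohomology_map C (k - 1) (\<lambda>_ c. c) ` carrier (cohomology L (k - 1))" using b(2) by blast
    next
      assume r: "?dA w = \<one>\<^bsub>grp A k\<^esub> \<and> cohomology_class C (k - 1) (?I w) \<in>
          cohomology_map C (k - 1) (\<lambda>_ c. c) ` carrier (cohomology L (k - 1))"
      then obtain a where a: "a \<in> carrier (cocycles L (k - 1))"
        "cohomology_class C (k - 1) (?I w) = coboundaries C (k - 1) #>\<^bsub>cocycles C (k - 1)\<^esub> a"
        using cls by (auto simp: cohomology_def FactGroup_def RCOSETS_def)
      have "?dC (?I w) = \<one>\<^bsub>grp C k\<^esub>" using dI[OF w] r I.map_one by simp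
      then have "?I w \<in> carrier (cocycles C (k - 1))" unfolding C.carrier_cocycles using IwC by simp
      then have "?I w \<in> cohomology_class C (k - 1) (?I w)"
        unfolding cohomology_class_def by (rule ZC.rcos_self[OF _ C.subgroup_coboundaries])
      then obtain c where c: "c \<in> carrier (grp C (k - 2))" "?I w = diff C (k - 2) c \<otimes>\<^bsub>grp C (k - 1)\<^esub> a"
        unfolding a(2) by (auto simp: r_coset_def BCe C.cocycles_simps)
      have aL: "a \<in> carrier (grp L (k - 1))" using ZLC[OF a(1)] by simp
      have "?\<pi> (?I w) = diff Q (k - 2) (\<pi> (k - 2) c)"
        unfolding c(2) using \<pi>_kernel[OF L_in_C[OF aL]] aL d2C[OF c(1)] L_in_C[OF aL] \<pi>.map_closed
        by (simp add: \<pi>.map_mult d2\<pi>[OF c(1), symmetric])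
      then show "q w \<in> coboundaries K1 k" unfolding q_def B1 using r \<pi>.map_closed[OF c(1)] by auto
    qed
  qed
  have "{w \<in> carrier (grp A (k - 1)). q w \<in> coboundaries K1 k} =
    {w \<in> carrier (grp A (k - 1)). ?dA w = \<one>\<^bsub>grp A k\<^esub> \<and>
      cohomology_class C (k - 1) (?I w) \<in> cohomology_map C (k - 1) (\<lambda>_ c. c) ` carrier (cohomology L (k - 1))}"
    using int by auto
  moreover have "p ` carrier (cocycles K2 k) = carrier (cocycles K1 k)" using p_in p_surj by blast
  ultimately show ?thesis
    using factor_group_correspondence[OF K1.comm_group_cocycles K2.comm_group_cocycles Al.is_group
      K1.subgroup_coboundaries K2.subgroup_coboundaries p_hom _ pB q_hom qp pq]
    unfolding cohomology_def by simp
qed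

end

section \<open>Compatible cochains\<close>

lemma comm_group_product_group:
  assumes "\<And>i. i \<in> I \<Longrightarrow> comm_group (G i)"
  shows "comm_group (product_group I G)"
proof (rule group.group_comm_groupI)
  show "group (product_group I G)" by (rule product_group) (rule comm_group.axioms(2)[OF assms])
  show "x \<otimes>\<^bsub>product_group I G\<^esub> y = y \<otimes>\<^bsub>product_group I G\<^esub> x"
    if "x \<in> carrier (product_group I G)" "y \<in> carrier (product_group I G)" for x y
    using that assms comm_group.axioms(1) comm_monoid.m_comm
    by (fastforce simp: PiE_iff intro!: restrict_ext)
qed

lemma comm_group_cochains: "comm_group R \<Longrightarrow> comm_group (cochains X R k)"
  unfolding cochains_def by (rule comm_group_product_group)

lemma restrict_eq_iff: "restrict f A = restrict g A \<longleftrightarrow> (\<forall>x\<in>A. f x = g x)"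
  by (auto simp: restrict_def fun_eq_iff)

lemma coboundary_negative: "k < 0 \<Longrightarrow> coboundary X R k c = (\<lambda>\<sigma>\<in>smooth_simplices X (k + 1). \<one>\<^bsub>R\<^esub>)"
  by (simp add: coboundary_def)

lemma coboundary_nat:
  "coboundary X R (int p) c = (\<lambda>\<sigma>\<in>smooth_simplices X (int (Suc p)).
     finprod R (\<lambda>i. c (singular_face (Suc p) i \<sigma>) [^]\<^bsub>R\<^esub> ((- 1) ^ i :: int)) {..Suc p})"
  by (simp add: coboundary_def nat_add_distrib add.commute)

lemma int_nat_cases: obtains "k < 0" | p where "k = int p"
  by (meson nonneg_int_cases not_le)

locale cochain_space = prism_space X n m for X :: "'a charted" and n m +
  fixes R :: "'r monoid"
  assumes comm_coeff: "comm_group R"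
begin

sublocale R: comm_group R by (rule comm_coeff)

lemma face_smooth:
  "\<sigma> \<in> smooth_simplices X (int (Suc p)) \<Longrightarrow> i \<le> Suc p \<Longrightarrow> singular_face (Suc p) i \<sigma> \<in> smooth_simplices X (int p)"
  by (rule singular_face_smooth[OF prism_space_axioms])

lemma coboundary_closed:
  assumes "c \<in> carrier (cochains X R k)"
  shows "coboundary X R k c \<in> carrier (cochains X R (k + 1))"
proof (cases k rule: int_nat_cases)
  case 1
  then show ?thesis by (simp add: coboundary_negative cochains_def)
next
  case (2 p)
  show ?thesis using assms unfolding 2 coboundary_nat cochains_def
    by (auto simp: PiE_iff add.commute[of 1] face_smooth intro!: R.finprod_closed R.int_pow_closed)
qed

lemma coboundary_mult:
  assumes "c \<in> carrier (cochains X R k)" "c' \<in> carrier (cochains X R k)"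
  shows "coboundary X R k (c \<otimes>\<^bsub>cochains X R k\<^esub> c') =
    coboundary X R k c \<otimes>\<^bsub>cochains X R (k + 1)\<^esub> coboundary X R k c'"
proof (cases k rule: int_nat_cases)
  case 1
  then show ?thesis by (auto simp: coboundary_negative cochains_def intro!: restrict_ext)
next
  case (2 p)
  have c: "c \<tau> \<in> carrier R" "c' \<tau> \<in> carrier R" if "\<tau> \<in> smooth_simplices X (int p)" for \<tau>
    using assms that by (auto simp: 2 cochains_def PiE_iff)
  have "finprod R (\<lambda>i. (c \<otimes>\<^bsub>cochains X R (int p)\<^esub> c') (singular_face (Suc p) i \<sigma>) [^]\<^bsub>R\<^esub> ((- 1) ^ i :: int)) {..Suc p} =
      finprod R (\<lambda>i. c (singular_face (Suc p) i \<sigma>) [^]\<^bsub>R\<^esub> ((- 1) ^ i :: int)) {..Suc p} \<otimes>\<^bsub>R\<^esub>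
      finprod R (\<lambda>i. c' (singular_face (Suc p) i \<sigma>) [^]\<^bsub>R\<^esub> ((- 1) ^ i :: int)) {..Suc p}"
    if \<sigma>: "\<sigma> \<in> smooth_simplices X (int (Suc p))" for \<sigma>
  proof (subst R.finprod_multf[symmetric])
    show "finprod R (\<lambda>i. (c \<otimes>\<^bsub>cochains X R (int p)\<^esub> c') (singular_face (Suc p) i \<sigma>) [^]\<^bsub>R\<^esub> ((- 1) ^ i :: int)) {..Suc p} =
      finprod R (\<lambda>i. c (singular_face (Suc p) i \<sigma>) [^]\<^bsub>R\<^esub> ((- 1) ^ i :: int) \<otimes>\<^bsub>R\<^esub>
        c' (singular_face (Suc p) i \<sigma>) [^]\<^bsub>R\<^esub> ((- 1) ^ i :: int)) {..Suc p}"
      using c face_smooth[OF \<sigma>] by (intro R.finprod_cong') (auto simp: cochains_def R.int_pow_distrib)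
  qed (use c face_smooth[OF \<sigma>] in auto)
  then show ?thesis unfolding 2 coboundary_nat
    by (auto simp: cochains_def add.commute[of 1] intro!: restrict_ext)
qed

end

text \<open>Faces commute with \<open>simplex_map\<close>. This expresses the coboundary at the
  image simplex through the faces of \<open>\<sigma>\<close>, so that compatibility of a cochain can
  be applied face by face.\<close>

lemma coboundary_simplex_map:
  assumes f: "prism_map X n m Y n' m' f" and R: "comm_group R" and c: "c \<in> carrier (cochains Y R k)"
    and \<sigma>: "\<sigma> \<in> smooth_simplices X (k + 1)"
  shows "coboundary Y R k c (simplex_map (nat (k + 1)) f \<sigma>) =
    (if k < 0 then \<one>\<^bsub>R\<^esub> else finprod R (\<lambda>i. c (simplex_map (nat k) f (singular_face (nat (k + 1)) i \<sigma>)) [^]\<^bsub>R\<^esub> ((- 1) ^ i :: int)) {..nat (k + 1)})"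
proof (cases k rule: int_nat_cases)
  case 1
  then show ?thesis using simplex_map_smooth[OF f \<sigma>] by (simp add: coboundary_negative)
next
  case (2 p)
  interpret prism_map X n m Y n' m' f by fact
  interpret R: comm_group R by fact
  have \<sigma>': "\<sigma> \<in> smooth_simplices X (int (Suc p))" using \<sigma> by (simp add: 2 add.commute)
  have fs: "simplex_map (Suc p) f \<sigma> \<in> smooth_simplices Y (int (Suc p))" using simplex_map_smooth[OF f \<sigma>'] by (simp only: nat_int)
  have eq: "singular_face (Suc p) i (simplex_map (Suc p) f \<sigma>) = simplex_map p f (singular_face (Suc p) i \<sigma>)" if "i \<le> Suc p" for i
    using singular_face_simplex_map[of "Suc p" i f \<sigma>] that
    by (simp add: singular_face_def simplex_map_def restrict_def fun_eq_iff)
  have cl: "c (simplex_map p f (singular_face (Suc p) i \<sigma>)) \<in> carrier R" if "i \<le> Suc p" for i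
    using simplex_map_smooth[OF f singular_face_smooth[OF X.prism_space_axioms \<sigma>' that]] c
    by (auto simp: 2 cochains_def PiE_iff)
  have "finprod R (\<lambda>i. c (singular_face (Suc p) i (simplex_map (Suc p) f \<sigma>)) [^]\<^bsub>R\<^esub> ((- 1) ^ i :: int)) {..Suc p} =
      finprod R (\<lambda>i. c (simplex_map p f (singular_face (Suc p) i \<sigma>)) [^]\<^bsub>R\<^esub> ((- 1) ^ i :: int)) {..Suc p}"
    using eq cl by (intro R.finprod_cong') auto
  moreover have "nat (int p + 1) = Suc p" by simp
  ultimately show ?thesis using fs by (simp only: 2 coboundary_nat restrict_apply' nat_int) simp
qed

section \<open>The maps defining compatibility, and the group of compatible cochains\<close>

context smooth_etale_groupoid
begin

lemma prism_space_simplicial_piece: "prism_space (simplicial_piece G n) n (ambient_dim (Obj G))"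
  using manifold_space.prism_space_simplex_times[OF manifold_space_nerve] by simp

lemma prism_space_mixed_piece: "prism_space (mixed_piece G n) (n - 1) (ambient_dim (Obj G))"
  using manifold_space.prism_space_simplex_times[OF manifold_space_nerve] by simp

lemma prism_map_coface:
  assumes "1 \<le> n" "i \<le> n"
  shows "prism_map (mixed_piece G n) (n - 1) (ambient_dim (Obj G)) (simplicial_piece G n) n (ambient_dim (Obj G))
    (map_prod (simplical_face i) id)"
proof -
  interpret X: prism_space "mixed_piece G n" "n - 1" "ambient_dim (Obj G)" by (rule prism_space_mixed_piece)
  interpret Y: prism_space "simplicial_piece G n" n "ambient_dim (Obj G)" by (rule prism_space_simplicial_piece)
  interpret N: manifold_space "nerve G n" by (rule manifold_space_nerve)
  obtain k where n: "n = Suc k" using assms(1) by (cases n) auto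
  show ?thesis
  proof unfold_locales
    show "smooth_map (mixed_piece G n) (simplicial_piece G n) (map_prod (simplical_face i) id)"
      by (rule N.smooth_map_prod[OF manifold_space_nerve smooth_map_id[OF N.charted_space_axioms]])
        (use assms(2) continuous_simplical_face[of i k] smooth_simplical_face_coord in \<open>simp_all add: n\<close>)
  qed
qed

lemma prism_map_nerve_face:
  assumes "1 \<le> n" "i \<le> n"
  shows "prism_map (mixed_piece G n) (n - 1) (ambient_dim (Obj G)) (simplicial_piece G (n - 1)) (n - 1) (ambient_dim (Obj G))
    (map_prod id (nerve_face G n i))"
proof -
  interpret X: prism_space "mixed_piece G n" "n - 1" "ambient_dim (Obj G)" by (rule prism_space_mixed_piece)
  interpret Y: prism_space "simplicial_piece G (n - 1)" "n - 1" "ambient_dim (Obj G)" by (rule prism_space_simplicial_piece)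
  interpret N: manifold_space "nerve G n" by (rule manifold_space_nerve)
  obtain k where n: "n = Suc k" using assms(1) by (cases n) auto
  show ?thesis
  proof unfold_locales
    show "smooth_map (mixed_piece G n) (simplicial_piece G (n - 1)) (map_prod id (nerve_face G n i))"
    proof (rule N.smooth_map_prod[OF manifold_space_nerve])
      show "smooth_map (nerve G n) (nerve G (n - 1)) (nerve_face G n i)"
        using smooth_nerve_face[of i k] assms(2) by (simp add: n)
      show "smooth_on_set (Suc (n - 1)) (standard_simplex (n - 1)) (\<lambda>t. id t j)" for j
        using standard_simplex_RN[of "n - 1"] by (auto simp: smooth_on_set_iff intro!: smooth_at_coord)
    qed simp
  qed
qed

lemma compatible_cochains_iff:
  "c \<in> compatible_cochains G R k \<longleftrightarrow> (\<forall>n. c n \<in> carrier (cochains (simplicial_piece G n) R k)) \<and>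
    (\<forall>n\<ge>1. \<forall>i\<le>n. \<forall>\<sigma>\<in>smooth_simplices (mixed_piece G n) k.
      c n (simplex_map (nat k) (map_prod (simplical_face i) id) \<sigma>) =
      c (n - 1) (simplex_map (nat k) (map_prod id (nerve_face G n i)) \<sigma>))"
  unfolding compatible_cochains_def cochain_pullback_def restrict_eq_iff by simp

lemma singular_complex_simps:
  "carrier (grp (singular_complex G R) k) = compatible_cochains G R k"
  "x \<otimes>\<^bsub>grp (singular_complex G R) k\<^esub> y = (\<lambda>n. \<lambda>\<sigma>\<in>smooth_simplices (simplicial_piece G n) k. x n \<sigma> \<otimes>\<^bsub>R\<^esub> y n \<sigma>)"
  "\<one>\<^bsub>grp (singular_complex G R) k\<^esub> = (\<lambda>n. \<lambda>\<sigma>\<in>smooth_simplices (simplicial_piece G n) k. \<one>\<^bsub>R\<^esub>)"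
  "diff (singular_complex G R) k c = (\<lambda>n. coboundary (simplicial_piece G n) R k (c n))"
  by (simp_all add: singular_complex_def cochains_def restrict_UNIV)

lemma cochain_faces:
  assumes "1 \<le> n" "i \<le> n" "\<sigma> \<in> smooth_simplices (mixed_piece G n) k"
  shows "simplex_map (nat k) (map_prod (simplical_face i) id) \<sigma> \<in> smooth_simplices (simplicial_piece G n) k"
    "simplex_map (nat k) (map_prod id (nerve_face G n i)) \<sigma> \<in> smooth_simplices (simplicial_piece G (n - 1)) k"
  using simplex_map_smooth[OF prism_map_coface[OF assms(1,2)] assms(3)]
    simplex_map_smooth[OF prism_map_nerve_face[OF assms(1,2)] assms(3)] by auto

context
  fixes R :: "'r monoid"
  assumes R: "comm_group R"
begin

interpretation R: comm_group R by (rule R)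

interpretation cochain_space "simplicial_piece G n" n "ambient_dim (Obj G)" R for n
  by (intro cochain_space.intro cochain_space_axioms.intro prism_space_simplicial_piece R)

lemma compatible_cochains_subgroup:
  "subgroup (compatible_cochains G R k) (product_group UNIV (\<lambda>n. cochains (simplicial_piece G n) R k))"
proof -
  interpret P: comm_group "product_group UNIV (\<lambda>n. cochains (simplicial_piece G n) R k)"
    by (intro comm_group_product_group comm_group_cochains R)
  have g: "group (cochains (simplicial_piece G n) R k)" for n
    using comm_group_cochains[OF R] comm_group.axioms(2) by blast
  have inv: "inv\<^bsub>product_group UNIV (\<lambda>n. cochains (simplicial_piece G n) R k)\<^esub> c =
      (\<lambda>n. \<lambda>\<sigma>\<in>smooth_simplices (simplicial_piece G n) k. inv\<^bsub>R\<^esub> c n \<sigma>)" if "c \<in> compatible_cochains G R k" for c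
  proof -
    have c: "c n \<in> carrier (cochains (simplicial_piece G n) R k)" for n using that by (simp add: compatible_cochains_iff)
    have "inv\<^bsub>cochains (simplicial_piece G n) R k\<^esub> c n = (\<lambda>\<sigma>\<in>smooth_simplices (simplicial_piece G n) k. inv\<^bsub>R\<^esub> c n \<sigma>)" for n
      unfolding cochains_def by (rule inv_product_group) (use c[of n] in \<open>simp_all add: cochains_def\<close>)
    then show ?thesis
      by (subst inv_product_group) (use c g in \<open>auto simp: restrict_UNIV PiE_iff\<close>)
  qed
  show ?thesis
  proof (rule P.subgroupI)
    show "compatible_cochains G R k \<subseteq> carrier (product_group UNIV (\<lambda>n. cochains (simplicial_piece G n) R k))"
      by (auto simp: compatible_cochains_iff)
    have "(\<lambda>n. \<lambda>\<sigma>\<in>smooth_simplices (simplicial_piece G n) k. \<one>\<^bsub>R\<^esub>) \<in> compatible_cochains G R k"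
      using cochain_faces unfolding compatible_cochains_iff by (simp add: cochains_def)
    then show "compatible_cochains G R k \<noteq> {}" by blast
    show "inv\<^bsub>product_group UNIV (\<lambda>n. cochains (simplicial_piece G n) R k)\<^esub> c \<in> compatible_cochains G R k"
      if "c \<in> compatible_cochains G R k" for c
      unfolding inv[OF that] using that cochain_faces unfolding compatible_cochains_iff
      by (auto simp: cochains_def PiE_iff)
    show "c \<otimes>\<^bsub>product_group UNIV (\<lambda>n. cochains (simplicial_piece G n) R k)\<^esub> c' \<in> compatible_cochains G R k"
      if "c \<in> compatible_cochains G R k" "c' \<in> compatible_cochains G R k" for c c'
      using that cochain_faces unfolding compatible_cochains_iff by (auto simp: cochains_def PiE_iff)
  qed
qed

lemma comm_group_singular_complex: "comm_group (grp (singular_complex G R) k)"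
  using comm_group_restrict[OF comm_group_product_group[OF comm_group_cochains[OF R]] compatible_cochains_subgroup]
  by (simp add: singular_complex_def)

text \<open>Compatibility survives the coboundary: both sides of the condition are rewritten by
  \<open>coboundary_simplex_map\<close> and then agree face by face.\<close>

lemma singular_complex_hom:
  "diff (singular_complex G R) k \<in> hom (grp (singular_complex G R) k) (grp (singular_complex G R) (k + 1))"
proof (rule homI)
  fix c assume c: "c \<in> carrier (grp (singular_complex G R) k)"
  have cn: "c n \<in> carrier (cochains (simplicial_piece G n) R k)" for n
    using c by (simp add: singular_complex_simps compatible_cochains_iff)
  have "coboundary (simplicial_piece G n) R k (c n) (simplex_map (nat (k + 1)) (map_prod (simplical_face i) id) \<sigma>) =
      coboundary (simplicial_piece G (n - 1)) R k (c (n - 1)) (simplex_map (nat (k + 1)) (map_prod id (nerve_face G n i)) \<sigma>)"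
    if n: "1 \<le> n" "i \<le> n" and \<sigma>: "\<sigma> \<in> smooth_simplices (mixed_piece G n) (k + 1)" for n i \<sigma>
    unfolding coboundary_simplex_map[OF prism_map_coface[OF n] R cn \<sigma>]
      coboundary_simplex_map[OF prism_map_nerve_face[OF n] R cn \<sigma>]
  proof (cases k rule: int_nat_cases)
    case (2 p)
    have \<sigma>': "\<sigma> \<in> smooth_simplices (mixed_piece G n) (int (Suc p))" using \<sigma> by (simp add: 2 add.commute)
    have face: "singular_face (Suc p) j \<sigma> \<in> smooth_simplices (mixed_piece G n) k" if "j \<le> Suc p" for j
      using singular_face_smooth[OF prism_space_mixed_piece \<sigma>' that] by (simp add: 2)
    have eq: "c n (simplex_map (nat k) (map_prod (simplical_face i) id) (singular_face (Suc p) j \<sigma>)) =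
        c (n - 1) (simplex_map (nat k) (map_prod id (nerve_face G n i)) (singular_face (Suc p) j \<sigma>))" if "j \<le> Suc p" for j
      using c n face[OF that] by (simp add: singular_complex_simps compatible_cochains_iff)
    have cl: "c (n - 1) (simplex_map (nat k) (map_prod id (nerve_face G n i)) (singular_face (Suc p) j \<sigma>)) \<in> carrier R"
      if "j \<le> Suc p" for j
      using cn[of "n - 1"] cochain_faces(2)[OF n face[OF that]] by (auto simp: cochains_def PiE_iff)
    have "nat (k + 1) = Suc p" by (simp add: 2)
    then show "(if k < 0 then \<one>\<^bsub>R\<^esub> else finprod R (\<lambda>j. c n (simplex_map (nat k) (map_prod (simplical_face i) id)
        (singular_face (nat (k + 1)) j \<sigma>)) [^]\<^bsub>R\<^esub> ((- 1) ^ j :: int)) {..nat (k + 1)}) =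
      (if k < 0 then \<one>\<^bsub>R\<^esub> else finprod R (\<lambda>j. c (n - 1) (simplex_map (nat k) (map_prod id (nerve_face G n i))
        (singular_face (nat (k + 1)) j \<sigma>)) [^]\<^bsub>R\<^esub> ((- 1) ^ j :: int)) {..nat (k + 1)})"
      using eq cl by (simp only:) (auto intro!: R.finprod_cong')
  qed simp
  then show "diff (singular_complex G R) k c \<in> carrier (grp (singular_complex G R) (k + 1))"
    using coboundary_closed[OF cn] by (simp add: singular_complex_simps compatible_cochains_iff)
next
  fix c c' assume "c \<in> carrier (grp (singular_complex G R) k)" "c' \<in> carrier (grp (singular_complex G R) k)"
  then have cn: "c n \<in> carrier (cochains (simplicial_piece G n) R k)" "c' n \<in> carrier (cochains (simplicial_piece G n) R k)" for n
    by (simp_all add: singular_complex_simps compatible_cochains_iff)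
  show "diff (singular_complex G R) k (c \<otimes>\<^bsub>grp (singular_complex G R) k\<^esub> c') =
      diff (singular_complex G R) k c \<otimes>\<^bsub>grp (singular_complex G R) (k + 1)\<^esub> diff (singular_complex G R) k c'"
    using coboundary_mult[OF cn] by (simp add: singular_complex_simps cochains_def)
qed

end

end

section \<open>Complex coefficients\<close>

lemma comm_group_complex_group: "comm_group complex_group"
proof (rule comm_groupI)
  show "\<exists>y\<in>carrier complex_group. y \<otimes>\<^bsub>complex_group\<^esub> x = \<one>\<^bsub>complex_group\<^esub>" for x
    by (rule bexI[of _ "- x"]) (simp_all add: complex_group_def)
qed (simp_all add: complex_group_def)

interpretation complex_group: comm_group complex_group by (rule comm_group_complex_group)

lemma complex_group_simps [simp]:
  "carrier complex_group = UNIV" "x \<otimes>\<^bsub>complex_group\<^esub> y = x + y" "\<one>\<^bsub>complex_group\<^esub> = 0"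
  by (simp_all add: complex_group_def)

lemma coeff_subgroup_UNIV: "coeff_subgroup UNIV = complex_group"
  by (simp add: complex_group_def)

lemma inv_complex_group [simp]: "inv\<^bsub>complex_group\<^esub> x = - x"
  by (rule complex_group.inv_equality) simp_all

lemma comm_group_coeff_subgroup: "subgroup \<Lambda> complex_group \<Longrightarrow> comm_group (coeff_subgroup \<Lambda>)"
  by (rule comm_group_restrict[OF comm_group_complex_group])

lemma sign_pow_complex_group: "x [^]\<^bsub>complex_group\<^esub> ((- 1) ^ i :: int) = (- 1) ^ i * x"
  by (cases "even i") (simp_all add: complex_group.int_pow_neg)

lemma finprod_coeff_subgroup:
  assumes "subgroup \<Lambda> complex_group" "finite A" "\<And>a. a \<in> A \<Longrightarrow> f a \<in> \<Lambda>"
  shows "finprod (coeff_subgroup \<Lambda>) f A = sum f A"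
proof -
  interpret comm_group "coeff_subgroup \<Lambda>" by (rule comm_group_coeff_subgroup[OF assms(1)])
  show ?thesis using assms(2,3) by (induction A) (simp_all add: Pi_iff)
qed

text \<open>Powers and products in the subgroup are those of \<complex>, which turns the coboundary
  into an ordinary alternating sum; \<open>\<Lambda> = UNIV\<close> gives the complex case.\<close>

lemma coboundary_coeff_subgroup:
  assumes \<Lambda>: "subgroup \<Lambda> complex_group" and X: "prism_space X n m"
    and c: "c \<in> carrier (cochains X (coeff_subgroup \<Lambda>) (int p))"
  shows "coboundary X (coeff_subgroup \<Lambda>) (int p) c =
    (\<lambda>\<sigma>\<in>smooth_simplices X (int (Suc p)). \<Sum>i\<le>Suc p. (- 1) ^ i * c (singular_face (Suc p) i \<sigma>))"
  unfolding coboundary_nat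
proof (rule restrict_ext)
  fix \<sigma> assume \<sigma>: "\<sigma> \<in> smooth_simplices X (int (Suc p))"
  have cl: "c (singular_face (Suc p) i \<sigma>) \<in> \<Lambda>" if "i \<le> Suc p" for i
    using c singular_face_smooth[OF X \<sigma> that] by (auto simp: cochains_def PiE_iff)
  have pow: "c (singular_face (Suc p) i \<sigma>) [^]\<^bsub>coeff_subgroup \<Lambda>\<^esub> ((- 1) ^ i :: int) = (- 1) ^ i * c (singular_face (Suc p) i \<sigma>)"
    "(- 1) ^ i * c (singular_face (Suc p) i \<sigma>) \<in> \<Lambda>" if "i \<le> Suc p" for i
    using complex_group.int_pow_consistent[OF \<Lambda> cl[OF that], of "(- 1) ^ i"]
      complex_group.subgroup_int_pow_closed[OF \<Lambda> cl[OF that], of "(- 1) ^ i"]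
    by (simp_all add: sign_pow_complex_group)
  have "finprod (coeff_subgroup \<Lambda>) (\<lambda>i. c (singular_face (Suc p) i \<sigma>) [^]\<^bsub>coeff_subgroup \<Lambda>\<^esub> ((- 1) ^ i :: int)) {..Suc p} =
      (\<Sum>i\<le>Suc p. c (singular_face (Suc p) i \<sigma>) [^]\<^bsub>coeff_subgroup \<Lambda>\<^esub> ((- 1) ^ i :: int))"
    by (rule finprod_coeff_subgroup[OF \<Lambda>]) (use pow in auto)
  then show "finprod (coeff_subgroup \<Lambda>) (\<lambda>i. c (singular_face (Suc p) i \<sigma>) [^]\<^bsub>coeff_subgroup \<Lambda>\<^esub> ((- 1) ^ i :: int)) {..Suc p} =
      (\<Sum>i\<le>Suc p. (- 1) ^ i * c (singular_face (Suc p) i \<sigma>))"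
    using pow(1) by simp
qed

lemma subgroup_UNIV_complex_group: "subgroup UNIV complex_group"
  using complex_group.subgroup_self by simp

lemmas coboundary_complex_group =
  coboundary_coeff_subgroup[OF subgroup_UNIV_complex_group, unfolded coeff_subgroup_UNIV]

lemma carrier_cochains_coeff_subgroup:
  "carrier (cochains X (coeff_subgroup \<Lambda>) k) = {c \<in> carrier (cochains X complex_group k). \<forall>\<sigma>\<in>smooth_simplices X k. c \<sigma> \<in> \<Lambda>}"
  by (auto simp: cochains_def PiE_iff extensional_def)

lemma coboundary_coeff_subgroup_eq:
  assumes \<Lambda>: "subgroup \<Lambda> complex_group" and X: "prism_space X n m"
    and c: "c \<in> carrier (cochains X (coeff_subgroup \<Lambda>) k)"
  shows "coboundary X (coeff_subgroup \<Lambda>) k c = coboundary X complex_group k c"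
proof (cases k rule: int_nat_cases)
  case (2 p)
  have "c \<in> carrier (cochains X complex_group k)" using c by (simp add: carrier_cochains_coeff_subgroup)
  then show ?thesis using c coboundary_coeff_subgroup[OF \<Lambda> X] coboundary_complex_group[OF X] by (simp add: 2)
qed (simp add: coboundary_negative)

lemma singular_face_singular_face:
  assumes "i \<le> j" "j \<le> Suc p"
  shows "singular_face (Suc p) i (singular_face (Suc (Suc p)) (Suc j) \<sigma>) =
    singular_face (Suc p) j (singular_face (Suc (Suc p)) i \<sigma>)"
proof
  fix t
  show "singular_face (Suc p) i (singular_face (Suc (Suc p)) (Suc j) \<sigma>) t =
      singular_face (Suc p) j (singular_face (Suc (Suc p)) i \<sigma>) t"
  proof (cases "t \<in> standard_simplex p")
    case True
    have "simplical_face (Suc j) (simplical_face i t) = simplical_face i (simplical_face j t)"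
      using assms by (auto simp: simplical_face_def fun_eq_iff)
    then show ?thesis
      using True simplical_face_simplex[of i p t] simplical_face_simplex[of j p t] assms
      by (simp add: singular_face_def)
  qed (simp add: singular_face_def)
qed

text \<open>Omitting two vertices in different orders carries opposite signs. Complex coefficients
  suffice: \<Lambda>-valued cochains are stable under the complex coboundary, and for
  \<complex>/\<Lambda> the identity descends along the surjective reduction.\<close>

lemma coboundary_coboundary:
  assumes X: "prism_space X n m" and c: "c \<in> carrier (cochains X complex_group k)"
  shows "coboundary X complex_group (k + 1) (coboundary X complex_group k c) = (\<lambda>\<sigma>\<in>smooth_simplices X (k + 1 + 1). 0)"
proof -
  interpret cochain_space X n m complex_group
    by (intro cochain_space.intro cochain_space_axioms.intro X comm_group_complex_group)
  note dc = coboundary_closed[OF c]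
  show ?thesis
  proof (cases k rule: int_nat_cases)
    case 1
    show ?thesis
    proof (cases "k + 1" rule: int_nat_cases)
      \<comment> \<open>This is degree -1: the first coboundary is the zero cochain of degree 0, on
        which the second one still has to be evaluated.\<close>
      case (2 q)
      have z: "coboundary X complex_group k c = (\<lambda>\<sigma>\<in>smooth_simplices X (int q). 0)"
        using \<open>k < 0\<close> by (simp add: coboundary_negative 2)
      have "coboundary X complex_group (int q) (coboundary X complex_group k c) = (\<lambda>\<sigma>\<in>smooth_simplices X (int (Suc q)). 0)"
        unfolding coboundary_complex_group[OF X dc[unfolded 2]]
        by (rule restrict_ext) (simp add: z face_smooth)
      then show ?thesis unfolding 2 by (simp add: add.commute)
    qed (simp add: coboundary_negative)
  next
    case (2 p)
    have k1: "k + 1 = int (Suc p)" "k + 1 + 1 = int (Suc (Suc p))" using 2 by simp_all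
    have "(\<Sum>i\<le>Suc (Suc p). (- 1) ^ i * coboundary X complex_group k c (singular_face (Suc (Suc p)) i \<sigma>)) = 0"
      if \<sigma>: "\<sigma> \<in> smooth_simplices X (int (Suc (Suc p)))" for \<sigma>
    proof -
      define s where "s i l = (if l < i then l else l - 1)" for i l :: nat
      define t where "t i l = (- 1) ^ i * ((- 1) ^ s i l * c (singular_face (Suc p) (s i l) (singular_face (Suc (Suc p)) i \<sigma>)))" for i l
      have "(\<Sum>i\<le>Suc (Suc p). (- 1) ^ i * coboundary X complex_group k c (singular_face (Suc (Suc p)) i \<sigma>)) =
          (\<Sum>i<Suc (Suc (Suc p)). \<Sum>l<Suc (Suc (Suc p)) - 1. t i (if l < i then l else Suc l))"
        unfolding lessThan_Suc_atMost diff_Suc_1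
      proof (intro sum.cong refl)
        fix i assume "i \<in> {..Suc (Suc p)}"
        then have face: "singular_face (Suc (Suc p)) i \<sigma> \<in> smooth_simplices X (int (Suc p))"
          using face_smooth[OF \<sigma>] by simp
        show "(- 1) ^ i * coboundary X complex_group k c (singular_face (Suc (Suc p)) i \<sigma>) =
            (\<Sum>l\<le>Suc p. t i (if l < i then l else Suc l))"
          unfolding 2 coboundary_complex_group[OF X c[unfolded 2]] restrict_apply'[OF face] sum_distrib_left
          by (intro sum.cong refl) (auto simp: t_def s_def)
      qed
      also have "\<dots> = 0"
      proof (rule antisymmetric_sum_zero)
        have *: "t j i = - t i j" if ij: "i < j" "j < Suc (Suc (Suc p))" for i j
        proof -
          obtain j' where j: "j = Suc j'" using ij by (cases j) auto
          have "singular_face (Suc p) i (singular_face (Suc (Suc p)) j \<sigma>) =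
              singular_face (Suc p) j' (singular_face (Suc (Suc p)) i \<sigma>)"
            unfolding j by (rule singular_face_singular_face) (use ij j in auto)
          then show ?thesis using ij by (simp add: t_def s_def j)
        qed
        show "t j i = - t i j" if "i < Suc (Suc (Suc p))" "j < Suc (Suc (Suc p))" "i \<noteq> j" for i j
          using that *[of i j] *[of j i] by (cases i j rule: linorder_cases) auto
      qed
      finally show ?thesis .
    qed
    then show ?thesis
      unfolding k1(2) unfolding k1(1) coboundary_complex_group[OF X dc[unfolded k1]] by (rule restrict_ext)
  qed
qed

text \<open>Applied to the coset map \<complex> \<rightarrow> \<complex>/\<Lambda>, this makes
  reduction commute with the differentials.\<close>

lemma coboundary_hom:
  assumes X: "prism_space X n m" and R: "comm_group R" and R': "comm_group R'" and h: "h \<in> hom R R'"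
    and c: "c \<in> carrier (cochains X R k)" and \<sigma>: "\<sigma> \<in> smooth_simplices X (k + 1)"
  shows "coboundary X R' k (\<lambda>\<sigma>\<in>smooth_simplices X k. h (c \<sigma>)) \<sigma> = h (coboundary X R k c \<sigma>)"
proof -
  interpret R: comm_group R by fact
  interpret R': comm_group R' by fact
  interpret h: group_hom R R' h by unfold_locales (rule h)
  show ?thesis
  proof (cases k rule: int_nat_cases)
    case 1
    then show ?thesis using \<sigma> by (simp add: coboundary_negative)
  next
    case (2 p)
    have fin: "h (finprod R f A) = finprod R' (\<lambda>i. h (f i)) A" if "finite A" "f \<in> A \<rightarrow> carrier R"
      for f and A :: "nat set"
      using that by (induction A) (auto simp: Pi_iff)
    have \<sigma>': "\<sigma> \<in> smooth_simplices X (int (Suc p))" using \<sigma> by (simp add: 2 add.commute)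
    note face = singular_face_smooth[OF X \<sigma>']
    have cl: "c (singular_face (Suc p) i \<sigma>) \<in> carrier R" if "i \<le> Suc p" for i
      using c face[OF that] by (auto simp: 2 cochains_def PiE_iff)
    have "h (coboundary X R k c \<sigma>) =
        finprod R' (\<lambda>i. h (c (singular_face (Suc p) i \<sigma>) [^]\<^bsub>R\<^esub> ((- 1) ^ i :: int))) {..Suc p}"
      unfolding 2 coboundary_nat restrict_apply'[OF \<sigma>'] by (rule fin) (use cl in auto)
    also have "\<dots> = coboundary X R' k (\<lambda>\<sigma>\<in>smooth_simplices X k. h (c \<sigma>)) \<sigma>"
      unfolding 2 coboundary_nat restrict_apply'[OF \<sigma>']
      by (rule R'.finprod_cong') (use cl face in \<open>auto simp: h.hom_int_pow\<close>)
    finally show ?thesis by simp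
  qed
qed

context smooth_etale_groupoid
begin

lemma group_complex_singular_complex: "group_complex (singular_complex G complex_group)"
proof (rule group_complex.intro)
  show "diff (singular_complex G complex_group) (k + 1) (diff (singular_complex G complex_group) k c) =
      \<one>\<^bsub>grp (singular_complex G complex_group) (k + 1 + 1)\<^esub>"
    if "c \<in> carrier (grp (singular_complex G complex_group) k)" for k c
    using coboundary_coboundary[OF prism_space_simplicial_piece] that
    by (simp add: singular_complex_simps compatible_cochains_iff)
qed (rule comm_group_singular_complex singular_complex_hom, rule comm_group_complex_group)+

section \<open>The de Rham complex, and integration as a map of complexes\<close>

lemma comm_group_de_rham: "comm_group (grp (de_rham G) k)"
proof (rule comm_groupI)
  note pull = pullback_add pullback_uminus pullback_zero
  have zero: "0 \<in> compatible_forms G k"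
    by (simp add: compatible_forms_def pull zero_in_forms[OF prism_space_simplicial_piece])
  have add: "\<omega> + \<omega>' \<in> compatible_forms G k" if "\<omega> \<in> compatible_forms G k" "\<omega>' \<in> compatible_forms G k" for \<omega> \<omega>'
    using that by (simp add: compatible_forms_def pull add_in_forms)
  have minus: "- \<omega> \<in> compatible_forms G k" if "\<omega> \<in> compatible_forms G k" for \<omega>
    using that by (simp add: compatible_forms_def pull uminus_in_forms)
  show "\<one>\<^bsub>grp (de_rham G) k\<^esub> \<in> carrier (grp (de_rham G) k)" using zero by (simp add: de_rham_def)
  show "\<omega> \<otimes>\<^bsub>grp (de_rham G) k\<^esub> \<omega>' \<in> carrier (grp (de_rham G) k)"
    if "\<omega> \<in> carrier (grp (de_rham G) k)" "\<omega>' \<in> carrier (grp (de_rham G) k)" for \<omega> \<omega>'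
    using add that by (simp add: de_rham_def)
  show "\<exists>\<omega>'\<in>carrier (grp (de_rham G) k). \<omega>' \<otimes>\<^bsub>grp (de_rham G) k\<^esub> \<omega> = \<one>\<^bsub>grp (de_rham G) k\<^esub>"
    if "\<omega> \<in> carrier (grp (de_rham G) k)" for \<omega>
    by (rule bexI[of _ "- \<omega>"]) (use minus that in \<open>simp_all add: de_rham_def\<close>)
qed (simp_all add: de_rham_def add.assoc add.commute)

lemma de_rham_simps:
  "carrier (grp (de_rham G) k) = compatible_forms G k"
  "\<omega> \<otimes>\<^bsub>grp (de_rham G) k\<^esub> \<omega>' = \<omega> + \<omega>'" "\<one>\<^bsub>grp (de_rham G) k\<^esub> = 0"
  "diff (de_rham G) k \<omega> = (\<lambda>n. ext_deriv (simplicial_piece G n) (\<omega> n))"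
  by (simp_all add: de_rham_def)

lemma compatible_forms_forms: "\<omega> \<in> compatible_forms G k \<Longrightarrow> \<omega> n \<in> forms (simplicial_piece G n) k"
  by (simp add: compatible_forms_def)

lemma group_complex_subcomplex:
  assumes "is_subcomplex (de_rham G) S"
  shows "group_complex (subcomplex_on (de_rham G) S)"
proof (rule group_complex.intro)
  fix k
  have S: "subgroup (S k) (grp (de_rham G) k)" for k using assms by (simp add: is_subcomplex_def)
  have sub: "S k \<subseteq> compatible_forms G k" for k using subgroup.subset[OF S] by (simp add: de_rham_simps)
  have d: "diff (de_rham G) k \<omega> \<in> S (k + 1)" if "\<omega> \<in> S k" for k \<omega> using assms that by (simp add: is_subcomplex_def)
  note forms = compatible_forms_forms[OF subsetD[OF sub]]
  show "comm_group (grp (subcomplex_on (de_rham G) S) k)"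
    using comm_group_restrict[OF comm_group_de_rham S] by (simp add: subcomplex_on_def)
  show "diff (subcomplex_on (de_rham G) S) k \<in>
      hom (grp (subcomplex_on (de_rham G) S) k) (grp (subcomplex_on (de_rham G) S) (k + 1))"
    by (rule homI) (use d in \<open>auto simp: subcomplex_on_def de_rham_simps plus_fun_def
        ext_deriv_add[OF prism_space_simplicial_piece forms forms, unfolded plus_fun_def]\<close>)
  show "diff (subcomplex_on (de_rham G) S) (k + 1) (diff (subcomplex_on (de_rham G) S) k \<omega>) =
      \<one>\<^bsub>grp (subcomplex_on (de_rham G) S) (k + 1 + 1)\<^esub>"
    if "\<omega> \<in> carrier (grp (subcomplex_on (de_rham G) S) k)" for \<omega>
    using that ext_deriv_ext_deriv[OF prism_space_simplicial_piece forms]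
    by (simp add: subcomplex_on_def de_rham_simps zero_fun_def)
qed

text \<open>The integrals over both image simplices are integrals of pulled back forms over
  \<open>\<sigma>\<close> itself, and these pulled back forms agree by compatibility of
  \<open>\<omega>\<close>.\<close>

lemma integration_compatible:
  assumes \<omega>: "\<omega> \<in> compatible_forms G k"
  shows "integration G k \<omega> \<in> compatible_cochains G complex_group k"
  unfolding compatible_cochains_iff
proof (intro conjI allI impI ballI)
  show "integration G k \<omega> n \<in> carrier (cochains (simplicial_piece G n) complex_group k)" for n
    by (simp add: integration_def cochains_def)
  fix n i \<sigma> assume n: "1 \<le> n" "i \<le> n" and \<sigma>: "\<sigma> \<in> smooth_simplices (mixed_piece G n) k"
  have k: "k = int (nat k)" using smooth_simplicesD(1)[OF \<sigma>] by simp
  have \<sigma>': "\<sigma> \<in> smooth_simplices (mixed_piece G n) (int (nat k))" using \<sigma> k by simp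
  have "pullback (mixed_piece G n) (simplicial_piece G n) (map_prod (simplical_face i) id) (\<omega> n) =
      pullback (mixed_piece G n) (simplicial_piece G (n - 1)) (map_prod id (nerve_face G n i)) (\<omega> (n - 1))"
    using \<omega> n by (simp add: compatible_forms_def)
  then show "integration G k \<omega> n (simplex_map (nat k) (map_prod (simplical_face i) id) \<sigma>) =
      integration G k \<omega> (n - 1) (simplex_map (nat k) (map_prod id (nerve_face G n i)) \<sigma>)"
    using cochain_faces[OF n \<sigma>] integrate_form_simplex_map[OF prism_map_coface[OF n] \<sigma>']
      integrate_form_simplex_map[OF prism_map_nerve_face[OF n] \<sigma>']
    by (simp add: integration_def)
qed

text \<open>Stokes' theorem enters here: \<open>integrate_form_ext_deriv\<close> is the
  compatibility with the differentials, separately for every simplicial degree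
  \<open>n\<close>.\<close>

lemma integration_map:
  assumes S: "is_subcomplex (de_rham G) S"
  shows "group_complex_map (subcomplex_on (de_rham G) S) (singular_complex G complex_group) (integration G)"
proof (intro group_complex_map.intro group_complex_map_axioms.intro group_complex_subcomplex[OF S]
    group_complex_singular_complex)
  fix k
  have sub: "S k \<subseteq> compatible_forms G k" for k
    using S subgroup.subset[of "S k" "grp (de_rham G) k"] by (auto simp: is_subcomplex_def de_rham_simps)
  show "integration G k \<in> hom (grp (subcomplex_on (de_rham G) S) k) (grp (singular_complex G complex_group) k)"
  proof (rule homI)
    show "integration G k \<omega> \<in> carrier (grp (singular_complex G complex_group) k)"
      if "\<omega> \<in> carrier (grp (subcomplex_on (de_rham G) S) k)" for \<omega>
      using that sub integration_compatible by (auto simp: subcomplex_on_def singular_complex_simps)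
    fix \<omega> \<omega>' assume "\<omega> \<in> carrier (grp (subcomplex_on (de_rham G) S) k)" "\<omega>' \<in> carrier (grp (subcomplex_on (de_rham G) S) k)"
    then have "\<omega> \<in> compatible_forms G k" "\<omega>' \<in> compatible_forms G k"
      using sub by (auto simp: subcomplex_on_def)
    then have f: "\<omega> n \<in> forms (simplicial_piece G n) k" "\<omega>' n \<in> forms (simplicial_piece G n) k" for n
      by (simp_all add: compatible_forms_forms)
    have "integrate_form (simplicial_piece G n) (nat k) \<sigma> (\<omega> n + \<omega>' n) =
        integrate_form (simplicial_piece G n) (nat k) \<sigma> (\<omega> n) + integrate_form (simplicial_piece G n) (nat k) \<sigma> (\<omega>' n)"
      if "\<sigma> \<in> smooth_simplices (simplicial_piece G n) k" for n \<sigma>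
      using integrate_form_add[OF prism_space_simplicial_piece _ f, of \<sigma> n "nat k"] smooth_simplicesD(1)[OF that] that by simp
    then show "integration G k (\<omega> \<otimes>\<^bsub>grp (subcomplex_on (de_rham G) S) k\<^esub> \<omega>') =
        integration G k \<omega> \<otimes>\<^bsub>grp (singular_complex G complex_group) k\<^esub> integration G k \<omega>'"
      by (auto simp: subcomplex_on_def de_rham_simps singular_complex_simps integration_def intro!: ext restrict_ext)
  qed
  fix \<omega> assume "\<omega> \<in> carrier (grp (subcomplex_on (de_rham G) S) k)"
  then have \<omega>: "\<omega> \<in> compatible_forms G k" using sub by (auto simp: subcomplex_on_def)
  have "integration G (k + 1) (\<lambda>n. ext_deriv (simplicial_piece G n) (\<omega> n)) n =
      coboundary (simplicial_piece G n) complex_group k (integration G k \<omega> n)" for n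
  proof (cases k rule: int_nat_cases)
    case 1
    \<comment> \<open>Forms of negative degree vanish. Degree -1 still needs an argument, since
      integration after the differential yields a cochain of degree 0.\<close>
    then have "\<omega> n = 0" using forms_negative compatible_forms_forms[OF \<omega>, of n] by blast
    moreover have "integrate_form X p \<sigma> 0 = 0" for X :: "((nat \<Rightarrow> real) \<times> 'a \<times> (nat \<Rightarrow> 'b)) charted" and p \<sigma>
      using simplex_integral_mult[of p 0 "\<lambda>_. 0"] by (simp add: integrate_form_eq pullback_zero)
    ultimately show ?thesis
      using 1 by (simp add: integration_def coboundary_negative ext_deriv_zero[OF prism_space_simplicial_piece])
  next
    case (2 p)
    have k1: "int p + 1 = int (Suc p)" "nat (int (Suc p)) = Suc p" by simp_all
    have c: "integration G k \<omega> n \<in> carrier (cochains (simplicial_piece G n) complex_group (int p))"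
      using integration_compatible[OF \<omega>] by (simp add: 2 compatible_cochains_iff)
    note X = prism_space_simplicial_piece
    have "(\<lambda>\<sigma>\<in>smooth_simplices (simplicial_piece G n) (int (Suc p)).
          integrate_form (simplicial_piece G n) (Suc p) \<sigma> (ext_deriv (simplicial_piece G n) (\<omega> n))) =
        (\<lambda>\<sigma>\<in>smooth_simplices (simplicial_piece G n) (int (Suc p)).
          \<Sum>i\<le>Suc p. (- 1) ^ i * integration G k \<omega> n (singular_face (Suc p) i \<sigma>))"
    proof (rule restrict_ext)
      fix \<sigma> assume \<sigma>: "\<sigma> \<in> smooth_simplices (simplicial_piece G n) (int (Suc p))"
      show "integrate_form (simplicial_piece G n) (Suc p) \<sigma> (ext_deriv (simplicial_piece G n) (\<omega> n)) =
          (\<Sum>i\<le>Suc p. (- 1) ^ i * integration G k \<omega> n (singular_face (Suc p) i \<sigma>))"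
        unfolding integrate_form_ext_deriv[OF X \<sigma> compatible_forms_forms[OF \<omega>]]
        by (intro sum.cong refl) (use singular_face_smooth[OF X \<sigma>] in \<open>simp add: 2 integration_def\<close>)
    qed
    then show ?thesis
      using coboundary_complex_group[OF X c] by (simp only: integration_def k1 2)
  qed
  then show "integration G (k + 1) (diff (subcomplex_on (de_rham G) S) k \<omega>) =
      diff (singular_complex G complex_group) k (integration G k \<omega>)"
    by (auto simp: subcomplex_on_def de_rham_simps singular_complex_simps)
qed

section \<open>Reduction modulo \<Lambda>\<close>

context
  fixes \<Lambda> :: "complex set"
  assumes \<Lambda>: "subgroup \<Lambda> complex_group"
begin

interpretation \<Lambda>: subgroup \<Lambda> complex_group by (rule \<Lambda>)
interpretation \<Lambda>: normal \<Lambda> complex_group by (rule complex_group.subgroup_imp_normal[OF \<Lambda>])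
interpretation Q: comm_group "complex_group Mod \<Lambda>" by (rule complex_group.abelian_FactGroup[OF \<Lambda>])

lemma reduction_compatible:
  assumes "c \<in> compatible_cochains G complex_group k"
  shows "reduction G \<Lambda> k c \<in> compatible_cochains G (complex_group Mod \<Lambda>) k"
  using assms cochain_faces hom_in_carrier[OF \<Lambda>.r_coset_hom_Mod]
  unfolding compatible_cochains_iff by (auto simp: reduction_def cochains_def)

lemma reduction_hom:
  "reduction G \<Lambda> k \<in> hom (grp (singular_complex G complex_group) k) (grp (singular_complex G (complex_group Mod \<Lambda>)) k)"
proof (rule homI)
  show "reduction G \<Lambda> k c \<in> carrier (grp (singular_complex G (complex_group Mod \<Lambda>)) k)"
    if "c \<in> carrier (grp (singular_complex G complex_group) k)" for c
    using reduction_compatible that by (simp add: singular_complex_simps)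
  have "\<Lambda> #>\<^bsub>complex_group\<^esub> (x + y) = (\<Lambda> #>\<^bsub>complex_group\<^esub> x) \<otimes>\<^bsub>complex_group Mod \<Lambda>\<^esub> (\<Lambda> #>\<^bsub>complex_group\<^esub> y)" for x y
    using hom_mult[OF \<Lambda>.r_coset_hom_Mod, of x y] by simp
  then show "reduction G \<Lambda> k (c \<otimes>\<^bsub>grp (singular_complex G complex_group) k\<^esub> c') =
      reduction G \<Lambda> k c \<otimes>\<^bsub>grp (singular_complex G (complex_group Mod \<Lambda>)) k\<^esub> reduction G \<Lambda> k c'" for c c'
    by (auto simp: singular_complex_simps reduction_def intro!: ext restrict_ext)
qed

lemma reduction_diff:
  assumes "c \<in> compatible_cochains G complex_group k"
  shows "reduction G \<Lambda> (k + 1) (diff (singular_complex G complex_group) k c) =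
    diff (singular_complex G (complex_group Mod \<Lambda>)) k (reduction G \<Lambda> k c)"
proof
  fix n
  have c: "c n \<in> carrier (cochains (simplicial_piece G n) complex_group k)" using assms by (simp add: compatible_cochains_iff)
  note * = coboundary_hom[OF prism_space_simplicial_piece comm_group_complex_group Q.comm_group_axioms \<Lambda>.r_coset_hom_Mod c]
  have "reduction G \<Lambda> k c n \<in> carrier (cochains (simplicial_piece G n) (complex_group Mod \<Lambda>) k)"
    using reduction_compatible[OF assms] by (simp add: compatible_cochains_iff)
  from cochain_space.coboundary_closed[OF _ this, of n "ambient_dim (Obj G)"]
  have "coboundary (simplicial_piece G n) (complex_group Mod \<Lambda>) k (reduction G \<Lambda> k c n) \<in>
      carrier (cochains (simplicial_piece G n) (complex_group Mod \<Lambda>) (k + 1))"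
    by (simp add: cochain_space_def cochain_space_axioms_def prism_space_simplicial_piece Q.comm_group_axioms)
  then have "coboundary (simplicial_piece G n) (complex_group Mod \<Lambda>) k (reduction G \<Lambda> k c n) \<in>
      extensional (smooth_simplices (simplicial_piece G n) (k + 1))"
    by (simp add: cochains_def PiE_iff)
  then show "reduction G \<Lambda> (k + 1) (diff (singular_complex G complex_group) k c) n =
      diff (singular_complex G (complex_group Mod \<Lambda>)) k (reduction G \<Lambda> k c) n"
    unfolding singular_complex_simps
    by (rule extensionalityI[rotated]) (use * in \<open>auto simp: reduction_def\<close>)
qed

text \<open>The lift \<open>s\<close> acts on values: simplices on which \<open>c\<close> takes the
  same value receive the same complex number. A lift chosen separately for each simplex could
  violate the compatibility conditions.\<close>

lemma reduction_surj: "reduction G \<Lambda> k ` compatible_cochains G complex_group k = compatible_cochains G (complex_group Mod \<Lambda>) k"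
proof (intro equalityI subsetI)
  fix c assume c: "c \<in> compatible_cochains G (complex_group Mod \<Lambda>) k"
  define s where "s Z = (SOME x. \<Lambda> #>\<^bsub>complex_group\<^esub> x = Z)" for Z
  have s: "\<Lambda> #>\<^bsub>complex_group\<^esub> s Z = Z" if "Z \<in> carrier (complex_group Mod \<Lambda>)" for Z
  proof -
    have "\<exists>x. \<Lambda> #>\<^bsub>complex_group\<^esub> x = Z" using that by (auto simp: FactGroup_def RCOSETS_def)
    then show ?thesis unfolding s_def by (rule someI_ex)
  qed
  define c' where "c' n = (\<lambda>\<sigma>\<in>smooth_simplices (simplicial_piece G n) k. s (c n \<sigma>))" for n
  have "c' \<in> compatible_cochains G complex_group k"
    using c cochain_faces unfolding compatible_cochains_iff by (simp add: c'_def cochains_def)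
  moreover have "reduction G \<Lambda> k c' = c"
  proof
    fix n
    have "c n \<in> carrier (cochains (simplicial_piece G n) (complex_group Mod \<Lambda>) k)"
      using c by (simp add: compatible_cochains_iff)
    then show "reduction G \<Lambda> k c' n = c n"
      by (intro extensionalityI[of _ "smooth_simplices (simplicial_piece G n) k"])
        (auto simp: reduction_def c'_def cochains_def PiE_iff s)
  qed
  ultimately show "c \<in> reduction G \<Lambda> k ` compatible_cochains G complex_group k" by blast
qed (use reduction_compatible in blast)

lemma compatible_cochains_coeff_subgroup:
  "c \<in> compatible_cochains G (coeff_subgroup \<Lambda>) k \<longleftrightarrow> c \<in> compatible_cochains G complex_group k \<and>
    (\<forall>n. \<forall>\<sigma>\<in>smooth_simplices (simplicial_piece G n) k. c n \<sigma> \<in> \<Lambda>)"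
  by (auto simp: compatible_cochains_iff carrier_cochains_coeff_subgroup)

lemma reduction_kernel:
  assumes "c \<in> compatible_cochains G complex_group k"
  shows "reduction G \<Lambda> k c = \<one>\<^bsub>grp (singular_complex G (complex_group Mod \<Lambda>)) k\<^esub> \<longleftrightarrow>
    c \<in> compatible_cochains G (coeff_subgroup \<Lambda>) k"
proof -
  have "\<Lambda> #>\<^bsub>complex_group\<^esub> x = \<Lambda> \<longleftrightarrow> x \<in> \<Lambda>" for x
    using complex_group.coset_join1[OF _ _ \<Lambda>, of x] complex_group.coset_join2[OF _ \<Lambda>, of x] by auto
  then show ?thesis
    using assms by (auto simp: compatible_cochains_coeff_subgroup reduction_def singular_complex_simps fun_eq_iff
        restrict_eq_iff)
qed

text \<open>Every compatible cochain with values in \<complex>/\<Lambda> is a reduction, and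
  reduction commutes with the coboundary, so d d = 0 is inherited from complex cochains.\<close>

lemma group_complex_quotient: "group_complex (singular_complex G (complex_group Mod \<Lambda>))"
proof (rule group_complex.intro)
  interpret C: group_complex "singular_complex G complex_group" by (rule group_complex_singular_complex)
  fix k c assume "c \<in> carrier (grp (singular_complex G (complex_group Mod \<Lambda>)) k)"
  then obtain c' where c': "c' \<in> compatible_cochains G complex_group k" "c = reduction G \<Lambda> k c'"
    using reduction_surj[of k] by (auto simp: singular_complex_simps)
  have g: "group (grp (singular_complex G (complex_group Mod \<Lambda>)) k)" for k
    using comm_group_singular_complex[OF Q.comm_group_axioms] comm_group.axioms(2) by blast
  have h: "group_hom (grp (singular_complex G complex_group) k) (grp (singular_complex G (complex_group Mod \<Lambda>)) k) (reduction G \<Lambda> k)" for k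
    by (simp add: group_hom_def group_hom_axioms_def C.group_grp g reduction_hom)
  have "diff (singular_complex G complex_group) k c' \<in> compatible_cochains G complex_group (k + 1)"
    using C.diff_closed[of c' k] c'(1) by (simp add: singular_complex_simps(1))
  then have "diff (singular_complex G (complex_group Mod \<Lambda>)) (k + 1) (diff (singular_complex G (complex_group Mod \<Lambda>)) k c) =
      reduction G \<Lambda> (k + 1 + 1) (diff (singular_complex G complex_group) (k + 1) (diff (singular_complex G complex_group) k c'))"
    using c'(1) by (simp only: c'(2) reduction_diff)
  also have "\<dots> = \<one>\<^bsub>grp (singular_complex G (complex_group Mod \<Lambda>)) (k + 1 + 1)\<^esub>"
    using C.diff_diff[of c' k] c'(1) group_hom.hom_one[OF h] by (simp add: singular_complex_simps(1))
  finally show "diff (singular_complex G (complex_group Mod \<Lambda>)) (k + 1) (diff (singular_complex G (complex_group Mod \<Lambda>)) k c) =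
      \<one>\<^bsub>grp (singular_complex G (complex_group Mod \<Lambda>)) (k + 1 + 1)\<^esub>" .
qed (rule comm_group_singular_complex singular_complex_hom, rule Q.comm_group_axioms)+

lemma integration_setup:
  assumes S: "is_subcomplex (de_rham G) S"
  shows "integration_setup (singular_complex G complex_group) (singular_complex G (complex_group Mod \<Lambda>))
    (subcomplex_on (de_rham G) S) (integration G) (reduction G \<Lambda>) (singular_complex G (coeff_subgroup \<Lambda>))"
proof (intro integration_setup.intro integration_setup_axioms.intro group_complex_map.intro[of _ _ "reduction G \<Lambda>"]
    group_complex_map_axioms.intro integration_map[OF S] group_complex_singular_complex group_complex_quotient reduction_hom)
  note \<Lambda>C = comm_group_coeff_subgroup[OF \<Lambda>]
  interpret C: group_complex "singular_complex G complex_group" by (rule group_complex_singular_complex)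
  fix k
  show L_grp: "grp (singular_complex G (coeff_subgroup \<Lambda>)) k = (grp (singular_complex G complex_group) k)
      \<lparr>carrier := carrier (grp (singular_complex G (coeff_subgroup \<Lambda>)) k)\<rparr>"
    by (simp add: singular_complex_def cochains_def product_group_def)
  show "subgroup (carrier (grp (singular_complex G (coeff_subgroup \<Lambda>)) k)) (grp (singular_complex G complex_group) k)"
  proof (rule group.group_incl_imp_subgroup[OF C.group_grp])
    show "carrier (grp (singular_complex G (coeff_subgroup \<Lambda>)) k) \<subseteq> carrier (grp (singular_complex G complex_group) k)"
      by (auto simp: singular_complex_simps compatible_cochains_coeff_subgroup)
    show "group ((grp (singular_complex G complex_group) k)\<lparr>carrier := carrier (grp (singular_complex G (coeff_subgroup \<Lambda>)) k)\<rparr>)"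
      unfolding L_grp[symmetric] using comm_group_singular_complex[OF \<Lambda>C] comm_group.axioms(2) by blast
  qed
  show "reduction G \<Lambda> (k + 1) (diff (singular_complex G complex_group) k c) =
      diff (singular_complex G (complex_group Mod \<Lambda>)) k (reduction G \<Lambda> k c)"
    if "c \<in> carrier (grp (singular_complex G complex_group) k)" for c
    using reduction_diff that by (simp add: singular_complex_simps(1))
  show d: "diff (singular_complex G (coeff_subgroup \<Lambda>)) k c = diff (singular_complex G complex_group) k c"
    if "c \<in> carrier (grp (singular_complex G (coeff_subgroup \<Lambda>)) k)" for c
    using that coboundary_coeff_subgroup_eq[OF \<Lambda> prism_space_simplicial_piece]
    by (simp add: singular_complex_simps compatible_cochains_iff)
  show "diff (singular_complex G complex_group) k c \<in> carrier (grp (singular_complex G (coeff_subgroup \<Lambda>)) (k + 1))"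
    if "c \<in> carrier (grp (singular_complex G (coeff_subgroup \<Lambda>)) k)" for c
    using hom_in_carrier[OF singular_complex_hom[OF \<Lambda>C] that] by (simp add: d[OF that])
  show "reduction G \<Lambda> k ` carrier (grp (singular_complex G complex_group) k) =
      carrier (grp (singular_complex G (complex_group Mod \<Lambda>)) k)"
    using reduction_surj by (simp add: singular_complex_simps(1))
  show "reduction G \<Lambda> k c = \<one>\<^bsub>grp (singular_complex G (complex_group Mod \<Lambda>)) k\<^esub> \<longleftrightarrow>
      c \<in> carrier (grp (singular_complex G (coeff_subgroup \<Lambda>)) k)"
    if "c \<in> carrier (grp (singular_complex G complex_group) k)" for c
    using reduction_kernel that by (simp add: singular_complex_simps(1))
qed

end

end

theorem theorem2p4:
  fixes G :: "('a, 'b) groupoid"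
    and \<Lambda> :: "complex set"
    and F :: "int \<Rightarrow> int \<Rightarrow> ('a, 'b) sform set"
    and r n :: int
  assumes "smooth_etale_groupoid G"
    and "subgroup \<Lambda> complex_group"
    and "is_filtration (de_rham G) F"
  shows "\<exists>\<Xi> \<in> hom (differential_characters G \<Lambda> F r (2 * r - n - 1)) (multiplicative_cohomology G \<Lambda> F r n).
      \<Xi> ` carrier (differential_characters G \<Lambda> F r (2 * r - n - 1)) =
        carrier (multiplicative_cohomology G \<Lambda> F r n) \<and>
      (differential_characters G \<Lambda> F r (2 * r - n - 1))
          \<lparr>carrier := kernel (differential_characters G \<Lambda> F r (2 * r - n - 1))
                             (multiplicative_cohomology G \<Lambda> F r n) \<Xi>\<rparr>
        \<cong> (grp (de_rham G) (2 * r - n - 1))\<lparr>carrier := F r (2 * r - n - 1)\<rparr>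
            Mod integral_forms G \<Lambda> (F r (2 * r - n - 1)) (2 * r - n - 1)"
proof -
  have "is_subcomplex (de_rham G) (F r)" using assms(3) by (simp add: is_filtration_def)
  \<comment> \<open>With \<open>k = 2 * r - n\<close> the truncation at \<open>j + 1\<close> for
    \<open>j = 2 * r - n - 1\<close> and both cohomology groups refer to the same degree
    \<open>k\<close>.\<close>
  from integration_setup.characters_onto_multiplicative_cohomology[OF
      smooth_etale_groupoid.integration_setup[OF assms(1,2) this], of "2 * r - n"]
  show ?thesis
    by (simp add: differential_characters_def multiplicative_cohomology_def integral_forms_def subcomplex_on_def)
qed

end
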